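(* Let $\mathcal{A}$ be a locally convex algebra, $(\alpha,\bar\alpha)$ a quasihomomorphism from $\mathbb{C}$ to $\mathcal{A}$ (relative to an algebra $\hat{\mathcal{A}}\supseteq\mathcal{A}$), and $H$ a split exact, $M_2$-stable functor from locally convex algebras to abelian groups. Then for every locally convex algebra $\mathcal{B}$ the following two homomorphisms $H(\mathcal{B})\to H(\mathcal{A}\otimes_\pi\mathcal{B})$ coincide: (1) multiplication $b\mapsto K(\alpha,\bar\alpha)(1)\cdot b$ with the class $K(\alpha,\bar\alpha)(1)\in K(\mathcal{A})$, where $1\in K(\mathbb{C})$ is the class of the unit; (2) the map $H((\alpha,\bar\alpha)\otimes\mathcal{B})=H(\iota\otimes\mathrm{id}_{\mathcal{B}})^{-1}\circ\big(H(\alpha'\otimes\mathrm{id}_{\mathcal{B}})-H(\bar\alpha'\otimes\mathrm{id}_{\mathcal{B}})\big)$.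
   Context: A locally convex algebra is a complete locally convex complex vector space with a jointly continuous associative multiplication; morphisms are continuous algebra homomorphisms; $\otimes_\pi$ is the completed projective tensor product. A functor $H$ (covariant) is split exact if it maps every short exact sequence of locally convex algebras that splits in the category of locally convex algebras to a short exact sequence. It is $M_2$-stable if the corner embedding $\mathcal{A}\to M_2(\mathcal{A})$ induces an isomorphism for every $\mathcal{A}$; then the corner embeddings into $M_n(\mathcal{A})$ induce isomorphisms for all $n$. A quasihomomorphism from $\mathcal{B}_1$ to $\mathcal{B}_2$ relative to an algebra $\hat{\mathcal{B}}_2\supseteq\mathcal{B}_2$ is a pair $(\alpha,\bar\alpha)$ of algebra homomorphisms $\mathcal{B}_1\to\hat{\mathcal{B}}_2$ such that $a\mapsto\alpha(a)-\bar\alpha(a)$, $(a,b)\mapsto\alpha(a)b$, $(b,a)\mapsto b\alpha(a)$ ($a\in\mathcal{B}_1,b\in\mathcal{B}_2$) are $\mathcal{B}_2$-valued and continuous. $D_\alpha$ is the locally convex algebra $\mathcal{B}_1\oplus\mathcal{B}_2$ with multiplication $(a,b)(a',b')=(aa',\alpha(a)b'+b\alpha(a')+bb')$; $\iota(b)=(0,b)$; $\alpha'(a)=(a,0)$, $\bar\alpha'(a)=(a,\bar\alpha(a)-\alpha(a))$ are splittings of $0\to\mathcal{B}_2\to D_\alpha\to\mathcal{B}_1\to0$. For a split exact functor $H$, $H(\alpha,\bar\alpha):=H(\iota)^{-1}\circ(H(\alpha')-H(\bar\alpha'))$. $K$ denotes algebraic $K_0$ (on nonunital algebras defined as the kernel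 of $K(\mathcal{A}^+)\to K(\mathbb{C})$, $\mathcal A^+$ the unitisation), which is a split exact functor. The product $K(\mathcal{A})\otimes H(\mathcal{B})\to H(\mathcal{A}\otimes_\pi\mathcal{B})$ is defined for unital $\mathcal{A}$ and an idempotent $p\in M_n(\mathcal{A})$ by $[p]\cdot b=H(\phi_p)(b)$, where $\phi_p:\mathcal{B}\to M_n(\mathcal{A}\otimes_\pi\mathcal{B})$, $\phi_p(b)=p\otimes b$, and $H(M_n(\mathcal{A}\otimes_\pi\mathcal{B}))$ is identified with $H(\mathcal{A}\otimes_\pi\mathcal{B})$ by stability; for nonunital $\mathcal{A}$ it is the restriction of the product for $\mathcal{A}^+$, which maps $K(\mathcal{A})\otimes H(\mathcal{B})$ into $H(\mathcal{A}\otimes_\pi\mathcal{B})\subseteq H(\mathcal{A}^+\otimes_\pi\mathcal{B})$. *)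

theory Defs
  imports "HOL-Analysis.Analysis" "HOL-Algebra.Module" "HOL-Algebra.Coset"
begin

section \<open>Locally convex algebras\<close>

definition complex_ring :: "complex ring" where
  "complex_ring = \<lparr>carrier = UNIV, monoid.mult = (*), one = 1, ring.zero = 0, ring.add = (+)\<rparr>"

text \<open>
  Algebras need not be unital. The field \<open>one\<close>, inherited from the ring records, is constrained
  by no axiom below, and it is used only for the scalars, for unitisations and for matrices
  over unital algebras.
\<close>

record 'a lca = "(complex, 'a) module" +
  topo :: "'a topology"

definition complex_algebra :: "(complex, 'a, 'm) module_scheme \<Rightarrow> bool" where
  "complex_algebra R \<longleftrightarrow> module complex_ring R \<and>
     (\<forall>x\<in>carrier R. \<forall>y\<in>carrier R. x \<otimes>\<^bsub>R\<^esub> y \<in> carrier R) \<and>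
     (\<forall>x\<in>carrier R. \<forall>y\<in>carrier R. \<forall>z\<in>carrier R.
        (x \<otimes>\<^bsub>R\<^esub> y) \<otimes>\<^bsub>R\<^esub> z = x \<otimes>\<^bsub>R\<^esub> (y \<otimes>\<^bsub>R\<^esub> z) \<and>
        (x \<oplus>\<^bsub>R\<^esub> y) \<otimes>\<^bsub>R\<^esub> z = (x \<otimes>\<^bsub>R\<^esub> z) \<oplus>\<^bsub>R\<^esub> (y \<otimes>\<^bsub>R\<^esub> z) \<and>
        x \<otimes>\<^bsub>R\<^esub> (y \<oplus>\<^bsub>R\<^esub> z) = (x \<otimes>\<^bsub>R\<^esub> y) \<oplus>\<^bsub>R\<^esub> (x \<otimes>\<^bsub>R\<^esub> z)) \<and>
     (\<forall>c. \<forall>x\<in>carrier R. \<forall>y\<in>carrier R.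
        (c \<odot>\<^bsub>R\<^esub> x) \<otimes>\<^bsub>R\<^esub> y = c \<odot>\<^bsub>R\<^esub> (x \<otimes>\<^bsub>R\<^esub> y) \<and>
        x \<otimes>\<^bsub>R\<^esub> (c \<odot>\<^bsub>R\<^esub> y) = c \<odot>\<^bsub>R\<^esub> (x \<otimes>\<^bsub>R\<^esub> y))"

definition alg_hom :: "(complex, 'a, 'm) module_scheme \<Rightarrow> (complex, 'b, 'n) module_scheme \<Rightarrow> ('a \<Rightarrow> 'b) set" where
  "alg_hom R S = {f. f \<in> carrier R \<rightarrow> carrier S \<and>
     (\<forall>x\<in>carrier R. \<forall>y\<in>carrier R.
        f (x \<oplus>\<^bsub>R\<^esub> y) = f x \<oplus>\<^bsub>S\<^esub> f y \<and> f (x \<otimes>\<^bsub>R\<^esub> y) = f x \<otimes>\<^bsub>S\<^esub> f y) \<and>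
     (\<forall>c. \<forall>x\<in>carrier R. f (c \<odot>\<^bsub>R\<^esub> x) = c \<odot>\<^bsub>S\<^esub> f x)}"

definition alg_convex :: "(complex, 'a, 'm) module_scheme \<Rightarrow> 'a set \<Rightarrow> bool" where
  "alg_convex R V \<longleftrightarrow> (\<forall>x\<in>V. \<forall>y\<in>V. \<forall>t\<in>{0..1::real}.
     (complex_of_real t \<odot>\<^bsub>R\<^esub> x) \<oplus>\<^bsub>R\<^esub> (complex_of_real (1 - t) \<odot>\<^bsub>R\<^esub> y) \<in> V)"

definition cauchy_filter_on :: "'a lca \<Rightarrow> 'a filter \<Rightarrow> bool" where
  "cauchy_filter_on A F \<longleftrightarrow> F \<noteq> bot \<and> eventually (\<lambda>x. x \<in> carrier A) F \<and>
     (\<forall>U. openin (topo A) U \<and> \<zero>\<^bsub>A\<^esub> \<in> U \<longrightarrow>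
        (\<exists>S. eventually (\<lambda>x. x \<in> S) F \<and> S \<subseteq> carrier A \<and> (\<forall>x\<in>S. \<forall>y\<in>S. x \<ominus>\<^bsub>A\<^esub> y \<in> U)))"

text \<open>Complete locally convex spaces are understood to be Hausdorff.\<close>

definition lc_algebra :: "'a lca \<Rightarrow> bool" where
  "lc_algebra A \<longleftrightarrow> complex_algebra A \<and>
     topspace (topo A) = carrier A \<and>
     Hausdorff_space (topo A) \<and>
     continuous_map (prod_topology (topo A) (topo A)) (topo A) (\<lambda>(x, y). x \<oplus>\<^bsub>A\<^esub> y) \<and>
     continuous_map (prod_topology euclidean (topo A)) (topo A) (\<lambda>(c, x). c \<odot>\<^bsub>A\<^esub> x) \<and>
     (\<forall>U. openin (topo A) U \<and> \<zero>\<^bsub>A\<^esub> \<in> U \<longrightarrow>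
        (\<exists>V. openin (topo A) V \<and> \<zero>\<^bsub>A\<^esub> \<in> V \<and> V \<subseteq> U \<and> alg_convex A V)) \<and>
     (\<forall>F. cauchy_filter_on A F \<longrightarrow> (\<exists>l. limitin (topo A) (\<lambda>x. x) l F)) \<and>
     continuous_map (prod_topology (topo A) (topo A)) (topo A) (\<lambda>(x, y). x \<otimes>\<^bsub>A\<^esub> y)"

definition lca_hom :: "'a lca \<Rightarrow> 'b lca \<Rightarrow> ('a \<Rightarrow> 'b) set" where
  "lca_hom A B = {f \<in> alg_hom A B. continuous_map (topo A) (topo B) f}"

definition lca_iso :: "'a lca \<Rightarrow> 'b lca \<Rightarrow> ('a \<Rightarrow> 'b) set" where
  "lca_iso A B = {f \<in> alg_hom A B. homeomorphic_map (topo A) (topo B) f}"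

definition complex_lca :: "complex lca" where
  "complex_lca = \<lparr>carrier = UNIV, monoid.mult = (*), one = 1, ring.zero = 0, ring.add = (+), smult = (*),
     topo = euclidean\<rparr>"

definition unitisation :: "'a lca \<Rightarrow> ('a \<times> complex) lca" where
  "unitisation A =
     \<lparr>carrier = carrier A \<times> UNIV,
      monoid.mult = (\<lambda>(a, z) (a', z').
        ((a \<otimes>\<^bsub>A\<^esub> a') \<oplus>\<^bsub>A\<^esub> ((z \<odot>\<^bsub>A\<^esub> a') \<oplus>\<^bsub>A\<^esub> (z' \<odot>\<^bsub>A\<^esub> a)), z * z')),
      one = (\<zero>\<^bsub>A\<^esub>, 1),
      ring.zero = (\<zero>\<^bsub>A\<^esub>, 0),
      ring.add = (\<lambda>(a, z) (a', z'). (a \<oplus>\<^bsub>A\<^esub> a', z + z')),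
      smult = (\<lambda>c (a, z). (c \<odot>\<^bsub>A\<^esub> a, c * z)),
      topo = prod_topology (topo A) euclidean\<rparr>"

definition unit_incl :: "'a \<Rightarrow> 'a \<times> complex" where
  "unit_incl a = (a, 0)"

definition unit_map :: "('a \<Rightarrow> 'b) \<Rightarrow> 'a \<times> complex \<Rightarrow> 'b \<times> complex" where
  "unit_map f = (\<lambda>(a, z). (f a, z))"

text \<open>
  A split extension: \<open>\<iota>\<close> identifies \<open>I\<close> with the kernel of \<open>\<pi>\<close> topologically; that \<open>\<pi>\<close> is a
  quotient map follows from the splitting \<open>s\<close>.
\<close>

definition split_extension ::
  "'i lca \<Rightarrow> 'e lca \<Rightarrow> 'q lca \<Rightarrow> ('i \<Rightarrow> 'e) \<Rightarrow> ('e \<Rightarrow> 'q) \<Rightarrow> ('q \<Rightarrow> 'e) \<Rightarrow> bool" where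
  "split_extension I E Q \<iota> \<pi> s \<longleftrightarrow>
     \<iota> \<in> lca_hom I E \<and> \<pi> \<in> lca_hom E Q \<and> s \<in> lca_hom Q E \<and>
     embedding_map (topo I) (topo E) \<iota> \<and>
     \<iota> ` carrier I = {x \<in> carrier E. \<pi> x = \<zero>\<^bsub>Q\<^esub>} \<and>
     (\<forall>y\<in>carrier Q. \<pi> (s y) = y)"


section \<open>Matrices\<close>

text \<open>
  An \<open>n \<times> m\<close> matrix is a function on all index pairs which vanishes outside the range, so that
  \<open>M\<^sub>n\<close> is contained in \<open>M\<^sub>n\<^sub>+\<^sub>1\<close> as the upper left corner.
\<close>

type_synonym 'a matrix = "nat \<times> nat \<Rightarrow> 'a"

definition mats :: "('a, 'm) ring_scheme \<Rightarrow> nat \<Rightarrow> nat \<Rightarrow> 'a matrix set" where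
  "mats R n m = {x. \<forall>i j. (i < n \<and> j < m \<longrightarrow> x (i, j) \<in> carrier R) \<and>
     (\<not> (i < n \<and> j < m) \<longrightarrow> x (i, j) = \<zero>\<^bsub>R\<^esub>)}"

definition mat_mult :: "('a, 'm) ring_scheme \<Rightarrow> nat \<Rightarrow> 'a matrix \<Rightarrow> 'a matrix \<Rightarrow> 'a matrix" where
  "mat_mult R k x y = (\<lambda>(i, j). \<Oplus>\<^bsub>R\<^esub>l\<in>{..<k}. x (i, l) \<otimes>\<^bsub>R\<^esub> y (l, j))"

definition corner :: "('a, 'm) ring_scheme \<Rightarrow> 'a \<Rightarrow> 'a matrix" where
  "corner R a = (\<lambda>ij. if ij = (0, 0) then a else \<zero>\<^bsub>R\<^esub>)"

definition mat_lca :: "nat \<Rightarrow> 'a lca \<Rightarrow> ('a matrix) lca" where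
  "mat_lca n A =
     \<lparr>carrier = mats A n n,
      monoid.mult = mat_mult A n,
      one = (\<lambda>(i, j). if i < n \<and> i = j then \<one>\<^bsub>A\<^esub> else \<zero>\<^bsub>A\<^esub>),
      ring.zero = (\<lambda>_. \<zero>\<^bsub>A\<^esub>),
      ring.add = (\<lambda>x y ij. x ij \<oplus>\<^bsub>A\<^esub> y ij),
      smult = (\<lambda>c x ij. c \<odot>\<^bsub>A\<^esub> x ij),
      topo = subtopology (product_topology (\<lambda>_. topo A) UNIV) (mats A n n)\<rparr>"


section \<open>The completed projective tensor product\<close>

text \<open>
  Elements of the algebraic tensor product of \<open>A\<close> and \<open>B\<close> are represented by lists of pairs,
  \<open>[(a\<^sub>1, b\<^sub>1), \<dots>, (a\<^sub>k, b\<^sub>k)]\<close> standing for \<open>\<Sum> a\<^sub>i \<otimes> b\<^sub>i\<close>; two lists represent the same tensor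
  iff they are related by the congruence generated by the defining relations.
\<close>

inductive tensor_rel :: "'a lca \<Rightarrow> 'b lca \<Rightarrow> ('a \<times> 'b) list \<Rightarrow> ('a \<times> 'b) list \<Rightarrow> bool"
  for A B where
  refl: "xs \<in> lists (carrier A \<times> carrier B) \<Longrightarrow> tensor_rel A B xs xs"
| sym: "tensor_rel A B xs ys \<Longrightarrow> tensor_rel A B ys xs"
| trans: "tensor_rel A B xs ys \<Longrightarrow> tensor_rel A B ys zs \<Longrightarrow> tensor_rel A B xs zs"
| append: "tensor_rel A B xs xs' \<Longrightarrow> tensor_rel A B ys ys' \<Longrightarrow> tensor_rel A B (xs @ ys) (xs' @ ys')"
| commute: "xs \<in> lists (carrier A \<times> carrier B) \<Longrightarrow> ys \<in> lists (carrier A \<times> carrier B) \<Longrightarrow>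
    tensor_rel A B (xs @ ys) (ys @ xs)"
| add_left: "a \<in> carrier A \<Longrightarrow> a' \<in> carrier A \<Longrightarrow> b \<in> carrier B \<Longrightarrow>
    tensor_rel A B [(a \<oplus>\<^bsub>A\<^esub> a', b)] [(a, b), (a', b)]"
| add_right: "a \<in> carrier A \<Longrightarrow> b \<in> carrier B \<Longrightarrow> b' \<in> carrier B \<Longrightarrow>
    tensor_rel A B [(a, b \<oplus>\<^bsub>B\<^esub> b')] [(a, b), (a, b')]"
| scalar: "a \<in> carrier A \<Longrightarrow> b \<in> carrier B \<Longrightarrow>
    tensor_rel A B [(c \<odot>\<^bsub>A\<^esub> a, b)] [(a, c \<odot>\<^bsub>B\<^esub> b)]"
| zero: "b \<in> carrier B \<Longrightarrow> tensor_rel A B [(\<zero>\<^bsub>A\<^esub>, b)] []"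

definition tensor_sum :: "'t lca \<Rightarrow> ('a \<Rightarrow> 'b \<Rightarrow> 't) \<Rightarrow> ('a \<times> 'b) list \<Rightarrow> 't" where
  "tensor_sum T \<tau> xs = foldr (\<lambda>(a, b) z. \<tau> a b \<oplus>\<^bsub>T\<^esub> z) xs \<zero>\<^bsub>T\<^esub>"

definition cont_seminorm :: "'a lca \<Rightarrow> ('a \<Rightarrow> real) \<Rightarrow> bool" where
  "cont_seminorm A p \<longleftrightarrow> continuous_map (topo A) euclideanreal p \<and>
     (\<forall>x\<in>carrier A. 0 \<le> p x) \<and>
     (\<forall>x\<in>carrier A. \<forall>y\<in>carrier A. p (x \<oplus>\<^bsub>A\<^esub> y) \<le> p x + p y) \<and>
     (\<forall>c. \<forall>x\<in>carrier A. p (c \<odot>\<^bsub>A\<^esub> x) = cmod c * p x)"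

definition proj_seminorm ::
  "'a lca \<Rightarrow> 'b lca \<Rightarrow> ('a \<Rightarrow> real) \<Rightarrow> ('b \<Rightarrow> real) \<Rightarrow> ('a \<times> 'b) list \<Rightarrow> real" where
  "proj_seminorm A B p q xs = Inf {(\<Sum>(a, b)\<leftarrow>ys. p a * q b) | ys. tensor_rel A B xs ys}"

text \<open>
  \<open>(T, \<tau>)\<close> is the completion of the algebraic tensor product with respect to the seminorms
  \<open>p \<otimes> q\<close>: the algebraic tensor product is embedded in \<open>T\<close> with \<open>a \<otimes> b\<close> corresponding to
  \<open>\<tau> a b\<close>, \<open>T\<close> induces on it the topology defined by these seminorms, and it is dense in the
  complete space \<open>T\<close>. Multiples of \<open>p\<close> being seminorms again, it suffices to
  consider the unit balls of the \<open>p \<otimes> q\<close>.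
\<close>

definition is_proj_tensor :: "'a lca \<Rightarrow> 'b lca \<Rightarrow> 't lca \<Rightarrow> ('a \<Rightarrow> 'b \<Rightarrow> 't) \<Rightarrow> bool" where
  "is_proj_tensor A B T \<tau> \<longleftrightarrow> lc_algebra T \<and>
     (\<forall>a\<in>carrier A. \<forall>b\<in>carrier B. \<tau> a b \<in> carrier T) \<and>
     (\<forall>c. \<forall>a\<in>carrier A. \<forall>b\<in>carrier B. \<tau> (c \<odot>\<^bsub>A\<^esub> a) b = c \<odot>\<^bsub>T\<^esub> \<tau> a b) \<and>
     (\<forall>a\<in>carrier A. \<forall>a'\<in>carrier A. \<forall>b\<in>carrier B. \<forall>b'\<in>carrier B.
        \<tau> a b \<otimes>\<^bsub>T\<^esub> \<tau> a' b' = \<tau> (a \<otimes>\<^bsub>A\<^esub> a') (b \<otimes>\<^bsub>B\<^esub> b')) \<and>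
     (\<forall>xs\<in>lists (carrier A \<times> carrier B). \<forall>ys\<in>lists (carrier A \<times> carrier B).
        tensor_sum T \<tau> xs = tensor_sum T \<tau> ys \<longleftrightarrow> tensor_rel A B xs ys) \<and>
     (\<forall>p q. cont_seminorm A p \<and> cont_seminorm B q \<longrightarrow>
        (\<exists>U. openin (topo T) U \<and> \<zero>\<^bsub>T\<^esub> \<in> U \<and>
           (\<forall>xs\<in>lists (carrier A \<times> carrier B).
              tensor_sum T \<tau> xs \<in> U \<longrightarrow> proj_seminorm A B p q xs < 1))) \<and>
     (\<forall>U. openin (topo T) U \<and> \<zero>\<^bsub>T\<^esub> \<in> U \<longrightarrow>
        (\<exists>p q. cont_seminorm A p \<and> cont_seminorm B q \<and>
           (\<forall>xs\<in>lists (carrier A \<times> carrier B).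
              proj_seminorm A B p q xs < 1 \<longrightarrow> tensor_sum T \<tau> xs \<in> U))) \<and>
     topo T closure_of (tensor_sum T \<tau> ` lists (carrier A \<times> carrier B)) = carrier T"


section \<open>Universes and functors\<close>

text \<open>
  HOL has no collection of all locally convex algebras. A universe is a set of locally
  convex algebras, with carriers in a common type, which contains up to
  isomorphism the scalars and is closed, up to isomorphism, under split extensions, matrix
  algebras and projective tensor products. Functors are defined on the full subcategory given
  by a universe.
\<close>

definition represented :: "'u lca set \<Rightarrow> 'a lca \<Rightarrow> bool" where
  "represented \<U> A \<longleftrightarrow> (\<exists>Y\<in>\<U>. \<exists>\<phi>. \<phi> \<in> lca_iso A Y)"

definition lca_universe :: "'u lca set \<Rightarrow> bool" where
  "lca_universe \<U> \<longleftrightarrow>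
     (\<forall>A\<in>\<U>. lc_algebra A) \<and>
     represented \<U> complex_lca \<and>
     (\<forall>I\<in>\<U>. \<forall>Q\<in>\<U>. \<forall>(E :: ('u \<times> 'u) lca) \<iota> \<pi> s.
        lc_algebra E \<and> split_extension I E Q \<iota> \<pi> s \<longrightarrow> represented \<U> E) \<and>
     (\<forall>A\<in>\<U>. \<forall>n\<ge>1. represented \<U> (mat_lca n A)) \<and>
     (\<forall>A\<in>\<U>. \<forall>B\<in>\<U>. \<exists>T\<in>\<U>. \<exists>\<tau>. is_proj_tensor A B T \<tau>)"

text \<open>
  Matrix algebras and tensor products as objects of the universe, with the isomorphism from
  the concrete matrix algebra and the canonical bilinear map, respectively. They are unique
  up to canonical isomorphism.
\<close>

definition mat_pair :: "'u lca set \<Rightarrow> nat \<Rightarrow> 'u lca \<Rightarrow> 'u lca \<times> ('u matrix \<Rightarrow> 'u)" where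
  "mat_pair \<U> n A = (SOME (Y, \<phi>). Y \<in> \<U> \<and> \<phi> \<in> lca_iso (mat_lca n A) Y)"

definition mat_obj :: "'u lca set \<Rightarrow> nat \<Rightarrow> 'u lca \<Rightarrow> 'u lca" where
  "mat_obj \<U> n A = fst (mat_pair \<U> n A)"

definition to_mat :: "'u lca set \<Rightarrow> nat \<Rightarrow> 'u lca \<Rightarrow> 'u matrix \<Rightarrow> 'u" where
  "to_mat \<U> n A = snd (mat_pair \<U> n A)"

definition tensor_pair :: "'u lca set \<Rightarrow> 'a lca \<Rightarrow> 'b lca \<Rightarrow> 'u lca \<times> ('a \<Rightarrow> 'b \<Rightarrow> 'u)" where
  "tensor_pair \<U> A B = (SOME (T, \<tau>). T \<in> \<U> \<and> is_proj_tensor A B T \<tau>)"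

definition tensor_obj :: "'u lca set \<Rightarrow> 'a lca \<Rightarrow> 'b lca \<Rightarrow> 'u lca" where
  "tensor_obj \<U> A B = fst (tensor_pair \<U> A B)"

definition tensor :: "'u lca set \<Rightarrow> 'a lca \<Rightarrow> 'b lca \<Rightarrow> 'a \<Rightarrow> 'b \<Rightarrow> 'u" where
  "tensor \<U> A B = snd (tensor_pair \<U> A B)"

text \<open>The morphism \<open>f \<otimes> id\<^sub>B\<close>; only its values on the carrier of \<open>A \<otimes>\<^sub>\<pi> B\<close> are determined.\<close>

definition tensor_map ::
  "'u lca set \<Rightarrow> 'a lca \<Rightarrow> 'c lca \<Rightarrow> 'b lca \<Rightarrow> ('a \<Rightarrow> 'c) \<Rightarrow> 'u \<Rightarrow> 'u" where
  "tensor_map \<U> A C B f = (SOME h. h \<in> lca_hom (tensor_obj \<U> A B) (tensor_obj \<U> C B) \<and>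
     (\<forall>a\<in>carrier A. \<forall>b\<in>carrier B. h (tensor \<U> A B a b) = tensor \<U> C B (f a) b))"

text \<open>Abelian groups are written multiplicatively, following HOL-Algebra.\<close>

record ('u, 'h) lca_functor =
  obj :: "'u lca \<Rightarrow> 'h monoid"
  mor :: "'u lca \<Rightarrow> 'u lca \<Rightarrow> ('u \<Rightarrow> 'u) \<Rightarrow> 'h \<Rightarrow> 'h"

text \<open>
  Morphisms are represented by functions on the whole type, of which only the values on the
  carrier matter; hence the fourth condition.
\<close>

definition is_functor :: "'u lca set \<Rightarrow> ('u, 'h) lca_functor \<Rightarrow> bool" where
  "is_functor \<U> H \<longleftrightarrow>
     (\<forall>X\<in>\<U>. comm_group (obj H X)) \<and>
     (\<forall>X\<in>\<U>. \<forall>Y\<in>\<U>. \<forall>f\<in>lca_hom X Y. mor H X Y f \<in> hom (obj H X) (obj H Y)) \<and>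
     (\<forall>X\<in>\<U>. \<forall>x\<in>carrier (obj H X). mor H X X (\<lambda>a. a) x = x) \<and>
     (\<forall>X\<in>\<U>. \<forall>Y\<in>\<U>. \<forall>f\<in>lca_hom X Y. \<forall>g\<in>lca_hom X Y. (\<forall>a\<in>carrier X. f a = g a) \<longrightarrow>
        (\<forall>x\<in>carrier (obj H X). mor H X Y f x = mor H X Y g x)) \<and>
     (\<forall>X\<in>\<U>. \<forall>Y\<in>\<U>. \<forall>Z\<in>\<U>. \<forall>f\<in>lca_hom X Y. \<forall>g\<in>lca_hom Y Z.
        \<forall>x\<in>carrier (obj H X). mor H X Z (g \<circ> f) x = mor H Y Z g (mor H X Y f x))"

definition split_exact :: "'u lca set \<Rightarrow> ('u, 'h) lca_functor \<Rightarrow> bool" where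
  "split_exact \<U> H \<longleftrightarrow>
     (\<forall>I\<in>\<U>. \<forall>E\<in>\<U>. \<forall>Q\<in>\<U>. \<forall>\<iota> \<pi> s. split_extension I E Q \<iota> \<pi> s \<longrightarrow>
        inj_on (mor H I E \<iota>) (carrier (obj H I)) \<and>
        mor H I E \<iota> ` carrier (obj H I) = kernel (obj H E) (obj H Q) (mor H E Q \<pi>) \<and>
        mor H E Q \<pi> ` carrier (obj H E) = carrier (obj H Q))"

definition corner_mor :: "'u lca set \<Rightarrow> ('u, 'h) lca_functor \<Rightarrow> nat \<Rightarrow> 'u lca \<Rightarrow> 'h \<Rightarrow> 'h" where
  "corner_mor \<U> H n A = mor H A (mat_obj \<U> n A) (\<lambda>a. to_mat \<U> n A (corner A a))"

definition M2_stable :: "'u lca set \<Rightarrow> ('u, 'h) lca_functor \<Rightarrow> bool" where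
  "M2_stable \<U> H \<longleftrightarrow>
     (\<forall>A\<in>\<U>. corner_mor \<U> H 2 A \<in> iso (obj H A) (obj H (mat_obj \<U> 2 A)))"


section \<open>Algebraic \<open>K\<^sub>0\<close>\<close>

text \<open>
  For unital \<open>R\<close>: the Grothendieck group of the monoid of equivalence classes of idempotent
  matrices, \<open>p \<sim> q\<close> iff \<open>p = x y\<close> and \<open>q = y x\<close> for some matrices \<open>x\<close>, \<open>y\<close>. A matrix is paired
  with its size, and a pair \<open>(p, q)\<close> of idempotents represents \<open>[p] - [q]\<close>.
\<close>

type_synonym 'a idem = "nat \<times> 'a matrix"

definition idems :: "('a, 'm) ring_scheme \<Rightarrow> 'a idem set" where
  "idems R = {(n, p). n \<ge> 1 \<and> p \<in> mats R n n \<and> mat_mult R n p p = p}"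

definition idem_equiv :: "('a, 'm) ring_scheme \<Rightarrow> 'a idem \<Rightarrow> 'a idem \<Rightarrow> bool" where
  "idem_equiv R = (\<lambda>(n, p) (m, q). \<exists>x\<in>mats R n m. \<exists>y\<in>mats R m n.
     mat_mult R m x y = p \<and> mat_mult R n y x = q)"

definition idem_sum :: "('a, 'm) ring_scheme \<Rightarrow> 'a idem \<Rightarrow> 'a idem \<Rightarrow> 'a idem" where
  "idem_sum R = (\<lambda>(n, p) (m, q). (n + m, \<lambda>(i, j).
     if i < n \<and> j < n then p (i, j)
     else if n \<le> i \<and> n \<le> j then q (i - n, j - n)
     else \<zero>\<^bsub>R\<^esub>))"

definition K0_rel :: "('a, 'm) ring_scheme \<Rightarrow> (('a idem \<times> 'a idem) \<times> ('a idem \<times> 'a idem)) set" where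
  "K0_rel R = {((p, q), (p', q')). p \<in> idems R \<and> q \<in> idems R \<and> p' \<in> idems R \<and> q' \<in> idems R \<and>
     (\<exists>r\<in>idems R. idem_equiv R (idem_sum R (idem_sum R p q') r) (idem_sum R (idem_sum R p' q) r))}"

definition zero_idem :: "('a, 'm) ring_scheme \<Rightarrow> 'a idem" where
  "zero_idem R = (1, \<lambda>_. \<zero>\<^bsub>R\<^esub>)"

definition K0_unital :: "('a, 'm) ring_scheme \<Rightarrow> ('a idem \<times> 'a idem) set monoid" where
  "K0_unital R =
     \<lparr>carrier = (idems R \<times> idems R) // K0_rel R,
      monoid.mult = (\<lambda>X Y. \<Union>(p, q)\<in>X. \<Union>(p', q')\<in>Y. K0_rel R `` {(idem_sum R p p', idem_sum R q q')}),
      one = K0_rel R `` {(zero_idem R, zero_idem R)}\<rparr>"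

definition map_idem :: "('a \<Rightarrow> 'b) \<Rightarrow> 'a idem \<Rightarrow> 'b idem" where
  "map_idem f = (\<lambda>(n, p). (n, f \<circ> p))"

definition K0_unital_map ::
  "('b, 'n) ring_scheme \<Rightarrow> ('a \<Rightarrow> 'b) \<Rightarrow> ('a idem \<times> 'a idem) set \<Rightarrow> ('b idem \<times> 'b idem) set" where
  "K0_unital_map S f X = (\<Union>(p, q)\<in>X. K0_rel S `` {(map_idem f p, map_idem f q)})"

text \<open>
  For arbitrary algebras \<open>K(A) = ker (K(A\<^sup>+) \<rightarrow> K(\<complex>))\<close>. This is also used for unital
  \<open>A\<close>, where it is canonically isomorphic to \<open>K0_unital A\<close>.
\<close>

definition K0 :: "'a lca \<Rightarrow> (('a \<times> complex) idem \<times> ('a \<times> complex) idem) set monoid" where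
  "K0 A = (K0_unital (unitisation A))
     \<lparr>carrier := kernel (K0_unital (unitisation A)) (K0_unital complex_lca) (K0_unital_map complex_lca snd)\<rparr>"

definition K0_map :: "'b lca \<Rightarrow> ('a \<Rightarrow> 'b) \<Rightarrow>
    (('a \<times> complex) idem \<times> ('a \<times> complex) idem) set \<Rightarrow>
    (('b \<times> complex) idem \<times> ('b \<times> complex) idem) set" where
  "K0_map B f = K0_unital_map (unitisation B) (unit_map f)"

text \<open>
  The class of the unit in \<open>K(\<complex>)\<close>: the unit of the (non-unitally included) ideal \<open>\<complex>\<close> is
  the idempotent \<open>(1, 0)\<close> of \<open>\<complex>\<^sup>+\<close>.
\<close>

definition K0_unit :: "((complex \<times> complex) idem \<times> (complex \<times> complex) idem) set" where
  "K0_unit = K0_rel (unitisation complex_lca) ``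
     {((1, corner (unitisation complex_lca) (unit_incl 1)), zero_idem (unitisation complex_lca))}"


section \<open>The product \<open>K(A) \<otimes> H(B) \<rightarrow> H(A \<otimes>\<^sub>\<pi> B)\<close>\<close>

definition idem_act ::
  "'u lca set \<Rightarrow> ('u, 'h) lca_functor \<Rightarrow> 'a lca \<Rightarrow> 'u lca \<Rightarrow> 'a idem \<Rightarrow> 'h \<Rightarrow> 'h" where
  "idem_act \<U> H R B = (\<lambda>(n, p) b.
     let T = tensor_obj \<U> R B;
         \<phi>\<^sub>p = (\<lambda>x. to_mat \<U> n T (\<lambda>ij. tensor \<U> R B (p ij) x))
     in inv_into (carrier (obj H T)) (corner_mor \<U> H n T) (mor H B (mat_obj \<U> n T) \<phi>\<^sub>p b))"

definition K0_unital_act ::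
  "'u lca set \<Rightarrow> ('u, 'h) lca_functor \<Rightarrow> 'a lca \<Rightarrow> 'u lca \<Rightarrow> ('a idem \<times> 'a idem) set \<Rightarrow> 'h \<Rightarrow> 'h" where
  "K0_unital_act \<U> H R B X b =
     (let (p, q) = (SOME pq. pq \<in> X); G = obj H (tensor_obj \<U> R B)
      in idem_act \<U> H R B p b \<otimes>\<^bsub>G\<^esub> inv\<^bsub>G\<^esub> idem_act \<U> H R B q b)"

text \<open>\<open>H(A \<otimes>\<^sub>\<pi> B)\<close> is regarded as a subgroup of \<open>H(A\<^sup>+ \<otimes>\<^sub>\<pi> B)\<close> by means of \<open>H(incl \<otimes> id\<^sub>B)\<close>.\<close>

definition K0_act ::
  "'u lca set \<Rightarrow> ('u, 'h) lca_functor \<Rightarrow> 'a lca \<Rightarrow> 'u lca \<Rightarrow>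
   (('a \<times> complex) idem \<times> ('a \<times> complex) idem) set \<Rightarrow> 'h \<Rightarrow> 'h" where
  "K0_act \<U> H A B X b =
     inv_into (carrier (obj H (tensor_obj \<U> A B)))
       (mor H (tensor_obj \<U> A B) (tensor_obj \<U> (unitisation A) B)
          (tensor_map \<U> A (unitisation A) B unit_incl))
       (K0_unital_act \<U> H (unitisation A) B X b)"


section \<open>Quasihomomorphisms\<close>

text \<open>
  The inclusion of \<open>B\<^sub>2\<close> into the ambient algebra is given by an injective
  homomorphism \<open>i\<close>; the ambient algebra carries no topology.
\<close>

definition quasihom :: "'a lca \<Rightarrow> 'b lca \<Rightarrow> (complex, 'c) module \<Rightarrow> ('b \<Rightarrow> 'c) \<Rightarrow>
    ('a \<Rightarrow> 'c) \<Rightarrow> ('a \<Rightarrow> 'c) \<Rightarrow> bool" where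
  "quasihom B1 B2 Bhat i \<alpha> \<alpha>bar \<longleftrightarrow>
     complex_algebra Bhat \<and> i \<in> alg_hom B2 Bhat \<and> inj_on i (carrier B2) \<and>
     \<alpha> \<in> alg_hom B1 Bhat \<and> \<alpha>bar \<in> alg_hom B1 Bhat \<and>
     (\<forall>a\<in>carrier B1. \<alpha> a \<ominus>\<^bsub>Bhat\<^esub> \<alpha>bar a \<in> i ` carrier B2) \<and>
     (\<forall>a\<in>carrier B1. \<forall>b\<in>carrier B2. \<alpha> a \<otimes>\<^bsub>Bhat\<^esub> i b \<in> i ` carrier B2) \<and>
     (\<forall>a\<in>carrier B1. \<forall>b\<in>carrier B2. i b \<otimes>\<^bsub>Bhat\<^esub> \<alpha> a \<in> i ` carrier B2) \<and>
     continuous_map (topo B1) (topo B2)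
       (\<lambda>a. inv_into (carrier B2) i (\<alpha> a \<ominus>\<^bsub>Bhat\<^esub> \<alpha>bar a)) \<and>
     continuous_map (prod_topology (topo B1) (topo B2)) (topo B2)
       (\<lambda>(a, b). inv_into (carrier B2) i (\<alpha> a \<otimes>\<^bsub>Bhat\<^esub> i b)) \<and>
     continuous_map (prod_topology (topo B2) (topo B1)) (topo B2)
       (\<lambda>(b, a). inv_into (carrier B2) i (i b \<otimes>\<^bsub>Bhat\<^esub> \<alpha> a))"

definition D_alg :: "'a lca \<Rightarrow> 'b lca \<Rightarrow> (complex, 'c) module \<Rightarrow> ('b \<Rightarrow> 'c) \<Rightarrow>
    ('a \<Rightarrow> 'c) \<Rightarrow> ('a \<times> 'b) lca" where
  "D_alg B1 B2 Bhat i \<alpha> =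
     \<lparr>carrier = carrier B1 \<times> carrier B2,
      monoid.mult = (\<lambda>(a, b) (a', b').
        (a \<otimes>\<^bsub>B1\<^esub> a',
         inv_into (carrier B2) i (\<alpha> a \<otimes>\<^bsub>Bhat\<^esub> i b') \<oplus>\<^bsub>B2\<^esub>
         inv_into (carrier B2) i (i b \<otimes>\<^bsub>Bhat\<^esub> \<alpha> a') \<oplus>\<^bsub>B2\<^esub>
         b \<otimes>\<^bsub>B2\<^esub> b')),
      one = undefined,
      ring.zero = (\<zero>\<^bsub>B1\<^esub>, \<zero>\<^bsub>B2\<^esub>),
      ring.add = (\<lambda>(a, b) (a', b'). (a \<oplus>\<^bsub>B1\<^esub> a', b \<oplus>\<^bsub>B2\<^esub> b')),
      smult = (\<lambda>c (a, b). (c \<odot>\<^bsub>B1\<^esub> a, c \<odot>\<^bsub>B2\<^esub> b)),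
      topo = prod_topology (topo B1) (topo B2)\<rparr>"

definition D_incl :: "'a lca \<Rightarrow> 'b \<Rightarrow> 'a \<times> 'b" where
  "D_incl B1 b = (\<zero>\<^bsub>B1\<^esub>, b)"

definition D_split :: "'b lca \<Rightarrow> 'a \<Rightarrow> 'a \<times> 'b" where
  "D_split B2 a = (a, \<zero>\<^bsub>B2\<^esub>)"

definition D_split_bar :: "'b lca \<Rightarrow> (complex, 'c) module \<Rightarrow> ('b \<Rightarrow> 'c) \<Rightarrow>
    ('a \<Rightarrow> 'c) \<Rightarrow> ('a \<Rightarrow> 'c) \<Rightarrow> 'a \<Rightarrow> 'a \<times> 'b" where
  "D_split_bar B2 Bhat i \<alpha> \<alpha>bar a = (a, inv_into (carrier B2) i (\<alpha>bar a \<ominus>\<^bsub>Bhat\<^esub> \<alpha> a))"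

text \<open>\<open>K(\<alpha>, \<alpha>bar) = K(\<iota>)\<^sup>-\<^sup>1 \<circ> (K(\<alpha>') - K(\<alpha>bar'))\<close>, a map from \<open>K(B\<^sub>1)\<close> to \<open>K(B\<^sub>2)\<close>.\<close>

definition K0_quasi :: "'a lca \<Rightarrow> 'b lca \<Rightarrow> (complex, 'c) module \<Rightarrow> ('b \<Rightarrow> 'c) \<Rightarrow>
    ('a \<Rightarrow> 'c) \<Rightarrow> ('a \<Rightarrow> 'c) \<Rightarrow>
    (('a \<times> complex) idem \<times> ('a \<times> complex) idem) set \<Rightarrow>
    (('b \<times> complex) idem \<times> ('b \<times> complex) idem) set" where
  "K0_quasi B1 B2 Bhat i \<alpha> \<alpha>bar x =
     (let D = D_alg B1 B2 Bhat i \<alpha> in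
      inv_into (carrier (K0 B2)) (K0_map D (D_incl B1))
        (K0_map D (D_split B2) x \<otimes>\<^bsub>K0 D\<^esub>
         inv\<^bsub>K0 D\<^esub> K0_map D (D_split_bar B2 Bhat i \<alpha> \<alpha>bar) x))"

text \<open>
  \<open>H((\<alpha>, \<alpha>bar) \<otimes> B) = H(\<iota> \<otimes> id\<^sub>B)\<^sup>-\<^sup>1 \<circ> (H(\<alpha>' \<otimes> id\<^sub>B) - H(\<alpha>bar' \<otimes> id\<^sub>B))\<close>,
  a map from \<open>H(B\<^sub>1 \<otimes>\<^sub>\<pi> B)\<close> to \<open>H(B\<^sub>2 \<otimes>\<^sub>\<pi> B)\<close>.
\<close>

definition quasi_tensor :: "'u lca set \<Rightarrow> ('u, 'h) lca_functor \<Rightarrow> 'a lca \<Rightarrow> 'b lca \<Rightarrow>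
    (complex, 'c) module \<Rightarrow> ('b \<Rightarrow> 'c) \<Rightarrow> ('a \<Rightarrow> 'c) \<Rightarrow> ('a \<Rightarrow> 'c) \<Rightarrow> 'd lca \<Rightarrow> 'h \<Rightarrow> 'h" where
  "quasi_tensor \<U> H B1 B2 Bhat i \<alpha> \<alpha>bar B x =
     (let D = D_alg B1 B2 Bhat i \<alpha>;
          S = tensor_obj \<U> B1 B;
          T = tensor_obj \<U> D B;
          T2 = tensor_obj \<U> B2 B
      in inv_into (carrier (obj H T2)) (mor H T2 T (tensor_map \<U> B2 D B (D_incl B1)))
           (mor H S T (tensor_map \<U> B1 D B (D_split B2)) x \<otimes>\<^bsub>obj H T\<^esub>
            inv\<^bsub>obj H T\<^esub> mor H S T (tensor_map \<U> B1 D B (D_split_bar B2 Bhat i \<alpha> \<alpha>bar)) x))"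

text \<open>The canonical isomorphism \<open>B \<rightarrow> \<complex> \<otimes>\<^sub>\<pi> B\<close>, by which \<open>H(B)\<close> is identified with \<open>H(\<complex> \<otimes>\<^sub>\<pi> B)\<close>.\<close>

definition scalar_tensor :: "'u lca set \<Rightarrow> 'b lca \<Rightarrow> 'b \<Rightarrow> 'u" where
  "scalar_tensor \<U> B b = tensor \<U> complex_lca B 1 b"

end

theory Submission
  imports Defs
begin

text \<open>
  Let \<open>D\<close> be the split extension of \<open>\<complex>\<close> by \<open>A\<close> given by the quasihomomorphism, and let \<open>e\<close>, \<open>f\<close> be the
  idempotents of \<open>D\<close> that are the images of \<open>1\<close> under its two splittings. As \<open>A \<otimes> B \<rightarrow> D \<otimes> B \<rightarrow> D\<^sup>+ \<otimes> B\<close>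
  is injective under \<open>H\<close>, it suffices to compare the two maps in \<open>H (D\<^sup>+ \<otimes> B)\<close>, where the second one is
  the difference of the actions of \<open>e\<close> and \<open>f\<close>. The action of idempotents on \<open>H\<close> is additive and
  invariant under Murray--von Neumann equivalence, because conjugation acts trivially on a stable functor.
  The class \<open>[e] - [f]\<close> lifts to \<open>K\<^sub>0 A\<close>: with \<open>e' = 1 - e\<close>, the symmetry \<open>u = [[e, e'], [e', e]]\<close> conjugates
  \<open>diag(e, e')\<close> to \<open>diag(1, 0)\<close>, and \<open>u diag(f, e') u\<close> differs from \<open>diag(1, 0)\<close> by a matrix over \<open>A\<close>.
\<close>

subsection \<open>Complex algebras and matrices\<close>

text \<open>Both maps end in an \<open>inv_into\<close>, so the elements concerned must be shown to
  lie in the images: the class [e] - [f] in that of K(A), and the product with \<open>b\<close> in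
  that of H(A \<otimes> B). K(\<alpha>, \<alpha>bar)(1) is then some preimage of [e] - [f], and the
  comparison in H(D^+ \<otimes> B) sees only its image. The passage to D^+ is forced by the product,
  which for a non-unital algebra is defined on the unitisation. Conjugation by u is trivial on H
  because diag(u, 1) ties it to the lower corner of M_2, where nothing moves, and both corners are
  isomorphisms under H. Without units in the algebras, u is available only as a pair of maps, its
  left multiplication and the right multiplication by its inverse. Projective tensor products need
  not preserve injections. A split extension, however, has a continuous linear retraction onto its
  ideal, and the identities between this retraction and the three homomorphisms survive tensoring
  with B. The same retraction gives coordinates on E, by which D, D^+ and A^+ are seen to be
  represented in the universe.\<close>

lemma complex_ring_simps [simp]:
  "carrier complex_ring = UNIV" "x \<otimes>\<^bsub>complex_ring\<^esub> y = x * y" "x \<oplus>\<^bsub>complex_ring\<^esub> y = x + y"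
  "\<one>\<^bsub>complex_ring\<^esub> = 1" "\<zero>\<^bsub>complex_ring\<^esub> = 0"
  by (simp_all add: complex_ring_def)

lemma cring_complex_ring: "cring complex_ring"
proof (rule cringI)
  show "abelian_group complex_ring"
    by (rule abelian_groupI) (auto simp: algebra_simps intro: exI[of _ "- x" for x])
  show "Group.comm_monoid complex_ring"
    by (rule comm_monoidI) (auto simp: algebra_simps)
qed (simp add: algebra_simps)

text \<open>Additive inverses are produced from the scalar -1, since
  \<open>(-1) \<odot> x \<oplus> x = 0 \<odot> x\<close>; this is why inverses do not occur among
  the premises.\<close>

lemma complex_algebraI:
  fixes R (structure)
  assumes "\<zero> \<in> carrier R"
    and "\<And>x y. x \<in> carrier R \<Longrightarrow> y \<in> carrier R \<Longrightarrow> x \<oplus> y \<in> carrier R"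
    and "\<And>x y. x \<in> carrier R \<Longrightarrow> y \<in> carrier R \<Longrightarrow> x \<otimes> y \<in> carrier R"
    and "\<And>c x. x \<in> carrier R \<Longrightarrow> c \<odot> x \<in> carrier R"
    and "\<And>x y z. x \<in> carrier R \<Longrightarrow> y \<in> carrier R \<Longrightarrow> z \<in> carrier R \<Longrightarrow> (x \<oplus> y) \<oplus> z = x \<oplus> (y \<oplus> z)"
    and "\<And>x y. x \<in> carrier R \<Longrightarrow> y \<in> carrier R \<Longrightarrow> x \<oplus> y = y \<oplus> x"
    and "\<And>x. x \<in> carrier R \<Longrightarrow> \<zero> \<oplus> x = x"
    and "\<And>x y z. x \<in> carrier R \<Longrightarrow> y \<in> carrier R \<Longrightarrow> z \<in> carrier R \<Longrightarrow> (x \<otimes> y) \<otimes> z = x \<otimes> (y \<otimes> z)"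
    and "\<And>x y z. x \<in> carrier R \<Longrightarrow> y \<in> carrier R \<Longrightarrow> z \<in> carrier R \<Longrightarrow> (x \<oplus> y) \<otimes> z = x \<otimes> z \<oplus> y \<otimes> z"
    and "\<And>x y z. x \<in> carrier R \<Longrightarrow> y \<in> carrier R \<Longrightarrow> z \<in> carrier R \<Longrightarrow> x \<otimes> (y \<oplus> z) = x \<otimes> y \<oplus> x \<otimes> z"
    and "\<And>c d x. x \<in> carrier R \<Longrightarrow> (c + d) \<odot> x = c \<odot> x \<oplus> d \<odot> x"
    and "\<And>c x y. x \<in> carrier R \<Longrightarrow> y \<in> carrier R \<Longrightarrow> c \<odot> (x \<oplus> y) = c \<odot> x \<oplus> c \<odot> y"
    and "\<And>c d x. x \<in> carrier R \<Longrightarrow> (c * d) \<odot> x = c \<odot> (d \<odot> x)"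
    and "\<And>x. x \<in> carrier R \<Longrightarrow> 1 \<odot> x = x"
    and "\<And>x. x \<in> carrier R \<Longrightarrow> 0 \<odot> x = \<zero>"
    and "\<And>c x y. x \<in> carrier R \<Longrightarrow> y \<in> carrier R \<Longrightarrow> (c \<odot> x) \<otimes> y = c \<odot> (x \<otimes> y)"
    and "\<And>c x y. x \<in> carrier R \<Longrightarrow> y \<in> carrier R \<Longrightarrow> x \<otimes> (c \<odot> y) = c \<odot> (x \<otimes> y)"
  shows "complex_algebra R"
proof -
  have "abelian_group R"
  proof (rule abelian_groupI)
    fix x assume x: "x \<in> carrier R"
    have "(-1) \<odot> x \<oplus> x = (-1 + 1) \<odot> x" using assms(11)[of x "-1" 1] assms(14) x by simp
    also have "\<dots> = \<zero>" using assms(15) x by simp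
    finally show "\<exists>y\<in>carrier R. y \<oplus> x = \<zero>" using assms(4) x by blast
  qed (use assms in auto)
  then have "module complex_ring R"
    by (intro moduleI) (use assms cring_complex_ring in auto)
  then show ?thesis
    unfolding complex_algebra_def
    by (intro conjI ballI allI) (simp_all add: assms(3,8,9,10,16,17))
qed

text \<open>Algebras here may be non-unital. The additive part is an \<open>abelian_group\<close>
  sublocale, while the multiplicative laws are read off from \<open>complex_algebra\<close>, because
  the \<open>ring\<close> locale asks for a unit.\<close>

locale complex_alg =
  fixes R :: "(complex, 'a, 'm) module_scheme" (structure)
  assumes complex_algebra: "complex_algebra R"
begin

lemma is_module: "module complex_ring R"
  using complex_algebra by (simp add: complex_algebra_def)

sublocale abelian_group R
  using is_module by (rule module.axioms)

lemma
  assumes "x \<in> carrier R"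
  shows smult_closed [simp]: "c \<odot> x \<in> carrier R"
    and smult_add_left: "(c + d) \<odot> x = c \<odot> x \<oplus> d \<odot> x"
    and smult_smult: "c \<odot> (d \<odot> x) = (c * d) \<odot> x"
    and smult_1 [simp]: "1 \<odot> x = x"
    and smult_0 [simp]: "0 \<odot> x = \<zero>"
  using assms module.smult_closed[OF is_module, of c x] module.smult_l_distr[OF is_module, of c d x]
    module.smult_assoc1[OF is_module, of c d x] module.smult_one[OF is_module, of x]
    module.smult_l_null[OF is_module, of x]
  by simp_all

lemma smult_add_right: "x \<in> carrier R \<Longrightarrow> y \<in> carrier R \<Longrightarrow> c \<odot> (x \<oplus> y) = c \<odot> x \<oplus> c \<odot> y"
  using module.smult_r_distr[OF is_module] by simp

lemma smult_zero [simp]: "c \<odot> \<zero> = \<zero>"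
  using module.smult_r_null[OF is_module] by simp

lemma
  assumes "x \<in> carrier R" "y \<in> carrier R"
  shows m_closed [simp]: "x \<otimes> y \<in> carrier R"
    and smult_mult_left: "(c \<odot> x) \<otimes> y = c \<odot> (x \<otimes> y)"
    and smult_mult_right: "x \<otimes> (c \<odot> y) = c \<odot> (x \<otimes> y)"
  using assms complex_algebra by (simp_all add: complex_algebra_def)

lemma
  assumes "x \<in> carrier R" "y \<in> carrier R" "z \<in> carrier R"
  shows m_assoc: "(x \<otimes> y) \<otimes> z = x \<otimes> (y \<otimes> z)"
    and l_distr: "(x \<oplus> y) \<otimes> z = x \<otimes> z \<oplus> y \<otimes> z"
    and r_distr: "x \<otimes> (y \<oplus> z) = x \<otimes> y \<oplus> x \<otimes> z"
  using assms complex_algebra by (simp_all add: complex_algebra_def)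

lemma l_null [simp]: "x \<in> carrier R \<Longrightarrow> \<zero> \<otimes> x = \<zero>"
  using smult_mult_left[of \<zero> x 0] by simp

lemma r_null [simp]: "x \<in> carrier R \<Longrightarrow> x \<otimes> \<zero> = \<zero>"
  using smult_mult_right[of x \<zero> 0] by simp

lemma minus_smult: "x \<in> carrier R \<Longrightarrow> \<ominus> x = (-1) \<odot> x"
  using smult_add_left[of x "-1" 1] by (intro minus_equality) simp_all

lemma sub_smult: "x \<in> carrier R \<Longrightarrow> x \<ominus> y = x \<oplus> (-1) \<odot> y" if "y \<in> carrier R"
  using that by (simp add: minus_eq minus_smult)

lemma add_sub_cancel: "x \<in> carrier R \<Longrightarrow> y \<in> carrier R \<Longrightarrow> x \<oplus> (y \<ominus> x) = y"
  by (simp add: minus_eq a_lcomm[of x y] r_neg)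

text \<open>Induction on the index set. Multiplication on either side, scaling, algebra
  homomorphisms and \<open>a \<mapsto> a \<otimes> b\<close> all occur later in the place of
  \<open>h\<close>, so every distributive law for finite sums comes from here.\<close>

lemma finsum_map:
  assumes S: "abelian_monoid S"
    and h: "\<And>x. x \<in> carrier R \<Longrightarrow> h x \<in> carrier S" "h \<zero> = \<zero>\<^bsub>S\<^esub>"
      "\<And>x y. x \<in> carrier R \<Longrightarrow> y \<in> carrier R \<Longrightarrow> h (x \<oplus> y) = h x \<oplus>\<^bsub>S\<^esub> h y"
    and f: "\<And>i. i \<in> I \<Longrightarrow> f i \<in> carrier R"
  shows "h (finsum R f I) = finsum S (\<lambda>i. h (f i)) I"
proof (cases "finite I")
  case True
  then show ?thesis using f
  proof (induction I)
    case empty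
    then show ?case using h(2) by (simp add: abelian_monoid.finsum_empty[OF S])
  next
    case (insert i I)
    have "h (finsum R f (insert i I)) = h (f i) \<oplus>\<^bsub>S\<^esub> h (finsum R f I)"
      using insert.hyps insert.prems by (subst finsum_insert) (auto simp: h(3) finsum_closed)
    also have "\<dots> = finsum S (\<lambda>i. h (f i)) (insert i I)"
      using insert by (subst abelian_monoid.finsum_insert[OF S]) (auto intro!: h(1))
    finally show ?case .
  qed
next
  case False
  then show ?thesis using h(2) by (simp add: finsum_infinite abelian_monoid.finsum_infinite[OF S])
qed

lemma finsum_lessThan_2: "f 0 \<in> carrier R \<Longrightarrow> f 1 \<in> carrier R \<Longrightarrow> finsum R f {..<2::nat} = f 0 \<oplus> f 1"
  by (simp add: numeral_2_eq_2 lessThan_Suc finsum_insert a_comm)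

lemma finsum_mult_right:
  assumes "\<And>i. i \<in> I \<Longrightarrow> f i \<in> carrier R" "y \<in> carrier R"
  shows "finsum R f I \<otimes> y = (\<Oplus>i\<in>I. f i \<otimes> y)"
  using assms by (intro finsum_map[where h = "\<lambda>x. x \<otimes> y"]) (auto simp: l_distr abelian_monoid_axioms)

lemma finsum_mult_left:
  assumes "\<And>i. i \<in> I \<Longrightarrow> f i \<in> carrier R" "y \<in> carrier R"
  shows "y \<otimes> finsum R f I = (\<Oplus>i\<in>I. y \<otimes> f i)"
  using assms by (intro finsum_map[where h = "\<lambda>x. y \<otimes> x"]) (auto simp: r_distr abelian_monoid_axioms)

lemma finsum_smult:
  assumes "\<And>i. i \<in> I \<Longrightarrow> f i \<in> carrier R"
  shows "c \<odot> finsum R f I = (\<Oplus>i\<in>I. c \<odot> f i)"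
  using assms by (intro finsum_map[where h = "\<lambda>x. c \<odot> x"]) (auto simp: smult_add_right abelian_monoid_axioms)

lemma finsum_swap:
  assumes "finite I" "finite J" "\<And>i j. i \<in> I \<Longrightarrow> j \<in> J \<Longrightarrow> f i j \<in> carrier R"
  shows "(\<Oplus>i\<in>I. \<Oplus>j\<in>J. f i j) = (\<Oplus>j\<in>J. \<Oplus>i\<in>I. f i j)"
  using assms(1,3)
proof (induction I)
  case (insert i I)
  have "(\<Oplus>j\<in>J. \<Oplus>i\<in>insert i I. f i j) = (\<Oplus>j\<in>J. f i j \<oplus> (\<Oplus>i\<in>I. f i j))"
    using insert by (intro finsum_cong') (auto simp: finsum_insert intro!: finsum_closed)
  also have "\<dots> = (\<Oplus>j\<in>J. f i j) \<oplus> (\<Oplus>j\<in>J. \<Oplus>i\<in>I. f i j)"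
    using insert by (intro finsum_addf) (auto intro!: finsum_closed)
  finally show ?case
    using insert by (subst finsum_insert) (auto intro!: finsum_closed)
qed (simp add: finsum_zero)

section \<open>Rectangular matrices over an algebra\<close>

lemma matsI:
  assumes "\<And>i j. i < n \<Longrightarrow> j < m \<Longrightarrow> x (i, j) \<in> carrier R" "\<And>i j. \<not> (i < n \<and> j < m) \<Longrightarrow> x (i, j) = \<zero>"
  shows "x \<in> mats R n m"
  using assms by (auto simp: mats_def)

lemma mats_carrier: "x \<in> mats R n m \<Longrightarrow> x ij \<in> carrier R"
  by (cases ij) (force simp: mats_def)

lemma mats_zero: "x \<in> mats R n m \<Longrightarrow> \<not> (i < n \<and> j < m) \<Longrightarrow> x (i, j) = \<zero>"
  by (auto simp: mats_def)

lemma mats_mono: "x \<in> mats R n m \<Longrightarrow> n \<le> n' \<Longrightarrow> m \<le> m' \<Longrightarrow> x \<in> mats R n' m'"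
  by (intro matsI) (auto intro: mats_carrier mats_zero)

lemma zero_mats [simp]: "(\<lambda>_. \<zero>) \<in> mats R n m"
  by (auto simp: mats_def)

lemma add_mats: "x \<in> mats R n m \<Longrightarrow> y \<in> mats R n m \<Longrightarrow> (\<lambda>ij. x ij \<oplus> y ij) \<in> mats R n m"
  by (intro matsI) (auto simp: mats_carrier mats_zero)

lemma smult_mats: "x \<in> mats R n m \<Longrightarrow> (\<lambda>ij. c \<odot> x ij) \<in> mats R n m"
  by (intro matsI) (auto simp: mats_carrier mats_zero)

lemma mat_mult_mats:
  assumes "x \<in> mats R n k" "y \<in> mats R k' m"
  shows "mat_mult R l x y \<in> mats R n m"
proof (rule matsI)
  show "mat_mult R l x y (i, j) \<in> carrier R" for i j
    using assms by (auto simp: mat_mult_def mats_carrier intro!: finsum_closed)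
  show "mat_mult R l x y (i, j) = \<zero>" if "\<not> (i < n \<and> j < m)" for i j
  proof -
    have "x (i, l) \<otimes> y (l, j) = \<zero>" for l
    proof (cases "i < n")
      case True
      then have "y (l, j) = \<zero>" using that assms(2) by (auto intro: mats_zero)
      then show ?thesis using assms by (simp add: mats_carrier)
    next
      case False
      then have "x (i, l) = \<zero>" using assms(1) by (auto intro: mats_zero)
      then show ?thesis using assms by (simp add: mats_carrier)
    qed
    then show ?thesis by (simp add: mat_mult_def finsum_zero)
  qed
qed

text \<open>Once the summation bound covers the columns of \<open>x\<close> or the rows of
  \<open>y\<close>, every further term has a zero factor. This is what makes the inclusion of M_n in
  M_N multiplicative and allows idempotents of different sizes to be compared.\<close>

lemma mat_mult_extend:
  assumes "x \<in> mats R n k" "y \<in> mats R k' m" "k \<le> K \<or> k' \<le> K"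
    and "k \<le> L \<or> k' \<le> L"
  shows "mat_mult R K x y = mat_mult R L x y"
proof -
  have "mat_mult R K x y (i, j) = (\<Oplus>l\<in>{..<min k k'}. x (i, l) \<otimes> y (l, j))" if "k \<le> K \<or> k' \<le> K" for i j K
    unfolding mat_mult_def prod.case
  proof (rule add.finprod_mono_neutral_cong_right)
    fix l assume "l \<in> {..<K} - {..<min k k'}"
    then have "x (i, l) = \<zero> \<or> y (l, j) = \<zero>" using assms(1,2) mats_zero by (metis DiffE lessThan_iff min_less_iff_conj)
    then show "x (i, l) \<otimes> y (l, j) = \<zero>"
      using assms by (auto simp: mats_carrier)
  qed (use that assms in \<open>auto simp: mats_carrier\<close>)
  then show ?thesis using assms by (intro ext) (auto simp: split_paired_all)
qed

text \<open>The two finite sums are exchanged. The sizes of the three matrices and the bounds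
  \<open>k\<close>, \<open>l\<close> are unrelated, because entries outside the range are zeros and
  hence still in the carrier.\<close>

lemma mat_mult_assoc:
  assumes "x \<in> mats R n1 n2" "y \<in> mats R n3 n4" "z \<in> mats R n5 n6"
  shows "mat_mult R l (mat_mult R k x y) z = mat_mult R k x (mat_mult R l y z)"
proof (rule ext, clarify)
  fix i j
  have c: "x ij \<in> carrier R" "y ij \<in> carrier R" "z ij \<in> carrier R" for ij
    using assms by (auto simp: mats_carrier)
  have "mat_mult R l (mat_mult R k x y) z (i, j)
      = (\<Oplus>b\<in>{..<l}. \<Oplus>a\<in>{..<k}. x (i, a) \<otimes> (y (a, b) \<otimes> z (b, j)))"
    unfolding mat_mult_def prod.case
    by (intro finsum_cong') (auto simp: finsum_mult_right c m_assoc intro!: finsum_closed)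
  also have "\<dots> = (\<Oplus>a\<in>{..<k}. \<Oplus>b\<in>{..<l}. x (i, a) \<otimes> (y (a, b) \<otimes> z (b, j)))"
    by (intro finsum_swap) (auto simp: c)
  also have "\<dots> = mat_mult R k x (mat_mult R l y z) (i, j)"
    unfolding mat_mult_def prod.case
    by (intro finsum_cong') (auto simp: finsum_mult_left c intro!: finsum_closed)
  finally show "mat_mult R l (mat_mult R k x y) z (i, j) = mat_mult R k x (mat_mult R l y z) (i, j)" .
qed

lemma mat_mult_add_left:
  assumes "x \<in> mats R n1 n2" "x' \<in> mats R n3 n4" "y \<in> mats R n5 n6"
  shows "mat_mult R k (\<lambda>ij. x ij \<oplus> x' ij) y = (\<lambda>ij. mat_mult R k x y ij \<oplus> mat_mult R k x' y ij)"
proof (rule ext, clarify)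
  fix i j
  have c: "x ij \<in> carrier R" "x' ij \<in> carrier R" "y ij \<in> carrier R" for ij
    using assms by (auto simp: mats_carrier)
  show "mat_mult R k (\<lambda>ij. x ij \<oplus> x' ij) y (i, j) = mat_mult R k x y (i, j) \<oplus> mat_mult R k x' y (i, j)"
    unfolding mat_mult_def prod.case
    by (subst finsum_addf [symmetric]) (auto simp: c l_distr intro!: finsum_cong')
qed

lemma mat_mult_add_right:
  assumes "x \<in> mats R n1 n2" "x' \<in> mats R n3 n4" "y \<in> mats R n5 n6"
  shows "mat_mult R k y (\<lambda>ij. x ij \<oplus> x' ij) = (\<lambda>ij. mat_mult R k y x ij \<oplus> mat_mult R k y x' ij)"
proof (rule ext, clarify)
  fix i j
  have c: "x ij \<in> carrier R" "x' ij \<in> carrier R" "y ij \<in> carrier R" for ij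
    using assms by (auto simp: mats_carrier)
  show "mat_mult R k y (\<lambda>ij. x ij \<oplus> x' ij) (i, j) = mat_mult R k y x (i, j) \<oplus> mat_mult R k y x' (i, j)"
    unfolding mat_mult_def prod.case
    by (subst finsum_addf [symmetric]) (auto simp: c r_distr intro!: finsum_cong')
qed

end

section \<open>Block matrices\<close>

definition place :: "('a, 'm) ring_scheme \<Rightarrow> nat \<Rightarrow> nat \<Rightarrow> 'a matrix \<Rightarrow> 'a matrix" where
  "place R r c x = (\<lambda>(i, j). if r \<le> i \<and> c \<le> j then x (i - r, j - c) else \<zero>\<^bsub>R\<^esub>)"

context complex_alg
begin

lemma place_0 [simp]: "place R 0 0 x = x"
  by (auto simp: place_def)

lemma place_mats:
  assumes "x \<in> mats R n m" "r + n \<le> n'" "c + m \<le> m'"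
  shows "place R r c x \<in> mats R n' m'"
  using assms by (intro matsI) (auto simp: place_def intro!: mats_carrier mats_zero)

text \<open>Only the inner indices from \<open>c\<close> to \<open>c + k - 1\<close> contribute, and
  the shift by \<open>c\<close> turns the remaining sum into that of the unshifted product.\<close>

lemma mat_mult_place:
  assumes x: "x \<in> mats R n k" and y: "y \<in> mats R k m" and K: "c + k \<le> K"
  shows "mat_mult R K (place R r c x) (place R c s y) = place R r s (mat_mult R k x y)"
proof (rule ext, clarify)
  fix i j
  have car: "place R r c x ij \<in> carrier R" "place R c s y ij \<in> carrier R" for ij
    using x y by (auto simp: place_def mats_carrier split: prod.split)
  show "mat_mult R K (place R r c x) (place R c s y) (i, j) = place R r s (mat_mult R k x y) (i, j)"
  proof (cases "r \<le> i \<and> s \<le> j")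
    case False
    then have "place R r c x (i, l) \<otimes> place R c s y (l, j) = \<zero>" for l
      using car by (auto simp: place_def mats_carrier[OF x] mats_carrier[OF y])
    then have "mat_mult R K (place R r c x) (place R c s y) (i, j) = \<zero>"
      by (simp add: mat_mult_def finsum_zero)
    with False show ?thesis by (auto simp: place_def)
  next
    case True
    have "mat_mult R K (place R r c x) (place R c s y) (i, j)
        = (\<Oplus>l\<in>(+) c ` {..<k}. place R r c x (i, l) \<otimes> place R c s y (l, j))"
      unfolding mat_mult_def prod.case
    proof (rule add.finprod_mono_neutral_cong_right)
      fix l assume "l \<in> {..<K} - (+) c ` {..<k}"
      then have "l < c \<or> c + k \<le> l"
        by (metis DiffD2 add_diff_inverse_nat imageI lessThan_iff nat_add_left_cancel_le not_le)
      then have "place R r c x (i, l) = \<zero>"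
        by (cases "c \<le> l") (auto simp: place_def intro!: mats_zero[OF x])
      then show "place R r c x (i, l) \<otimes> place R c s y (l, j) = \<zero>"
        using car by simp
    qed (use K car in \<open>auto simp del: split_paired_All\<close>)
    also have "\<dots> = (\<Oplus>l\<in>{..<k}. place R r c x (i, c + l) \<otimes> place R c s y (c + l, j))"
      by (rule finsum_reindex) (use car in auto)
    also have "\<dots> = place R r s (mat_mult R k x y) (i, j)"
      using True by (simp add: place_def mat_mult_def)
    finally show ?thesis .
  qed
qed

lemma mat_mult_place_disjoint:
  assumes x: "x \<in> mats R n k" and y: "y \<in> mats R k' m" and "c + k \<le> c' \<or> c' + k' \<le> c"
  shows "mat_mult R K (place R r c x) (place R c' s y) = (\<lambda>_. \<zero>)"
proof (rule ext, clarify)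
  fix i j
  have "place R r c x (i, l) \<otimes> place R c' s y (l, j) = \<zero>" for l
  proof (cases "c \<le> l \<and> l < c + k")
    case True
    then have "place R c' s y (l, j) = \<zero>"
      using mats_zero[OF y] assms(3) by (auto simp: place_def)
    then show ?thesis using mats_carrier[OF x] by (auto simp: place_def)
  next
    case False
    then have "place R r c x (i, l) = \<zero>"
      by (cases "c \<le> l") (auto simp: place_def intro!: mats_zero[OF x])
    then show ?thesis using mats_carrier[OF y] by (auto simp: place_def)
  qed
  then show "mat_mult R K (place R r c x) (place R c' s y) (i, j) = \<zero>"
    by (simp add: mat_mult_def finsum_zero)
qed

lemma idem_sum_place:
  assumes "p \<in> mats R n n" "q \<in> mats R m m"
  shows "idem_sum R (n, p) (m, q) = (n + m, \<lambda>ij. p ij \<oplus> place R n n q ij)"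
  using assms by (auto simp: idem_sum_def place_def fun_eq_iff mats_carrier mats_zero)

text \<open>Blocks whose inner index ranges are disjoint multiply separately, so of the four
  products of shifted blocks the two mixed ones vanish. The outer positions \<open>r\<close>,
  \<open>r'\<close>, \<open>s\<close>, \<open>s'\<close> are free; the lemma thus covers block
  diagonal matrices as well as the block permutations of \<open>idem_sum_comm\<close>.\<close>

lemma mat_mult_blocks:
  assumes x: "x \<in> mats R n k" and y: "y \<in> mats R k m" and x': "x' \<in> mats R n' k'" and y': "y' \<in> mats R k' m'"
    and K: "c + k \<le> K" "c' + k' \<le> K" and disj: "c + k \<le> c' \<or> c' + k' \<le> c"
  shows "mat_mult R K (\<lambda>ij. place R r c x ij \<oplus> place R r' c' x' ij) (\<lambda>ij. place R c s y ij \<oplus> place R c' s' y' ij)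
    = (\<lambda>ij. place R r s (mat_mult R k x y) ij \<oplus> place R r' s' (mat_mult R k' x' y') ij)"
proof -
  note pl = place_mats[OF x order_refl order_refl, of r c] place_mats[OF x' order_refl order_refl, of r' c']
    place_mats[OF y order_refl order_refl, of c s] place_mats[OF y' order_refl order_refl, of c' s']
  note mm = mat_mult_mats[OF x y] mat_mult_mats[OF x' y']
  have car: "place R r s (mat_mult R k x y) ij \<in> carrier R"
      "place R r' s' (mat_mult R k' x' y') ij \<in> carrier R" for ij
    by (rule mats_carrier, rule place_mats, rule mm, rule order_refl, rule order_refl)+
  have a: "(\<lambda>ij. place R r c x ij \<oplus> place R r' c' x' ij) \<in> mats R (max (r+n) (r'+n')) (max (c+k) (c'+k'))"
    by (intro add_mats place_mats[OF x] place_mats[OF x']) auto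
  show ?thesis
    using disj car
    by (subst mat_mult_add_right[OF pl(3,4) a])
      (auto simp: mat_mult_add_left[OF pl(1,2) pl(3)] mat_mult_add_left[OF pl(1,2) pl(4)]
        mat_mult_place[OF x y K(1)] mat_mult_place[OF x' y' K(2)]
        mat_mult_place_disjoint[OF x y'] mat_mult_place_disjoint[OF x' y])
qed

end

subsection \<open>The group \<open>K\<^sub>0\<close>\<close>

text \<open>\<open>K0_unital\<close> and \<open>K0_unital_map\<close> define their operations as
  unions over all representatives. When each representative yields the same class, the union is that
  class, provided there is at least one representative.\<close>

lemma UN_const_on: "X \<noteq> {} \<Longrightarrow> (\<And>x. x \<in> X \<Longrightarrow> f x = C) \<Longrightarrow> (\<Union>x\<in>X. f x) = C"
  by auto

context complex_alg
begin

lemma idems_iff: "(n, p) \<in> idems R \<longleftrightarrow> n \<ge> 1 \<and> p \<in> mats R n n \<and> mat_mult R n p p = p"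
  by (simp add: idems_def)

lemma zero_idem_idems: "zero_idem R \<in> idems R"
  by (auto simp: zero_idem_def idems_def mat_mult_def finsum_zero)

lemma idem_equiv_refl: "a \<in> idems R \<Longrightarrow> idem_equiv R a a"
  by (auto simp: idems_def idem_equiv_def)

lemma idem_equiv_sym: "idem_equiv R a b \<Longrightarrow> idem_equiv R b a"
  by (auto simp: idem_equiv_def)

text \<open>With \<open>x y = p\<close>, \<open>y x = q\<close>, \<open>z w = q\<close> and
  \<open>w z = r\<close>, the new witnesses are \<open>x z\<close> and \<open>w y\<close>: one has
  \<open>x z w y = x q y = x y p = p p = p\<close>, and symmetrically for \<open>r\<close>. The
  given witnesses are not assumed to be cut down by the idempotents, so the idempotency of the outer
  two closes the computation.\<close>

lemma idem_equiv_trans: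
  assumes "idem_equiv R a b" "idem_equiv R b c" and a: "a \<in> idems R" and c: "c \<in> idems R"
  shows "idem_equiv R a c"
proof -
  obtain n p m q l r where [simp]: "a = (n, p)" "b = (m, q)" "c = (l, r)"
    by (metis prod.exhaust)
  obtain x y where x: "x \<in> mats R n m" and y: "y \<in> mats R m n"
    and xy: "mat_mult R m x y = p" "mat_mult R n y x = q"
    using assms(1) by (auto simp: idem_equiv_def)
  obtain z w where z: "z \<in> mats R m l" and w: "w \<in> mats R l m"
    and zw: "mat_mult R l z w = q" "mat_mult R m w z = r"
    using assms(2) by (auto simp: idem_equiv_def)
  have p: "mat_mult R n p p = p" and r: "mat_mult R l r r = r"
    using a c by (auto simp: idems_def)
  note xz = mat_mult_mats[OF x z, of m] and wy = mat_mult_mats[OF w y, of m]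
  have "mat_mult R l (mat_mult R m x z) (mat_mult R m w y) = mat_mult R m x (mat_mult R l z (mat_mult R m w y))"
    by (rule mat_mult_assoc[OF x z wy])
  also have "mat_mult R l z (mat_mult R m w y) = mat_mult R m q y"
    using mat_mult_assoc[OF z w y, of m l] zw by simp
  also have "mat_mult R m q y = mat_mult R n y p"
    using mat_mult_assoc[OF y x y, of m n] xy by simp
  also have "mat_mult R m x (mat_mult R n y p) = p"
    using mat_mult_assoc[OF x y mats_mono, of p n n n n n m] xy p a by (simp add: idems_iff)
  finally have 1: "mat_mult R l (mat_mult R m x z) (mat_mult R m w y) = p" .
  have "mat_mult R n (mat_mult R m w y) (mat_mult R m x z) = mat_mult R m w (mat_mult R n y (mat_mult R m x z))"
    by (rule mat_mult_assoc[OF w y xz])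
  also have "mat_mult R n y (mat_mult R m x z) = mat_mult R m q z"
    using mat_mult_assoc[OF y x z, of m n] xy by simp
  also have "mat_mult R m q z = mat_mult R l z r"
    using mat_mult_assoc[OF z w z, of m l] zw by simp
  also have "mat_mult R m w (mat_mult R l z r) = r"
    using mat_mult_assoc[OF w z mats_mono, of r l l l l l m] zw r c by (simp add: idems_iff)
  finally show ?thesis using 1 xz wy by (auto simp: idem_equiv_def)
qed

lemma idem_sum_closed:
  assumes "a \<in> idems R" "b \<in> idems R"
  shows "idem_sum R a b \<in> idems R"
proof -
  obtain n p m q where [simp]: "a = (n, p)" "b = (m, q)" by (metis prod.exhaust)
  have p: "p \<in> mats R n n" "mat_mult R n p p = p" "n \<ge> 1" and q: "q \<in> mats R m m" "mat_mult R m q q = q"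
    using assms by (auto simp: idems_def)
  have "mat_mult R (n + m) (\<lambda>ij. p ij \<oplus> place R n n q ij) (\<lambda>ij. p ij \<oplus> place R n n q ij) = (\<lambda>ij. p ij \<oplus> place R n n q ij)"
    using mat_mult_blocks[OF p(1) p(1) q(1) q(1), of 0 "n + m" n 0 n 0 n] p q by simp
  moreover have "(\<lambda>ij. p ij \<oplus> place R n n q ij) \<in> mats R (n + m) (n + m)"
    by (intro add_mats mats_mono[OF p(1)] place_mats[OF q(1)]) auto
  ultimately show ?thesis
    using p q by (simp add: idem_sum_place idems_iff)
qed

lemma idem_sum_cong:
  assumes ab: "idem_equiv R a b" "idem_equiv R c d" and i: "a \<in> idems R" "b \<in> idems R" "c \<in> idems R" "d \<in> idems R"
  shows "idem_equiv R (idem_sum R a c) (idem_sum R b d)"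
proof -
  obtain n p m q n' p' m' q' where [simp]: "a = (n, p)" "b = (m, q)" "c = (n', p')" "d = (m', q')"
    by (metis prod.exhaust)
  have mats: "p \<in> mats R n n" "q \<in> mats R m m" "p' \<in> mats R n' n'" "q' \<in> mats R m' m'"
    using i by (auto simp: idems_def)
  obtain x y where x: "x \<in> mats R n m" and y: "y \<in> mats R m n"
    and xy: "mat_mult R m x y = p" "mat_mult R n y x = q"
    using ab(1) by (auto simp: idem_equiv_def)
  obtain z w where z: "z \<in> mats R n' m'" and w: "w \<in> mats R m' n'"
    and zw: "mat_mult R m' z w = p'" "mat_mult R n' w z = q'"
    using ab(2) by (auto simp: idem_equiv_def)
  let ?x = "\<lambda>ij. x ij \<oplus> place R n m z ij" and ?y = "\<lambda>ij. y ij \<oplus> place R m n w ij"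
  have "?x \<in> mats R (n + n') (m + m')" "?y \<in> mats R (m + m') (n + n')"
    by (intro add_mats mats_mono[OF x] mats_mono[OF y] place_mats[OF z] place_mats[OF w]; simp)+
  moreover have "mat_mult R (m + m') ?x ?y = (\<lambda>ij. p ij \<oplus> place R n n p' ij)"
    using mat_mult_blocks[OF x y z w, of 0 "m + m'" m 0 n 0 n] xy zw by simp
  moreover have "mat_mult R (n + n') ?y ?x = (\<lambda>ij. q ij \<oplus> place R m m q' ij)"
    using mat_mult_blocks[OF y x w z, of 0 "n + n'" n 0 m 0 m] xy zw by simp
  ultimately show ?thesis
    using mats by (auto simp: idem_sum_place idem_equiv_def)
qed

lemma idem_sum_comm:
  assumes "a \<in> idems R" "b \<in> idems R"
  shows "idem_equiv R (idem_sum R a b) (idem_sum R b a)"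
proof -
  obtain n p m q where [simp]: "a = (n, p)" "b = (m, q)" by (metis prod.exhaust)
  have p: "p \<in> mats R n n" "mat_mult R n p p = p" and q: "q \<in> mats R m m" "mat_mult R m q q = q"
    using assms by (auto simp: idems_def)
  \<comment> \<open>In block form the witnesses are [[0, p], [q, 0]] and [[0, q], [p, 0]]: the
    exchange of the two summands, cut down by \<open>p\<close> and \<open>q\<close>.\<close>
  let ?x = "\<lambda>ij. place R 0 m p ij \<oplus> place R n 0 q ij" and ?y = "\<lambda>ij. place R m 0 p ij \<oplus> place R 0 n q ij"
  have "?x \<in> mats R (n + m) (m + n)" "?y \<in> mats R (m + n) (n + m)"
    by (intro add_mats place_mats[OF p(1)] place_mats[OF q(1)]; simp)+
  moreover have "mat_mult R (m + n) ?x ?y = (\<lambda>ij. p ij \<oplus> place R n n q ij)"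
    using mat_mult_blocks[OF p(1) p(1) q(1) q(1), of m "m + n" 0 0 n 0 n] p q by simp
  moreover have "mat_mult R (n + m) ?y ?x = (\<lambda>ij. q ij \<oplus> place R m m p ij)"
    using mat_mult_blocks[OF p(1) p(1) q(1) q(1), of 0 "n + m" n m 0 m 0] p q
    by (simp add: a_comm mats_carrier[OF q(1)] mats_carrier[OF place_mats[OF p(1) order_refl order_refl]])
  ultimately show ?thesis
    using p q by (auto simp: idem_sum_place idem_equiv_def)
qed

lemma idem_sum_assoc:
  "idem_sum R (idem_sum R a b) c = idem_sum R a (idem_sum R b c)"
proof -
  obtain n p m q l r where [simp]: "a = (n, p)" "b = (m, q)" "c = (l, r)"
    by (metis prod.exhaust)
  have "snd (idem_sum R (idem_sum R a b) c) (i, j) = snd (idem_sum R a (idem_sum R b c)) (i, j)" for i j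
  proof (cases "n \<le> i \<and> n \<le> j")
    case True
    then obtain i' j' where "i = n + i'" "j = n + j'" by (metis le_Suc_ex)
    then show ?thesis by (simp add: idem_sum_def)
  next
    case False
    then have "\<not> (n + m \<le> i \<and> n + m \<le> j)" by linarith
    with False show ?thesis by (auto simp: idem_sum_def)
  qed
  moreover have "fst (idem_sum R (idem_sum R a b) c) = fst (idem_sum R a (idem_sum R b c))"
    by (simp add: idem_sum_def)
  ultimately show ?thesis
    by (auto intro!: prod_eqI)
qed

lemma idem_sum_zero:
  assumes "a \<in> idems R"
  shows "idem_equiv R (idem_sum R a (zero_idem R)) a"
proof -
  obtain n p where [simp]: "a = (n, p)" by (metis prod.exhaust)
  have p: "p \<in> mats R n n" "mat_mult R n p p = p"
    using assms by (auto simp: idems_def)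
  \<comment> \<open>Adding a zero summand changes the recorded size only, not the underlying
    function, so \<open>p\<close> serves as both witnesses, read as an
    \<open>(n + 1) \<times> n\<close> and as an \<open>n \<times> (n + 1)\<close> matrix.\<close>
  have "idem_sum R a (zero_idem R) = (n + 1, p)"
    using mats_zero[OF p(1)] by (auto simp: idem_sum_def zero_idem_def fun_eq_iff)
  moreover have "p \<in> mats R (n + 1) n" "p \<in> mats R n (n + 1)"
    by (rule mats_mono[OF p(1)]; simp)+
  moreover have "mat_mult R (n + 1) p p = p"
    using mat_mult_extend[OF p(1) p(1), of "n + 1" n] p by simp
  ultimately show ?thesis
    using p by (auto simp: idem_equiv_def)
qed

end

section \<open>The monoid of equivalence classes of idempotents and its Grothendieck group\<close>

definition idem_class :: "('a, 'm) ring_scheme \<Rightarrow> 'a idem \<Rightarrow> 'a idem set" where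
  "idem_class R a = {b \<in> idems R. idem_equiv R a b}"

text \<open>This is the monoid usually called V(R). Having it as a commutative monoid of HOL-Algebra
  turns manipulations of equivalences of direct sums into rewriting with associativity and
  commutativity.\<close>

definition idem_monoid :: "('a, 'm) ring_scheme \<Rightarrow> 'a idem set monoid" where
  "idem_monoid R = \<lparr>carrier = idem_class R ` idems R,
     monoid.mult = (\<lambda>X Y. idem_class R (idem_sum R (SOME a. a \<in> X) (SOME b. b \<in> Y))),
     one = idem_class R (zero_idem R)\<rparr>"

abbreviation K0_class :: "('a, 'm) ring_scheme \<Rightarrow> 'a idem \<Rightarrow> 'a idem \<Rightarrow> ('a idem \<times> 'a idem) set" where
  "K0_class R p q \<equiv> K0_rel R `` {(p, q)}"

text \<open>Transitivity of the Grothendieck relation in a monoid that may lack cancellation: the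
  two given equations are multiplied, and the new stabilising element has to absorb the middle pair
  \<open>p'\<close>, \<open>q'\<close> in addition to \<open>r\<close> and \<open>s\<close>.\<close>

lemma (in Group.comm_monoid) difference_trans:
  assumes "p \<in> carrier G" "q \<in> carrier G" "p' \<in> carrier G" "q' \<in> carrier G" "p'' \<in> carrier G" "q'' \<in> carrier G"
    "r \<in> carrier G" "s \<in> carrier G"
    and 1: "p \<otimes> q' \<otimes> r = p' \<otimes> q \<otimes> r" and 2: "p' \<otimes> q'' \<otimes> s = p'' \<otimes> q' \<otimes> s"
  shows "p \<otimes> q'' \<otimes> (r \<otimes> s \<otimes> p' \<otimes> q') = p'' \<otimes> q \<otimes> (r \<otimes> s \<otimes> p' \<otimes> q')"
proof -
  have "p \<otimes> q'' \<otimes> (r \<otimes> s \<otimes> p' \<otimes> q') = (p \<otimes> q' \<otimes> r) \<otimes> (q'' \<otimes> s \<otimes> p')"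
    using assms(1-8) by (simp add: m_ac)
  also have "\<dots> = (p' \<otimes> q'' \<otimes> s) \<otimes> (p' \<otimes> q \<otimes> r)"
    unfolding 1 using assms(1-8) by (simp add: m_ac)
  also have "\<dots> = p'' \<otimes> q \<otimes> (r \<otimes> s \<otimes> p' \<otimes> q')"
    unfolding 2 using assms(1-8) by (simp add: m_ac)
  finally show ?thesis .
qed

context complex_alg
begin

lemma idem_class_eq_iff:
  assumes "a \<in> idems R" "b \<in> idems R"
  shows "idem_class R a = idem_class R b \<longleftrightarrow> idem_equiv R a b"
proof
  assume "idem_class R a = idem_class R b"
  then have "b \<in> idem_class R a"
    using idem_equiv_refl[OF assms(2)] assms(2) by (simp add: idem_class_def)
  then show "idem_equiv R a b"
    by (simp add: idem_class_def)
next
  assume ab: "idem_equiv R a b"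
  show "idem_class R a = idem_class R b"
    unfolding idem_class_def
    using idem_equiv_trans[OF ab _ assms(1)] idem_equiv_trans[OF idem_equiv_sym[OF ab] _ assms(2)] by auto
qed

lemma idem_class_mult:
  assumes "a \<in> idems R" "b \<in> idems R"
  shows "idem_class R a \<otimes>\<^bsub>idem_monoid R\<^esub> idem_class R b = idem_class R (idem_sum R a b)"
proof -
  have 1: "(SOME c. c \<in> idem_class R a) \<in> idem_class R a" if "a \<in> idems R" for a
    using that idem_equiv_refl by (intro someI[of "\<lambda>c. c \<in> idem_class R a" a]) (simp add: idem_class_def)
  have "idem_equiv R (idem_sum R (SOME c. c \<in> idem_class R a) (SOME c. c \<in> idem_class R b)) (idem_sum R a b)"
    using 1[OF assms(1)] 1[OF assms(2)] assms
    by (intro idem_sum_cong) (auto simp: idem_class_def dest: idem_equiv_sym)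
  moreover have "(SOME c. c \<in> idem_class R a) \<in> idems R" "(SOME c. c \<in> idem_class R b) \<in> idems R"
    using 1[OF assms(1)] 1[OF assms(2)] by (simp_all only: idem_class_def mem_Collect_eq)
  ultimately show ?thesis
    by (simp add: idem_monoid_def idem_class_eq_iff assms idem_sum_closed)
qed

lemma idem_class_closed: "a \<in> idems R \<Longrightarrow> idem_class R a \<in> carrier (idem_monoid R)"
  by (simp add: idem_monoid_def)

lemma idem_monoid_comm_monoid: "Group.comm_monoid (idem_monoid R)"
proof (rule comm_monoidI)
  have 1: "\<one>\<^bsub>idem_monoid R\<^esub> = idem_class R (zero_idem R)"
    by (simp add: idem_monoid_def)
  show "\<one>\<^bsub>idem_monoid R\<^esub> \<in> carrier (idem_monoid R)"
    unfolding 1 by (intro idem_class_closed zero_idem_idems)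
  fix x y z assume "x \<in> carrier (idem_monoid R)" "y \<in> carrier (idem_monoid R)" "z \<in> carrier (idem_monoid R)"
  then obtain a b c where [simp]: "x = idem_class R a" "y = idem_class R b" "z = idem_class R c"
    and i [simp]: "a \<in> idems R" "b \<in> idems R" "c \<in> idems R" by (auto simp: idem_monoid_def)
  note [simp] = idem_class_mult idem_sum_closed zero_idem_idems idem_class_closed
  show "x \<otimes>\<^bsub>idem_monoid R\<^esub> y \<in> carrier (idem_monoid R)"
    by simp
  show "x \<otimes>\<^bsub>idem_monoid R\<^esub> y \<otimes>\<^bsub>idem_monoid R\<^esub> z = x \<otimes>\<^bsub>idem_monoid R\<^esub> (y \<otimes>\<^bsub>idem_monoid R\<^esub> z)"
    by (simp add: idem_sum_assoc)
  show "x \<otimes>\<^bsub>idem_monoid R\<^esub> y = y \<otimes>\<^bsub>idem_monoid R\<^esub> x"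
    by (simp add: idem_class_eq_iff idem_sum_comm)
  have "x \<otimes>\<^bsub>idem_monoid R\<^esub> \<one>\<^bsub>idem_monoid R\<^esub> = x"
    by (simp add: 1 idem_class_eq_iff idem_sum_zero)
  moreover have "x \<otimes>\<^bsub>idem_monoid R\<^esub> \<one>\<^bsub>idem_monoid R\<^esub> = \<one>\<^bsub>idem_monoid R\<^esub> \<otimes>\<^bsub>idem_monoid R\<^esub> x"
    by (simp add: 1 idem_class_eq_iff idem_sum_comm)
  ultimately show "\<one>\<^bsub>idem_monoid R\<^esub> \<otimes>\<^bsub>idem_monoid R\<^esub> x = x"
    by simp
qed

sublocale V: Group.comm_monoid "idem_monoid R"
  by (rule idem_monoid_comm_monoid)

text \<open>The relation becomes an equation in \<open>idem_monoid\<close>, where the simplifier can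
  rearrange summands freely.\<close>

lemma K0_rel_iff:
  "((p, q), (p', q')) \<in> K0_rel R \<longleftrightarrow> p \<in> idems R \<and> q \<in> idems R \<and> p' \<in> idems R \<and> q' \<in> idems R \<and>
     (\<exists>r\<in>idems R. idem_class R p \<otimes>\<^bsub>idem_monoid R\<^esub> idem_class R q' \<otimes>\<^bsub>idem_monoid R\<^esub> idem_class R r
       = idem_class R p' \<otimes>\<^bsub>idem_monoid R\<^esub> idem_class R q \<otimes>\<^bsub>idem_monoid R\<^esub> idem_class R r)"
  by (auto simp: K0_rel_def idem_class_mult idem_sum_closed idem_class_eq_iff)

lemma equiv_K0_rel: "equiv (idems R \<times> idems R) (K0_rel R)"
proof (rule equivI)
  show "K0_rel R \<subseteq> (idems R \<times> idems R) \<times> (idems R \<times> idems R)"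
    by (auto simp: K0_rel_def)
  show "refl_on (idems R \<times> idems R) (K0_rel R)"
    using zero_idem_idems by (auto simp: refl_on_def K0_rel_iff)
  show "sym (K0_rel R)"
  proof (rule symI, clarify)
    fix p q p' q' assume "((p, q), p', q') \<in> K0_rel R"
    then obtain r where "p \<in> idems R" "q \<in> idems R" "p' \<in> idems R" "q' \<in> idems R" "r \<in> idems R"
      and "idem_class R p \<otimes>\<^bsub>idem_monoid R\<^esub> idem_class R q' \<otimes>\<^bsub>idem_monoid R\<^esub> idem_class R r
        = idem_class R p' \<otimes>\<^bsub>idem_monoid R\<^esub> idem_class R q \<otimes>\<^bsub>idem_monoid R\<^esub> idem_class R r"
      unfolding K0_rel_iff by blast
    then show "((p', q'), p, q) \<in> K0_rel R"
      unfolding K0_rel_iff by (metis)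
  qed
  show "trans (K0_rel R)"
  proof (rule transI, clarify)
    fix p q p' q' p'' q''
    assume a: "((p, q), p', q') \<in> K0_rel R" "((p', q'), p'', q'') \<in> K0_rel R"
    obtain r s where i: "p \<in> idems R" "q \<in> idems R" "p' \<in> idems R" "q' \<in> idems R" "p'' \<in> idems R" "q'' \<in> idems R"
       "r \<in> idems R" "s \<in> idems R"
      and e: "idem_class R p \<otimes>\<^bsub>idem_monoid R\<^esub> idem_class R q' \<otimes>\<^bsub>idem_monoid R\<^esub> idem_class R r
       = idem_class R p' \<otimes>\<^bsub>idem_monoid R\<^esub> idem_class R q \<otimes>\<^bsub>idem_monoid R\<^esub> idem_class R r"
       "idem_class R p' \<otimes>\<^bsub>idem_monoid R\<^esub> idem_class R q'' \<otimes>\<^bsub>idem_monoid R\<^esub> idem_class R s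
       = idem_class R p'' \<otimes>\<^bsub>idem_monoid R\<^esub> idem_class R q' \<otimes>\<^bsub>idem_monoid R\<^esub> idem_class R s"
      using a unfolding K0_rel_iff by blast
    \<comment> \<open>The stabilising element of \<open>difference_trans\<close>, now as an
      idempotent.\<close>
    let ?t = "idem_sum R (idem_sum R (idem_sum R r s) p') q'"
    have "idem_class R p \<otimes>\<^bsub>idem_monoid R\<^esub> idem_class R q'' \<otimes>\<^bsub>idem_monoid R\<^esub> idem_class R ?t
       = idem_class R p'' \<otimes>\<^bsub>idem_monoid R\<^esub> idem_class R q \<otimes>\<^bsub>idem_monoid R\<^esub> idem_class R ?t"
      using V.difference_trans[OF i[THEN idem_class_closed] e]
      by (simp only: idem_class_mult idem_sum_closed i)
    then show "((p, q), p'', q'') \<in> K0_rel R"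
      unfolding K0_rel_iff by (intro conjI bexI[of _ ?t]) (use i in \<open>simp_all only: idem_sum_closed\<close>)
  qed
qed

lemma K0_class_eq_iff:
  assumes "p \<in> idems R" "q \<in> idems R" "p' \<in> idems R" "q' \<in> idems R"
  shows "K0_class R p q = K0_class R p' q' \<longleftrightarrow> ((p, q), (p', q')) \<in> K0_rel R"
  using assms eq_equiv_class_iff[OF equiv_K0_rel] by auto

lemma K0_class_closed: "p \<in> idems R \<Longrightarrow> q \<in> idems R \<Longrightarrow> K0_class R p q \<in> carrier (K0_unital R)"
  by (auto simp: K0_unital_def intro!: quotientI)

lemma K0_unital_cases:
  assumes "X \<in> carrier (K0_unital R)"
  obtains p q where "p \<in> idems R" "q \<in> idems R" "X = K0_class R p q"
  using assms by (auto simp: K0_unital_def elim!: quotientE)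

lemma K0_class_self: "p \<in> idems R \<Longrightarrow> q \<in> idems R \<Longrightarrow> (p, q) \<in> K0_class R p q"
  using equiv_class_self[OF equiv_K0_rel] by auto

lemma K0_class_nonempty: "p \<in> idems R \<Longrightarrow> q \<in> idems R \<Longrightarrow> K0_class R p q \<noteq> {}"
  using K0_class_self by (metis empty_iff)

lemma K0_rel_sum:
  assumes 1: "((p, q), (p1, q1)) \<in> K0_rel R" and 2: "((p', q'), (p1', q1')) \<in> K0_rel R"
  shows "((idem_sum R p p', idem_sum R q q'), (idem_sum R p1 p1', idem_sum R q1 q1')) \<in> K0_rel R"
proof -
  let ?c = "idem_class R"
  obtain r where i: "p \<in> idems R" "q \<in> idems R" "p1 \<in> idems R" "q1 \<in> idems R" "r \<in> idems R"
    and e: "?c p \<otimes>\<^bsub>idem_monoid R\<^esub> ?c q1 \<otimes>\<^bsub>idem_monoid R\<^esub> ?c r = ?c p1 \<otimes>\<^bsub>idem_monoid R\<^esub> ?c q \<otimes>\<^bsub>idem_monoid R\<^esub> ?c r"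
    using 1 unfolding K0_rel_iff by blast
  obtain s where j: "p' \<in> idems R" "q' \<in> idems R" "p1' \<in> idems R" "q1' \<in> idems R" "s \<in> idems R"
    and e': "?c p' \<otimes>\<^bsub>idem_monoid R\<^esub> ?c q1' \<otimes>\<^bsub>idem_monoid R\<^esub> ?c s = ?c p1' \<otimes>\<^bsub>idem_monoid R\<^esub> ?c q' \<otimes>\<^bsub>idem_monoid R\<^esub> ?c s"
    using 2 unfolding K0_rel_iff by blast
  note ij = i[THEN idem_class_closed] j[THEN idem_class_closed]
  have "(?c p \<otimes>\<^bsub>idem_monoid R\<^esub> ?c p') \<otimes>\<^bsub>idem_monoid R\<^esub> (?c q1 \<otimes>\<^bsub>idem_monoid R\<^esub> ?c q1') \<otimes>\<^bsub>idem_monoid R\<^esub> (?c r \<otimes>\<^bsub>idem_monoid R\<^esub> ?c s)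
    = (?c p \<otimes>\<^bsub>idem_monoid R\<^esub> ?c q1 \<otimes>\<^bsub>idem_monoid R\<^esub> ?c r) \<otimes>\<^bsub>idem_monoid R\<^esub> (?c p' \<otimes>\<^bsub>idem_monoid R\<^esub> ?c q1' \<otimes>\<^bsub>idem_monoid R\<^esub> ?c s)"
    using ij by (simp add: V.m_ac)
  also have "\<dots> = (?c p1 \<otimes>\<^bsub>idem_monoid R\<^esub> ?c p1') \<otimes>\<^bsub>idem_monoid R\<^esub> (?c q \<otimes>\<^bsub>idem_monoid R\<^esub> ?c q') \<otimes>\<^bsub>idem_monoid R\<^esub> (?c r \<otimes>\<^bsub>idem_monoid R\<^esub> ?c s)"
    unfolding e e' using ij by (simp add: V.m_ac)
  finally have "?c (idem_sum R p p') \<otimes>\<^bsub>idem_monoid R\<^esub> ?c (idem_sum R q1 q1') \<otimes>\<^bsub>idem_monoid R\<^esub> ?c (idem_sum R r s)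
    = ?c (idem_sum R p1 p1') \<otimes>\<^bsub>idem_monoid R\<^esub> ?c (idem_sum R q q') \<otimes>\<^bsub>idem_monoid R\<^esub> ?c (idem_sum R r s)"
    by (simp only: idem_class_mult i j)
  then show ?thesis
    unfolding K0_rel_iff
    by (intro conjI bexI[of _ "idem_sum R r s"]) (simp_all only: i j idem_sum_closed)
qed

lemma K0_class_mult:
  assumes "p \<in> idems R" "q \<in> idems R" "p' \<in> idems R" "q' \<in> idems R"
  shows "K0_class R p q \<otimes>\<^bsub>K0_unital R\<^esub> K0_class R p' q' = K0_class R (idem_sum R p p') (idem_sum R q q')"
proof -
  have e: "K0_class R (idem_sum R a a') (idem_sum R b b') = K0_class R (idem_sum R p p') (idem_sum R q q')"
    if "(a, b) \<in> K0_class R p q" "(a', b') \<in> K0_class R p' q'" for a b a' b'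
    using that by (intro equiv_class_eq[OF equiv_K0_rel, symmetric] K0_rel_sum) auto
  have "(\<Union>(a, b)\<in>K0_class R p q. \<Union>(a', b')\<in>K0_class R p' q'. K0_class R (idem_sum R a a') (idem_sum R b b'))
    = K0_class R (idem_sum R p p') (idem_sum R q q')"
  proof (rule UN_const_on, rule K0_class_nonempty[OF assms(1,2)])
    fix x assume x: "x \<in> K0_class R p q"
    have "(\<Union>(a', b')\<in>K0_class R p' q'. K0_class R (idem_sum R (fst x) a') (idem_sum R (snd x) b'))
      = K0_class R (idem_sum R p p') (idem_sum R q q')"
    proof (rule UN_const_on, rule K0_class_nonempty[OF assms(3,4)])
      fix y assume "y \<in> K0_class R p' q'"
      with x show "(case y of (a', b') \<Rightarrow> K0_class R (idem_sum R (fst x) a') (idem_sum R (snd x) b'))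
        = K0_class R (idem_sum R p p') (idem_sum R q q')"
        by (cases x; cases y) (simp only: prod.case fst_conv snd_conv e)
    qed
    then show "(case x of (a, b) \<Rightarrow> \<Union>(a', b')\<in>K0_class R p' q'. K0_class R (idem_sum R a a') (idem_sum R b b'))
      = K0_class R (idem_sum R p p') (idem_sum R q q')"
      by (cases x) simp
  qed
  then show ?thesis by (simp add: K0_unital_def)
qed

lemma K0_unital_one: "\<one>\<^bsub>K0_unital R\<^esub> = K0_class R (zero_idem R) (zero_idem R)"
  by (simp add: K0_unital_def)

lemma K0_class_eqI:
  assumes "p \<in> idems R" "q \<in> idems R" "p' \<in> idems R" "q' \<in> idems R"
    and "idem_equiv R (idem_sum R p q') (idem_sum R p' q)"
  shows "K0_class R p q = K0_class R p' q'"
  unfolding K0_class_eq_iff[OF assms(1-4)] K0_rel_iff using assms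
  by (intro conjI bexI[of _ "zero_idem R"])
    (simp_all add: idem_class_mult idem_sum_closed idem_class_eq_iff zero_idem_idems idem_sum_cong idem_equiv_refl)

lemma K0_class_diag:
  assumes "p \<in> idems R"
  shows "K0_class R p p = \<one>\<^bsub>K0_unital R\<^esub>"
  unfolding K0_unital_one using assms
  by (intro K0_class_eqI) (auto simp: zero_idem_idems idem_sum_comm)

lemma K0_unital_comm_group: "comm_group (K0_unital R)"
proof (rule comm_groupI)
  show "\<one>\<^bsub>K0_unital R\<^esub> \<in> carrier (K0_unital R)"
    unfolding K0_unital_one by (intro K0_class_closed zero_idem_idems)
  fix x y z assume "x \<in> carrier (K0_unital R)" "y \<in> carrier (K0_unital R)" "z \<in> carrier (K0_unital R)"
  then obtain p q p' q' p'' q'' where [simp]: "x = K0_class R p q" "y = K0_class R p' q'" "z = K0_class R p'' q''"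
    and i [simp]: "p \<in> idems R" "q \<in> idems R" "p' \<in> idems R" "q' \<in> idems R" "p'' \<in> idems R" "q'' \<in> idems R"
    by (auto elim!: K0_unital_cases)
  note [simp] = K0_class_mult idem_sum_closed
  show "x \<otimes>\<^bsub>K0_unital R\<^esub> y \<in> carrier (K0_unital R)"
    by (simp add: K0_class_closed)
  show "x \<otimes>\<^bsub>K0_unital R\<^esub> y \<otimes>\<^bsub>K0_unital R\<^esub> z = x \<otimes>\<^bsub>K0_unital R\<^esub> (y \<otimes>\<^bsub>K0_unital R\<^esub> z)"
    by (simp add: idem_sum_assoc)
  have comm: "K0_class R (idem_sum R p p') (idem_sum R q q') = K0_class R (idem_sum R p' p) (idem_sum R q' q)"
    if "p \<in> idems R" "q \<in> idems R" "p' \<in> idems R" "q' \<in> idems R" for p q p' q'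
    using that by (intro K0_class_eqI) (auto intro!: idem_sum_cong idem_sum_comm)
  show "x \<otimes>\<^bsub>K0_unital R\<^esub> y = y \<otimes>\<^bsub>K0_unital R\<^esub> x"
    by (simp add: comm[of p q p' q'])
  have "K0_class R (idem_sum R p (zero_idem R)) (idem_sum R q (zero_idem R)) = K0_class R p q"
    by (intro K0_class_eqI idem_equiv_trans[OF idem_sum_cong[OF idem_sum_zero idem_equiv_refl]]
        idem_sum_cong[OF idem_equiv_refl idem_equiv_sym[OF idem_sum_zero]])
      (auto simp: zero_idem_idems)
  then show "\<one>\<^bsub>K0_unital R\<^esub> \<otimes>\<^bsub>K0_unital R\<^esub> x = x"
    by (simp add: K0_unital_one zero_idem_idems comm[of "zero_idem R"])
  show "\<exists>y\<in>carrier (K0_unital R). y \<otimes>\<^bsub>K0_unital R\<^esub> x = \<one>\<^bsub>K0_unital R\<^esub>"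
  proof
    show "K0_class R q p \<otimes>\<^bsub>K0_unital R\<^esub> x = \<one>\<^bsub>K0_unital R\<^esub>"
      using K0_class_eqI[of "idem_sum R q p" "idem_sum R p q" "idem_sum R p q" "idem_sum R p q"]
      by (simp add: idem_sum_cong idem_equiv_refl idem_sum_comm K0_class_diag)
  qed (simp add: K0_class_closed)
qed

sublocale KG: comm_group "K0_unital R"
  by (rule K0_unital_comm_group)

lemma K0_class_inv:
  assumes "p \<in> idems R" "q \<in> idems R"
  shows "inv\<^bsub>K0_unital R\<^esub> K0_class R p q = K0_class R q p"
proof (rule KG.inv_equality)
  show "K0_class R q p \<otimes>\<^bsub>K0_unital R\<^esub> K0_class R p q = \<one>\<^bsub>K0_unital R\<^esub>"
    using K0_class_eqI[of "idem_sum R q p" "idem_sum R p q" "idem_sum R p q" "idem_sum R p q"] assms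
    by (simp add: K0_class_mult idem_sum_closed idem_sum_cong idem_equiv_refl idem_sum_comm K0_class_diag)
qed (use assms in \<open>auto intro: K0_class_closed\<close>)

end

lemma alg_homD:
  assumes "f \<in> alg_hom R S"
  shows "x \<in> carrier R \<Longrightarrow> f x \<in> carrier S"
    and "x \<in> carrier R \<Longrightarrow> y \<in> carrier R \<Longrightarrow> f (x \<oplus>\<^bsub>R\<^esub> y) = f x \<oplus>\<^bsub>S\<^esub> f y"
    and "x \<in> carrier R \<Longrightarrow> y \<in> carrier R \<Longrightarrow> f (x \<otimes>\<^bsub>R\<^esub> y) = f x \<otimes>\<^bsub>S\<^esub> f y"
    and "x \<in> carrier R \<Longrightarrow> f (c \<odot>\<^bsub>R\<^esub> x) = c \<odot>\<^bsub>S\<^esub> f x"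
  using assms by (auto simp: alg_hom_def)

text \<open>Units need not be preserved: idempotents, their equivalence and their direct sums
  involve only products, sums and zeros. This matters for \<open>unit_incl\<close>, which does not
  map a unit of the algebra to the unit of the unitisation.\<close>

locale complex_alg_hom = R: complex_alg R + S: complex_alg S
  for R :: "(complex, 'a, 'm) module_scheme" and S :: "(complex, 'b, 'n) module_scheme" +
  fixes f
  assumes hom: "f \<in> alg_hom R S"
begin

lemmas closed = alg_homD(1)[OF hom] and add = alg_homD(2)[OF hom] and mult = alg_homD(3)[OF hom]
  and smult = alg_homD(4)[OF hom]

lemma zero [simp]: "f \<zero>\<^bsub>R\<^esub> = \<zero>\<^bsub>S\<^esub>"
  using smult[of "\<zero>\<^bsub>R\<^esub>" 0] closed[of "\<zero>\<^bsub>R\<^esub>"] by simp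

lemma map_mats: "x \<in> mats R n m \<Longrightarrow> f \<circ> x \<in> mats S n m"
  by (intro S.matsI) (auto simp: closed R.mats_carrier R.mats_zero)

lemma map_mat_mult:
  assumes "x \<in> mats R n m" "y \<in> mats R n' m'"
  shows "f \<circ> mat_mult R k x y = mat_mult S k (f \<circ> x) (f \<circ> y)"
proof (rule ext, clarify)
  fix i j
  have c: "x ij \<in> carrier R" "y ij \<in> carrier R" for ij
    using assms by (auto simp: R.mats_carrier)
  show "(f \<circ> mat_mult R k x y) (i, j) = mat_mult S k (f \<circ> x) (f \<circ> y) (i, j)"
    using R.finsum_map[OF S.abelian_monoid_axioms closed zero add, of "{..<k}" "\<lambda>l. x (i, l) \<otimes>\<^bsub>R\<^esub> y (l, j)"]
    by (auto simp: mat_mult_def c mult closed intro!: S.finsum_cong')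
qed

lemma map_idems: "a \<in> idems R \<Longrightarrow> map_idem f a \<in> idems S"
  by (auto simp: idems_def map_idem_def map_mats map_mat_mult[symmetric])

lemma map_equiv:
  assumes "idem_equiv R a b"
  shows "idem_equiv S (map_idem f a) (map_idem f b)"
proof -
  obtain n p m q where [simp]: "a = (n, p)" "b = (m, q)" by (metis prod.exhaust)
  obtain x y where x: "x \<in> mats R n m" and y: "y \<in> mats R m n"
    and xy: "mat_mult R m x y = p" "mat_mult R n y x = q"
    using assms by (auto simp: idem_equiv_def)
  then show ?thesis
    using map_mats[OF x] map_mats[OF y] map_mat_mult[OF x y, of m] map_mat_mult[OF y x, of n]
    by (auto simp: idem_equiv_def map_idem_def)
qed

lemma map_sum: "map_idem f (idem_sum R a b) = idem_sum S (map_idem f a) (map_idem f b)"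
  by (cases a; cases b) (auto simp: map_idem_def idem_sum_def fun_eq_iff)

lemma map_zero_idem: "map_idem f (zero_idem R) = zero_idem S"
  by (auto simp: map_idem_def zero_idem_def fun_eq_iff)

lemma map_K0_rel:
  assumes "((p, q), (p', q')) \<in> K0_rel R"
  shows "((map_idem f p, map_idem f q), (map_idem f p', map_idem f q')) \<in> K0_rel S"
proof -
  obtain r where i: "p \<in> idems R" "q \<in> idems R" "p' \<in> idems R" "q' \<in> idems R" "r \<in> idems R"
    and e: "idem_equiv R (idem_sum R (idem_sum R p q') r) (idem_sum R (idem_sum R p' q) r)"
    using assms unfolding K0_rel_def mem_Collect_eq prod.case by blast
  then show ?thesis
    unfolding K0_rel_def mem_Collect_eq prod.case
    using map_idems[OF i(5)] map_equiv[OF e] by (auto simp only: map_idems map_sum)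
qed

lemma map_K0_class:
  assumes "p \<in> idems R" "q \<in> idems R"
  shows "K0_unital_map S f (K0_class R p q) = K0_class S (map_idem f p) (map_idem f q)"
  unfolding K0_unital_map_def
proof (rule UN_const_on, rule R.K0_class_nonempty[OF assms])
  fix x assume x: "x \<in> K0_class R p q"
  obtain a b where [simp]: "x = (a, b)" by (metis prod.exhaust)
  have "((p, q), (a, b)) \<in> K0_rel R" using x by simp
  from equiv_class_eq[OF S.equiv_K0_rel map_K0_rel[OF this]]
  show "(case x of (p, q) \<Rightarrow> K0_class S (map_idem f p) (map_idem f q)) = K0_class S (map_idem f p) (map_idem f q)"
    by simp
qed

lemma K0_unital_map_hom: "K0_unital_map S f \<in> Group.hom (K0_unital R) (K0_unital S)"
proof (rule homI)
  fix x y assume "x \<in> carrier (K0_unital R)" "y \<in> carrier (K0_unital R)"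
  then obtain p q p' q' where [simp]: "x = K0_class R p q" "y = K0_class R p' q'"
    and i [simp]: "p \<in> idems R" "q \<in> idems R" "p' \<in> idems R" "q' \<in> idems R"
    by (auto elim!: R.K0_unital_cases)
  show "K0_unital_map S f x \<in> carrier (K0_unital S)"
    by (simp add: map_K0_class S.K0_class_closed map_idems)
  show "K0_unital_map S f (x \<otimes>\<^bsub>K0_unital R\<^esub> y) = K0_unital_map S f x \<otimes>\<^bsub>K0_unital S\<^esub> K0_unital_map S f y"
    by (simp add: map_K0_class R.K0_class_mult S.K0_class_mult map_idems R.idem_sum_closed map_sum)
qed

end

subsection \<open>Unitisations\<close>

lemma complex_lca_simps [simp]:
  "carrier complex_lca = UNIV" "x \<otimes>\<^bsub>complex_lca\<^esub> y = x * y" "x \<oplus>\<^bsub>complex_lca\<^esub> y = x + y"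
  "\<one>\<^bsub>complex_lca\<^esub> = 1" "\<zero>\<^bsub>complex_lca\<^esub> = 0" "c \<odot>\<^bsub>complex_lca\<^esub> x = c * x" "topo complex_lca = euclidean"
  by (simp_all add: complex_lca_def)

lemma complex_alg_complex_lca: "complex_alg complex_lca"
  by (unfold_locales, rule complex_algebraI) (auto simp: algebra_simps)

lemma unitisation_simps [simp]:
  "carrier (unitisation A) = carrier A \<times> UNIV"
  "(a, z) \<otimes>\<^bsub>unitisation A\<^esub> (a', z') = ((a \<otimes>\<^bsub>A\<^esub> a') \<oplus>\<^bsub>A\<^esub> ((z \<odot>\<^bsub>A\<^esub> a') \<oplus>\<^bsub>A\<^esub> (z' \<odot>\<^bsub>A\<^esub> a)), z * z')"
  "(a, z) \<oplus>\<^bsub>unitisation A\<^esub> (a', z') = (a \<oplus>\<^bsub>A\<^esub> a', z + z')"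
  "\<one>\<^bsub>unitisation A\<^esub> = (\<zero>\<^bsub>A\<^esub>, 1)" "\<zero>\<^bsub>unitisation A\<^esub> = (\<zero>\<^bsub>A\<^esub>, 0)"
  "c \<odot>\<^bsub>unitisation A\<^esub> (a, z) = (c \<odot>\<^bsub>A\<^esub> a, c * z)"
  "topo (unitisation A) = prod_topology (topo A) euclidean"
  by (simp_all add: unitisation_def)

lemma complex_alg_unitisation:
  assumes "complex_alg (A :: 'a lca)"
  shows "complex_alg (unitisation A)"
proof -
  interpret A: complex_alg A by fact
  note A_simps = A.smult_add_left A.smult_add_right A.smult_smult A.l_distr A.r_distr A.m_assoc
    A.smult_mult_left A.smult_mult_right A.a_ac
  show ?thesis
    by (unfold_locales, rule complex_algebraI) (auto simp: A_simps algebra_simps)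
qed

lemma snd_alg_hom: "snd \<in> alg_hom (unitisation A) complex_lca"
  by (auto simp: alg_hom_def)

lemma unit_map_alg_hom:
  assumes "complex_alg A" "complex_alg B" "f \<in> alg_hom A B"
  shows "unit_map f \<in> alg_hom (unitisation A) (unitisation B)"
proof -
  interpret complex_alg_hom A B f
    using assms by (simp add: complex_alg_hom_def complex_alg_hom_axioms_def)
  show ?thesis
    by (auto simp: alg_hom_def unit_map_def add mult smult closed)
qed

lemma K0_simps [simp]:
  "monoid.mult (K0 A) = monoid.mult (K0_unital (unitisation A))"
  "one (K0 A) = one (K0_unital (unitisation A))"
  by (simp_all add: K0_def)

lemma subgroup_K0:
  assumes "complex_alg A"
  shows "subgroup (carrier (K0 A)) (K0_unital (unitisation A))"
proof -
  interpret complex_alg_hom "unitisation A" complex_lca snd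
    by (simp add: complex_alg_hom_def complex_alg_hom_axioms_def complex_alg_unitisation assms
        complex_alg_complex_lca snd_alg_hom)
  interpret group_hom "K0_unital (unitisation A)" "K0_unital complex_lca" "K0_unital_map complex_lca snd"
    by unfold_locales (rule K0_unital_map_hom)
  show ?thesis
    using subgroup_kernel by (simp add: K0_def)
qed

text \<open>\<open>K0 A\<close> is \<open>K0_unital\<close> with a smaller carrier, and
  \<open>m_inv\<close> refers to the carrier; that the two inverses agree is a fact about
  subgroups.\<close>

lemma K0_inv:
  assumes "complex_alg A" "x \<in> carrier (K0 A)"
  shows "inv\<^bsub>K0 A\<^esub> x = inv\<^bsub>K0_unital (unitisation A)\<^esub> x"
proof -
  interpret complex_alg "unitisation A" using assms by (simp add: complex_alg_unitisation)
  show ?thesis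
    using KG.m_inv_consistent[OF subgroup_K0[OF assms(1)]] assms(2) by (simp add: K0_def)
qed

lemma K0_class_in_K0:
  assumes "complex_alg A" and i: "p \<in> idems (unitisation A)" "q \<in> idems (unitisation A)"
  shows "K0_class (unitisation A) p q \<in> carrier (K0 A) \<longleftrightarrow>
    K0_class complex_lca (map_idem snd p) (map_idem snd q) = \<one>\<^bsub>K0_unital complex_lca\<^esub>"
proof -
  interpret complex_alg_hom "unitisation A" complex_lca snd
    by (simp add: complex_alg_hom_def complex_alg_hom_axioms_def complex_alg_unitisation assms
        complex_alg_complex_lca snd_alg_hom)
  show ?thesis
    using i by (simp add: K0_def kernel_def R.K0_class_closed map_K0_class)
qed

subsection \<open>Locally convex algebras as topological vector spaces\<close>

locale lc_alg =
  fixes A :: "'a lca" (structure)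
  assumes lc_algebra: "lc_algebra A"
begin

sublocale complex_alg A
  using lc_algebra by unfold_locales (simp add: lc_algebra_def)

lemma topspace_topo [simp]: "topspace (topo A) = carrier A"
  using lc_algebra by (simp add: lc_algebra_def)

lemma hausdorff: "Hausdorff_space (topo A)"
  using lc_algebra by (simp add: lc_algebra_def)

lemma convex_nbhd:
  assumes "openin (topo A) U" "\<zero> \<in> U"
  obtains V where "openin (topo A) V" "\<zero> \<in> V" "V \<subseteq> U" "alg_convex A V"
  using lc_algebra assms unfolding lc_algebra_def by blast

lemma complete:
  assumes "cauchy_filter_on A F"
  obtains l where "limitin (topo A) (\<lambda>x. x) l F"
  using lc_algebra assms unfolding lc_algebra_def by blast

lemma continuous_closed: "continuous_map X (topo A) f \<Longrightarrow> x \<in> topspace X \<Longrightarrow> f x \<in> carrier A"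
  using continuous_map_image_subset_topspace by fastforce

lemma continuous_add:
  assumes "continuous_map X (topo A) f" "continuous_map X (topo A) g"
  shows "continuous_map X (topo A) (\<lambda>x. f x \<oplus> g x)"
proof -
  have "continuous_map (prod_topology (topo A) (topo A)) (topo A) (\<lambda>(x, y). x \<oplus> y)"
    using lc_algebra by (simp add: lc_algebra_def)
  from continuous_map_compose[OF continuous_map_pairedI[OF assms] this]
  show ?thesis by (simp add: o_def)
qed

lemma continuous_mult:
  assumes "continuous_map X (topo A) f" "continuous_map X (topo A) g"
  shows "continuous_map X (topo A) (\<lambda>x. f x \<otimes> g x)"
proof -
  have "continuous_map (prod_topology (topo A) (topo A)) (topo A) (\<lambda>(x, y). x \<otimes> y)"
    using lc_algebra by (simp add: lc_algebra_def)
  from continuous_map_compose[OF continuous_map_pairedI[OF assms] this]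
  show ?thesis by (simp add: o_def)
qed

lemma continuous_smult:
  assumes "continuous_map X euclidean c" "continuous_map X (topo A) f"
  shows "continuous_map X (topo A) (\<lambda>x. c x \<odot> f x)"
proof -
  have "continuous_map (prod_topology euclidean (topo A)) (topo A) (\<lambda>(c, x). c \<odot> x)"
    using lc_algebra by (simp add: lc_algebra_def)
  from continuous_map_compose[OF continuous_map_pairedI[OF assms] this]
  show ?thesis by (simp add: o_def)
qed

lemma continuous_sub:
  assumes "continuous_map X (topo A) f" "continuous_map X (topo A) g"
  shows "continuous_map X (topo A) (\<lambda>x. f x \<ominus> g x)"
proof (rule continuous_map_eq)
  show "continuous_map X (topo A) (\<lambda>x. f x \<oplus> (-1) \<odot> g x)"
    using assms by (intro continuous_add continuous_smult) auto
  show "f x \<oplus> (-1) \<odot> g x = f x \<ominus> g x" if "x \<in> topspace X" for x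
    using that assms[THEN continuous_closed] by (simp add: sub_smult)
qed

lemma continuous_const: "x \<in> carrier A \<Longrightarrow> continuous_map X (topo A) (\<lambda>_. x)"
  by simp

lemma sub_self: "x \<in> carrier A \<Longrightarrow> x \<ominus> x = \<zero>"
  by (simp add: minus_eq r_neg)

lemma sub_sub_sub:
  assumes "x \<in> carrier A" "y \<in> carrier A" "z \<in> carrier A"
  shows "(x \<ominus> z) \<ominus> (y \<ominus> z) = x \<ominus> y" "x \<oplus> ((z \<ominus> x) \<ominus> (z \<ominus> y)) = y"
proof -
  have 1: "z \<oplus> (\<ominus> y \<oplus> \<ominus> z) = \<ominus> y"
    using assms a_lcomm[of z "\<ominus> y" "\<ominus> z"] by (simp add: r_neg)
  have "(x \<ominus> z) \<ominus> (y \<ominus> z) = x \<oplus> (z \<oplus> (\<ominus> y \<oplus> \<ominus> z))"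
    using assms by (simp add: minus_eq minus_add a_ac)
  then show "(x \<ominus> z) \<ominus> (y \<ominus> z) = x \<ominus> y"
    using 1 by (simp add: minus_eq)
  have "x \<oplus> ((z \<ominus> x) \<ominus> (z \<ominus> y)) = x \<oplus> (\<ominus> x \<oplus> (y \<oplus> (z \<oplus> \<ominus> z)))"
    using assms by (simp add: minus_eq minus_add a_ac)
  then show "x \<oplus> ((z \<ominus> x) \<ominus> (z \<ominus> y)) = y"
    using assms by (simp add: r_neg r_neg2)
qed

lemma openin_translate:
  assumes "openin (topo A) U" "x \<in> carrier A"
  shows "openin (topo A) {y \<in> carrier A. y \<ominus> x \<in> U}" "openin (topo A) {y \<in> carrier A. x \<oplus> y \<in> U}"
proof -
  have "continuous_map (topo A) (topo A) (\<lambda>y. y \<ominus> x)" "continuous_map (topo A) (topo A) (\<lambda>y. x \<oplus> y)"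
    by (rule continuous_sub continuous_add continuous_const assms continuous_map_id[unfolded id_def])+
  from this[THEN openin_continuous_map_preimage, OF assms(1)]
  show "openin (topo A) {y \<in> carrier A. y \<ominus> x \<in> U}" "openin (topo A) {y \<in> carrier A. x \<oplus> y \<in> U}"
    by simp_all
qed

text \<open>Continuity of subtraction at the point \<open>(\<zero>, \<zero>)\<close>. It does the
  work of halving an epsilon in the arguments on regularity and Cauchy filters.\<close>

lemma small_nbhd:
  assumes "openin (topo A) U" "\<zero> \<in> U"
  shows "\<exists>V. openin (topo A) V \<and> \<zero> \<in> V \<and> (\<forall>x\<in>V. \<forall>y\<in>V. x \<ominus> y \<in> U)"
proof -
  define S where "S = {x \<in> carrier A \<times> carrier A. fst x \<ominus> snd x \<in> U}"
  have "continuous_map (prod_topology (topo A) (topo A)) (topo A) (\<lambda>x. fst x \<ominus> snd x)"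
    by (intro continuous_sub continuous_map_fst continuous_map_snd)
  from openin_continuous_map_preimage[OF this assms(1)]
  have "openin (prod_topology (topo A) (topo A)) S"
    by (simp add: S_def)
  moreover have "(\<zero>, \<zero>) \<in> S"
    using assms by (simp add: sub_smult S_def)
  ultimately obtain V W where VW: "openin (topo A) V" "openin (topo A) W" "\<zero> \<in> V" "\<zero> \<in> W" "V \<times> W \<subseteq> S"
    using openin_prod_topology_alt[of "topo A" "topo A" S] by meson
  then have "x \<ominus> y \<in> U" if "x \<in> V \<inter> W" "y \<in> V \<inter> W" for x y
    using that by (auto simp: S_def)
  then show ?thesis using VW by (intro exI[of _ "V \<inter> W"]) auto
qed

text \<open>If \<open>x\<close> is within \<open>V\<close> both of \<open>a\<close> and of some
  \<open>c\<close> in \<open>C\<close>, then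
  \<open>c = a \<oplus> ((x \<ominus> a) \<ominus> (x \<ominus> c))\<close> lies in a neighbourhood
  of \<open>a\<close> that misses \<open>C\<close>. Regularity of the target is what the extension
  of maps from a dense subspace relies on.\<close>

lemma regular: "regular_space (topo A)"
  unfolding regular_space_def
proof clarify
  fix C a assume C: "closedin (topo A) C" and a: "a \<in> topspace (topo A)" "a \<notin> C"
  let ?U = "{y \<in> carrier A. a \<oplus> y \<in> topspace (topo A) - C}"
  have 1: "openin (topo A) ?U"
    using C a by (intro openin_translate) (auto simp: closedin_def)
  have 2: "\<zero> \<in> ?U" using a by simp
  obtain V where V: "openin (topo A) V" "\<zero> \<in> V" "\<And>x y. x \<in> V \<Longrightarrow> y \<in> V \<Longrightarrow> x \<ominus> y \<in> ?U"
    using small_nbhd[OF 1 2] by blast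
  have Cc: "C \<subseteq> carrier A" using closedin_subset[OF C] by simp
  have ac: "a \<in> carrier A" using a by simp
  let ?V = "{x \<in> carrier A. x \<ominus> a \<in> V}" and ?W = "\<Union>c\<in>C. {x \<in> carrier A. x \<ominus> c \<in> V}"
  have "disjnt ?V ?W"
    unfolding disjnt_iff
  proof (clarify)
    fix x c assume x: "x \<in> carrier A" "x \<ominus> a \<in> V" "c \<in> C" "x \<ominus> c \<in> V"
    have c: "c \<in> carrier A" using x Cc by auto
    have "a \<oplus> ((x \<ominus> a) \<ominus> (x \<ominus> c)) = c"
      using x(1) ac c by (intro sub_sub_sub(2))
    with V(3)[OF x(2,4)] x(3) show False by auto
  qed
  moreover have "openin (topo A) ?V" "openin (topo A) ?W"
    using openin_translate(1)[OF V(1)] ac Cc by auto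
  moreover have "a \<in> ?V"
    using V(2) ac by (simp add: sub_self)
  moreover have "C \<subseteq> ?W"
  proof
    fix c assume "c \<in> C"
    then have "c \<in> {x \<in> carrier A. x \<ominus> c \<in> V}" using V(2) Cc by (auto simp: sub_self)
    then show "c \<in> ?W" using \<open>c \<in> C\<close> by blast
  qed
  ultimately show "\<exists>U V. openin (topo A) U \<and> openin (topo A) V \<and> a \<in> U \<and> C \<subseteq> V \<and> disjnt U V"
    by blast
qed

end

section \<open>Continuity and extension of additive and linear maps\<close>

locale lc_alg_pair = A: lc_alg A + B: lc_alg B for A :: "'a lca" and B :: "'b lca"
begin

text \<open>For an additive map on a subgroup, continuity at zero is carried to every other point by
  translation.\<close>

lemma additive_continuous_map:
  assumes M: "M \<subseteq> carrier A" "\<And>x y. x \<in> M \<Longrightarrow> y \<in> M \<Longrightarrow> x \<ominus>\<^bsub>A\<^esub> y \<in> M"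
    and g: "g \<in> M \<rightarrow> carrier B" "\<And>x y. x \<in> M \<Longrightarrow> y \<in> M \<Longrightarrow> g (x \<ominus>\<^bsub>A\<^esub> y) = g x \<ominus>\<^bsub>B\<^esub> g y"
    and c: "\<And>V. openin (topo B) V \<Longrightarrow> \<zero>\<^bsub>B\<^esub> \<in> V \<Longrightarrow>
      \<exists>U. openin (topo A) U \<and> \<zero>\<^bsub>A\<^esub> \<in> U \<and> (\<forall>x\<in>M \<inter> U. g x \<in> V)"
  shows "continuous_map (subtopology (topo A) M) (topo B) g"
  unfolding continuous_map_def
proof (intro conjI allI impI)
  show "g \<in> topspace (subtopology (topo A) M) \<rightarrow> topspace (topo B)"
    using g(1) M(1) by auto
  fix V assume V: "openin (topo B) V"
  show "openin (subtopology (topo A) M) {x \<in> topspace (subtopology (topo A) M). g x \<in> V}"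
  proof (subst openin_subopen, clarify)
    fix x assume x: "x \<in> topspace (subtopology (topo A) M)" "g x \<in> V"
    have xA: "x \<in> carrier A" "x \<in> M" "g x \<in> carrier B" using x M g by auto
    obtain U where U: "openin (topo A) U" "\<zero>\<^bsub>A\<^esub> \<in> U" "\<And>y. y \<in> M \<Longrightarrow> y \<in> U \<Longrightarrow> g x \<oplus>\<^bsub>B\<^esub> g y \<in> V"
      using c[OF B.openin_translate(2)[OF V xA(3)]] x(2) xA by auto
    let ?T = "{y \<in> carrier A. y \<ominus>\<^bsub>A\<^esub> x \<in> U} \<inter> M"
    have "openin (subtopology (topo A) M) ?T"
      unfolding openin_subtopology using A.openin_translate(1)[OF U(1) xA(1)] by blast
    moreover have "x \<in> ?T" using xA U(2) by (simp add: A.minus_eq A.r_neg)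
    moreover have "g y \<in> V" if "y \<in> ?T" for y
    proof -
      have "g x \<oplus>\<^bsub>B\<^esub> (g y \<ominus>\<^bsub>B\<^esub> g x) \<in> V"
        using U(3)[of "y \<ominus>\<^bsub>A\<^esub> x"] that M(2) xA g(2) by auto
      then show ?thesis
        using g(1) that xA B.add_sub_cancel[of "g x" "g y"] by (simp add: Pi_iff)
    qed
    ultimately show "\<exists>T. openin (subtopology (topo A) M) T \<and> x \<in> T \<and>
      T \<subseteq> {x \<in> topspace (subtopology (topo A) M). g x \<in> V}"
      using M(1) by (intro exI[of _ ?T]) auto
  qed
qed

text \<open>For a regular target it suffices that \<open>g\<close> has a limit along
  \<open>M\<close> at each point \<open>t\<close> outside \<open>M\<close>. The image of the filter
  of neighbourhoods of \<open>t\<close> in \<open>M\<close> is Cauchy, since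
  \<open>(x \<ominus> t) \<ominus> (y \<ominus> t) = x \<ominus> y\<close> is small when
  \<open>x\<close> and \<open>y\<close> are close to \<open>t\<close>, and completeness of
  \<open>B\<close> supplies the limit.\<close>

lemma additive_extension:
  assumes M: "M \<subseteq> carrier A" "\<And>x y. x \<in> M \<Longrightarrow> y \<in> M \<Longrightarrow> x \<ominus>\<^bsub>A\<^esub> y \<in> M"
    and dense: "topo A closure_of M = carrier A"
    and g: "g \<in> M \<rightarrow> carrier B" "\<And>x y. x \<in> M \<Longrightarrow> y \<in> M \<Longrightarrow> g (x \<ominus>\<^bsub>A\<^esub> y) = g x \<ominus>\<^bsub>B\<^esub> g y"
    and c: "\<And>V. openin (topo B) V \<Longrightarrow> \<zero>\<^bsub>B\<^esub> \<in> V \<Longrightarrow>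
      \<exists>U. openin (topo A) U \<and> \<zero>\<^bsub>A\<^esub> \<in> U \<and> (\<forall>x\<in>M \<inter> U. g x \<in> V)"
  obtains h where "continuous_map (topo A) (topo B) h" "\<And>x. x \<in> M \<Longrightarrow> h x = g x"
proof -
  have "\<exists>l. limitin (topo B) g l (atin_within (topo A) t M)" if t: "t \<in> carrier A - M" for t
  proof -
    let ?F = "filtermap g (atin_within (topo A) t M)"
    have "cauchy_filter_on B ?F"
      unfolding cauchy_filter_on_def
    proof (intro conjI allI impI)
      \<comment> \<open>As \<open>t\<close> is in the closure of \<open>M\<close> but not in
        \<open>M\<close>, its punctured neighbourhoods meet \<open>M\<close>, so the filter is
        proper.\<close>
      have "\<not> eventually (\<lambda>_. False) (atin_within (topo A) t M)"
        using t dense unfolding eventually_atin_within by (auto simp: in_closure_of set_eq_iff)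
      then show "?F \<noteq> bot"
        by (simp add: trivial_limit_def eventually_filtermap)
      show "\<forall>\<^sub>F x in ?F. x \<in> carrier B"
        using g(1) t openin_topspace[of "topo A"] by (auto simp: eventually_filtermap eventually_atin_within Pi_iff)
      fix U assume "openin (topo B) U \<and> \<zero>\<^bsub>B\<^esub> \<in> U"
      with c[of U] obtain W where W: "openin (topo A) W" "\<zero>\<^bsub>A\<^esub> \<in> W" "\<forall>x\<in>M \<inter> W. g x \<in> U"
        by auto
      obtain V where V: "openin (topo A) V" "\<zero>\<^bsub>A\<^esub> \<in> V" "\<And>x y. x \<in> V \<Longrightarrow> y \<in> V \<Longrightarrow> x \<ominus>\<^bsub>A\<^esub> y \<in> W"
        using A.small_nbhd[OF W(1,2)] by blast
      let ?S = "g ` {x \<in> M. x \<ominus>\<^bsub>A\<^esub> t \<in> V}"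
      have "\<forall>\<^sub>F x in ?F. x \<in> ?S"
        unfolding eventually_filtermap eventually_atin_within
      proof (intro disjI2 exI conjI)
        show "openin (topo A) {y \<in> carrier A. y \<ominus>\<^bsub>A\<^esub> t \<in> V}"
          using A.openin_translate(1)[OF V(1)] t by simp
      qed (use t V in \<open>auto simp: A.minus_eq A.r_neg\<close>)
      moreover have "?S \<subseteq> carrier B" using g(1) by auto
      moreover have "g x \<ominus>\<^bsub>B\<^esub> g y \<in> U"
        if xy: "x \<in> M" "x \<ominus>\<^bsub>A\<^esub> t \<in> V" "y \<in> M" "y \<ominus>\<^bsub>A\<^esub> t \<in> V" for x y
      proof -
        have "(x \<ominus>\<^bsub>A\<^esub> t) \<ominus>\<^bsub>A\<^esub> (y \<ominus>\<^bsub>A\<^esub> t) = x \<ominus>\<^bsub>A\<^esub> y"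
          using xy M(1) t by (intro A.sub_sub_sub) auto
        then show ?thesis
          using V(3)[OF xy(2,4)] bspec[OF W(3), of "x \<ominus>\<^bsub>A\<^esub> y"] M(2)[OF xy(1,3)] g(2)[OF xy(1,3)] by simp
      qed
      ultimately show "\<exists>S. (\<forall>\<^sub>F x in ?F. x \<in> S) \<and> S \<subseteq> carrier B \<and> (\<forall>x\<in>S. \<forall>y\<in>S. x \<ominus>\<^bsub>B\<^esub> y \<in> U)"
        by (intro exI[of _ ?S]) auto
    qed
    then obtain l where "limitin (topo B) (\<lambda>x. x) l ?F" by (rule B.complete)
    then show ?thesis by (auto simp: limitin_def eventually_filtermap)
  qed
  moreover have "subtopology (topo A) (carrier A) = topo A"
    using subtopology_topspace[of "topo A"] by simp
  ultimately show thesis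
    using continuous_map_extension_pointwise_alt[OF B.regular M(1) _ additive_continuous_map[OF M g c], of thesis] that dense
    by auto
qed

end

text \<open>Many maps of the proof are continuous and linear but not multiplicative: entries of
  matrices, one-sided multiplications, \<open>b \<mapsto> a \<otimes> b\<close> and the retraction
  of a split extension onto its ideal.\<close>

definition lca_lin :: "'a lca \<Rightarrow> 'b lca \<Rightarrow> ('a \<Rightarrow> 'b) set" where
  "lca_lin A B = {f. f \<in> carrier A \<rightarrow> carrier B \<and>
     (\<forall>x\<in>carrier A. \<forall>y\<in>carrier A. f (x \<oplus>\<^bsub>A\<^esub> y) = f x \<oplus>\<^bsub>B\<^esub> f y) \<and>
     (\<forall>c. \<forall>x\<in>carrier A. f (c \<odot>\<^bsub>A\<^esub> x) = c \<odot>\<^bsub>B\<^esub> f x) \<and> continuous_map (topo A) (topo B) f}"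

lemma lca_linD:
  assumes "f \<in> lca_lin A B"
  shows "x \<in> carrier A \<Longrightarrow> f x \<in> carrier B"
    and "x \<in> carrier A \<Longrightarrow> y \<in> carrier A \<Longrightarrow> f (x \<oplus>\<^bsub>A\<^esub> y) = f x \<oplus>\<^bsub>B\<^esub> f y"
    and "x \<in> carrier A \<Longrightarrow> f (c \<odot>\<^bsub>A\<^esub> x) = c \<odot>\<^bsub>B\<^esub> f x"
    and "continuous_map (topo A) (topo B) f"
  using assms by (auto simp: lca_lin_def)

lemma lca_homD:
  assumes "f \<in> lca_hom A B"
  shows "x \<in> carrier A \<Longrightarrow> f x \<in> carrier B"
    and "x \<in> carrier A \<Longrightarrow> y \<in> carrier A \<Longrightarrow> f (x \<oplus>\<^bsub>A\<^esub> y) = f x \<oplus>\<^bsub>B\<^esub> f y"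
    and "x \<in> carrier A \<Longrightarrow> y \<in> carrier A \<Longrightarrow> f (x \<otimes>\<^bsub>A\<^esub> y) = f x \<otimes>\<^bsub>B\<^esub> f y"
    and "x \<in> carrier A \<Longrightarrow> f (c \<odot>\<^bsub>A\<^esub> x) = c \<odot>\<^bsub>B\<^esub> f x"
    and "continuous_map (topo A) (topo B) f" and "f \<in> alg_hom A B"
  using assms by (auto simp: lca_hom_def alg_hom_def)

lemma lca_hom_lin: "f \<in> lca_hom A B \<Longrightarrow> f \<in> lca_lin A B"
  by (auto simp: lca_hom_def alg_hom_def lca_lin_def)

lemma lca_homI:
  assumes "f \<in> lca_lin A B"
    and "\<And>x y. x \<in> carrier A \<Longrightarrow> y \<in> carrier A \<Longrightarrow> f (x \<otimes>\<^bsub>A\<^esub> y) = f x \<otimes>\<^bsub>B\<^esub> f y"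
  shows "f \<in> lca_hom A B"
  using assms by (auto simp: lca_hom_def alg_hom_def lca_lin_def)

lemma lca_lin_comp: "f \<in> lca_lin A B \<Longrightarrow> g \<in> lca_lin B C \<Longrightarrow> g \<circ> f \<in> lca_lin A C"
  by (auto simp: lca_lin_def Pi_iff intro: continuous_map_compose)

lemma lca_hom_comp: "f \<in> lca_hom A B \<Longrightarrow> g \<in> lca_hom B C \<Longrightarrow> g \<circ> f \<in> lca_hom A C"
  by (auto simp: lca_hom_def alg_hom_def Pi_iff intro: continuous_map_compose)

lemma lca_hom_id: "(\<lambda>x. x) \<in> lca_hom A A"
  by (auto simp: lca_hom_def alg_hom_def continuous_map_id[unfolded id_def])

context lc_alg_pair
begin

lemma lca_lin_zero:
  assumes "f \<in> lca_lin A B"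
  shows "f \<zero>\<^bsub>A\<^esub> = \<zero>\<^bsub>B\<^esub>"
  using lca_linD(3)[OF assms, of "\<zero>\<^bsub>A\<^esub>" 0] lca_linD(1)[OF assms, of "\<zero>\<^bsub>A\<^esub>"] by simp

lemma lca_lin_sub:
  assumes f: "f \<in> lca_lin A B" and x: "x \<in> carrier A" "y \<in> carrier A"
  shows "f (x \<ominus>\<^bsub>A\<^esub> y) = f x \<ominus>\<^bsub>B\<^esub> f y"
  using x lca_linD[OF f] by (simp add: A.sub_smult B.sub_smult)

lemma lca_linI:
  assumes f: "\<And>x. x \<in> carrier A \<Longrightarrow> f x \<in> carrier B"
    "\<And>x y. x \<in> carrier A \<Longrightarrow> y \<in> carrier A \<Longrightarrow> f (x \<oplus>\<^bsub>A\<^esub> y) = f x \<oplus>\<^bsub>B\<^esub> f y"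
    "\<And>c x. x \<in> carrier A \<Longrightarrow> f (c \<odot>\<^bsub>A\<^esub> x) = c \<odot>\<^bsub>B\<^esub> f x"
    and c: "\<And>V. openin (topo B) V \<Longrightarrow> \<zero>\<^bsub>B\<^esub> \<in> V \<Longrightarrow>
      \<exists>U. openin (topo A) U \<and> \<zero>\<^bsub>A\<^esub> \<in> U \<and> (\<forall>x\<in>carrier A \<inter> U. f x \<in> V)"
  shows "f \<in> lca_lin A B"
proof -
  have "continuous_map (subtopology (topo A) (carrier A)) (topo B) f"
    using f c by (intro additive_continuous_map) (auto simp: A.sub_smult B.sub_smult)
  moreover have "subtopology (topo A) (carrier A) = topo A"
    using subtopology_topspace[of "topo A"] by simp
  ultimately show ?thesis using f by (auto simp: lca_lin_def)
qed

lemma lca_lin_add: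
  assumes f: "f \<in> lca_lin A B" and g: "g \<in> lca_lin A B"
  shows "(\<lambda>x. f x \<oplus>\<^bsub>B\<^esub> g x) \<in> lca_lin A B"
  using lca_linD[OF f] lca_linD[OF g] B.continuous_add
  by (auto simp: lca_lin_def B.smult_add_right B.a_ac)

lemma lca_lin_diff:
  assumes f: "f \<in> lca_lin A B" and g: "g \<in> lca_lin A B"
  shows "(\<lambda>x. f x \<ominus>\<^bsub>B\<^esub> g x) \<in> lca_lin A B"
  using lca_linD[OF f] lca_linD[OF g] B.continuous_sub
  by (auto simp: lca_lin_def B.sub_smult B.smult_add_right B.smult_smult B.a_ac)

text \<open>The extension inherits homogeneity and additivity from \<open>g\<close> because these
  are equalities of continuous maps into a Hausdorff space which hold on the dense sets
  \<open>M\<close> and \<open>M \<times> M\<close>.\<close>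

lemma linear_extension:
  assumes M: "M \<subseteq> carrier A" "\<And>x y. x \<in> M \<Longrightarrow> y \<in> M \<Longrightarrow> x \<oplus>\<^bsub>A\<^esub> y \<in> M"
      "\<And>c x. x \<in> M \<Longrightarrow> c \<odot>\<^bsub>A\<^esub> x \<in> M"
    and dense: "topo A closure_of M = carrier A"
    and g: "g \<in> M \<rightarrow> carrier B" "\<And>x y. x \<in> M \<Longrightarrow> y \<in> M \<Longrightarrow> g (x \<oplus>\<^bsub>A\<^esub> y) = g x \<oplus>\<^bsub>B\<^esub> g y"
      "\<And>c x. x \<in> M \<Longrightarrow> g (c \<odot>\<^bsub>A\<^esub> x) = c \<odot>\<^bsub>B\<^esub> g x"
    and c: "\<And>V. openin (topo B) V \<Longrightarrow> \<zero>\<^bsub>B\<^esub> \<in> V \<Longrightarrow>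
      \<exists>U. openin (topo A) U \<and> \<zero>\<^bsub>A\<^esub> \<in> U \<and> (\<forall>x\<in>M \<inter> U. g x \<in> V)"
  obtains h where "h \<in> lca_lin A B" "\<And>x. x \<in> M \<Longrightarrow> h x = g x"
proof -
  have sub: "x \<ominus>\<^bsub>A\<^esub> y = x \<oplus>\<^bsub>A\<^esub> (-1) \<odot>\<^bsub>A\<^esub> y" if "x \<in> M" "y \<in> M" for x y
    using M(1) that by (intro A.sub_smult) auto
  have gM: "g x \<in> carrier B" if "x \<in> M" for x using g(1) that by auto
  have "x \<ominus>\<^bsub>A\<^esub> y \<in> M" "g (x \<ominus>\<^bsub>A\<^esub> y) = g x \<ominus>\<^bsub>B\<^esub> g y" if "x \<in> M" "y \<in> M" for x y
    using that M(2,3) g(2,3) gM by (simp_all add: sub B.sub_smult)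
  then obtain h where h: "continuous_map (topo A) (topo B) h" and hM: "\<And>x. x \<in> M \<Longrightarrow> h x = g x"
    using additive_extension[OF M(1) _ dense g(1) _ c, of thesis] by blast
  have hc: "h x \<in> carrier B" if "x \<in> carrier A" for x
    using B.continuous_closed[OF h] that by simp
  have smult: "h (c \<odot>\<^bsub>A\<^esub> x) = c \<odot>\<^bsub>B\<^esub> h x" if "x \<in> carrier A" for c x
  proof (rule forall_in_closure_of_eq[where f = "\<lambda>x. h (c \<odot>\<^bsub>A\<^esub> x)" and g = "\<lambda>x. c \<odot>\<^bsub>B\<^esub> h x", OF _ B.hausdorff])
    show "x \<in> topo A closure_of M" using dense that by simp
    show "continuous_map (topo A) (topo B) (\<lambda>x. h (c \<odot>\<^bsub>A\<^esub> x))"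
      by (rule continuous_map_compose[OF A.continuous_smult h, unfolded o_def]) (auto simp: continuous_map_id[unfolded id_def])
    show "continuous_map (topo A) (topo B) (\<lambda>x. c \<odot>\<^bsub>B\<^esub> h x)"
      by (rule B.continuous_smult) (auto simp: h)
  qed (use hM M g in auto)
  have add: "h (x \<oplus>\<^bsub>A\<^esub> y) = h x \<oplus>\<^bsub>B\<^esub> h y" if "x \<in> carrier A" "y \<in> carrier A" for x y
  proof -
    have "h (fst (x, y) \<oplus>\<^bsub>A\<^esub> snd (x, y)) = h (fst (x, y)) \<oplus>\<^bsub>B\<^esub> h (snd (x, y))"
    proof (rule forall_in_closure_of_eq[where f = "\<lambda>x. h (fst x \<oplus>\<^bsub>A\<^esub> snd x)" and
          g = "\<lambda>x. h (fst x) \<oplus>\<^bsub>B\<^esub> h (snd x)", OF _ B.hausdorff])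
      let ?X = "prod_topology (topo A) (topo A)"
      show "(x, y) \<in> ?X closure_of (M \<times> M)" using dense that by (simp add: closure_of_Times)
      show "continuous_map ?X (topo B) (\<lambda>x. h (fst x \<oplus>\<^bsub>A\<^esub> snd x))"
        by (rule continuous_map_compose[OF A.continuous_add h, unfolded o_def]) (auto intro: continuous_map_fst continuous_map_snd)
      show "continuous_map ?X (topo B) (\<lambda>x. h (fst x) \<oplus>\<^bsub>B\<^esub> h (snd x))"
        by (intro B.continuous_add continuous_map_compose[OF _ h, unfolded o_def] continuous_map_fst continuous_map_snd)
    qed (use hM M g in auto)
    then show ?thesis by simp
  qed
  have "h \<in> lca_lin A B" using add smult h hc by (auto simp: lca_lin_def)
  with hM that show thesis by blast
qed

end

subsection \<open>Isomorphisms, products and split extensions\<close>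

text \<open>The structure an isomorphism has to know on either side. A transported algebra is first
  shown to be of this kind and then receives \<open>lc_algebra\<close> across the isomorphism;
  concrete matrix algebras are handled at this level too.\<close>

locale top_alg = complex_alg A for A :: "'a lca" (structure) +
  assumes topspace_eq: "topspace (topo A) = carrier A"

context lc_alg
begin
sublocale top_alg by unfold_locales simp
end

lemma lca_iso_lca_hom: "f \<in> lca_iso X Y \<Longrightarrow> f \<in> lca_hom X Y"
  by (auto simp: lca_iso_def lca_hom_def homeomorphic_imp_continuous_map)

lemma lca_isoI:
  assumes "f \<in> lca_hom X Y" "homeomorphic_maps (topo X) (topo Y) f g"
  shows "f \<in> lca_iso X Y"
  using assms homeomorphic_maps_map by (auto simp: lca_iso_def lca_hom_def)

lemma lca_iso_comp: "f \<in> lca_iso X Y \<Longrightarrow> g \<in> lca_iso Y Z \<Longrightarrow> g \<circ> f \<in> lca_iso X Z"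
  using lca_hom_comp[of f X Y g Z] lca_iso_lca_hom[of f X Y] lca_iso_lca_hom[of g Y Z]
  by (auto simp: lca_iso_def lca_hom_def intro: homeomorphic_map_compose)

lemma lca_iso_id: "(\<lambda>x. x) \<in> lca_iso A A"
  using lca_hom_id[of A] homeomorphic_map_id[of "topo A" "topo A"] by (auto simp: lca_iso_def lca_hom_def id_def)

locale lca_isomorphism = X: top_alg X + Y: top_alg Y for X :: "'a lca" and Y :: "'b lca" +
  fixes f assumes iso: "f \<in> lca_iso X Y"
begin

definition g where "g = inv_into (carrier X) f"

lemmas hom = lca_iso_lca_hom[OF iso]

lemma bij: "bij_betw f (carrier X) (carrier Y)"
proof -
  have h: "homeomorphic_map (topo X) (topo Y) f" using iso by (simp add: lca_iso_def)
  show ?thesis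
    using homeomorphic_imp_injective_map[OF h] homeomorphic_imp_surjective_map[OF h] X.topspace_eq Y.topspace_eq
    by (simp add: bij_betw_def)
qed

lemma f_closed: "x \<in> carrier X \<Longrightarrow> f x \<in> carrier Y"
  by (rule lca_homD(1)[OF hom])

lemma g_closed: "y \<in> carrier Y \<Longrightarrow> g y \<in> carrier X"
  using bij_betw_imp_surj_on[OF bij] inv_into_into[of y f "carrier X"] by (simp add: g_def)

lemma g_f [simp]: "x \<in> carrier X \<Longrightarrow> g (f x) = x"
  using inv_into_f_f[OF bij_betw_imp_inj_on[OF bij]] by (simp add: g_def)

lemma f_g [simp]: "y \<in> carrier Y \<Longrightarrow> f (g y) = y"
  using bij_betw_imp_surj_on[OF bij] f_inv_into_f[of y f "carrier X"] by (simp add: g_def)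

lemma homeo: "homeomorphic_maps (topo X) (topo Y) f g"
proof -
  obtain h where h: "homeomorphic_maps (topo X) (topo Y) f h"
    using iso by (auto simp: lca_iso_def homeomorphic_map_maps)
  have "h y = g y" if "y \<in> carrier Y" for y
  proof -
    have "h (f (g y)) = g y" using h g_closed[OF that] X.topspace_eq by (simp add: homeomorphic_maps_def)
    then show ?thesis using that by simp
  qed
  then show ?thesis using homeomorphic_maps_eq[OF h] Y.topspace_eq by simp
qed

lemma g_hom: "g \<in> lca_hom Y X"
proof -
  have 1: "g (u \<oplus>\<^bsub>Y\<^esub> v) = g u \<oplus>\<^bsub>X\<^esub> g v" "g (u \<otimes>\<^bsub>Y\<^esub> v) = g u \<otimes>\<^bsub>X\<^esub> g v" "g (c \<odot>\<^bsub>Y\<^esub> u) = c \<odot>\<^bsub>X\<^esub> g u"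
    if uv: "u \<in> carrier Y" "v \<in> carrier Y" for u v c
  proof -
    have "f (g u \<oplus>\<^bsub>X\<^esub> g v) = u \<oplus>\<^bsub>Y\<^esub> v" "f (g u \<otimes>\<^bsub>X\<^esub> g v) = u \<otimes>\<^bsub>Y\<^esub> v" "f (c \<odot>\<^bsub>X\<^esub> g u) = c \<odot>\<^bsub>Y\<^esub> u"
      using uv lca_homD[OF hom] by (simp_all add: g_closed)
    then show "g (u \<oplus>\<^bsub>Y\<^esub> v) = g u \<oplus>\<^bsub>X\<^esub> g v" "g (u \<otimes>\<^bsub>Y\<^esub> v) = g u \<otimes>\<^bsub>X\<^esub> g v" "g (c \<odot>\<^bsub>Y\<^esub> u) = c \<odot>\<^bsub>X\<^esub> g u"
      using uv by (metis X.a_closed X.m_closed X.smult_closed g_closed g_f)+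
  qed
  then show ?thesis
    using homeo by (auto simp: lca_hom_def alg_hom_def homeomorphic_maps_def g_closed)
qed

lemma f_zero [simp]: "f \<zero>\<^bsub>X\<^esub> = \<zero>\<^bsub>Y\<^esub>"
  using lca_homD(4)[OF hom, of "\<zero>\<^bsub>X\<^esub>" 0] f_closed[of "\<zero>\<^bsub>X\<^esub>"] by simp

lemma f_eq_zero: "x \<in> carrier X \<Longrightarrow> f x = \<zero>\<^bsub>Y\<^esub> \<longleftrightarrow> x = \<zero>\<^bsub>X\<^esub>"
  by (metis X.zero_closed f_zero g_f)

text \<open>Operations and neighbourhoods are pulled back along the inverse \<open>g\<close>. A
  Cauchy filter on \<open>Y\<close> is mapped to \<open>X\<close> by \<open>g\<close>, converges
  there, and the limit is pushed forward by \<open>f\<close>, using that \<open>f \<circ> g\<close>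
  is eventually the identity along the filter.\<close>

lemma lc_algebra_image:
  assumes "lc_algebra X"
  shows "lc_algebra Y"
proof -
  interpret L: lc_alg X by unfold_locales fact
  have fc: "continuous_map (topo X) (topo Y) f" and gc: "continuous_map (topo Y) (topo X) g"
    using homeo by (auto simp: homeomorphic_maps_def)
  have fst_c: "continuous_map (prod_topology (topo Y) (topo Y)) (topo X) (g \<circ> fst)"
    and snd_c: "continuous_map (prod_topology Z (topo Y)) (topo X) (g \<circ> snd)" for Z :: "'c topology"
    by (intro continuous_map_compose[OF _ gc] continuous_map_fst continuous_map_snd)+
  have 1: "continuous_map (prod_topology (topo Y) (topo Y)) (topo Y) (\<lambda>(x, y). x \<oplus>\<^bsub>Y\<^esub> y)"
    by (rule continuous_map_eq[OF continuous_map_compose[OF L.continuous_add[OF fst_c snd_c] fc]])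
      (auto simp: Y.topspace_eq g_closed lca_homD[OF hom])
  have 2: "continuous_map (prod_topology (topo Y) (topo Y)) (topo Y) (\<lambda>(x, y). x \<otimes>\<^bsub>Y\<^esub> y)"
    by (rule continuous_map_eq[OF continuous_map_compose[OF L.continuous_mult[OF fst_c snd_c] fc]])
      (auto simp: Y.topspace_eq g_closed lca_homD[OF hom])
  have 3: "continuous_map (prod_topology euclidean (topo Y)) (topo Y) (\<lambda>(c, y). c \<odot>\<^bsub>Y\<^esub> y)"
    by (rule continuous_map_eq[OF continuous_map_compose[OF L.continuous_smult[OF continuous_map_fst snd_c] fc]])
      (auto simp: Y.topspace_eq g_closed lca_homD[OF hom])
  have 4: "\<exists>V. openin (topo Y) V \<and> \<zero>\<^bsub>Y\<^esub> \<in> V \<and> V \<subseteq> U \<and> alg_convex Y V"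
    if U: "openin (topo Y) U" "\<zero>\<^bsub>Y\<^esub> \<in> U" for U
  proof -
    have "openin (topo X) {x \<in> carrier X. f x \<in> U}"
      using openin_continuous_map_preimage[OF fc U(1)] by simp
    moreover have "\<zero>\<^bsub>X\<^esub> \<in> {x \<in> carrier X. f x \<in> U}" using U(2) by simp
    ultimately obtain V where V: "openin (topo X) V" "\<zero>\<^bsub>X\<^esub> \<in> V" "V \<subseteq> {x \<in> carrier X. f x \<in> U}" "alg_convex X V"
      by (rule L.convex_nbhd)
    have "openin (topo Y) {y \<in> carrier Y. g y \<in> V}"
      using openin_continuous_map_preimage[OF gc V(1)] by (simp add: Y.topspace_eq)
    moreover have "g \<zero>\<^bsub>Y\<^esub> = \<zero>\<^bsub>X\<^esub>" by (metis X.zero_closed f_zero g_f)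
    moreover have "alg_convex Y {y \<in> carrier Y. g y \<in> V}"
      using V(4) lca_homD[OF g_hom] unfolding alg_convex_def by simp
    moreover have "{y \<in> carrier Y. g y \<in> V} \<subseteq> U"
      using V(3) by (auto simp: subset_iff)
    ultimately show ?thesis using V(2) by (intro exI[of _ "{y \<in> carrier Y. g y \<in> V}"]) simp
  qed
  have 5: "\<exists>l. limitin (topo Y) (\<lambda>x. x) l F" if F: "cauchy_filter_on Y F" for F
  proof -
    have "cauchy_filter_on X (filtermap g F)"
      unfolding cauchy_filter_on_def
    proof (intro conjI allI impI)
      show "filtermap g F \<noteq> bot" using F by (simp add: cauchy_filter_on_def filtermap_bot_iff)
      have e: "\<forall>\<^sub>F x in F. x \<in> carrier Y" using F by (simp add: cauchy_filter_on_def)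
      then show "\<forall>\<^sub>F x in filtermap g F. x \<in> carrier X"
        unfolding eventually_filtermap by eventually_elim (rule g_closed)
      fix U assume U: "openin (topo X) U \<and> \<zero>\<^bsub>X\<^esub> \<in> U"
      have "openin (topo Y) {y \<in> carrier Y. g y \<in> U}"
        using openin_continuous_map_preimage[OF gc] U by (simp add: Y.topspace_eq)
      moreover have "\<zero>\<^bsub>Y\<^esub> \<in> {y \<in> carrier Y. g y \<in> U}"
        using U by (simp add: f_zero[symmetric] f_closed del: f_zero)
      ultimately obtain S where S: "\<forall>\<^sub>F x in F. x \<in> S" "S \<subseteq> carrier Y"
        "\<forall>x\<in>S. \<forall>y\<in>S. x \<ominus>\<^bsub>Y\<^esub> y \<in> {y \<in> carrier Y. g y \<in> U}"
        using F unfolding cauchy_filter_on_def by blast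
      have "\<forall>\<^sub>F x in filtermap g F. x \<in> g ` S"
        using S(1) unfolding eventually_filtermap by eventually_elim auto
      moreover have "g x \<ominus>\<^bsub>X\<^esub> g y \<in> U" if "x \<in> S" "y \<in> S" for x y
      proof -
        have "x \<in> carrier Y" "y \<in> carrier Y" using that S(2) by auto
        then have "g (x \<ominus>\<^bsub>Y\<^esub> y) = g x \<ominus>\<^bsub>X\<^esub> g y"
          using lca_homD[OF g_hom] by (simp add: X.sub_smult Y.sub_smult)
        then show ?thesis using S(3) that by force
      qed
      ultimately show "\<exists>S. (\<forall>\<^sub>F x in filtermap g F. x \<in> S) \<and> S \<subseteq> carrier X \<and> (\<forall>x\<in>S. \<forall>y\<in>S. x \<ominus>\<^bsub>X\<^esub> y \<in> U)"
        using S(2) g_closed by (intro exI[of _ "g ` S"]) auto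
    qed
    then obtain l where "limitin (topo X) (\<lambda>x. x) l (filtermap g F)" by (rule L.complete)
    from continuous_map_limit[OF fc this]
    have l: "limitin (topo Y) (f \<circ> g) (f l) F"
      by (simp add: limitin_def eventually_filtermap)
    have "\<forall>\<^sub>F x in F. (f \<circ> g) x = x"
      using F unfolding cauchy_filter_on_def by (auto elim: eventually_mono)
    from limitin_transform_eventually[OF this l] show ?thesis by (rule exI)
  qed
  have 6: "Hausdorff_space (topo Y)"
    using L.hausdorff homeomorphic_Hausdorff_space homeo unfolding homeomorphic_space_def by blast
  show ?thesis
    unfolding lc_algebra_def
    by (intro conjI allI impI Y.complex_algebra Y.topspace_eq 1 2 3 6) (elim conjE, rule 4, assumption+, rule 5, assumption)
qed

end

text \<open>Structure is moved along an injection in order to change the type of the elements: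
  \<open>lca_universe\<close> speaks of extensions with elements in \<open>'u \<times> 'u\<close>,
  whereas the extensions of this proof live on several other types.\<close>

definition transport_lca :: "('a \<Rightarrow> 'b) \<Rightarrow> 'a lca \<Rightarrow> 'b lca" where
  "transport_lca h A = (let k = inv_into (carrier A) h in
     \<lparr>carrier = h ` carrier A, monoid.mult = (\<lambda>x y. h (k x \<otimes>\<^bsub>A\<^esub> k y)), one = h \<one>\<^bsub>A\<^esub>,
      ring.zero = h \<zero>\<^bsub>A\<^esub>, ring.add = (\<lambda>x y. h (k x \<oplus>\<^bsub>A\<^esub> k y)), smult = (\<lambda>c x. h (c \<odot>\<^bsub>A\<^esub> k x)),
      topo = pullback_topology (h ` carrier A) k (topo A)\<rparr>)"

lemma (in lc_alg) transport_lca: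
  assumes h: "inj_on h (carrier A)"
  shows "lc_algebra (transport_lca h A)" "h \<in> lca_iso A (transport_lca h A)"
proof -
  define k where "k = inv_into (carrier A) h"
  let ?T = "transport_lca h A"
  have [simp]: "k (h x) = x" if "x \<in> carrier A" for x
    using h that by (simp add: k_def)
  have T [simp]: "carrier ?T = h ` carrier A" "x \<otimes>\<^bsub>?T\<^esub> y = h (k x \<otimes> k y)" "x \<oplus>\<^bsub>?T\<^esub> y = h (k x \<oplus> k y)"
    "\<zero>\<^bsub>?T\<^esub> = h \<zero>" "c \<odot>\<^bsub>?T\<^esub> x = h (c \<odot> k x)" "topo ?T = pullback_topology (h ` carrier A) k (topo A)" for x y c
    by (simp_all add: transport_lca_def Let_def k_def)
  have "complex_algebra ?T"
    by (rule complex_algebraI)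
      (auto simp: smult_add_left smult_add_right smult_smult l_distr r_distr m_assoc smult_mult_left smult_mult_right a_ac)
  moreover have ts: "topspace (topo ?T) = carrier ?T"
    by (auto simp: topspace_pullback_topology)
  ultimately have "top_alg ?T" by unfold_locales
  have "homeomorphic_maps (topo A) (topo ?T) h k"
    unfolding homeomorphic_maps_def
  proof (intro conjI)
    show "continuous_map (topo A) (topo ?T) h"
      unfolding T
    proof (rule continuous_map_pullback')
      show "continuous_map (topo A) (topo A) (k \<circ> h)"
        by (rule continuous_map_eq[OF continuous_map_id]) simp
    qed auto
    show "continuous_map (topo ?T) (topo A) k"
      using continuous_map_pullback[OF continuous_map_id] unfolding T by (metis id_comp)
  qed (auto simp: topspace_pullback_topology)
  moreover from this have "h \<in> lca_hom A ?T"
    by (auto simp: lca_hom_def alg_hom_def homeomorphic_maps_def simp del: T(6))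
  ultimately show iso: "h \<in> lca_iso A ?T" by (rule lca_isoI[rotated])
  interpret lca_isomorphism A ?T h
    using \<open>top_alg ?T\<close> iso by (intro lca_isomorphism.intro lca_isomorphism_axioms.intro top_alg_axioms)
  show "lc_algebra ?T" using lc_algebra by (rule lc_algebra_image)
qed

lemma continuous_map_projections:
  "continuous_map (prod_topology (prod_topology X Y) Z) X (\<lambda>z. fst (fst z))"
  "continuous_map (prod_topology (prod_topology X Y) Z) Y (\<lambda>z. snd (fst z))"
  "continuous_map (prod_topology Z (prod_topology X Y)) X (\<lambda>z. fst (snd z))"
  "continuous_map (prod_topology Z (prod_topology X Y)) Y (\<lambda>z. snd (snd z))"
  by (rule continuous_map_compose[OF continuous_map_fst continuous_map_fst, unfolded o_def]
      continuous_map_compose[OF continuous_map_fst continuous_map_snd, unfolded o_def]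
      continuous_map_compose[OF continuous_map_snd continuous_map_fst, unfolded o_def]
      continuous_map_compose[OF continuous_map_snd continuous_map_snd, unfolded o_def])+

context lc_alg_pair
begin

text \<open>Of the multiplication of \<open>E\<close> only continuity is asked, beyond the algebra
  axioms. The same lemma therefore yields the unitisation, the direct product and the algebra
  \<open>D\<close> of a quasihomomorphism.\<close>

lemma lc_algebra_prodI:
  fixes E :: "('a \<times> 'b) lca"
  assumes "complex_algebra E" and car [simp]: "carrier E = carrier A \<times> carrier B" and zero [simp]: "\<zero>\<^bsub>E\<^esub> = (\<zero>\<^bsub>A\<^esub>, \<zero>\<^bsub>B\<^esub>)"
    and add [simp]: "\<And>a b a' b'. (a, b) \<oplus>\<^bsub>E\<^esub> (a', b') = (a \<oplus>\<^bsub>A\<^esub> a', b \<oplus>\<^bsub>B\<^esub> b')"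
    and smult [simp]: "\<And>c a b. c \<odot>\<^bsub>E\<^esub> (a, b) = (c \<odot>\<^bsub>A\<^esub> a, c \<odot>\<^bsub>B\<^esub> b)"
    and topo [simp]: "topo E = prod_topology (topo A) (topo B)"
    and mult: "continuous_map (prod_topology (topo E) (topo E)) (topo E) (\<lambda>(x, y). x \<otimes>\<^bsub>E\<^esub> y)"
  shows "lc_algebra E"
proof -
  interpret E: complex_alg E by unfold_locales fact
  have 1: "continuous_map (prod_topology (topo E) (topo E)) (topo E) (\<lambda>(x, y). x \<oplus>\<^bsub>E\<^esub> y)"
  proof -
    have "(\<lambda>(x, y). x \<oplus>\<^bsub>E\<^esub> y) = (\<lambda>z. (fst (fst z) \<oplus>\<^bsub>A\<^esub> fst (snd z), snd (fst z) \<oplus>\<^bsub>B\<^esub> snd (snd z)))"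
      by (auto simp: fun_eq_iff)
    then show ?thesis
      by (simp add: continuous_map_pairedI A.continuous_add B.continuous_add continuous_map_projections)
  qed
  have 2: "continuous_map (prod_topology euclidean (topo E)) (topo E) (\<lambda>(c, y). c \<odot>\<^bsub>E\<^esub> y)"
  proof -
    have "(\<lambda>(c, y). c \<odot>\<^bsub>E\<^esub> y) = (\<lambda>z. (fst z \<odot>\<^bsub>A\<^esub> fst (snd z), fst z \<odot>\<^bsub>B\<^esub> snd (snd z)))"
      by (auto simp: fun_eq_iff)
    then show ?thesis
      by (simp add: continuous_map_pairedI A.continuous_smult B.continuous_smult continuous_map_projections continuous_map_fst)
  qed
  have 3: "\<exists>V. openin (topo E) V \<and> \<zero>\<^bsub>E\<^esub> \<in> V \<and> V \<subseteq> U \<and> alg_convex E V" if U: "openin (topo E) U" "\<zero>\<^bsub>E\<^esub> \<in> U" for U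
  proof -
    obtain V W where VW: "openin (topo A) V" "openin (topo B) W" "\<zero>\<^bsub>A\<^esub> \<in> V" "\<zero>\<^bsub>B\<^esub> \<in> W" "V \<times> W \<subseteq> U"
      using U[unfolded topo zero] openin_prod_topology_alt[of "topo A" "topo B" U] by meson
    obtain V' where V': "openin (topo A) V'" "\<zero>\<^bsub>A\<^esub> \<in> V'" "V' \<subseteq> V" "alg_convex A V'"
      using A.convex_nbhd[OF VW(1,3)] by blast
    obtain W' where W': "openin (topo B) W'" "\<zero>\<^bsub>B\<^esub> \<in> W'" "W' \<subseteq> W" "alg_convex B W'"
      using B.convex_nbhd[OF VW(2,4)] by blast
    have "alg_convex E (V' \<times> W')"
      using V'(4) W'(4) unfolding alg_convex_def by auto
    moreover have "openin (topo E) (V' \<times> W')"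
      using V'(1) W'(1) by (auto simp: openin_prod_Times_iff)
    moreover have "\<zero>\<^bsub>E\<^esub> \<in> V' \<times> W'" "V' \<times> W' \<subseteq> U"
      using V' W' VW(5) by auto
    ultimately show ?thesis by (intro exI[of _ "V' \<times> W'"] conjI)
  qed
  have 4: "\<exists>l. limitin (topo E) (\<lambda>x. x) l F" if F: "cauchy_filter_on E F" for F
  proof -
    have ev: "F \<noteq> bot" "\<forall>\<^sub>F x in F. x \<in> carrier E" using F by (simp_all add: cauchy_filter_on_def del: car)
    have "cauchy_filter_on A (filtermap fst F)"
      unfolding cauchy_filter_on_def
    proof (intro conjI allI impI)
      show "filtermap fst F \<noteq> bot" using ev by (simp add: filtermap_bot_iff)
      show "\<forall>\<^sub>F x in filtermap fst F. x \<in> carrier A"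
        using ev(2) unfolding eventually_filtermap by eventually_elim auto
      fix U assume U: "openin (topo A) U \<and> \<zero>\<^bsub>A\<^esub> \<in> U"
      have "openin (topo E) (U \<times> carrier B)" "\<zero>\<^bsub>E\<^esub> \<in> U \<times> carrier B"
        using U openin_topspace[of "topo B"] by (auto simp: openin_prod_Times_iff)
      then obtain S where S: "\<forall>\<^sub>F x in F. x \<in> S" "S \<subseteq> carrier E" "\<forall>x\<in>S. \<forall>y\<in>S. x \<ominus>\<^bsub>E\<^esub> y \<in> U \<times> carrier B"
        using F unfolding cauchy_filter_on_def by metis
      have "\<forall>\<^sub>F x in filtermap fst F. x \<in> fst ` S"
        using S(1) unfolding eventually_filtermap by eventually_elim auto
      moreover have "fst x \<ominus>\<^bsub>A\<^esub> fst y \<in> U" if "x \<in> S" "y \<in> S" for x y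
      proof -
        have "x \<in> carrier E" "y \<in> carrier E" using that S(2) by auto
        then have "fst (x \<ominus>\<^bsub>E\<^esub> y) = fst x \<ominus>\<^bsub>A\<^esub> fst y"
          by (cases x; cases y) (simp add: E.sub_smult A.sub_smult)
        then show ?thesis using S(3) that by force
      qed
      ultimately show "\<exists>S. (\<forall>\<^sub>F x in filtermap fst F. x \<in> S) \<and> S \<subseteq> carrier A \<and> (\<forall>x\<in>S. \<forall>y\<in>S. x \<ominus>\<^bsub>A\<^esub> y \<in> U)"
        using S(2) by (intro exI[of _ "fst ` S"]) auto
    qed
    then obtain l where l: "limitin (topo A) (\<lambda>x. x) l (filtermap fst F)" by (rule A.complete)
    have "cauchy_filter_on B (filtermap snd F)"
      unfolding cauchy_filter_on_def
    proof (intro conjI allI impI)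
      show "filtermap snd F \<noteq> bot" using ev by (simp add: filtermap_bot_iff)
      show "\<forall>\<^sub>F x in filtermap snd F. x \<in> carrier B"
        using ev(2) unfolding eventually_filtermap by eventually_elim auto
      fix U assume U: "openin (topo B) U \<and> \<zero>\<^bsub>B\<^esub> \<in> U"
      have "openin (topo E) (carrier A \<times> U)" "\<zero>\<^bsub>E\<^esub> \<in> carrier A \<times> U"
        using U openin_topspace[of "topo A"] by (auto simp: openin_prod_Times_iff)
      then obtain S where S: "\<forall>\<^sub>F x in F. x \<in> S" "S \<subseteq> carrier E" "\<forall>x\<in>S. \<forall>y\<in>S. x \<ominus>\<^bsub>E\<^esub> y \<in> carrier A \<times> U"
        using F unfolding cauchy_filter_on_def by metis
      have "\<forall>\<^sub>F x in filtermap snd F. x \<in> snd ` S"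
        using S(1) unfolding eventually_filtermap by eventually_elim auto
      moreover have "snd x \<ominus>\<^bsub>B\<^esub> snd y \<in> U" if "x \<in> S" "y \<in> S" for x y
      proof -
        have "x \<in> carrier E" "y \<in> carrier E" using that S(2) by auto
        then have "snd (x \<ominus>\<^bsub>E\<^esub> y) = snd x \<ominus>\<^bsub>B\<^esub> snd y"
          by (cases x; cases y) (simp add: E.sub_smult B.sub_smult)
        then show ?thesis using S(3) that by force
      qed
      ultimately show "\<exists>S. (\<forall>\<^sub>F x in filtermap snd F. x \<in> S) \<and> S \<subseteq> carrier B \<and> (\<forall>x\<in>S. \<forall>y\<in>S. x \<ominus>\<^bsub>B\<^esub> y \<in> U)"
        using S(2) by (intro exI[of _ "snd ` S"]) auto
    qed
    then obtain m where m: "limitin (topo B) (\<lambda>x. x) m (filtermap snd F)" by (rule B.complete)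
    have "limitin (topo E) (\<lambda>x. x) (l, m) F"
      using l m by (simp add: limitin_pairwise) (simp add: limitin_def eventually_filtermap)
    then show ?thesis by blast
  qed
  have 5: "Hausdorff_space (topo E)"
    using A.hausdorff B.hausdorff by (simp add: Hausdorff_space_prod_topology)
  have 6: "topspace (topo E) = carrier E" by simp
  show ?thesis
    unfolding lc_algebra_def
    by (intro conjI allI impI assms(1) 6 1 2 5 mult) (elim conjE, rule 3, assumption+, rule 4, assumption)
qed

end

lemma lc_algebra_complex_lca: "lc_algebra complex_lca"
proof -
  interpret C: complex_alg complex_lca by (rule complex_alg_complex_lca)
  have sub [simp]: "x \<ominus>\<^bsub>complex_lca\<^esub> y = x - y" for x y
    by (simp add: C.sub_smult)
  have c: "continuous_map (prod_topology euclidean euclidean) euclidean (\<lambda>(x, y). x + y :: complex)"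
    "continuous_map (prod_topology euclidean euclidean) euclidean (\<lambda>(x, y). x * y :: complex)"
    by (auto simp: euclidean_product_topology case_prod_beta intro!: continuous_intros)
  have conv: "\<exists>V. open V \<and> 0 \<in> V \<and> V \<subseteq> U \<and> alg_convex complex_lca V"
    if "open U" "0 \<in> U" for U :: "complex set"
  proof -
    obtain e where e: "e > 0" "ball 0 e \<subseteq> U" using \<open>open U\<close> \<open>0 \<in> U\<close> by (metis openE)
    have "alg_convex complex_lca (ball 0 e)"
      unfolding alg_convex_def
    proof (intro ballI)
      fix x y :: complex and t :: real assume "x \<in> ball 0 e" "y \<in> ball 0 e" "t \<in> {0..1}"
      then have "(1 - t) *\<^sub>R y + t *\<^sub>R x \<in> ball 0 e"
        by (intro convexD_alt) auto
      then show "(complex_of_real t \<odot>\<^bsub>complex_lca\<^esub> x) \<oplus>\<^bsub>complex_lca\<^esub> (complex_of_real (1 - t) \<odot>\<^bsub>complex_lca\<^esub> y) \<in> ball 0 e"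
        by (simp only: complex_lca_simps scaleR_conv_of_real add.commute)
    qed
    with e show ?thesis by (intro exI[of _ "ball 0 e"]) auto
  qed
  have compl: "\<exists>l. limitin euclidean (\<lambda>x. x) l F" if F: "cauchy_filter_on complex_lca F" for F
  proof -
    have "cauchy_filter F"
      unfolding cauchy_filter_metric
    proof (intro allI impI)
      fix e :: real assume "e > 0"
      then have "openin (topo complex_lca) (ball 0 e) \<and> \<zero>\<^bsub>complex_lca\<^esub> \<in> ball 0 e" by simp
      then obtain S where "\<forall>\<^sub>F x in F. x \<in> S" "\<forall>x\<in>S. \<forall>y\<in>S. x \<ominus>\<^bsub>complex_lca\<^esub> y \<in> ball 0 e"
        using F unfolding cauchy_filter_on_def by blast
      then show "\<exists>P. eventually P F \<and> (\<forall>x y. P x \<and> P y \<longrightarrow> dist x y < e)"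
        by (intro exI[of _ "\<lambda>x. x \<in> S"]) (auto simp: dist_norm)
    qed
    moreover have "F \<noteq> bot" using F by (simp add: cauchy_filter_on_def)
    moreover have "complete (UNIV :: complex set)" by (rule complete_UNIV)
    ultimately obtain l where "F \<le> nhds l" unfolding complete_uniform by auto
    then have "limitin euclidean (\<lambda>x. x) l F" by (auto simp: filterlim_def)
    then show ?thesis by blast
  qed
  have "ring.add complex_lca = (+)" "monoid.mult complex_lca = (*)" "smult complex_lca = (*)"
    by (simp_all add: complex_lca_def)
  then show ?thesis
    unfolding lc_algebra_def using C.complex_algebra c conv compl by simp
qed

section \<open>Split extensions and their linear retractions\<close>

locale split_ext = I: lc_alg I + E: lc_alg E + Q: lc_alg Q
  for I :: "'i lca" and E :: "'e lca" and Q :: "'q lca" +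
  fixes \<iota> \<pi> s
  assumes split: "split_extension I E Q \<iota> \<pi> s"
begin

sublocale IE: lc_alg_pair I E ..
sublocale EI: lc_alg_pair E I ..
sublocale EQ: lc_alg_pair E Q ..
sublocale QE: lc_alg_pair Q E ..
sublocale EE: lc_alg_pair E E ..

lemma \<iota>: "\<iota> \<in> lca_hom I E" and \<pi>: "\<pi> \<in> lca_hom E Q" and s: "s \<in> lca_hom Q E"
  and embedding: "embedding_map (topo I) (topo E) \<iota>"
  and image: "\<iota> ` carrier I = {x \<in> carrier E. \<pi> x = \<zero>\<^bsub>Q\<^esub>}"
  and \<pi>_s [simp]: "y \<in> carrier Q \<Longrightarrow> \<pi> (s y) = y"
  using split by (auto simp: split_extension_def)

lemmas \<iota>_closed [simp] = lca_homD(1)[OF \<iota>] and \<pi>_closed [simp] = lca_homD(1)[OF \<pi>]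
  and s_closed [simp] = lca_homD(1)[OF s]

lemma \<pi>_\<iota> [simp]: "x \<in> carrier I \<Longrightarrow> \<pi> (\<iota> x) = \<zero>\<^bsub>Q\<^esub>"
  using image by blast

lemma \<iota>_inj: "inj_on \<iota> (carrier I)"
  using embedding homeomorphic_imp_injective_map unfolding embedding_map_def by fastforce

text \<open>The linear retraction onto the ideal complementary to the splitting. It makes
  \<open>E\<close> the direct sum of \<open>I\<close> and \<open>Q\<close> as a topological vector
  space, although it is in general not multiplicative.\<close>

definition r where "r x = inv_into (carrier I) \<iota> (x \<ominus>\<^bsub>E\<^esub> s (\<pi> x))"

lemma sub_in_image: "x \<in> carrier E \<Longrightarrow> x \<ominus>\<^bsub>E\<^esub> s (\<pi> x) \<in> \<iota> ` carrier I"
  using EQ.lca_lin_sub[OF lca_hom_lin[OF \<pi>], of x "s (\<pi> x)"] by (simp add: image Q.sub_self)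

lemma r_closed [simp]: "x \<in> carrier E \<Longrightarrow> r x \<in> carrier I"
  unfolding r_def by (rule inv_into_into[OF sub_in_image])

lemma \<iota>_r: "x \<in> carrier E \<Longrightarrow> \<iota> (r x) = x \<ominus>\<^bsub>E\<^esub> s (\<pi> x)"
  unfolding r_def by (rule f_inv_into_f[OF sub_in_image])

lemma s_zero [simp]: "s \<zero>\<^bsub>Q\<^esub> = \<zero>\<^bsub>E\<^esub>" and \<pi>_zero [simp]: "\<pi> \<zero>\<^bsub>E\<^esub> = \<zero>\<^bsub>Q\<^esub>" and \<iota>_zero [simp]: "\<iota> \<zero>\<^bsub>I\<^esub> = \<zero>\<^bsub>E\<^esub>"
  using QE.lca_lin_zero[OF lca_hom_lin[OF s]] EQ.lca_lin_zero[OF lca_hom_lin[OF \<pi>]]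
    IE.lca_lin_zero[OF lca_hom_lin[OF \<iota>]] by auto

lemma r_\<iota> [simp]: "x \<in> carrier I \<Longrightarrow> r (\<iota> x) = x"
  using \<iota>_r[of "\<iota> x"] inj_onD[OF \<iota>_inj] by (simp add: E.minus_eq)

lemma decompose: "x \<in> carrier E \<Longrightarrow> \<iota> (r x) \<oplus>\<^bsub>E\<^esub> s (\<pi> x) = x"
  using E.add_sub_cancel[of "s (\<pi> x)" x] by (simp add: \<iota>_r E.a_comm E.minus_eq)

text \<open>The map \<open>x \<mapsto> x \<ominus> s (\<pi> x)\<close> is continuous into the image
  of \<iota>, and on that image the inverse of \<iota> is continuous because \<iota> is an
  embedding. Linearity is checked after applying the injective \<iota>.\<close>

lemma r_lin: "r \<in> lca_lin E I"
proof -
  have "homeomorphic_map (topo I) (subtopology (topo E) (\<iota> ` carrier I)) \<iota>"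
    using embedding by (simp add: embedding_map_def)
  then obtain k where k: "homeomorphic_maps (topo I) (subtopology (topo E) (\<iota> ` carrier I)) \<iota> k"
    by (auto simp: homeomorphic_map_maps)
  have "continuous_map (topo E) (subtopology (topo E) (\<iota> ` carrier I)) (\<lambda>x. x \<ominus>\<^bsub>E\<^esub> s (\<pi> x))"
    using sub_in_image
    by (auto simp: continuous_map_in_subtopology intro!: E.continuous_sub continuous_map_id[unfolded id_def]
        continuous_map_compose[OF lca_homD(5)[OF \<pi>] lca_homD(5)[OF s], unfolded o_def])
  from continuous_map_compose[OF this, of "topo I" k] k
  have "continuous_map (topo E) (topo I) (\<lambda>x. k (x \<ominus>\<^bsub>E\<^esub> s (\<pi> x)))"
    by (simp add: homeomorphic_maps_def o_def)
  moreover have "k (x \<ominus>\<^bsub>E\<^esub> s (\<pi> x)) = r x" if "x \<in> carrier E" for x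
    using k that by (simp add: \<iota>_r[symmetric] homeomorphic_maps_def)
  ultimately have c: "continuous_map (topo E) (topo I) r"
    by (rule continuous_map_eq) simp
  have e: "x = y" if "\<iota> x = \<iota> y" "x \<in> carrier I" "y \<in> carrier I" for x y
    using inj_onD[OF \<iota>_inj] that by blast
  have L: "(\<lambda>x. x \<ominus>\<^bsub>E\<^esub> s (\<pi> x)) \<in> lca_lin E E"
    using EE.lca_lin_diff[OF lca_hom_lin[OF lca_hom_id] lca_hom_lin[OF lca_hom_comp[OF \<pi> s]]] by simp
  have "r (x \<oplus>\<^bsub>E\<^esub> y) = r x \<oplus>\<^bsub>I\<^esub> r y" if "x \<in> carrier E" "y \<in> carrier E" for x y
    using that lca_linD(2)[OF L] by (intro e) (simp_all add: \<iota>_r lca_homD(2)[OF \<iota>])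
  moreover have "r (c \<odot>\<^bsub>E\<^esub> x) = c \<odot>\<^bsub>I\<^esub> r x" if "x \<in> carrier E" for x c
    using that lca_linD(3)[OF L] by (intro e) (simp_all add: \<iota>_r lca_homD(4)[OF \<iota>])
  ultimately show ?thesis using c by (simp add: lca_lin_def)
qed

end

lemma split_extI:
  assumes "lc_algebra I" "lc_algebra E" "lc_algebra Q" "split_extension I E Q \<iota> \<pi> s"
  shows "split_ext I E Q \<iota> \<pi> s"
  using assms by (simp add: split_ext_def split_ext_axioms_def lc_alg_def)

text \<open>A linear retraction \<open>r\<close> with the stated identities makes \<iota> a
  topological embedding and supplies preimages for the elements of the kernel of \<pi>. These are
  equations between continuous linear maps, hence easy to transport and to tensor.\<close>

lemma split_extensionI:
  assumes \<iota>: "\<iota> \<in> lca_hom I E" and "\<pi> \<in> lca_hom E Q" "s \<in> lca_hom Q E" and "lc_algebra I" "lc_algebra E"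
    and r: "r \<in> lca_lin E I" and r\<iota>: "\<And>x. x \<in> carrier I \<Longrightarrow> r (\<iota> x) = x"
    and "\<And>x. x \<in> carrier I \<Longrightarrow> \<pi> (\<iota> x) = \<zero>\<^bsub>Q\<^esub>"
    and \<iota>r: "\<And>x. x \<in> carrier E \<Longrightarrow> \<pi> x = \<zero>\<^bsub>Q\<^esub> \<Longrightarrow> \<iota> (r x) = x"
    and "\<And>y. y \<in> carrier Q \<Longrightarrow> \<pi> (s y) = y"
  shows "split_extension I E Q \<iota> \<pi> s"
proof -
  interpret I: lc_alg I by unfold_locales fact
  have "section_map (topo I) (topo E) \<iota>"
    unfolding section_map_def retraction_maps_def
    using lca_homD(5)[OF \<iota>] lca_linD(4)[OF r] r\<iota> by auto
  then have "embedding_map (topo I) (topo E) \<iota>" by (rule section_imp_embedding_map)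
  moreover have "\<iota> ` carrier I = {x \<in> carrier E. \<pi> x = \<zero>\<^bsub>Q\<^esub>}"
  proof (intro equalityI subsetI)
    fix x assume "x \<in> {x \<in> carrier E. \<pi> x = \<zero>\<^bsub>Q\<^esub>}"
    then show "x \<in> \<iota> ` carrier I"
      using \<iota>r[of x] lca_linD(1)[OF r, of x] by (auto intro!: image_eqI[of _ _ "r x"])
  qed (use assms lca_homD(1)[OF \<iota>] in auto)
  ultimately show ?thesis using assms by (simp add: split_extension_def)
qed

lemma representedE:
  assumes "represented \<U> A"
  obtains Y \<phi> where "Y \<in> \<U>" "\<phi> \<in> lca_iso A Y"
  using assms by (auto simp: represented_def)

lemma represented_self: "A \<in> \<U> \<Longrightarrow> represented \<U> A"
  using lca_iso_id by (auto simp: represented_def)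

lemma lca_universe_lc_algebra: "lca_universe \<U> \<Longrightarrow> A \<in> \<U> \<Longrightarrow> lc_algebra A"
  by (simp add: lca_universe_def)

text \<open>An extension of arbitrary element type is replaced by an isomorphic copy with elements
  in \<open>'u \<times> 'u\<close>, to which the closure condition of the universe applies; its
  ideal and quotient are replaced by members of the universe.\<close>

lemma (in split_ext) represented_extension:
  fixes \<U> :: "'u lca set"
  assumes U: "lca_universe \<U>" and I: "represented \<U> I" and Q: "represented \<U> Q"
  shows "represented \<U> E"
proof -
  obtain YI \<phi>I where YI: "YI \<in> \<U>" "\<phi>I \<in> lca_iso I YI" using I by (rule representedE)
  obtain YQ \<phi>Q where YQ: "YQ \<in> \<U>" "\<phi>Q \<in> lca_iso Q YQ" using Q by (rule representedE)
  interpret YI: lc_alg YI using lca_universe_lc_algebra[OF U YI(1)] by unfold_locales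
  interpret YQ: lc_alg YQ using lca_universe_lc_algebra[OF U YQ(1)] by unfold_locales
  interpret fI: lca_isomorphism I YI \<phi>I by unfold_locales (rule YI(2))
  interpret fQ: lca_isomorphism Q YQ \<phi>Q by unfold_locales (rule YQ(2))
  \<comment> \<open>The coordinates of \<open>x\<close> in the ideal and in the quotient; by
    \<open>decompose\<close> they determine \<open>x\<close>.\<close>
  define h where "h x = (\<phi>I (r x), \<phi>Q (\<pi> x))" for x
  define T where "T = transport_lca h E"
  have "inj_on h (carrier E)"
  proof (rule inj_onI)
    fix x y assume xy: "x \<in> carrier E" "y \<in> carrier E" and h: "h x = h y"
    have "fI.g (fst (h x)) = fI.g (fst (h y))" "fQ.g (snd (h x)) = fQ.g (snd (h y))"
      using h by simp_all
    then have r\<pi>: "r x = r y" "\<pi> x = \<pi> y"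
      using xy by (simp_all add: h_def)
    show "x = y"
      using decompose[OF xy(1)] unfolding r\<pi> unfolding decompose[OF xy(2)] by simp
  qed
  from E.transport_lca[OF this] have T: "lc_algebra T" "h \<in> lca_iso E T"
    by (simp_all add: T_def)
  interpret T: lc_alg T by unfold_locales fact
  interpret h: lca_isomorphism E T h by unfold_locales (rule T(2))
  have "split_extension YI T YQ (h \<circ> \<iota> \<circ> fI.g) (\<phi>Q \<circ> \<pi> \<circ> h.g) (h \<circ> s \<circ> fQ.g)"
  proof (rule split_extensionI[where r = "\<phi>I \<circ> r \<circ> h.g"])
    show "h \<circ> \<iota> \<circ> fI.g \<in> lca_hom YI T" "\<phi>Q \<circ> \<pi> \<circ> h.g \<in> lca_hom T YQ" "h \<circ> s \<circ> fQ.g \<in> lca_hom YQ T"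
      by (intro lca_hom_comp[OF fI.g_hom lca_hom_comp[OF \<iota> h.hom]] lca_hom_comp[OF h.g_hom lca_hom_comp[OF \<pi> fQ.hom]]
          lca_hom_comp[OF fQ.g_hom lca_hom_comp[OF s h.hom]])+
    show "\<phi>I \<circ> r \<circ> h.g \<in> lca_lin T YI"
      by (intro lca_lin_comp[OF lca_hom_lin[OF h.g_hom] lca_lin_comp[OF r_lin lca_hom_lin[OF fI.hom]]])
    show "lc_algebra YI" "lc_algebra T" by (rule YI.lc_algebra T.lc_algebra)+
    fix x assume "x \<in> carrier T" "(\<phi>Q \<circ> \<pi> \<circ> h.g) x = \<zero>\<^bsub>YQ\<^esub>"
    then show "(h \<circ> \<iota> \<circ> fI.g) ((\<phi>I \<circ> r \<circ> h.g) x) = x"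
      using decompose[of "h.g x"] by (simp add: h.g_closed fQ.f_eq_zero)
  qed (simp_all add: fI.g_closed fQ.g_closed)
  then have "represented \<U> T"
    using U[unfolded lca_universe_def, THEN conjunct2, THEN conjunct2, THEN conjunct1, rule_format, OF YI(1) YQ(1)]
      T.lc_algebra by metis
  then obtain Y \<phi> where "Y \<in> \<U>" "\<phi> \<in> lca_iso T Y" by (rule representedE)
  with lca_iso_comp[OF T(2)] show ?thesis by (auto simp: represented_def)
qed

context lc_alg
begin

lemma lc_algebra_unitisation: "lc_algebra (unitisation A)"
proof -
  interpret C: lc_alg complex_lca by unfold_locales (rule lc_algebra_complex_lca)
  interpret lc_alg_pair A complex_lca ..
  note [simp] = continuous_mult continuous_add continuous_smult C.continuous_mult[simplified]
    continuous_map_projections continuous_map_pairedI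
  have "(\<lambda>(x, y). x \<otimes>\<^bsub>unitisation A\<^esub> y) = (\<lambda>z. (fst (fst z) \<otimes> fst (snd z) \<oplus>
    (snd (fst z) \<odot> fst (snd z) \<oplus> snd (snd z) \<odot> fst (fst z)), snd (fst z) * snd (snd z)))"
    by (auto simp: fun_eq_iff)
  then have "continuous_map (prod_topology (topo (unitisation A)) (topo (unitisation A))) (topo (unitisation A))
    (\<lambda>(x, y). x \<otimes>\<^bsub>unitisation A\<^esub> y)"
    by simp
  then show ?thesis
    using complex_alg.complex_algebra[OF complex_alg_unitisation[OF complex_alg_axioms]]
    by (intro lc_algebra_prodI) auto
qed

lemma split_extension_unitisation:
  "split_extension A (unitisation A) complex_lca unit_incl snd (\<lambda>z. (\<zero>, z))"
proof (rule split_extensionI[where r = fst])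
  show "unit_incl \<in> lca_hom A (unitisation A)"
    by (auto simp: lca_hom_def alg_hom_def unit_incl_def[abs_def] continuous_map_pairedI continuous_map_id[unfolded id_def])
  show "(\<lambda>z. (\<zero>, z)) \<in> lca_hom complex_lca (unitisation A)"
    by (auto simp: lca_hom_def alg_hom_def continuous_map_pairedI continuous_map_id[unfolded id_def])
qed (auto simp: lca_hom_def lca_lin_def alg_hom_def unit_incl_def continuous_map_fst continuous_map_snd
    lc_algebra lc_algebra_unitisation)

end

text \<open>The product serves the additivity of \<open>H\<close>: two homomorphisms on
  \<open>B\<close> with orthogonal ranges amount to one homomorphism on the product of
  \<open>B\<close> with itself.\<close>

definition prod_lca :: "'a lca \<Rightarrow> 'b lca \<Rightarrow> ('a \<times> 'b) lca" where
  "prod_lca A B = \<lparr>carrier = carrier A \<times> carrier B,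
    monoid.mult = (\<lambda>(a, b) (a', b'). (a \<otimes>\<^bsub>A\<^esub> a', b \<otimes>\<^bsub>B\<^esub> b')), one = (\<one>\<^bsub>A\<^esub>, \<one>\<^bsub>B\<^esub>),
    ring.zero = (\<zero>\<^bsub>A\<^esub>, \<zero>\<^bsub>B\<^esub>), ring.add = (\<lambda>(a, b) (a', b'). (a \<oplus>\<^bsub>A\<^esub> a', b \<oplus>\<^bsub>B\<^esub> b')),
    smult = (\<lambda>c (a, b). (c \<odot>\<^bsub>A\<^esub> a, c \<odot>\<^bsub>B\<^esub> b)), topo = prod_topology (topo A) (topo B)\<rparr>"

lemma prod_lca_simps [simp]:
  "carrier (prod_lca A B) = carrier A \<times> carrier B" "\<zero>\<^bsub>prod_lca A B\<^esub> = (\<zero>\<^bsub>A\<^esub>, \<zero>\<^bsub>B\<^esub>)"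
  "(a, b) \<otimes>\<^bsub>prod_lca A B\<^esub> (a', b') = (a \<otimes>\<^bsub>A\<^esub> a', b \<otimes>\<^bsub>B\<^esub> b')"
  "(a, b) \<oplus>\<^bsub>prod_lca A B\<^esub> (a', b') = (a \<oplus>\<^bsub>A\<^esub> a', b \<oplus>\<^bsub>B\<^esub> b')"
  "c \<odot>\<^bsub>prod_lca A B\<^esub> (a, b) = (c \<odot>\<^bsub>A\<^esub> a, c \<odot>\<^bsub>B\<^esub> b)" "topo (prod_lca A B) = prod_topology (topo A) (topo B)"
  by (simp_all add: prod_lca_def)

context lc_alg_pair
begin

lemma lc_algebra_prod: "lc_algebra (prod_lca A B)"
proof (rule lc_algebra_prodI)
  show "complex_algebra (prod_lca A B)"
    by (rule complex_algebraI)
      (auto simp: A.smult_add_left A.smult_add_right A.smult_smult A.l_distr A.r_distr A.m_assoc A.smult_mult_left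
        A.smult_mult_right A.a_ac B.smult_add_left B.smult_add_right B.smult_smult B.l_distr B.r_distr B.m_assoc
        B.smult_mult_left B.smult_mult_right B.a_ac)
  have "(\<lambda>(x, y). x \<otimes>\<^bsub>prod_lca A B\<^esub> y) = (\<lambda>z. (fst (fst z) \<otimes>\<^bsub>A\<^esub> fst (snd z), snd (fst z) \<otimes>\<^bsub>B\<^esub> snd (snd z)))"
    by (auto simp: fun_eq_iff)
  then show "continuous_map (prod_topology (topo (prod_lca A B)) (topo (prod_lca A B))) (topo (prod_lca A B))
    (\<lambda>(x, y). x \<otimes>\<^bsub>prod_lca A B\<^esub> y)"
    by (simp add: A.continuous_mult B.continuous_mult continuous_map_projections continuous_map_pairedI)
qed simp_all

lemma split_extension_prod:
  "split_extension A (prod_lca A B) B (\<lambda>a. (a, \<zero>\<^bsub>B\<^esub>)) snd (\<lambda>b. (\<zero>\<^bsub>A\<^esub>, b))"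
proof (rule split_extensionI[where r = fst])
  show "(\<lambda>a. (a, \<zero>\<^bsub>B\<^esub>)) \<in> lca_hom A (prod_lca A B)" "(\<lambda>b. (\<zero>\<^bsub>A\<^esub>, b)) \<in> lca_hom B (prod_lca A B)"
    by (auto simp: lca_hom_def alg_hom_def continuous_map_pairedI continuous_map_id[unfolded id_def])
qed (auto simp: lca_hom_def lca_lin_def alg_hom_def continuous_map_fst continuous_map_snd
    A.lc_algebra lc_algebra_prod)

end

subsection \<open>Topological matrix algebras\<close>

lemma mat_lca_simps [simp]:
  "carrier (mat_lca n A) = mats A n n" "x \<otimes>\<^bsub>mat_lca n A\<^esub> y = mat_mult A n x y"
  "\<zero>\<^bsub>mat_lca n A\<^esub> = (\<lambda>_. \<zero>\<^bsub>A\<^esub>)" "x \<oplus>\<^bsub>mat_lca n A\<^esub> y = (\<lambda>ij. x ij \<oplus>\<^bsub>A\<^esub> y ij)"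
  "c \<odot>\<^bsub>mat_lca n A\<^esub> x = (\<lambda>ij. c \<odot>\<^bsub>A\<^esub> x ij)"
  "topo (mat_lca n A) = subtopology (product_topology (\<lambda>_. topo A) UNIV) (mats A n n)"
  by (simp_all add: mat_lca_def)

lemma (in lc_alg) top_alg_mat: "top_alg (mat_lca n A)"
proof (unfold_locales, rule complex_algebraI)
  note mc = mats_carrier
  show "x \<otimes>\<^bsub>mat_lca n A\<^esub> y \<in> carrier (mat_lca n A)" if "x \<in> carrier (mat_lca n A)" "y \<in> carrier (mat_lca n A)" for x y
    using that mat_mult_mats by simp
  show "x \<otimes>\<^bsub>mat_lca n A\<^esub> y \<otimes>\<^bsub>mat_lca n A\<^esub> z = x \<otimes>\<^bsub>mat_lca n A\<^esub> (y \<otimes>\<^bsub>mat_lca n A\<^esub> z)"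
    if "x \<in> carrier (mat_lca n A)" "y \<in> carrier (mat_lca n A)" "z \<in> carrier (mat_lca n A)" for x y z
    using that mat_mult_assoc by simp
  show "(x \<oplus>\<^bsub>mat_lca n A\<^esub> y) \<otimes>\<^bsub>mat_lca n A\<^esub> z = x \<otimes>\<^bsub>mat_lca n A\<^esub> z \<oplus>\<^bsub>mat_lca n A\<^esub> y \<otimes>\<^bsub>mat_lca n A\<^esub> z"
    "z \<otimes>\<^bsub>mat_lca n A\<^esub> (x \<oplus>\<^bsub>mat_lca n A\<^esub> y) = z \<otimes>\<^bsub>mat_lca n A\<^esub> x \<oplus>\<^bsub>mat_lca n A\<^esub> z \<otimes>\<^bsub>mat_lca n A\<^esub> y"
    if "x \<in> carrier (mat_lca n A)" "y \<in> carrier (mat_lca n A)" "z \<in> carrier (mat_lca n A)" for x y z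
    using that mat_mult_add_left mat_mult_add_right by simp_all
  show "(c \<odot>\<^bsub>mat_lca n A\<^esub> x) \<otimes>\<^bsub>mat_lca n A\<^esub> y = c \<odot>\<^bsub>mat_lca n A\<^esub> (x \<otimes>\<^bsub>mat_lca n A\<^esub> y)"
    "x \<otimes>\<^bsub>mat_lca n A\<^esub> (c \<odot>\<^bsub>mat_lca n A\<^esub> y) = c \<odot>\<^bsub>mat_lca n A\<^esub> (x \<otimes>\<^bsub>mat_lca n A\<^esub> y)"
    if "x \<in> carrier (mat_lca n A)" "y \<in> carrier (mat_lca n A)" for c x y
  proof -
    have "x ij \<in> carrier A" "y ij \<in> carrier A" for ij using that mc by auto
    then show "(c \<odot>\<^bsub>mat_lca n A\<^esub> x) \<otimes>\<^bsub>mat_lca n A\<^esub> y = c \<odot>\<^bsub>mat_lca n A\<^esub> (x \<otimes>\<^bsub>mat_lca n A\<^esub> y)"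
      "x \<otimes>\<^bsub>mat_lca n A\<^esub> (c \<odot>\<^bsub>mat_lca n A\<^esub> y) = c \<odot>\<^bsub>mat_lca n A\<^esub> (x \<otimes>\<^bsub>mat_lca n A\<^esub> y)"
      by (auto simp: mat_mult_def fun_eq_iff finsum_smult smult_mult_left smult_mult_right)
  qed
  show "topspace (topo (mat_lca n A)) = carrier (mat_lca n A)"
    using mc by (auto simp: PiE_def)
qed (auto simp: add_mats smult_mats smult_add_left smult_add_right smult_smult a_ac mats_carrier fun_eq_iff)

lemma (in lc_alg) continuous_map_entry:
  "continuous_map (topo (mat_lca n A)) (topo A) (\<lambda>x. x ij)"
  by (auto intro!: continuous_map_from_subtopology continuous_map_product_projection)

lemma (in lc_alg) continuous_map_into_mat:
  assumes "\<And>i j. i < n \<Longrightarrow> j < n \<Longrightarrow> continuous_map X (topo A) (\<lambda>x. f x (i, j))"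
    and "\<And>x. x \<in> topspace X \<Longrightarrow> f x \<in> mats A n n"
  shows "continuous_map X (topo (mat_lca n A)) f"
proof -
  have "continuous_map X (topo A) (\<lambda>x. f x ij)" for ij
  proof (cases "fst ij < n \<and> snd ij < n")
    case True
    then show ?thesis using assms(1)[of "fst ij" "snd ij"] by simp
  next
    case False
    have "continuous_map X (topo A) (\<lambda>x. \<zero>)" by simp
    then show ?thesis
      by (rule continuous_map_eq) (use False assms(2) mats_zero in \<open>metis prod.collapse\<close>)
  qed
  then show ?thesis
    using assms(2) by (auto simp: continuous_map_in_subtopology continuous_map_componentwise_UNIV)
qed

subsection \<open>Projective tensor products\<close>

declare in_lists_conv_set [simp del] in_listsD [rule del] in_listsI [rule del]

text \<open>The map \<open>f \<otimes> id\<close> at the level of representing lists.\<close>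

definition map_left :: "('a \<Rightarrow> 'c) \<Rightarrow> ('a \<times> 'b) list \<Rightarrow> ('c \<times> 'b) list" where
  "map_left f xs = map (\<lambda>(a, b). (f a, b)) xs"

lemma map_left_simps [simp]:
  "map_left f [] = []" "map_left f ((a, b) # xs) = (f a, b) # map_left f xs"
  "map_left f (xs @ ys) = map_left f xs @ map_left f ys"
  by (simp_all add: map_left_def)

lemma map_left_lists:
  assumes "xs \<in> lists (carrier A \<times> carrier B)" "\<And>a. a \<in> carrier A \<Longrightarrow> f a \<in> carrier C"
  shows "map_left f xs \<in> lists (carrier C \<times> carrier B)"
  using assms by (induction xs) auto

lemma map_left_inverse:
  assumes "xs \<in> lists (carrier A \<times> carrier B)" "\<And>a. a \<in> carrier A \<Longrightarrow> g (f a) = a"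
  shows "map_left g (map_left f xs) = xs"
  using assms by (induction xs) auto

lemma sum_map_left: "(\<Sum>(a, b)\<leftarrow>map_left f xs. p a * q b) = (\<Sum>(a, b)\<leftarrow>xs. p (f a) * q b)"
  by (induction xs) auto

context lc_alg_pair
begin

lemma tensor_rel_lists:
  "tensor_rel A B xs ys \<Longrightarrow> xs \<in> lists (carrier A \<times> carrier B) \<and> ys \<in> lists (carrier A \<times> carrier B)"
  by (induction rule: tensor_rel.induct) auto

lemma sum_seminorms_nonneg:
  assumes "cont_seminorm A p" "cont_seminorm B q" "xs \<in> lists (carrier A \<times> carrier B)"
  shows "0 \<le> (\<Sum>(a, b)\<leftarrow>xs. p a * q b)"
  using assms(3,1,2) by (induction xs) (auto simp: cont_seminorm_def)

text \<open>The set of representing sums is nonempty and bounded below by 0, so its infimum is below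
  1 exactly when some representative is. Infima are avoided from here on.\<close>

lemma proj_seminorm_less_iff:
  assumes "cont_seminorm A p" "cont_seminorm B q" "xs \<in> lists (carrier A \<times> carrier B)"
  shows "proj_seminorm A B p q xs < 1 \<longleftrightarrow> (\<exists>ys. tensor_rel A B xs ys \<and> (\<Sum>(a, b)\<leftarrow>ys. p a * q b) < 1)"
proof -
  let ?S = "{(\<Sum>(a, b)\<leftarrow>ys. p a * q b) | ys. tensor_rel A B xs ys}"
  have "bdd_below ?S"
    using tensor_rel_lists sum_seminorms_nonneg[OF assms(1,2)] by (intro bdd_belowI[of _ 0]) blast
  moreover have "?S \<noteq> {}" using tensor_rel.refl[OF assms(3)] by blast
  ultimately show ?thesis
    unfolding proj_seminorm_def by (subst cInf_less_iff) auto
qed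

end

lemma tensor_rel_map_left:
  assumes "lc_alg A" "lc_alg C" and f: "f \<in> lca_lin A C" and "tensor_rel A B xs ys"
  shows "tensor_rel C B (map_left f xs) (map_left f ys)"
proof -
  interpret lc_alg_pair A C using assms by (simp add: lc_alg_pair_def)
  note fD = lca_linD[OF f]
  have l: "map_left f xs \<in> lists (carrier C \<times> carrier B)" if "xs \<in> lists (carrier A \<times> carrier B)" for xs
    using map_left_lists[OF that fD(1)] .
  show ?thesis
    using assms(4)
  proof (induction rule: tensor_rel.induct)
    case (refl xs)
    then show ?case by (intro tensor_rel.refl l)
  next
    case (sym xs ys)
    show ?case by (rule tensor_rel.sym[OF sym.IH])
  next
    case (trans xs ys zs)
    show ?case by (rule tensor_rel.trans[OF trans.IH])
  next
    case (append xs xs' ys ys')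
    show ?case using tensor_rel.append[OF append.IH] by simp
  next
    case (commute xs ys)
    show ?case using tensor_rel.commute[OF commute[THEN l]] by simp
  qed (simp_all add: fD lca_lin_zero[OF f] tensor_rel.add_left tensor_rel.add_right tensor_rel.scalar tensor_rel.zero)
qed

lemma cont_seminorm_comp:
  assumes "cont_seminorm C p" "f \<in> lca_lin A C"
  shows "cont_seminorm A (\<lambda>a. p (f a))"
  using assms lca_linD[OF assms(2)] continuous_map_compose[OF lca_linD(4)[OF assms(2)], of euclideanreal p]
  by (auto simp: cont_seminorm_def o_def)

text \<open>A representative that is small for \<open>p \<circ> f\<close> and \<open>q\<close> is
  mapped by \<open>map_left f\<close> to a representative that is small for \<open>p\<close> and
  \<open>q\<close>. This is the estimate behind the continuity of
  \<open>f \<otimes> id\<close>.\<close>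

lemma proj_seminorm_map_left:
  assumes "lc_alg A" "lc_alg B" "lc_alg C" and f: "f \<in> lca_lin A C"
    and p: "cont_seminorm C p" and q: "cont_seminorm B q" and xs: "xs \<in> lists (carrier A \<times> carrier B)"
    and less: "proj_seminorm A B (\<lambda>a. p (f a)) q xs < 1"
  shows "proj_seminorm C B p q (map_left f xs) < 1"
proof -
  interpret AB: lc_alg_pair A B using assms by (simp add: lc_alg_pair_def)
  interpret CB: lc_alg_pair C B using assms by (simp add: lc_alg_pair_def)
  obtain ys where ys: "tensor_rel A B xs ys" "(\<Sum>(a, b)\<leftarrow>ys. p (f a) * q b) < 1"
    using less AB.proj_seminorm_less_iff[OF cont_seminorm_comp[OF p f] q xs] by blast
  have "tensor_rel C B (map_left f xs) (map_left f ys)"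
    using tensor_rel_map_left[OF assms(1,3) f ys(1)] .
  then show ?thesis
    using ys(2) by (subst CB.proj_seminorm_less_iff[OF p q map_left_lists[OF xs lca_linD(1)[OF f]]])
      (auto simp: sum_map_left)
qed

locale proj_tensor = lc_alg_pair A B for A :: "'a lca" and B :: "'b lca" +
  fixes T :: "'t lca" and \<tau>
  assumes proj_tensor: "is_proj_tensor A B T \<tau>"
begin

sublocale T: lc_alg T
  using proj_tensor by unfold_locales (simp add: is_proj_tensor_def)

sublocale BT: lc_alg_pair B T ..

lemma \<tau>_closed [simp]: "a \<in> carrier A \<Longrightarrow> b \<in> carrier B \<Longrightarrow> \<tau> a b \<in> carrier T"
  using proj_tensor by (simp add: is_proj_tensor_def)

lemma \<tau>_smult_left: "a \<in> carrier A \<Longrightarrow> b \<in> carrier B \<Longrightarrow> \<tau> (c \<odot>\<^bsub>A\<^esub> a) b = c \<odot>\<^bsub>T\<^esub> \<tau> a b"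
  using proj_tensor by (simp add: is_proj_tensor_def)

lemma \<tau>_mult: "a \<in> carrier A \<Longrightarrow> a' \<in> carrier A \<Longrightarrow> b \<in> carrier B \<Longrightarrow> b' \<in> carrier B \<Longrightarrow>
    \<tau> a b \<otimes>\<^bsub>T\<^esub> \<tau> a' b' = \<tau> (a \<otimes>\<^bsub>A\<^esub> a') (b \<otimes>\<^bsub>B\<^esub> b')"
  using proj_tensor by (simp add: is_proj_tensor_def)

lemma tsum_eq_iff: "xs \<in> lists (carrier A \<times> carrier B) \<Longrightarrow> ys \<in> lists (carrier A \<times> carrier B) \<Longrightarrow>
    tensor_sum T \<tau> xs = tensor_sum T \<tau> ys \<longleftrightarrow> tensor_rel A B xs ys"
  using proj_tensor by (simp add: is_proj_tensor_def)

lemma nbhd_proj_seminorm: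
  "cont_seminorm A p \<Longrightarrow> cont_seminorm B q \<Longrightarrow> \<exists>U. openin (topo T) U \<and> \<zero>\<^bsub>T\<^esub> \<in> U \<and>
    (\<forall>xs\<in>lists (carrier A \<times> carrier B). tensor_sum T \<tau> xs \<in> U \<longrightarrow> proj_seminorm A B p q xs < 1)"
  using proj_tensor by (simp add: is_proj_tensor_def)

lemma proj_seminorm_nbhd:
  "openin (topo T) U \<Longrightarrow> \<zero>\<^bsub>T\<^esub> \<in> U \<Longrightarrow> \<exists>p q. cont_seminorm A p \<and> cont_seminorm B q \<and>
    (\<forall>xs\<in>lists (carrier A \<times> carrier B). proj_seminorm A B p q xs < 1 \<longrightarrow> tensor_sum T \<tau> xs \<in> U)"
  using proj_tensor by (simp add: is_proj_tensor_def)

lemma dense: "topo T closure_of (tensor_sum T \<tau> ` lists (carrier A \<times> carrier B)) = carrier T"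
  using proj_tensor by (simp add: is_proj_tensor_def)

lemma tsum_simps [simp]:
  "tensor_sum T \<tau> [] = \<zero>\<^bsub>T\<^esub>" "tensor_sum T \<tau> ((a, b) # xs) = \<tau> a b \<oplus>\<^bsub>T\<^esub> tensor_sum T \<tau> xs"
  by (simp_all add: tensor_sum_def)

lemma tsum_closed [simp]: "xs \<in> lists (carrier A \<times> carrier B) \<Longrightarrow> tensor_sum T \<tau> xs \<in> carrier T"
  by (induction xs) auto

lemma tsum_append [simp]:
  "xs \<in> lists (carrier A \<times> carrier B) \<Longrightarrow> ys \<in> lists (carrier A \<times> carrier B) \<Longrightarrow>
    tensor_sum T \<tau> (xs @ ys) = tensor_sum T \<tau> xs \<oplus>\<^bsub>T\<^esub> tensor_sum T \<tau> ys"
  by (induction xs) (auto simp: T.a_assoc)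

lemma tsum_smult:
  "xs \<in> lists (carrier A \<times> carrier B) \<Longrightarrow> c \<odot>\<^bsub>T\<^esub> tensor_sum T \<tau> xs = tensor_sum T \<tau> (map_left (\<lambda>a. c \<odot>\<^bsub>A\<^esub> a) xs)"
  by (induction xs) (auto simp: T.smult_add_right \<tau>_smult_left)

text \<open>Additivity of \<tau> is contained in the description of equality of tensors: the
  defining relation identifies the lists \<open>[(a \<oplus> a', b)]\<close> and
  \<open>[(a, b), (a', b)]\<close>, and \<open>tsum_eq_iff\<close> turns this into an equation in
  \<open>T\<close>.\<close>

lemma \<tau>_add_left: "a \<in> carrier A \<Longrightarrow> a' \<in> carrier A \<Longrightarrow> b \<in> carrier B \<Longrightarrow> \<tau> (a \<oplus>\<^bsub>A\<^esub> a') b = \<tau> a b \<oplus>\<^bsub>T\<^esub> \<tau> a' b"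
  using tsum_eq_iff[of "[(a \<oplus>\<^bsub>A\<^esub> a', b)]" "[(a, b), (a', b)]"] by (simp add: tensor_rel.add_left)

lemma \<tau>_add_right: "a \<in> carrier A \<Longrightarrow> b \<in> carrier B \<Longrightarrow> b' \<in> carrier B \<Longrightarrow> \<tau> a (b \<oplus>\<^bsub>B\<^esub> b') = \<tau> a b \<oplus>\<^bsub>T\<^esub> \<tau> a b'"
  using tsum_eq_iff[of "[(a, b \<oplus>\<^bsub>B\<^esub> b')]" "[(a, b), (a, b')]"] by (simp add: tensor_rel.add_right)

lemma \<tau>_smult_right: "a \<in> carrier A \<Longrightarrow> b \<in> carrier B \<Longrightarrow> \<tau> a (c \<odot>\<^bsub>B\<^esub> b) = c \<odot>\<^bsub>T\<^esub> \<tau> a b"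
  using tsum_eq_iff[of "[(c \<odot>\<^bsub>A\<^esub> a, b)]" "[(a, c \<odot>\<^bsub>B\<^esub> b)]"]
  by (simp add: tensor_rel.scalar \<tau>_smult_left)

lemma \<tau>_zero_left [simp]: "b \<in> carrier B \<Longrightarrow> \<tau> \<zero>\<^bsub>A\<^esub> b = \<zero>\<^bsub>T\<^esub>"
  using \<tau>_smult_left[of "\<zero>\<^bsub>A\<^esub>" b 0] by simp

text \<open>Finite sums of elementary tensors are dense, so a closed property has to be checked on
  such sums only, by induction on the representing list.\<close>

lemma tensor_induct:
  assumes x: "x \<in> carrier T" and cl: "closedin (topo T) {x \<in> carrier T. P x}" and "P \<zero>\<^bsub>T\<^esub>"
    and "\<And>a b. a \<in> carrier A \<Longrightarrow> b \<in> carrier B \<Longrightarrow> P (\<tau> a b)"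
    and "\<And>x y. x \<in> carrier T \<Longrightarrow> y \<in> carrier T \<Longrightarrow> P x \<Longrightarrow> P y \<Longrightarrow> P (x \<oplus>\<^bsub>T\<^esub> y)"
  shows "P x"
proof (rule forall_in_closure_of[where P = P])
  show "x \<in> topo T closure_of (tensor_sum T \<tau> ` lists (carrier A \<times> carrier B))" using x dense by simp
  have "P (tensor_sum T \<tau> xs)" if "xs \<in> lists (carrier A \<times> carrier B)" for xs
    using that by (induction xs) (use assms in auto)
  then show "P x" if "x \<in> tensor_sum T \<tau> ` lists (carrier A \<times> carrier B)" for x using that by auto
qed (use cl in simp)

lemma tensor_lin_eq:
  assumes S: "lc_alg S" and f: "f \<in> lca_lin T S" and g: "g \<in> lca_lin T S"
    and fg: "\<And>a b. a \<in> carrier A \<Longrightarrow> b \<in> carrier B \<Longrightarrow> f (\<tau> a b) = g (\<tau> a b)" and x: "x \<in> carrier T"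
  shows "f x = g x"
proof (rule tensor_induct[where P = "\<lambda>x. f x = g x", OF x])
  interpret S: lc_alg S by fact
  interpret TS: lc_alg_pair T S ..
  show "closedin (topo T) {x \<in> carrier T. f x = g x}"
    using closedin_continuous_maps_eq[OF S.hausdorff lca_linD(4)[OF f] lca_linD(4)[OF g]] by simp
  show "f \<zero>\<^bsub>T\<^esub> = g \<zero>\<^bsub>T\<^esub>" using TS.lca_lin_zero[OF f] TS.lca_lin_zero[OF g] by simp
  show "f (x \<oplus>\<^bsub>T\<^esub> y) = g (x \<oplus>\<^bsub>T\<^esub> y)" if "x \<in> carrier T" "y \<in> carrier T" "f x = g x" "f y = g y" for x y
    using that lca_linD(2)[OF f] lca_linD(2)[OF g] by simp
qed (rule fg)

lemma \<tau>_right_lin: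
  assumes a: "a \<in> carrier A"
  shows "\<tau> a \<in> lca_lin B T"
proof (rule BT.lca_linI)
  fix V assume V: "openin (topo T) V" "\<zero>\<^bsub>T\<^esub> \<in> V"
  obtain p q where pq: "cont_seminorm A p" "cont_seminorm B q"
    "\<forall>xs\<in>lists (carrier A \<times> carrier B). proj_seminorm A B p q xs < 1 \<longrightarrow> tensor_sum T \<tau> xs \<in> V"
    using proj_seminorm_nbhd[OF V] by blast
  have q: "continuous_map (topo B) euclideanreal q" "q (0 \<odot>\<^bsub>B\<^esub> \<zero>\<^bsub>B\<^esub>) = cmod 0 * q \<zero>\<^bsub>B\<^esub>"
    using pq(2) B.zero_closed unfolding cont_seminorm_def by blast+
  \<comment> \<open>The condition is written as \<open>p a * q b < 1\<close>, without dividing by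
    \<open>p a\<close>, so that \<open>p a = 0\<close> is included; the singleton list
    \<open>[(a, b)]\<close> is then a representative of seminorm below 1.\<close>
  let ?U = "{b \<in> topspace (topo B). q b \<in> {t. p a * t < 1}}"
  have "open {t. p a * t < 1}"
    by (intro open_Collect_less continuous_intros)
  then have "openin (topo B) ?U"
    by (intro openin_continuous_map_preimage[OF q(1)]) simp
  moreover have "\<zero>\<^bsub>B\<^esub> \<in> ?U" using q(2) by simp
  moreover have "\<tau> a b \<in> V" if b: "b \<in> ?U" for b
  proof -
    have ab: "[(a, b)] \<in> lists (carrier A \<times> carrier B)" using a b by simp
    have "proj_seminorm A B p q [(a, b)] < 1"
      unfolding proj_seminorm_less_iff[OF pq(1,2) ab] using b by (intro exI[of _ "[(a, b)]"]) (simp add: tensor_rel.refl[OF ab])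
    then have "tensor_sum T \<tau> [(a, b)] \<in> V" using pq(3) ab by blast
    then show ?thesis using ab by simp
  qed
  ultimately show "\<exists>U. openin (topo B) U \<and> \<zero>\<^bsub>B\<^esub> \<in> U \<and> (\<forall>x\<in>carrier B \<inter> U. \<tau> a x \<in> V)" by blast
qed (use a in \<open>simp_all add: \<tau>_add_right \<tau>_smult_right\<close>)

end

section \<open>Functoriality of the projective tensor product\<close>

locale tensor_morphism = T1: proj_tensor A B T \<tau> + T2: proj_tensor C B S \<sigma>
  for A :: "'a lca" and B :: "'b lca" and T :: "'t lca" and \<tau> and C :: "'c lca" and S :: "'s lca" and \<sigma>
begin

sublocale AC: lc_alg_pair A C ..
sublocale TS: lc_alg_pair T S ..

lemma tsum_map_left:
  assumes f: "f \<in> lca_lin A C"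
    and xs: "xs \<in> lists (carrier A \<times> carrier B)" "ys \<in> lists (carrier A \<times> carrier B)"
    and eq: "tensor_sum T \<tau> xs = tensor_sum T \<tau> ys"
  shows "tensor_sum S \<sigma> (map_left f xs) = tensor_sum S \<sigma> (map_left f ys)"
  using tensor_rel_map_left[OF T1.A.lc_alg_axioms T2.A.lc_alg_axioms f] eq
    T1.tsum_eq_iff[OF xs] T2.tsum_eq_iff[OF map_left_lists map_left_lists, OF xs(1) _ xs(2)] lca_linD(1)[OF f]
  by blast

text \<open>On the algebraic tensor product the map applies \<open>f\<close> to the first components
  of a chosen representing list, which is independent of the choice by \<open>tsum_map_left\<close>.
  Pulling seminorms back along \<open>f\<close> gives continuity at zero, and density with
  completeness gives the extension to all of \<open>T\<close>.\<close>

lemma tensor_lin_exists: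
  assumes f: "f \<in> lca_lin A C"
  obtains h where "h \<in> lca_lin T S" "\<And>a b. a \<in> carrier A \<Longrightarrow> b \<in> carrier B \<Longrightarrow> h (\<tau> a b) = \<sigma> (f a) b"
proof -
  let ?L = "lists (carrier A \<times> carrier B)"
  define M where "M = tensor_sum T \<tau> ` ?L"
  define g where "g x = tensor_sum S \<sigma> (map_left f (SOME xs. xs \<in> ?L \<and> tensor_sum T \<tau> xs = x))" for x
  have g: "g (tensor_sum T \<tau> xs) = tensor_sum S \<sigma> (map_left f xs)" if "xs \<in> ?L" for xs
  proof -
    have "(SOME ys. ys \<in> ?L \<and> tensor_sum T \<tau> ys = tensor_sum T \<tau> xs) \<in> ?L \<and>
      tensor_sum T \<tau> (SOME ys. ys \<in> ?L \<and> tensor_sum T \<tau> ys = tensor_sum T \<tau> xs) = tensor_sum T \<tau> xs"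
      by (rule someI[of "\<lambda>ys. ys \<in> ?L \<and> tensor_sum T \<tau> ys = tensor_sum T \<tau> xs" xs]) (use that in simp)
    then show ?thesis
      unfolding g_def using that by (intro tsum_map_left[OF f]) auto
  qed
  have ml: "map_left f xs \<in> lists (carrier C \<times> carrier B)" if "xs \<in> ?L" for xs
    using map_left_lists[OF that lca_linD(1)[OF f]] .
  have M: "M \<subseteq> carrier T" by (auto simp: M_def)
  have add: "x \<oplus>\<^bsub>T\<^esub> y \<in> M" "g (x \<oplus>\<^bsub>T\<^esub> y) = g x \<oplus>\<^bsub>S\<^esub> g y" if xy: "x \<in> M" "y \<in> M" for x y
  proof -
    obtain xs ys where [simp]: "x = tensor_sum T \<tau> xs" "y = tensor_sum T \<tau> ys" and l: "xs \<in> ?L" "ys \<in> ?L"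
      using xy by (auto simp: M_def)
    have l': "xs @ ys \<in> ?L" using l by (simp only: append_in_lists_conv)
    have e: "x \<oplus>\<^bsub>T\<^esub> y = tensor_sum T \<tau> (xs @ ys)" using l by simp
    show "x \<oplus>\<^bsub>T\<^esub> y \<in> M" unfolding e M_def using l' by (rule imageI)
    show "g (x \<oplus>\<^bsub>T\<^esub> y) = g x \<oplus>\<^bsub>S\<^esub> g y"
      unfolding e g[OF l'] using l ml by (simp add: g)
  qed
  have smult: "c \<odot>\<^bsub>T\<^esub> x \<in> M" "g (c \<odot>\<^bsub>T\<^esub> x) = c \<odot>\<^bsub>S\<^esub> g x" if x: "x \<in> M" for c x
  proof -
    obtain xs where [simp]: "x = tensor_sum T \<tau> xs" and l: "xs \<in> ?L"
      using x by (auto simp: M_def)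
    have l': "map_left (\<lambda>a. c \<odot>\<^bsub>A\<^esub> a) xs \<in> ?L" using l by (intro map_left_lists) auto
    have e: "c \<odot>\<^bsub>T\<^esub> x = tensor_sum T \<tau> (map_left (\<lambda>a. c \<odot>\<^bsub>A\<^esub> a) xs)" using l by (simp add: T1.tsum_smult)
    show "c \<odot>\<^bsub>T\<^esub> x \<in> M" unfolding e M_def using l' by (rule imageI)
    have "map_left f (map_left (\<lambda>a. c \<odot>\<^bsub>A\<^esub> a) xs) = map_left (\<lambda>a. c \<odot>\<^bsub>C\<^esub> a) (map_left f xs)"
      using l by (induction xs) (auto simp: lca_linD(3)[OF f])
    then show "g (c \<odot>\<^bsub>T\<^esub> x) = c \<odot>\<^bsub>S\<^esub> g x"
      unfolding e g[OF l'] using l by (simp add: g T2.tsum_smult[OF ml])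
  qed
  have dense: "topo T closure_of M = carrier T" by (simp add: M_def T1.dense)
  have closed: "g \<in> M \<rightarrow> carrier S"
  proof
    fix x assume "x \<in> M"
    then obtain xs where "x = tensor_sum T \<tau> xs" "xs \<in> ?L" by (auto simp: M_def)
    then show "g x \<in> carrier S" by (simp add: g ml)
  qed
  have cont: "\<exists>U. openin (topo T) U \<and> \<zero>\<^bsub>T\<^esub> \<in> U \<and> (\<forall>x\<in>M \<inter> U. g x \<in> V)"
    if V: "openin (topo S) V" "\<zero>\<^bsub>S\<^esub> \<in> V" for V
  proof -
    obtain p q where p: "cont_seminorm C p" and q: "cont_seminorm B q"
      and pq: "\<forall>xs\<in>lists (carrier C \<times> carrier B). proj_seminorm C B p q xs < 1 \<longrightarrow> tensor_sum S \<sigma> xs \<in> V"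
      using T2.proj_seminorm_nbhd[OF V] by blast
    obtain U where U: "openin (topo T) U" "\<zero>\<^bsub>T\<^esub> \<in> U"
      "\<forall>xs\<in>?L. tensor_sum T \<tau> xs \<in> U \<longrightarrow> proj_seminorm A B (\<lambda>a. p (f a)) q xs < 1"
      using T1.nbhd_proj_seminorm[OF cont_seminorm_comp[OF p f] q] by blast
    have "g x \<in> V" if x: "x \<in> M \<inter> U" for x
    proof -
      obtain xs where [simp]: "x = tensor_sum T \<tau> xs" and l: "xs \<in> ?L"
        using x by (auto simp: M_def)
      have "proj_seminorm A B (\<lambda>a. p (f a)) q xs < 1" using U(3) l x by simp
      then have "proj_seminorm C B p q (map_left f xs) < 1"
        by (rule proj_seminorm_map_left[OF T1.A.lc_alg_axioms T1.B.lc_alg_axioms T2.A.lc_alg_axioms f p q l])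
      then show ?thesis using pq ml[OF l] by (simp add: g[OF l])
    qed
    then show ?thesis using U(1,2) by blast
  qed
  have "\<exists>h. h \<in> lca_lin T S \<and> (\<forall>x\<in>M. h x = g x)"
    by (rule TS.linear_extension[OF M add(1) smult(1) dense closed add(2) smult(2) cont])
      (assumption | rule exI conjI ballI | simp)+
  then obtain h where h: "h \<in> lca_lin T S" "\<And>x. x \<in> M \<Longrightarrow> h x = g x"
    by metis
  show thesis
  proof (rule that[OF h(1)])
    fix a b assume ab: "a \<in> carrier A" "b \<in> carrier B"
    then have l: "[(a, b)] \<in> ?L" by simp
    have "h (tensor_sum T \<tau> [(a, b)]) = g (tensor_sum T \<tau> [(a, b)])"
      by (rule h(2)) (unfold M_def, rule imageI[OF l])
    then show "h (\<tau> a b) = \<sigma> (f a) b"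
      unfolding g[OF l] using ab lca_linD(1)[OF f] by simp
  qed
qed

text \<open>Multiplicativity is obtained one variable at a time: for a fixed elementary tensor on
  the right both sides are continuous linear in \<open>x\<close> and agree on elementary tensors;
  then \<open>x\<close> is arbitrary but fixed and the same argument runs in
  \<open>y\<close>.\<close>

lemma tensor_hom_exists:
  assumes f: "f \<in> lca_hom A C"
  shows "\<exists>h. h \<in> lca_hom T S \<and> (\<forall>a\<in>carrier A. \<forall>b\<in>carrier B. h (\<tau> a b) = \<sigma> (f a) b)"
proof -
  obtain h where h: "h \<in> lca_lin T S" and h\<tau>: "\<And>a b. a \<in> carrier A \<Longrightarrow> b \<in> carrier B \<Longrightarrow> h (\<tau> a b) = \<sigma> (f a) b"
    using tensor_lin_exists[OF lca_hom_lin[OF f]] by blast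
  note hD = lca_linD[OF h]
  have 1: "h (x \<otimes>\<^bsub>T\<^esub> \<tau> a b) = h x \<otimes>\<^bsub>S\<^esub> h (\<tau> a b)" if "a \<in> carrier A" "b \<in> carrier B" "x \<in> carrier T" for x a b
  proof (rule T1.tensor_lin_eq[OF T2.T.lc_alg_axioms _ _ _ that(3)])
    have "(\<lambda>x. x \<otimes>\<^bsub>T\<^esub> \<tau> a b) \<in> lca_lin T T"
      using that by (auto simp: lca_lin_def T1.T.l_distr T1.T.smult_mult_left
          intro!: T1.T.continuous_mult continuous_map_id[unfolded id_def])
    from lca_lin_comp[OF this h] show "(\<lambda>x. h (x \<otimes>\<^bsub>T\<^esub> \<tau> a b)) \<in> lca_lin T S" by (simp add: o_def)
    have "(\<lambda>x. x \<otimes>\<^bsub>S\<^esub> h (\<tau> a b)) \<in> lca_lin S S"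
      using that hD by (auto simp: lca_lin_def T2.T.l_distr T2.T.smult_mult_left
          intro!: T2.T.continuous_mult continuous_map_id[unfolded id_def])
    from lca_lin_comp[OF h this] show "(\<lambda>x. h x \<otimes>\<^bsub>S\<^esub> h (\<tau> a b)) \<in> lca_lin T S" by (simp add: o_def)
    show "h (\<tau> a' b' \<otimes>\<^bsub>T\<^esub> \<tau> a b) = h (\<tau> a' b') \<otimes>\<^bsub>S\<^esub> h (\<tau> a b)" if "a' \<in> carrier A" "b' \<in> carrier B" for a' b'
      using that \<open>a \<in> carrier A\<close> \<open>b \<in> carrier B\<close> lca_homD[OF f] by (simp add: h\<tau> T1.\<tau>_mult T2.\<tau>_mult)
  qed
  have "h (x \<otimes>\<^bsub>T\<^esub> y) = h x \<otimes>\<^bsub>S\<^esub> h y" if "x \<in> carrier T" "y \<in> carrier T" for x y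
  proof (rule T1.tensor_lin_eq[OF T2.T.lc_alg_axioms _ _ _ that(2)])
    have "(\<lambda>y. x \<otimes>\<^bsub>T\<^esub> y) \<in> lca_lin T T"
      using that by (auto simp: lca_lin_def T1.T.r_distr T1.T.smult_mult_right
          intro!: T1.T.continuous_mult continuous_map_id[unfolded id_def])
    from lca_lin_comp[OF this h] show "(\<lambda>y. h (x \<otimes>\<^bsub>T\<^esub> y)) \<in> lca_lin T S" by (simp add: o_def)
    have "(\<lambda>y. h x \<otimes>\<^bsub>S\<^esub> y) \<in> lca_lin S S"
      using that hD by (auto simp: lca_lin_def T2.T.r_distr T2.T.smult_mult_right
          intro!: T2.T.continuous_mult continuous_map_id[unfolded id_def])
    from lca_lin_comp[OF h this] show "(\<lambda>y. h x \<otimes>\<^bsub>S\<^esub> h y) \<in> lca_lin T S" by (simp add: o_def)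
    show "h (x \<otimes>\<^bsub>T\<^esub> \<tau> a' b') = h x \<otimes>\<^bsub>S\<^esub> h (\<tau> a' b')" if "a' \<in> carrier A" "b' \<in> carrier B" for a' b'
      using 1[OF that \<open>x \<in> carrier T\<close>] .
  qed
  then have "h \<in> lca_hom T S" by (rule lca_homI[OF h])
  with h\<tau> show ?thesis by blast
qed

end

text \<open>The universe provides tensor products for its members. Algebras such as \<complex>,
  \<open>D\<close> and the unitisations are only isomorphic to members, and precomposing \<tau> with
  the isomorphism makes the same \<open>T\<close> a tensor product for them.\<close>

lemma (in lca_isomorphism) is_proj_tensor_transport:
  assumes X: "lc_alg X" and Y: "lc_alg Y" and B: "lc_alg B" and T: "is_proj_tensor Y B T \<tau>"
  shows "is_proj_tensor X B T (\<lambda>x. \<tau> (f x))"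
proof -
  interpret Y: lc_alg Y by fact
  interpret B: lc_alg B by fact
  interpret T: proj_tensor Y B T \<tau> by unfold_locales fact
  interpret X: lc_alg X by fact
  note fl = lca_hom_lin[OF hom] and gl = lca_hom_lin[OF g_hom]
  have sum: "tensor_sum T (\<lambda>x. \<tau> (f x)) xs = tensor_sum T \<tau> (map_left f xs)" for xs
    by (induction xs) (auto simp: tensor_sum_def)
  have fl': "map_left f xs \<in> lists (carrier Y \<times> carrier B)" if "xs \<in> lists (carrier X \<times> carrier B)" for xs
    using map_left_lists[OF that f_closed] .
  have gl': "map_left g ys \<in> lists (carrier X \<times> carrier B)" if "ys \<in> lists (carrier Y \<times> carrier B)" for ys
    using map_left_lists[OF that g_closed] .
  have gf: "map_left g (map_left f xs) = xs" if "xs \<in> lists (carrier X \<times> carrier B)" for xs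
    by (rule map_left_inverse[OF that]) simp
  have fg: "map_left f (map_left g ys) = ys" if "ys \<in> lists (carrier Y \<times> carrier B)" for ys
    by (rule map_left_inverse[OF that]) simp
  have rel: "tensor_rel Y B (map_left f xs) (map_left f ys) \<longleftrightarrow> tensor_rel X B xs ys"
    if "xs \<in> lists (carrier X \<times> carrier B)" "ys \<in> lists (carrier X \<times> carrier B)" for xs ys
    using tensor_rel_map_left[OF X Y fl] tensor_rel_map_left[OF Y X gl] gf[OF that(1)] gf[OF that(2)] by metis
  have "\<exists>U. openin (topo T) U \<and> \<zero>\<^bsub>T\<^esub> \<in> U \<and> (\<forall>xs\<in>lists (carrier X \<times> carrier B).
    tensor_sum T (\<lambda>x. \<tau> (f x)) xs \<in> U \<longrightarrow> proj_seminorm X B p q xs < 1)"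
    if p: "cont_seminorm X p" and q: "cont_seminorm B q" for p q
  proof -
    obtain U where U: "openin (topo T) U" "\<zero>\<^bsub>T\<^esub> \<in> U"
      "\<forall>ys\<in>lists (carrier Y \<times> carrier B). tensor_sum T \<tau> ys \<in> U \<longrightarrow> proj_seminorm Y B (\<lambda>y. p (g y)) q ys < 1"
      using T.nbhd_proj_seminorm[OF cont_seminorm_comp[OF p gl] q] by blast
    have "proj_seminorm X B p q xs < 1"
      if xs: "xs \<in> lists (carrier X \<times> carrier B)" and "tensor_sum T (\<lambda>x. \<tau> (f x)) xs \<in> U" for xs
      using proj_seminorm_map_left[OF Y B X gl p q fl'[OF xs]] U(3) that fl'[OF xs] by (simp add: sum gf)
    with U show ?thesis by blast
  qed
  moreover have "\<exists>p q. cont_seminorm X p \<and> cont_seminorm B q \<and> (\<forall>xs\<in>lists (carrier X \<times> carrier B).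
    proj_seminorm X B p q xs < 1 \<longrightarrow> tensor_sum T (\<lambda>x. \<tau> (f x)) xs \<in> U)"
    if U: "openin (topo T) U" "\<zero>\<^bsub>T\<^esub> \<in> U" for U
  proof -
    obtain p q where p: "cont_seminorm Y p" and q: "cont_seminorm B q"
      and pq: "\<forall>ys\<in>lists (carrier Y \<times> carrier B). proj_seminorm Y B p q ys < 1 \<longrightarrow> tensor_sum T \<tau> ys \<in> U"
      using T.proj_seminorm_nbhd[OF U] by blast
    have "tensor_sum T (\<lambda>x. \<tau> (f x)) xs \<in> U"
      if xs: "xs \<in> lists (carrier X \<times> carrier B)" and "proj_seminorm X B (\<lambda>x. p (f x)) q xs < 1" for xs
      using proj_seminorm_map_left[OF X B Y fl p q xs that(2)] pq fl'[OF xs] by (simp add: sum)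
    then show ?thesis using cont_seminorm_comp[OF p fl] q by blast
  qed
  moreover have "tensor_sum T (\<lambda>x. \<tau> (f x)) ` lists (carrier X \<times> carrier B) = tensor_sum T \<tau> ` lists (carrier Y \<times> carrier B)"
    unfolding sum
  proof (intro equalityI subsetI)
    fix z assume "z \<in> tensor_sum T \<tau> ` lists (carrier Y \<times> carrier B)"
    then obtain ys where ys: "z = tensor_sum T \<tau> ys" "ys \<in> lists (carrier Y \<times> carrier B)" by blast
    show "z \<in> (\<lambda>xs. tensor_sum T \<tau> (map_left f xs)) ` lists (carrier X \<times> carrier B)"
      by (rule image_eqI[OF _ gl'[OF ys(2)]]) (simp add: fg ys)
  qed (auto simp: fl')
  ultimately show ?thesis
    unfolding is_proj_tensor_def
    by (intro conjI allI impI ballI)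
      (auto simp: T.T.lc_algebra f_closed lca_homD[OF hom] T.\<tau>_smult_left T.\<tau>_mult T.dense
        sum T.tsum_eq_iff[OF fl' fl'] rel)
qed

section \<open>Tensor products and matrix algebras within a universe\<close>

locale universe =
  fixes \<U> :: "'u lca set"
  assumes universe: "lca_universe \<U>"
begin

lemma lc_alg: "X \<in> \<U> \<Longrightarrow> lc_alg X"
  using universe by unfold_locales (rule lca_universe_lc_algebra)

lemma represented_complex: "represented \<U> complex_lca"
  using universe by (simp add: lca_universe_def)

lemma tensor_pair:
  assumes A: "lc_alg A" "represented \<U> A" and B: "B \<in> \<U>"
  shows "tensor_obj \<U> A B \<in> \<U> \<and> is_proj_tensor A B (tensor_obj \<U> A B) (tensor \<U> A B)"
proof -
  obtain Y \<phi> where Y: "Y \<in> \<U>" "\<phi> \<in> lca_iso A Y" using A(2) by (rule representedE)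
  interpret A: lc_alg A by fact
  interpret Y: lc_alg Y using Y by (intro lc_alg)
  interpret B: lc_alg B using B by (intro lc_alg)
  interpret lca_isomorphism A Y \<phi> by unfold_locales (rule Y(2))
  obtain T \<tau> where T: "T \<in> \<U>" "is_proj_tensor Y B T \<tau>"
    using universe Y(1) B unfolding lca_universe_def by meson
  have "T \<in> \<U> \<and> is_proj_tensor A B T (\<lambda>x. \<tau> (\<phi> x))"
    using T is_proj_tensor_transport[OF A.lc_alg_axioms Y.lc_alg_axioms B.lc_alg_axioms T(2)] by simp
  then have "case (T, \<lambda>x. \<tau> (\<phi> x)) of (T, \<tau>) \<Rightarrow> T \<in> \<U> \<and> is_proj_tensor A B T \<tau>" by simp
  then have "case tensor_pair \<U> A B of (T, \<tau>) \<Rightarrow> T \<in> \<U> \<and> is_proj_tensor A B T \<tau>"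
    unfolding tensor_pair_def by (rule someI)
  then show ?thesis
    by (simp add: tensor_obj_def tensor_def case_prod_beta)
qed

lemma tensor_obj_closed: "lc_alg A \<Longrightarrow> represented \<U> A \<Longrightarrow> B \<in> \<U> \<Longrightarrow> tensor_obj \<U> A B \<in> \<U>"
  using tensor_pair by blast

lemma proj_tensor: "lc_alg A \<Longrightarrow> represented \<U> A \<Longrightarrow> B \<in> \<U> \<Longrightarrow> proj_tensor A B (tensor_obj \<U> A B) (tensor \<U> A B)"
  using tensor_pair[of A B] lc_alg[of B] by (simp add: proj_tensor_def proj_tensor_axioms_def lc_alg_pair_def)

lemma tensor_map:
  assumes "lc_alg A" "represented \<U> A" "lc_alg C" "represented \<U> C" "B \<in> \<U>" and f: "f \<in> lca_hom A C"
  shows "tensor_map \<U> A C B f \<in> lca_hom (tensor_obj \<U> A B) (tensor_obj \<U> C B)"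
    and "a \<in> carrier A \<Longrightarrow> b \<in> carrier B \<Longrightarrow> tensor_map \<U> A C B f (tensor \<U> A B a b) = tensor \<U> C B (f a) b"
proof -
  interpret tensor_morphism A B "tensor_obj \<U> A B" "tensor \<U> A B" C "tensor_obj \<U> C B" "tensor \<U> C B"
    using assms by (intro tensor_morphism.intro proj_tensor)
  have "tensor_map \<U> A C B f \<in> lca_hom (tensor_obj \<U> A B) (tensor_obj \<U> C B) \<and>
    (\<forall>a\<in>carrier A. \<forall>b\<in>carrier B. tensor_map \<U> A C B f (tensor \<U> A B a b) = tensor \<U> C B (f a) b)"
    unfolding tensor_map_def by (rule someI_ex[OF tensor_hom_exists[OF f]])
  then show "tensor_map \<U> A C B f \<in> lca_hom (tensor_obj \<U> A B) (tensor_obj \<U> C B)"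
    and "a \<in> carrier A \<Longrightarrow> b \<in> carrier B \<Longrightarrow> tensor_map \<U> A C B f (tensor \<U> A B a b) = tensor \<U> C B (f a) b"
    by auto
qed

text \<open>The linear retraction \<open>r\<close> tensors to a continuous linear \<rho>. The
  identities expressing that the extension is split hold on elementary tensors, hence everywhere by
  density, and \<open>split_extensionI\<close> recovers exactness from them.\<close>

lemma split_extension_tensor:
  assumes "split_ext I E Q \<iota> \<pi> s" and I: "represented \<U> I" and Q: "represented \<U> Q" and B: "B \<in> \<U>"
  shows "split_extension (tensor_obj \<U> I B) (tensor_obj \<U> E B) (tensor_obj \<U> Q B)
    (tensor_map \<U> I E B \<iota>) (tensor_map \<U> E Q B \<pi>) (tensor_map \<U> Q E B s)"
proof -
  interpret split_ext I E Q \<iota> \<pi> s by fact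
  have E: "represented \<U> E" by (rule represented_extension[OF universe I Q])
  note lc = I.lc_alg_axioms E.lc_alg_axioms Q.lc_alg_axioms
  interpret TI: proj_tensor I B "tensor_obj \<U> I B" "tensor \<U> I B" by (rule proj_tensor[OF lc(1) I B])
  interpret TE: proj_tensor E B "tensor_obj \<U> E B" "tensor \<U> E B" by (rule proj_tensor[OF lc(2) E B])
  interpret TQ: proj_tensor Q B "tensor_obj \<U> Q B" "tensor \<U> Q B" by (rule proj_tensor[OF lc(3) Q B])
  interpret EI: tensor_morphism E B "tensor_obj \<U> E B" "tensor \<U> E B" I "tensor_obj \<U> I B" "tensor \<U> I B" ..
  interpret IQ: lc_alg_pair "tensor_obj \<U> I B" "tensor_obj \<U> Q B" ..
  interpret EE: lc_alg_pair "tensor_obj \<U> E B" "tensor_obj \<U> E B" ..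
  interpret QQ: lc_alg_pair "tensor_obj \<U> Q B" "tensor_obj \<U> E B" ..
  note i = tensor_map[OF lc(1) I lc(2) E B \<iota>] and p = tensor_map[OF lc(2) E lc(3) Q B \<pi>]
    and s' = tensor_map[OF lc(3) Q lc(2) E B s]
  obtain \<rho> where \<rho>: "\<rho> \<in> lca_lin (tensor_obj \<U> E B) (tensor_obj \<U> I B)"
    and \<rho>\<tau>: "\<And>a b. a \<in> carrier E \<Longrightarrow> b \<in> carrier B \<Longrightarrow> \<rho> (tensor \<U> E B a b) = tensor \<U> I B (r a) b"
    using EI.tensor_lin_exists[OF r_lin] by blast
  show ?thesis
  proof (rule split_extensionI[OF i(1) p(1) s'(1) TI.T.lc_algebra TE.T.lc_algebra \<rho>])
    fix x assume x: "x \<in> carrier (tensor_obj \<U> I B)"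
    have "(\<rho> \<circ> tensor_map \<U> I E B \<iota>) x = (\<lambda>x. x) x"
      by (rule TI.tensor_lin_eq[OF TI.T.lc_alg_axioms lca_lin_comp[OF lca_hom_lin[OF i(1)] \<rho>] lca_hom_lin[OF lca_hom_id] _ x])
        (simp add: i(2) \<rho>\<tau>)
    then show "\<rho> (tensor_map \<U> I E B \<iota> x) = x" by simp
    have z: "(\<lambda>_. \<zero>\<^bsub>tensor_obj \<U> Q B\<^esub>) \<in> lca_lin (tensor_obj \<U> I B) (tensor_obj \<U> Q B)"
      by (simp add: lca_lin_def)
    have "(tensor_map \<U> E Q B \<pi> \<circ> tensor_map \<U> I E B \<iota>) x = (\<lambda>_. \<zero>\<^bsub>tensor_obj \<U> Q B\<^esub>) x"
      by (rule TI.tensor_lin_eq[OF TQ.T.lc_alg_axioms lca_lin_comp[OF lca_hom_lin[OF i(1)] lca_hom_lin[OF p(1)]] z _ x])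
        (simp add: i(2) p(2))
    then show "tensor_map \<U> E Q B \<pi> (tensor_map \<U> I E B \<iota> x) = \<zero>\<^bsub>tensor_obj \<U> Q B\<^esub>" by simp
  next
    fix x assume x: "x \<in> carrier (tensor_obj \<U> E B)" "tensor_map \<U> E Q B \<pi> x = \<zero>\<^bsub>tensor_obj \<U> Q B\<^esub>"
    \<comment> \<open>This is \<open>decompose\<close> tensored with \<open>B\<close>. On the kernel
      of the tensored \<pi> the second summand vanishes, and what is left says that \<rho> provides
      a preimage.\<close>
    have "(\<lambda>x. (tensor_map \<U> I E B \<iota> \<circ> \<rho>) x \<oplus>\<^bsub>tensor_obj \<U> E B\<^esub> (tensor_map \<U> Q E B s \<circ> tensor_map \<U> E Q B \<pi>) x) x
      = (\<lambda>x. x) x"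
      by (rule TE.tensor_lin_eq[OF TE.T.lc_alg_axioms EE.lca_lin_add[OF lca_lin_comp[OF \<rho> lca_hom_lin[OF i(1)]]
          lca_lin_comp[OF lca_hom_lin[OF p(1)] lca_hom_lin[OF s'(1)]]] lca_hom_lin[OF lca_hom_id] _ x(1)])
        (simp add: i(2) p(2) s'(2) \<rho>\<tau> TE.\<tau>_add_left[symmetric] decompose)
    then show "tensor_map \<U> I E B \<iota> (\<rho> x) = x"
      using x QQ.lca_lin_zero[OF lca_hom_lin[OF s'(1)]] lca_linD(1)[OF \<rho> x(1)] lca_homD(1)[OF i(1)] by simp
  next
    fix y assume y: "y \<in> carrier (tensor_obj \<U> Q B)"
    have "(tensor_map \<U> E Q B \<pi> \<circ> tensor_map \<U> Q E B s) y = (\<lambda>x. x) y"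
      by (rule TQ.tensor_lin_eq[OF TQ.T.lc_alg_axioms lca_lin_comp[OF lca_hom_lin[OF s'(1)] lca_hom_lin[OF p(1)]]
          lca_hom_lin[OF lca_hom_id] _ y]) (simp add: s'(2) p(2))
    then show "tensor_map \<U> E Q B \<pi> (tensor_map \<U> Q E B s y) = y" by simp
  qed
qed

lemma mat_pair:
  assumes "A \<in> \<U>" "n \<ge> 1"
  shows "mat_obj \<U> n A \<in> \<U>" "to_mat \<U> n A \<in> lca_iso (mat_lca n A) (mat_obj \<U> n A)"
proof -
  have "represented \<U> (mat_lca n A)"
    using universe assms by (simp add: lca_universe_def)
  then obtain Y \<phi> where "Y \<in> \<U>" "\<phi> \<in> lca_iso (mat_lca n A) Y" by (rule representedE)
  then have "case (Y, \<phi>) of (Y, \<phi>) \<Rightarrow> Y \<in> \<U> \<and> \<phi> \<in> lca_iso (mat_lca n A) Y" by simp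
  then have "case mat_pair \<U> n A of (Y, \<phi>) \<Rightarrow> Y \<in> \<U> \<and> \<phi> \<in> lca_iso (mat_lca n A) Y"
    unfolding mat_pair_def by (rule someI)
  then show "mat_obj \<U> n A \<in> \<U>" "to_mat \<U> n A \<in> lca_iso (mat_lca n A) (mat_obj \<U> n A)"
    by (simp_all add: mat_obj_def to_mat_def case_prod_beta)
qed

lemma mat_iso:
  assumes "A \<in> \<U>" "n \<ge> 1"
  shows "lca_isomorphism (mat_lca n A) (mat_obj \<U> n A) (to_mat \<U> n A)"
proof -
  interpret A: lc_alg A using assms by (intro lc_alg)
  interpret Y: lc_alg "mat_obj \<U> n A" using mat_pair[OF assms] by (intro lc_alg)
  show ?thesis
    by (intro lca_isomorphism.intro lca_isomorphism_axioms.intro A.top_alg_mat Y.top_alg_axioms mat_pair[OF assms])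
qed

end

subsection \<open>Homomorphisms of matrix algebras\<close>

lemma (in lc_alg) entry_lin: "(\<lambda>x. x ij) \<in> lca_lin (mat_lca n A) A"
  using continuous_map_entry[of n ij] by (auto simp: lca_lin_def mats_carrier)

lemma (in lc_alg) mats_eqI:
  assumes "x \<in> mats A n n" "y \<in> mats A n n" "\<And>i j. i < n \<Longrightarrow> j < n \<Longrightarrow> x (i, j) = y (i, j)"
  shows "x = y"
  using assms mats_zero[OF assms(1)] mats_zero[OF assms(2)] by (intro ext) (metis surj_pair)

lemma (in lc_alg) mat_linI:
  assumes X: "top_alg X"
    and lin: "\<And>i j. i < n \<Longrightarrow> j < n \<Longrightarrow> (\<lambda>x. f x (i, j)) \<in> lca_lin X A"
    and mats: "\<And>x. x \<in> carrier X \<Longrightarrow> f x \<in> mats A n n"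
  shows "f \<in> lca_lin X (mat_lca n A)"
proof -
  interpret X: top_alg X by fact
  have "f (x \<oplus>\<^bsub>X\<^esub> y) = f x \<oplus>\<^bsub>mat_lca n A\<^esub> f y" if "x \<in> carrier X" "y \<in> carrier X" for x y
    using that lca_linD(2)[OF lin] by (intro mats_eqI[of _ n]) (auto intro!: mats add_mats)
  moreover have "f (c \<odot>\<^bsub>X\<^esub> x) = c \<odot>\<^bsub>mat_lca n A\<^esub> f x" if "x \<in> carrier X" for x c
    using that lca_linD(3)[OF lin] by (intro mats_eqI[of _ n]) (auto intro!: mats smult_mats)
  moreover have "continuous_map (topo X) (topo (mat_lca n A)) f"
    using X.topspace_eq mats lca_linD(4)[OF lin] by (intro continuous_map_into_mat) auto
  ultimately show ?thesis using mats by (simp add: lca_lin_def)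
qed

lemma (in lc_alg) mat_homI:
  assumes X: "top_alg X"
    and lin: "\<And>i j. i < n \<Longrightarrow> j < n \<Longrightarrow> (\<lambda>x. f x (i, j)) \<in> lca_lin X A"
    and mats: "\<And>x. x \<in> carrier X \<Longrightarrow> f x \<in> mats A n n"
    and mult: "\<And>x y i j. x \<in> carrier X \<Longrightarrow> y \<in> carrier X \<Longrightarrow> i < n \<Longrightarrow> j < n \<Longrightarrow>
      f (x \<otimes>\<^bsub>X\<^esub> y) (i, j) = mat_mult A n (f x) (f y) (i, j)"
  shows "f \<in> lca_hom X (mat_lca n A)"
proof (rule lca_homI[OF mat_linI[OF X lin mats]])
  interpret X: top_alg X by fact
  show "f (x \<otimes>\<^bsub>X\<^esub> y) = f x \<otimes>\<^bsub>mat_lca n A\<^esub> f y" if "x \<in> carrier X" "y \<in> carrier X" for x y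
    using that mult by (intro mats_eqI[of _ n]) (auto intro!: mats mat_mult_mats)
qed

definition matrix_unit :: "('a, 'm) ring_scheme \<Rightarrow> nat \<Rightarrow> 'a \<Rightarrow> 'a matrix" where
  "matrix_unit R k a = (\<lambda>ij. if ij = (k, k) then a else \<zero>\<^bsub>R\<^esub>)"

lemma corner_matrix_unit: "corner R = matrix_unit R 0"
  by (simp add: corner_def matrix_unit_def fun_eq_iff)

text \<open>The map applied to an entry may depend on its position. This allows conjugation by a
  diagonal matrix, and two homomorphisms side by side on the diagonal, to be treated
  uniformly.\<close>

definition entrywise :: "('b, 'm) ring_scheme \<Rightarrow> nat \<Rightarrow> (nat \<Rightarrow> nat \<Rightarrow> 'a \<Rightarrow> 'b) \<Rightarrow> 'a matrix \<Rightarrow> 'b matrix" where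
  "entrywise S n f x = (\<lambda>(i, j). if i < n \<and> j < n then f i j (x (i, j)) else \<zero>\<^bsub>S\<^esub>)"

context lc_alg
begin

lemma matrix_unit_mats: "a \<in> carrier A \<Longrightarrow> k < n \<Longrightarrow> matrix_unit A k a \<in> mats A n n"
  by (intro matsI) (auto simp: matrix_unit_def)

lemma finsum_single:
  assumes "finite I" "k \<in> I" "f k \<in> carrier A" "\<And>i. i \<in> I \<Longrightarrow> i \<noteq> k \<Longrightarrow> f i = \<zero>"
  shows "finsum A f I = f k"
proof -
  have fc: "f i \<in> carrier A" if "i \<in> I" for i
    using assms(3) assms(4)[OF that] by (cases "i = k") auto
  have "finsum A f I = finsum A (\<lambda>i. if i = k then f i else \<zero>) I"
    using assms(4) fc by (intro finsum_cong') auto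
  also have "\<dots> = f k"
    using add.finprod_singleton_swap[of k I f] assms(1,2) fc by auto
  finally show ?thesis .
qed

lemma zero_lin: "(\<lambda>x. \<zero>) \<in> lca_lin X A"
  by (simp add: lca_lin_def)

lemma id_lin: "(\<lambda>x. x) \<in> lca_lin A A"
  by (rule lca_hom_lin[OF lca_hom_id])

lemma matrix_unit_hom:
  assumes k: "k < n"
  shows "matrix_unit A k \<in> lca_hom A (mat_lca n A)"
proof (rule mat_homI)
  fix i j
  have "(\<lambda>x. matrix_unit A k x (i, j)) = (if (i, j) = (k, k) then (\<lambda>x. x) else (\<lambda>x. \<zero>))"
    by (auto simp: matrix_unit_def)
  then show "(\<lambda>x. matrix_unit A k x (i, j)) \<in> lca_lin A A"
    by (simp add: zero_lin id_lin)
  fix x y assume xy: "x \<in> carrier A" "y \<in> carrier A"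
  have "mat_mult A n (matrix_unit A k x) (matrix_unit A k y) (i, j) = matrix_unit A k x (i, k) \<otimes> matrix_unit A k y (k, j)"
    unfolding mat_mult_def prod.case using k xy
    by (intro finsum_single) (auto simp: matrix_unit_def)
  then show "matrix_unit A k (x \<otimes> y) (i, j) = mat_mult A n (matrix_unit A k x) (matrix_unit A k y) (i, j)"
    using xy by (auto simp: matrix_unit_def)
qed (use k in \<open>auto simp: matrix_unit_mats top_alg_axioms\<close>)

lemma mat_inclusion_hom:
  assumes "n \<le> m"
  shows "(\<lambda>x. x) \<in> lca_hom (mat_lca n A) (mat_lca m A)"
proof -
  interpret M: top_alg "mat_lca n A" by (rule top_alg_mat)
  show ?thesis
  proof (rule mat_homI)
    fix x y i j assume "x \<in> carrier (mat_lca n A)" "y \<in> carrier (mat_lca n A)"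
    then have "mat_mult A n x y = mat_mult A m x y"
      using assms by (intro mat_mult_extend[of x n n y n n]) auto
    then show "(x \<otimes>\<^bsub>mat_lca n A\<^esub> y) (i, j) = mat_mult A m x y (i, j)"
      unfolding mat_lca_simps by (rule fun_cong)
  next
    show "(\<lambda>x. x (i, j)) \<in> lca_lin (mat_lca n A) A" for i j by (rule entry_lin)
  next
    fix x assume "x \<in> carrier (mat_lca n A)"
    then show "x \<in> mats A m m" using assms by (auto intro: mats_mono)
  qed (rule M.top_alg_axioms)
qed

end

context lc_alg_pair
begin

text \<open>The relation \<open>f i k a \<otimes> f k j b = f i j (a \<otimes> b)\<close> makes each
  term of the matrix product the image of the corresponding term under the same linear map
  \<open>f i j\<close>, which can then be taken out of the sum. Off the diagonal the maps are only
  linear.\<close>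

lemma entrywise_hom:
  assumes lin: "\<And>i j. i < n \<Longrightarrow> j < n \<Longrightarrow> f i j \<in> lca_lin A B"
    and mult: "\<And>i j k a b. i < n \<Longrightarrow> j < n \<Longrightarrow> k < n \<Longrightarrow> a \<in> carrier A \<Longrightarrow> b \<in> carrier A \<Longrightarrow>
      f i k a \<otimes>\<^bsub>B\<^esub> f k j b = f i j (a \<otimes>\<^bsub>A\<^esub> b)"
  shows "entrywise B n f \<in> lca_hom (mat_lca n A) (mat_lca n B)"
proof -
  interpret M: top_alg "mat_lca n A" by (rule A.top_alg_mat)
  note fD = lca_linD[OF lin]
  show ?thesis
  proof (rule B.mat_homI)
    fix i j assume ij: "i < n" "j < n"
    show "(\<lambda>x. entrywise B n f x (i, j)) \<in> lca_lin (mat_lca n A) B"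
      using ij lca_lin_comp[OF A.entry_lin[where n = n and ij = "(i, j)"] lin[OF ij]] by (simp add: entrywise_def o_def)
    fix x y assume xy: "x \<in> carrier (mat_lca n A)" "y \<in> carrier (mat_lca n A)"
    have c: "x l \<in> carrier A" "y l \<in> carrier A" for l using xy A.mats_carrier by auto
    have "mat_mult B n (entrywise B n f x) (entrywise B n f y) (i, j) = (\<Oplus>\<^bsub>B\<^esub>l\<in>{..<n}. f i j (x (i, l) \<otimes>\<^bsub>A\<^esub> y (l, j)))"
      unfolding mat_mult_def prod.case using ij c fD
      by (intro B.finsum_cong') (auto simp: entrywise_def mult)
    also have "\<dots> = f i j (\<Oplus>\<^bsub>A\<^esub>l\<in>{..<n}. x (i, l) \<otimes>\<^bsub>A\<^esub> y (l, j))"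
      using c by (intro A.finsum_map[symmetric] B.abelian_monoid_axioms)
        (auto simp: fD[OF ij] lca_lin_zero[OF lin[OF ij]])
    finally show "entrywise B n f (x \<otimes>\<^bsub>mat_lca n A\<^esub> y) (i, j) = mat_mult B n (entrywise B n f x) (entrywise B n f y) (i, j)"
      using ij by (simp add: entrywise_def mat_mult_def)
  next
    fix x assume x: "x \<in> carrier (mat_lca n A)"
    then show "entrywise B n f x \<in> mats B n n"
      using fD(1) A.mats_carrier by (intro B.matsI) (auto simp: entrywise_def)
  qed (rule M.top_alg_axioms)
qed

lemma entrywise_matrix_unit:
  assumes "\<And>i j. i < n \<Longrightarrow> j < n \<Longrightarrow> f i j \<in> lca_lin A B" and "k < n"
  shows "entrywise B n f (matrix_unit A k a) = matrix_unit B k (f k k a)"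
  using assms(2) lca_lin_zero[OF assms(1)] by (auto simp: entrywise_def matrix_unit_def fun_eq_iff)

end

subsection \<open>Stable split exact functors\<close>

lemma bij_betw_of_comp:
  assumes "bij_betw (g \<circ> f) X Z" "f ` X \<subseteq> Y" "g ` Y \<subseteq> Z" "inj_on g Y"
  shows "bij_betw f X Y" "bij_betw g Y Z"
proof -
  have Z: "g ` f ` X = Z" using assms(1) by (auto simp: bij_betw_def image_comp)
  then have "g ` Y = Z" using assms(2,3) by blast
  then show "bij_betw g Y Z" using assms(4) by (simp add: bij_betw_def)
  have "f ` X = Y"
    using Z assms(2,3,4) by (metis \<open>g ` Y = Z\<close> inj_on_image_eq_iff order_refl)
  moreover have "inj_on f X" using assms(1) inj_on_imageI2 unfolding bij_betw_def by blast
  ultimately show "bij_betw f X Y" by (simp add: bij_betw_def)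
qed

locale stable_functor = universe \<U> for \<U> :: "'u lca set" +
  fixes H :: "('u, 'h) lca_functor"
  assumes functor_H: "is_functor \<U> H" and split_exact: "split_exact \<U> H" and stable: "M2_stable \<U> H"
begin

abbreviation HX where "HX X \<equiv> carrier (obj H X)"

lemma group_obj: "X \<in> \<U> \<Longrightarrow> comm_group (obj H X)"
  using functor_H by (simp add: is_functor_def)

lemma group_hom_mor: "X \<in> \<U> \<Longrightarrow> Y \<in> \<U> \<Longrightarrow> f \<in> lca_hom X Y \<Longrightarrow> group_hom (obj H X) (obj H Y) (mor H X Y f)"
  using functor_H group_obj by (simp add: is_functor_def group_hom_def group_hom_axioms_def comm_group.axioms)

lemma mor_closed: "X \<in> \<U> \<Longrightarrow> Y \<in> \<U> \<Longrightarrow> f \<in> lca_hom X Y \<Longrightarrow> x \<in> HX X \<Longrightarrow> mor H X Y f x \<in> HX Y"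
  using group_hom.hom_closed[OF group_hom_mor] .

lemma mor_id: "X \<in> \<U> \<Longrightarrow> x \<in> HX X \<Longrightarrow> mor H X X (\<lambda>a. a) x = x"
  using functor_H by (simp add: is_functor_def)

lemma mor_cong: "X \<in> \<U> \<Longrightarrow> Y \<in> \<U> \<Longrightarrow> f \<in> lca_hom X Y \<Longrightarrow> g \<in> lca_hom X Y \<Longrightarrow>
    (\<And>a. a \<in> carrier X \<Longrightarrow> f a = g a) \<Longrightarrow> x \<in> HX X \<Longrightarrow> mor H X Y f x = mor H X Y g x"
  by (rule functor_H[unfolded is_functor_def, THEN conjunct2, THEN conjunct2, THEN conjunct2, THEN conjunct1, rule_format])
    auto

lemma mor_comp: "X \<in> \<U> \<Longrightarrow> Y \<in> \<U> \<Longrightarrow> Z \<in> \<U> \<Longrightarrow> f \<in> lca_hom X Y \<Longrightarrow> g \<in> lca_hom Y Z \<Longrightarrow> x \<in> HX X \<Longrightarrow>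
    mor H Y Z g (mor H X Y f x) = mor H X Z (\<lambda>a. g (f a)) x"
  using functor_H[unfolded is_functor_def, THEN conjunct2, THEN conjunct2, THEN conjunct2, THEN conjunct2, rule_format,
    of X Y Z f g x] by (simp add: o_def)

lemma mor_is_id:
  assumes "X \<in> \<U>" "f \<in> lca_hom X X" "\<And>a. a \<in> carrier X \<Longrightarrow> f a = a" "x \<in> HX X"
  shows "mor H X X f x = x"
  using mor_cong[OF assms(1,1,2) lca_hom_id assms(3,4)] mor_id[OF assms(1,4)] by simp

lemma mor_bij:
  assumes X: "X \<in> \<U>" and Y: "Y \<in> \<U>" and f: "f \<in> lca_hom X Y" and g: "g \<in> lca_hom Y X"
    and "\<And>a. a \<in> carrier X \<Longrightarrow> g (f a) = a" "\<And>a. a \<in> carrier Y \<Longrightarrow> f (g a) = a"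
  shows "bij_betw (mor H X Y f) (HX X) (HX Y)"
proof (rule bij_betwI[where g = "mor H Y X g"])
  show "mor H Y X g (mor H X Y f x) = x" if "x \<in> HX X" for x
    using that assms lca_hom_comp[OF f g] by (simp add: mor_comp[OF X Y X f g] mor_is_id[OF X] o_def)
  show "mor H X Y f (mor H Y X g x) = x" if "x \<in> HX Y" for x
    using that assms lca_hom_comp[OF g f] by (simp add: mor_comp[OF Y X Y g f] mor_is_id[OF Y] o_def)
qed (use mor_closed[OF X Y f] mor_closed[OF Y X g] in auto)

definition from_mat where "from_mat n A = inv_into (mats A n n) (to_mat \<U> n A)"

text \<open>A functor sees only members of the universe, so matrix algebras enter through the chosen
  models \<open>mat_obj\<close>. This definition moves a map of concrete matrices to the models;
  \<open>mor_into\<close> and \<open>mor_mat\<close> then hide the models from the later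
  computations.\<close>

definition mat_map where "mat_map n A m Z G = (\<lambda>x. to_mat \<U> m Z (G (from_mat n A x)))"

abbreviation mor_into where
  "mor_into X n A f \<equiv> mor H X (mat_obj \<U> n A) (\<lambda>x. to_mat \<U> n A (f x))"

abbreviation mor_mat where
  "mor_mat n A m Z G \<equiv> mor H (mat_obj \<U> n A) (mat_obj \<U> m Z) (mat_map n A m Z G)"

context
  fixes A :: "'u lca" and n :: nat assumes A: "A \<in> \<U>" and n: "n \<ge> 1"
begin

interpretation M: lca_isomorphism "mat_lca n A" "mat_obj \<U> n A" "to_mat \<U> n A"
  using mat_iso[OF A n] .

lemma from_mat_g: "from_mat n A = M.g"
  by (simp add: from_mat_def M.g_def)

lemma to_mat_hom: "to_mat \<U> n A \<in> lca_hom (mat_lca n A) (mat_obj \<U> n A)"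
  by (rule M.hom)

lemma from_mat_hom: "from_mat n A \<in> lca_hom (mat_obj \<U> n A) (mat_lca n A)"
  unfolding from_mat_g by (rule M.g_hom)

lemma from_to_mat: "x \<in> mats A n n \<Longrightarrow> from_mat n A (to_mat \<U> n A x) = x"
  unfolding from_mat_g using M.g_f by simp

lemma to_from_mat: "x \<in> carrier (mat_obj \<U> n A) \<Longrightarrow> to_mat \<U> n A (from_mat n A x) = x"
  unfolding from_mat_g using M.f_g by simp

lemma from_mat_closed: "x \<in> carrier (mat_obj \<U> n A) \<Longrightarrow> from_mat n A x \<in> mats A n n"
  unfolding from_mat_g using M.g_closed by simp

lemma mat_obj: "mat_obj \<U> n A \<in> \<U>"
  by (rule mat_pair[OF A n])

lemma into_mat_hom: "f \<in> lca_hom X (mat_lca n A) \<Longrightarrow> (\<lambda>x. to_mat \<U> n A (f x)) \<in> lca_hom X (mat_obj \<U> n A)"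
  using lca_hom_comp[OF _ to_mat_hom] by (simp add: o_def)

end

lemma mat_map_hom:
  assumes "A \<in> \<U>" "n \<ge> 1" "Z \<in> \<U>" "m \<ge> 1" "G \<in> lca_hom (mat_lca n A) (mat_lca m Z)"
  shows "mat_map n A m Z G \<in> lca_hom (mat_obj \<U> n A) (mat_obj \<U> m Z)"
  using into_mat_hom[OF assms(3,4) lca_hom_comp[OF from_mat_hom[OF assms(1,2)] assms(5)]]
  by (simp add: mat_map_def o_def)

lemma mor_mat_into:
  assumes X: "X \<in> \<U>" and A: "A \<in> \<U>" "n \<ge> 1" and Z: "Z \<in> \<U>" "m \<ge> 1"
    and f: "f \<in> lca_hom X (mat_lca n A)" and G: "G \<in> lca_hom (mat_lca n A) (mat_lca m Z)" and x: "x \<in> HX X"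
  shows "mor_mat n A m Z G (mor_into X n A f x) = mor_into X m Z (\<lambda>x. G (f x)) x"
  unfolding mor_comp[OF X mat_obj[OF A] mat_obj[OF Z] into_mat_hom[OF A f] mat_map_hom[OF A Z G] x]
proof (rule mor_cong[OF X mat_obj[OF Z] _ _ _ x])
  show "(\<lambda>a. mat_map n A m Z G (to_mat \<U> n A (f a))) \<in> lca_hom X (mat_obj \<U> m Z)"
    using lca_hom_comp[OF into_mat_hom[OF A f] mat_map_hom[OF A Z G]] by (simp add: o_def)
  show "(\<lambda>x. to_mat \<U> m Z (G (f x))) \<in> lca_hom X (mat_obj \<U> m Z)"
    using into_mat_hom[OF Z lca_hom_comp[OF f G]] by (simp add: o_def)
  show "mat_map n A m Z G (to_mat \<U> n A (f a)) = to_mat \<U> m Z (G (f a))" if "a \<in> carrier X" for a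
    using from_to_mat[OF A] lca_homD(1)[OF f that] by (simp add: mat_map_def)
qed

lemma mor_mat_comp:
  assumes A: "A \<in> \<U>" "n \<ge> 1" and Z: "Z \<in> \<U>" "m \<ge> 1" and W: "W \<in> \<U>" "k \<ge> 1"
    and F: "F \<in> lca_hom (mat_lca n A) (mat_lca m Z)" and G: "G \<in> lca_hom (mat_lca m Z) (mat_lca k W)"
    and x: "x \<in> HX (mat_obj \<U> n A)"
  shows "mor_mat m Z k W G (mor_mat n A m Z F x) = mor_mat n A k W (\<lambda>x. G (F x)) x"
proof -
  have 1: "(\<lambda>x. F (from_mat n A x)) \<in> lca_hom (mat_obj \<U> n A) (mat_lca m Z)"
    using lca_hom_comp[OF from_mat_hom[OF A] F] by (simp add: o_def)
  show ?thesis
    using mor_mat_into[OF mat_obj[OF A] Z W 1 G x] by (simp add: mat_map_def)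
qed

lemma mor_into_pre:
  assumes X: "X \<in> \<U>" and Y: "Y \<in> \<U>" and A: "A \<in> \<U>" "n \<ge> 1"
    and g: "g \<in> lca_hom X Y" and f: "f \<in> lca_hom Y (mat_lca n A)" and x: "x \<in> HX X"
  shows "mor_into Y n A f (mor H X Y g x) = mor_into X n A (\<lambda>x. f (g x)) x"
  using mor_comp[OF X Y mat_obj[OF A] g into_mat_hom[OF A f] x] .

lemma mor_into_cong:
  assumes X: "X \<in> \<U>" and A: "A \<in> \<U>" "n \<ge> 1" and f: "f \<in> lca_hom X (mat_lca n A)" and g: "g \<in> lca_hom X (mat_lca n A)"
    and "\<And>a. a \<in> carrier X \<Longrightarrow> f a = g a" and x: "x \<in> HX X"
  shows "mor_into X n A f x = mor_into X n A g x"
  using assms(6) by (intro mor_cong[OF X mat_obj[OF A] into_mat_hom[OF A f] into_mat_hom[OF A g] _ x]) simp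

lemma mor_into_closed:
  assumes X: "X \<in> \<U>" and A: "A \<in> \<U>" "n \<ge> 1" and f: "f \<in> lca_hom X (mat_lca n A)" and x: "x \<in> HX X"
  shows "mor_into X n A f x \<in> HX (mat_obj \<U> n A)"
  by (rule mor_closed[OF X mat_obj[OF A] into_mat_hom[OF A f] x])

lemma mor_mat_closed:
  assumes A: "A \<in> \<U>" "n \<ge> 1" and Z: "Z \<in> \<U>" "m \<ge> 1" and F: "F \<in> lca_hom (mat_lca n A) (mat_lca m Z)"
    and x: "x \<in> HX (mat_obj \<U> n A)"
  shows "mor_mat n A m Z F x \<in> HX (mat_obj \<U> m Z)"
  by (rule mor_closed[OF mat_obj[OF A] mat_obj[OF Z] mat_map_hom[OF A Z F] x])

lemma corner_mor_eq: "corner_mor \<U> H n A = mor_into A n A (corner A)"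
  by (simp add: corner_mor_def)

end

lemma lca_hom_cong:
  assumes "lc_alg X" and f: "f \<in> lca_hom X Y" and gf: "\<And>x. x \<in> carrier X \<Longrightarrow> g x = f x"
  shows "g \<in> lca_hom X Y"
proof -
  interpret X: lc_alg X by fact
  have "continuous_map (topo X) (topo Y) g"
    by (rule continuous_map_eq[OF lca_homD(5)[OF f]]) (simp add: gf)
  then show ?thesis using lca_homD[OF f] by (simp add: lca_hom_def alg_hom_def gf)
qed

text \<open>For permutations \<open>s\<close> and \<open>t\<close> this is multiplication by
  permutation matrices from the left and from the right. Over a non-unital algebra such matrices are
  not elements of M_n, so their action is expressed on the indices.\<close>

definition reindex :: "('a, 'm) ring_scheme \<Rightarrow> nat \<Rightarrow> (nat \<Rightarrow> nat) \<Rightarrow> (nat \<Rightarrow> nat) \<Rightarrow> 'a matrix \<Rightarrow> 'a matrix" where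
  "reindex R n s t x = (\<lambda>(i, j). if i < n \<and> j < n then x (s i, t j) else \<zero>\<^bsub>R\<^esub>)"

context lc_alg
begin

lemma reindex_mats: "x \<in> mats A n n \<Longrightarrow> reindex A n s t x \<in> mats A n n"
  by (intro matsI) (auto simp: reindex_def mats_carrier)

lemma reindex_lin: "reindex A n s t \<in> lca_lin (mat_lca n A) (mat_lca n A)"
proof (rule mat_linI[OF top_alg_mat])
  fix i j assume "i < n" "j < n"
  then show "(\<lambda>x. reindex A n s t x (i, j)) \<in> lca_lin (mat_lca n A) A"
    using entry_lin[of "(s i, t j)" n] by (simp add: reindex_def)
qed (simp add: reindex_mats)

text \<open>The permutation \<open>t\<close> stands on the inner index of both factors and
  disappears when the sum is reindexed; this is the cancellation of a permutation matrix against its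
  inverse.\<close>

lemma mat_mult_reindex:
  assumes x: "x \<in> mats A n n" and y: "y \<in> mats A n n" and t: "bij_betw t {..<n} {..<n}"
  shows "mat_mult A n (reindex A n s t x) (reindex A n t u y) = reindex A n s u (mat_mult A n x y)"
proof (rule mats_eqI[of _ n])
  fix i j assume ij: "i < n" "j < n"
  have c: "x l \<in> carrier A" "y l \<in> carrier A" for l using x y mats_carrier by auto
  have "mat_mult A n (reindex A n s t x) (reindex A n t u y) (i, j) = (\<Oplus>l\<in>{..<n}. x (s i, t l) \<otimes> y (t l, u j))"
    unfolding mat_mult_def prod.case using ij c by (intro finsum_cong') (auto simp: reindex_def)
  also have "\<dots> = (\<Oplus>l\<in>t ` {..<n}. x (s i, l) \<otimes> y (l, u j))"
    using t c by (intro finsum_reindex[symmetric]) (auto simp: bij_betw_def)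
  also have "\<dots> = reindex A n s u (mat_mult A n x y) (i, j)"
    using t ij by (simp add: bij_betw_def reindex_def mat_mult_def)
  finally show "mat_mult A n (reindex A n s t x) (reindex A n t u y) (i, j) = reindex A n s u (mat_mult A n x y) (i, j)" .
qed (rule mat_mult_mats[OF reindex_mats[OF x] reindex_mats[OF y]] reindex_mats[OF mat_mult_mats[OF x y]])+

lemma reindex_hom:
  assumes "bij_betw s {..<n} {..<n}"
  shows "reindex A n s s \<in> lca_hom (mat_lca n A) (mat_lca n A)"
  using mat_mult_reindex[OF _ _ assms] by (intro lca_homI[OF reindex_lin]) simp

lemma reindex_reindex:
  assumes "bij_betw s {..<n} {..<n}" "bij_betw t {..<n} {..<n}"
  shows "reindex A n s t (reindex A n s' t' x) = reindex A n (s' \<circ> s) (t' \<circ> t) x"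
  using assms[THEN bij_betwE] by (auto simp: reindex_def fun_eq_iff)

lemma reindex_id: "x \<in> mats A n n \<Longrightarrow> reindex A n (\<lambda>i. i) (\<lambda>i. i) x = x"
  by (intro mats_eqI[of _ n] reindex_mats) (auto simp: reindex_def)

end

lemma less_2_cases_nat: "i < 2 \<longleftrightarrow> i = 0 \<or> i = (1::nat)"
  by auto

definition swap01 :: "nat \<Rightarrow> nat" where "swap01 i = 1 - i"

lemma bij_swap01: "bij_betw swap01 {..<2} {..<2}"
  by (rule bij_betwI[where g = swap01]) (auto simp: less_2_cases_nat swap01_def)

definition flip where "flip R = reindex R 2 swap01 swap01"

lemma flip_matrix_unit: "flip R (matrix_unit R 0 a) = matrix_unit R 1 a"
  by (auto simp: flip_def reindex_def matrix_unit_def fun_eq_iff swap01_def)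

section \<open>Corners, inner automorphisms and orthogonal sums under a stable functor\<close>

context stable_functor
begin

lemma corner_2_bij:
  assumes "Z \<in> \<U>"
  shows "bij_betw (mor_into Z 2 Z (matrix_unit Z 0)) (HX Z) (HX (mat_obj \<U> 2 Z))"
proof -
  have "corner_mor \<U> H 2 Z \<in> iso (obj H Z) (obj H (mat_obj \<U> 2 Z))"
    using stable assms by (simp add: M2_stable_def)
  then show ?thesis by (simp add: iso_def corner_mor_eq corner_matrix_unit)
qed

lemma flip_hom: "Z \<in> \<U> \<Longrightarrow> flip Z \<in> lca_hom (mat_lca 2 Z) (mat_lca 2 Z)"
  using lc_alg.reindex_hom[OF lc_alg bij_swap01] by (simp add: flip_def)

lemma matrix_unit_hom: "Z \<in> \<U> \<Longrightarrow> k < n \<Longrightarrow> matrix_unit Z k \<in> lca_hom Z (mat_lca n Z)"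
  by (rule lc_alg.matrix_unit_hom[OF lc_alg])

lemma mor_flip:
  assumes Z: "Z \<in> \<U>" and x: "x \<in> HX Z"
  shows "mor_mat 2 Z 2 Z (flip Z) (mor_into Z 2 Z (matrix_unit Z 0) x) = mor_into Z 2 Z (matrix_unit Z 1) x"
  using mor_mat_into[OF Z Z _ Z _ matrix_unit_hom[OF Z] flip_hom[OF Z] x, of 0] by (simp add: flip_matrix_unit)

lemma mor_flip_bij:
  assumes Z: "Z \<in> \<U>"
  shows "bij_betw (mor_mat 2 Z 2 Z (flip Z)) (HX (mat_obj \<U> 2 Z)) (HX (mat_obj \<U> 2 Z))"
proof -
  interpret Z: lc_alg Z using Z by (rule lc_alg)
  have ff: "flip Z (flip Z x) = x" if "x \<in> mats Z 2 2" for x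
  proof -
    have "flip Z (flip Z x) = reindex Z 2 (\<lambda>i. i) (\<lambda>i. i) x"
      unfolding flip_def Z.reindex_reindex[OF bij_swap01 bij_swap01] by (auto simp: reindex_def fun_eq_iff less_2_cases_nat swap01_def)
    then show ?thesis using Z.reindex_id[OF that] by simp
  qed
  have h: "mat_map 2 Z 2 Z (flip Z) \<in> lca_hom (mat_obj \<U> 2 Z) (mat_obj \<U> 2 Z)"
    using mat_map_hom[OF Z _ Z _ flip_hom[OF Z]] by simp
  have "mat_map 2 Z 2 Z (flip Z) (mat_map 2 Z 2 Z (flip Z) a) = a" if "a \<in> carrier (mat_obj \<U> 2 Z)" for a
    using that Z.reindex_mats[OF from_mat_closed[OF Z _ that], of swap01 swap01] from_mat_closed[OF Z _ that]
    by (simp add: mat_map_def from_to_mat[OF Z] to_from_mat[OF Z] ff flip_def[symmetric])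
  then show ?thesis
    using mor_bij[OF mat_obj[OF Z] mat_obj[OF Z] h h] by simp
qed

text \<open>The lower corner embedding is the upper one followed by the automorphism
  \<open>flip\<close>.\<close>

lemma corner_2_lower_bij:
  assumes Z: "Z \<in> \<U>"
  shows "bij_betw (mor_into Z 2 Z (matrix_unit Z 1)) (HX Z) (HX (mat_obj \<U> 2 Z))"
  using bij_betw_trans[OF corner_2_bij[OF Z] mor_flip_bij[OF Z]] mor_flip[OF Z]
  by (subst bij_betw_cong[where g = "mor_mat 2 Z 2 Z (flip Z) \<circ> mor_into Z 2 Z (matrix_unit Z 0)"]) auto

text \<open>Restricted to the \<open>k\<close>-th diagonal corner, an entrywise homomorphism is
  \<open>f k k\<close> followed by the corner embedding. Information on one corner can thus be
  carried through the matrix algebra to another.\<close>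

lemma mor_entrywise:
  assumes B: "B \<in> \<U>" and Z: "Z \<in> \<U>" and k: "k < n"
    and lin: "\<And>i j. i < n \<Longrightarrow> j < n \<Longrightarrow> f i j \<in> lca_lin B Z" and h: "f k k \<in> lca_hom B Z"
    and mult: "\<And>i j k a b. i < n \<Longrightarrow> j < n \<Longrightarrow> k < n \<Longrightarrow> a \<in> carrier B \<Longrightarrow> b \<in> carrier B \<Longrightarrow>
      f i k a \<otimes>\<^bsub>Z\<^esub> f k j b = f i j (a \<otimes>\<^bsub>B\<^esub> b)" and x: "x \<in> HX B"
  shows "mor_mat n B n Z (entrywise Z n f) (mor_into B n B (matrix_unit B k) x)
    = mor_into Z n Z (matrix_unit Z k) (mor H B Z (f k k) x)"
proof -
  interpret B: lc_alg B using B by (rule lc_alg)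
  interpret Z: lc_alg Z using Z by (rule lc_alg)
  interpret lc_alg_pair B Z ..
  have n: "n \<ge> 1" using k by simp
  have e: "entrywise Z n f \<in> lca_hom (mat_lca n B) (mat_lca n Z)"
    by (rule entrywise_hom[OF lin mult])
  have "mor_mat n B n Z (entrywise Z n f) (mor_into B n B (matrix_unit B k) x)
      = mor_into B n Z (\<lambda>a. entrywise Z n f (matrix_unit B k a)) x"
    by (rule mor_mat_into[OF B B n Z n matrix_unit_hom[OF B k] e x])
  also have "\<dots> = mor_into B n Z (\<lambda>a. matrix_unit Z k (f k k a)) x"
    using entrywise_matrix_unit[OF lin k] by simp
  also have "\<dots> = mor_into Z n Z (matrix_unit Z k) (mor H B Z (f k k) x)"
    by (rule mor_into_pre[OF B Z Z n h matrix_unit_hom[OF Z k] x, symmetric])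
  finally show ?thesis .
qed

text \<open>Conjugation by \<open>diag(u, 1)\<close> fixes the lower corner of \<open>M\<^sub>2\<close>, so it induces the identity;
  restricting it to the upper corner shows the same for conjugation by \<open>u\<close>. Here \<open>L\<close> and \<open>R\<close> are
  left multiplication by \<open>u\<close> and right multiplication by its inverse.\<close>

lemma mor_inner:
  assumes Z: "Z \<in> \<U>" and L: "L \<in> lca_lin Z Z" and R: "R \<in> lca_lin Z Z"
    and LR: "\<And>a. a \<in> carrier Z \<Longrightarrow> L (R a) = R (L a)"
    and L_mult: "\<And>a b. a \<in> carrier Z \<Longrightarrow> b \<in> carrier Z \<Longrightarrow> L (a \<otimes>\<^bsub>Z\<^esub> b) = L a \<otimes>\<^bsub>Z\<^esub> b"
    and R_mult: "\<And>a b. a \<in> carrier Z \<Longrightarrow> b \<in> carrier Z \<Longrightarrow> R (a \<otimes>\<^bsub>Z\<^esub> b) = a \<otimes>\<^bsub>Z\<^esub> R b"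
    and RL: "\<And>a b. a \<in> carrier Z \<Longrightarrow> b \<in> carrier Z \<Longrightarrow> R a \<otimes>\<^bsub>Z\<^esub> L b = a \<otimes>\<^bsub>Z\<^esub> b"
    and x: "x \<in> HX Z"
  shows "mor H Z Z (\<lambda>a. L (R a)) x = x"
proof -
  interpret Z: lc_alg Z using Z by (rule lc_alg)
  \<comment> \<open>Conjugation by diag(u, 1) entry by entry: \<open>u a u^-1\<close> and
    \<open>u a\<close> in the first row, \<open>a u^-1\<close> and \<open>a\<close> in the
    second.\<close>
  define f :: "nat \<Rightarrow> nat \<Rightarrow> 'u \<Rightarrow> 'u" where
    "f i j = (if i = 0 then if j = 0 then (\<lambda>a. L (R a)) else L else if j = 0 then R else (\<lambda>a. a))" for i j
  note LD = lca_linD[OF L] and RD = lca_linD[OF R]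
  have LR_lin: "(\<lambda>a. L (R a)) \<in> lca_lin Z Z" using lca_lin_comp[OF R L] by (simp add: o_def)
  have lin: "f i j \<in> lca_lin Z Z" for i j
    using L R LR_lin Z.id_lin by (simp add: f_def)
  have RLR: "R a \<otimes>\<^bsub>Z\<^esub> L (R b) = R (a \<otimes>\<^bsub>Z\<^esub> b)" if "a \<in> carrier Z" "b \<in> carrier Z" for a b
    using that RD LD by (simp add: RL R_mult)
  have mult: "f i k a \<otimes>\<^bsub>Z\<^esub> f k j b = f i j (a \<otimes>\<^bsub>Z\<^esub> b)" if "a \<in> carrier Z" "b \<in> carrier Z" for i j k a b
    using that LD RD by (simp add: f_def L_mult[symmetric] R_mult[symmetric] RL RLR LR[symmetric])
  have \<sigma>: "(\<lambda>a. L (R a)) \<in> lca_hom Z Z"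
    using mult[of _ _ 0 0 0] by (intro lca_homI[OF LR_lin]) (simp add: f_def)
  let ?E = "mor_mat 2 Z 2 Z (entrywise Z 2 f)"
  have ent: "?E (mor_into Z 2 Z (matrix_unit Z k) y) = mor_into Z 2 Z (matrix_unit Z k) (mor H Z Z (f k k) y)"
    if "y \<in> HX Z" "k < 2" for k y
    using that \<sigma> lca_hom_id[of Z] by (intro mor_entrywise[OF Z Z _ lin _ mult]) (auto simp: f_def)
  \<comment> \<open>Every element of H(M_2(Z)) comes from the lower corner, where the entry map is
    the identity.\<close>
  have E_id: "?E y = y" if y: "y \<in> HX (mat_obj \<U> 2 Z)" for y
  proof -
    obtain z where z: "z \<in> HX Z" "y = mor_into Z 2 Z (matrix_unit Z 1) z"
      using corner_2_lower_bij[OF Z] y by (auto simp: bij_betw_def)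
    then show ?thesis using ent[OF z(1), of 1] mor_id[OF Z z(1)] by (simp add: f_def)
  qed
  have "mor_into Z 2 Z (matrix_unit Z 0) (mor H Z Z (\<lambda>a. L (R a)) x) = mor_into Z 2 Z (matrix_unit Z 0) x"
    using ent[OF x, of 0] E_id[OF mor_into_closed[OF Z Z _ matrix_unit_hom[OF Z] x]] by (simp add: f_def)
  then show ?thesis
    using corner_2_bij[OF Z] mor_closed[OF Z Z \<sigma> x] x by (meson bij_betw_def inj_onD)
qed

text \<open>\<open>flip\<close> is conjugation of M_2(B) by the permutation matrix that exchanges
  the two indices. By \<open>mor_inner\<close>, applied with M_2(B) in the place of
  \<open>Z\<close>, it induces the identity, while it takes the upper corner to the lower
  one.\<close>

lemma mor_corners_eq:
  assumes B: "B \<in> \<U>" and x: "x \<in> HX B"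
  shows "mor_into B 2 B (matrix_unit B 0) x = mor_into B 2 B (matrix_unit B 1) x"
proof -
  interpret B: lc_alg B using B by (rule lc_alg)
  let ?Z = "mat_obj \<U> 2 B" and ?s = swap01 and ?i = "\<lambda>i::nat. i"
  have two: "(2::nat) \<ge> 1" by simp
  have Z: "?Z \<in> \<U>" by (rule mat_obj[OF B two])
  interpret ZZ: lc_alg ?Z using Z by (rule lc_alg)
  have bi: "bij_betw ?i {..<2} {..<2}" by (simp add: bij_betw_def)
  note ft = from_to_mat[OF B two] and tf = to_from_mat[OF B two] and fc = from_mat_closed[OF B two]
    and rm = B.reindex_mats and toh = to_mat_hom[OF B two] and frh = from_mat_hom[OF B two]
  note toD = lca_homD[OF toh, simplified] and frD = lca_homD[OF frh, simplified]
  \<comment> \<open>\<open>L\<close> exchanges the rows and \<open>R\<close> the columns, that is,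
    they multiply by the exchange matrix, which is its own inverse, from the left and from the
    right.\<close>
  define L where "L a = to_mat \<U> 2 B (reindex B 2 ?s ?i (from_mat 2 B a))" for a
  define R where "R a = to_mat \<U> 2 B (reindex B 2 ?i ?s (from_mat 2 B a))" for a
  have lin: "(\<lambda>a. to_mat \<U> 2 B (reindex B 2 s t (from_mat 2 B a))) \<in> lca_lin ?Z ?Z" for s t
    using lca_lin_comp[OF lca_lin_comp[OF lca_hom_lin[OF frh] B.reindex_lin] lca_hom_lin[OF toh]] by (simp add: o_def)
  have mult: "to_mat \<U> 2 B (reindex B 2 s t (from_mat 2 B a)) \<otimes>\<^bsub>?Z\<^esub> to_mat \<U> 2 B (reindex B 2 t u (from_mat 2 B b))
    = to_mat \<U> 2 B (reindex B 2 s u (from_mat 2 B (a \<otimes>\<^bsub>?Z\<^esub> b)))"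
    if "a \<in> carrier ?Z" "b \<in> carrier ?Z" "bij_betw t {..<2} {..<2}" for a b s t u
    using that by (simp add: toD(3)[symmetric] frD(3) fc rm B.mat_mult_reindex)
  have id: "to_mat \<U> 2 B (reindex B 2 ?i ?i (from_mat 2 B a)) = a" if "a \<in> carrier ?Z" for a
    using that by (simp add: B.reindex_id fc tf)
  have LRa: "L (R a) = mat_map 2 B 2 B (flip B) a" "R (L a) = mat_map 2 B 2 B (flip B) a" if "a \<in> carrier ?Z" for a
    using that fc[OF that] by (simp_all add: L_def R_def ft rm B.reindex_reindex[OF bij_swap01 bi] B.reindex_reindex[OF bi bij_swap01]
        mat_map_def flip_def o_def)
  have "mor H ?Z ?Z (\<lambda>a. L (R a)) y = y" if "y \<in> HX ?Z" for y
  proof (rule mor_inner[where L = L and R = R, OF Z _ _ _ _ _ _ that])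
    show "L \<in> lca_lin ?Z ?Z" unfolding L_def[abs_def] by (rule lin)
    show "R \<in> lca_lin ?Z ?Z" unfolding R_def[abs_def] by (rule lin)
    show "L (R a) = R (L a)" if "a \<in> carrier ?Z" for a using that LRa by simp
    fix a b assume ab: "a \<in> carrier ?Z" "b \<in> carrier ?Z"
    show "L (a \<otimes>\<^bsub>?Z\<^esub> b) = L a \<otimes>\<^bsub>?Z\<^esub> b"
      using mult[OF ab bi, of ?s ?i] id[OF ab(2)] by (simp add: L_def)
    show "R (a \<otimes>\<^bsub>?Z\<^esub> b) = a \<otimes>\<^bsub>?Z\<^esub> R b"
      using mult[OF ab bi, of ?i ?s] id[OF ab(1)] by (simp add: R_def)
    show "R a \<otimes>\<^bsub>?Z\<^esub> L b = a \<otimes>\<^bsub>?Z\<^esub> b"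
      using mult[OF ab bij_swap01, of ?i ?i] ab id[of "a \<otimes>\<^bsub>?Z\<^esub> b"] by (simp add: L_def R_def ZZ.m_closed)
  qed
  moreover have "mor H ?Z ?Z (\<lambda>a. L (R a)) y = mor_mat 2 B 2 B (flip B) y" if "y \<in> HX ?Z" for y
  proof (rule mor_cong[OF Z Z _ mat_map_hom[OF B two B two flip_hom[OF B]] LRa(1) that])
    show "(\<lambda>a. L (R a)) \<in> lca_hom ?Z ?Z"
      by (rule lca_hom_cong[OF lc_alg[OF Z] mat_map_hom[OF B two B two flip_hom[OF B]] LRa(1)])
  qed
  ultimately show ?thesis
    using mor_flip[OF B x] mor_into_closed[OF B B two matrix_unit_hom[OF B] x, of 0] by simp
qed

text \<open>The six relations, together with multiplicativity of \<phi> and \<psi>, say that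
  [[\<phi>, \<xi>], [\<eta>, \<psi>]], applied entrywise, is a homomorphism from M_2(B) to M_2(Z).
  It restricts to \<phi> on the upper and to \<psi> on the lower corner, and the two corners agree
  under \<open>H\<close> on both sides.\<close>

lemma mor_linked:
  assumes B: "B \<in> \<U>" and Z: "Z \<in> \<U>" and \<phi>: "\<phi> \<in> lca_hom B Z" and \<psi>: "\<psi> \<in> lca_hom B Z"
    and \<xi>: "\<xi> \<in> lca_lin B Z" and \<eta>: "\<eta> \<in> lca_lin B Z"
    and mult: "\<And>a b. a \<in> carrier B \<Longrightarrow> b \<in> carrier B \<Longrightarrow> \<phi> a \<otimes>\<^bsub>Z\<^esub> \<xi> b = \<xi> (a \<otimes>\<^bsub>B\<^esub> b)"
      "\<And>a b. a \<in> carrier B \<Longrightarrow> b \<in> carrier B \<Longrightarrow> \<xi> a \<otimes>\<^bsub>Z\<^esub> \<psi> b = \<xi> (a \<otimes>\<^bsub>B\<^esub> b)"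
      "\<And>a b. a \<in> carrier B \<Longrightarrow> b \<in> carrier B \<Longrightarrow> \<xi> a \<otimes>\<^bsub>Z\<^esub> \<eta> b = \<phi> (a \<otimes>\<^bsub>B\<^esub> b)"
      "\<And>a b. a \<in> carrier B \<Longrightarrow> b \<in> carrier B \<Longrightarrow> \<eta> a \<otimes>\<^bsub>Z\<^esub> \<xi> b = \<psi> (a \<otimes>\<^bsub>B\<^esub> b)"
      "\<And>a b. a \<in> carrier B \<Longrightarrow> b \<in> carrier B \<Longrightarrow> \<psi> a \<otimes>\<^bsub>Z\<^esub> \<eta> b = \<eta> (a \<otimes>\<^bsub>B\<^esub> b)"
      "\<And>a b. a \<in> carrier B \<Longrightarrow> b \<in> carrier B \<Longrightarrow> \<eta> a \<otimes>\<^bsub>Z\<^esub> \<phi> b = \<eta> (a \<otimes>\<^bsub>B\<^esub> b)"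
    and x: "x \<in> HX B"
  shows "mor H B Z \<phi> x = mor H B Z \<psi> x"
proof -
  define f :: "nat \<Rightarrow> nat \<Rightarrow> 'u \<Rightarrow> 'u" where
    "f i j = (if i = 0 then if j = 0 then \<phi> else \<xi> else if j = 0 then \<eta> else \<psi>)" for i j
  have lin: "f i j \<in> lca_lin B Z" for i j
    using \<xi> \<eta> lca_hom_lin[OF \<phi>] lca_hom_lin[OF \<psi>] by (simp add: f_def)
  have m: "f i k a \<otimes>\<^bsub>Z\<^esub> f k j b = f i j (a \<otimes>\<^bsub>B\<^esub> b)" if "a \<in> carrier B" "b \<in> carrier B" for i j k a b
    using that mult lca_homD(3)[OF \<phi>] lca_homD(3)[OF \<psi>] by (simp add: f_def)
  have h: "f k k \<in> lca_hom B Z" for k using \<phi> \<psi> by (simp add: f_def)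
  have "mor_into Z 2 Z (matrix_unit Z k) (mor H B Z (f k k) x)
    = mor_mat 2 B 2 Z (entrywise Z 2 f) (mor_into B 2 B (matrix_unit B k) x)" if "k < 2" for k
    by (rule mor_entrywise[OF B Z that lin h m x, symmetric])
  from this[of 0] this[of 1]
  have "mor_into Z 2 Z (matrix_unit Z 0) (mor H B Z \<phi> x) = mor_into Z 2 Z (matrix_unit Z 0) (mor H B Z \<psi> x)"
    using mor_corners_eq[OF B x] mor_corners_eq[OF Z mor_closed[OF B Z \<psi> x]] by (simp add: f_def)
  then show ?thesis
    using corner_2_bij[OF Z] mor_closed[OF B Z \<phi> x] mor_closed[OF B Z \<psi> x] by (meson bij_betw_def inj_onD)
qed

lemma zero_hom:
  assumes "X \<in> \<U>" "Y \<in> \<U>"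
  shows "(\<lambda>_. \<zero>\<^bsub>Y\<^esub>) \<in> lca_hom X Y"
proof -
  interpret Y: lc_alg Y using assms by (intro lc_alg)
  show ?thesis by (rule lca_homI[OF Y.zero_lin]) simp
qed

text \<open>For orthogonal homomorphisms \<open>\<phi>\<close> and \<open>\<psi>\<close>, the map \<open>(a, b) \<mapsto> \<phi> a + \<psi> b\<close> is a homomorphism
  on \<open>B \<oplus> B\<close>, and by split exactness the diagonal of \<open>B \<oplus> B\<close> is the sum of the two inclusions under \<open>H\<close>.\<close>

lemma mor_orthogonal_sum:
  assumes B: "B \<in> \<U>" and Z: "Z \<in> \<U>" and \<phi>: "\<phi> \<in> lca_hom B Z" and \<psi>: "\<psi> \<in> lca_hom B Z"
    and orth: "\<And>a b. a \<in> carrier B \<Longrightarrow> b \<in> carrier B \<Longrightarrow> \<phi> a \<otimes>\<^bsub>Z\<^esub> \<psi> b = \<zero>\<^bsub>Z\<^esub>"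
      "\<And>a b. a \<in> carrier B \<Longrightarrow> b \<in> carrier B \<Longrightarrow> \<psi> a \<otimes>\<^bsub>Z\<^esub> \<phi> b = \<zero>\<^bsub>Z\<^esub>"
    and x: "x \<in> HX B"
  shows "(\<lambda>a. \<phi> a \<oplus>\<^bsub>Z\<^esub> \<psi> a) \<in> lca_hom B Z"
    "mor H B Z (\<lambda>a. \<phi> a \<oplus>\<^bsub>Z\<^esub> \<psi> a) x = mor H B Z \<phi> x \<otimes>\<^bsub>obj H Z\<^esub> mor H B Z \<psi> x"
proof -
  interpret B: lc_alg B using B by (rule lc_alg)
  interpret Z: lc_alg Z using Z by (rule lc_alg)
  interpret BB: lc_alg_pair B B ..
  let ?P = "prod_lca B B"
  interpret P: lc_alg ?P by unfold_locales (rule BB.lc_algebra_prod)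
  interpret PZ: lc_alg_pair ?P Z ..
  have split: "split_ext B ?P B (\<lambda>a. (a, \<zero>\<^bsub>B\<^esub>)) snd (\<lambda>b. (\<zero>\<^bsub>B\<^esub>, b))"
    by (rule split_extI[OF B.lc_algebra P.lc_algebra B.lc_algebra BB.split_extension_prod])
  interpret S: split_ext B ?P B "\<lambda>a. (a, \<zero>\<^bsub>B\<^esub>)" snd "\<lambda>b. (\<zero>\<^bsub>B\<^esub>, b)" by (rule split)
  \<comment> \<open>The concrete product has pairs as elements; since \<open>H\<close> is defined on
    the universe, an isomorphic member \<open>Y\<close> takes its place.\<close>
  obtain Y \<theta> where Y: "Y \<in> \<U>" and \<theta>: "\<theta> \<in> lca_iso ?P Y"
    by (rule representedE[OF S.represented_extension[OF universe represented_self[OF B] represented_self[OF B]]])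
  interpret Y: lc_alg Y using Y by (rule lc_alg)
  interpret T: lca_isomorphism ?P Y \<theta> by unfold_locales (rule \<theta>)
  define \<kappa> where "\<kappa> = T.g"
  note \<kappa> = T.g_hom[folded \<kappa>_def] and \<kappa>\<theta> = T.g_f[folded \<kappa>_def] and \<theta>\<kappa> = T.f_g[folded \<kappa>_def] and \<kappa>c = T.g_closed[folded \<kappa>_def]
  define i1 where "i1 = (\<lambda>a. \<theta> (a, \<zero>\<^bsub>B\<^esub>))"
  define i2 where "i2 = (\<lambda>a. \<theta> (\<zero>\<^bsub>B\<^esub>, a))"
  define d where "d = (\<lambda>a. \<theta> (a, a))"
  define p1 where "p1 = (\<lambda>y. fst (\<kappa> y))"
  define p2 where "p2 = (\<lambda>y. snd (\<kappa> y))"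
  have i1: "i1 \<in> lca_hom B Y" and i2: "i2 \<in> lca_hom B Y" and p2: "p2 \<in> lca_hom Y B"
    using lca_hom_comp[OF S.\<iota> T.hom] lca_hom_comp[OF S.s T.hom] lca_hom_comp[OF \<kappa> S.\<pi>]
    by (simp_all add: i1_def i2_def p2_def o_def)
  have "fst \<in> lca_hom ?P B" by (auto simp: lca_hom_def alg_hom_def continuous_map_fst)
  from lca_hom_comp[OF \<kappa> this] have p1: "p1 \<in> lca_hom Y B" by (simp add: p1_def o_def)
  have "(\<lambda>a. (a, a)) \<in> lca_hom B ?P"
    by (auto simp: lca_hom_def alg_hom_def continuous_map_pairedI continuous_map_id[unfolded id_def])
  from lca_hom_comp[OF this T.hom] have d: "d \<in> lca_hom B Y" by (simp add: d_def o_def)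
  have eqs: "p1 (i1 a) = a" "p2 (i1 a) = \<zero>\<^bsub>B\<^esub>" "p1 (i2 a) = \<zero>\<^bsub>B\<^esub>" "p2 (i2 a) = a" "p1 (d a) = a" "p2 (d a) = a"
    if "a \<in> carrier B" for a
    using that by (simp_all add: p1_def p2_def i1_def i2_def d_def \<kappa>\<theta>)
  have "split_extension B Y B i1 p2 i2"
  proof (rule split_extensionI[OF i1 p2 i2 B.lc_algebra Y.lc_algebra lca_hom_lin[OF p1]])
    fix y assume "y \<in> carrier Y" "p2 y = \<zero>\<^bsub>B\<^esub>"
    then have "(p1 y, \<zero>\<^bsub>B\<^esub>) = \<kappa> y" by (cases "\<kappa> y") (simp add: p1_def p2_def)
    then show "i1 (p1 y) = y" using \<theta>\<kappa>[OF \<open>y \<in> carrier Y\<close>] by (simp add: i1_def)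
  qed (simp_all add: eqs)
  with split_exact B Y have ker: "mor H B Y i1 ` HX B = kernel (obj H Y) (obj H B) (mor H Y B p2)"
    unfolding split_exact_def by blast
  interpret GB: comm_group "obj H B" using group_obj[OF B] .
  interpret GY: comm_group "obj H Y" using group_obj[OF Y] .
  interpret GZ: comm_group "obj H Z" using group_obj[OF Z] .
  interpret p1: group_hom "obj H Y" "obj H B" "mor H Y B p1" by (rule group_hom_mor[OF Y B p1])
  interpret p2: group_hom "obj H Y" "obj H B" "mor H Y B p2" by (rule group_hom_mor[OF Y B p2])
  have mid: "mor H B B f x = x" if "f \<in> lca_hom B B" "\<And>a. a \<in> carrier B \<Longrightarrow> f a = a" for f
    using mor_is_id[OF B that x] .
  have cl: "mor H B Y d x \<in> HX Y" "mor H B Y i1 x \<in> HX Y" "mor H B Y i2 x \<in> HX Y"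
    by (rule mor_closed[OF B Y d x] mor_closed[OF B Y i1 x] mor_closed[OF B Y i2 x])+
  have comp: "mor H Y B g (mor H B Y f x) = mor H B B (\<lambda>a. g (f a)) x" "(\<lambda>a. g (f a)) \<in> lca_hom B B"
    if "f \<in> lca_hom B Y" "g \<in> lca_hom Y B" for f g
    using mor_comp[OF B Y B that x] lca_hom_comp[OF that] by (simp_all add: o_def)
  \<comment> \<open>The zero homomorphism is \<open>p2 \<circ> i1\<close>, and exactness puts the
    image of H(i1) into the kernel of H(p2). Hence zero homomorphisms induce the trivial
    map.\<close>
  have "mor H B Y i1 x \<in> kernel (obj H Y) (obj H B) (mor H Y B p2)" using ker x by blast
  then have "mor H B B (\<lambda>a. p2 (i1 a)) x = \<one>\<^bsub>obj H B\<^esub>"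
    by (simp add: kernel_def comp(1)[OF i1 p2])
  then have zero: "mor H B B (\<lambda>_. \<zero>\<^bsub>B\<^esub>) x = \<one>\<^bsub>obj H B\<^esub>"
    using mor_cong[OF B B comp(2)[OF i1 p2] zero_hom[OF B B] eqs(2) x] by simp
  have p1i2: "mor H Y B p1 (mor H B Y i2 x) = \<one>\<^bsub>obj H B\<^esub>"
    using mor_cong[OF B B comp(2)[OF i2 p1] zero_hom[OF B B] eqs(3) x] zero by (simp add: comp(1)[OF i2 p1])
  have p2i2: "mor H Y B p2 (mor H B Y i2 x) = x" and p2d: "mor H Y B p2 (mor H B Y d x) = x"
    and p1d: "mor H Y B p1 (mor H B Y d x) = x"
    using mid[OF comp(2)[OF i2 p2] eqs(4)] mid[OF comp(2)[OF d p2] eqs(6)] mid[OF comp(2)[OF d p1] eqs(5)]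
    by (simp_all add: comp(1)[OF i2 p2] comp(1)[OF d p2] comp(1)[OF d p1])
  \<comment> \<open>The difference of the diagonal and the second inclusion is killed by H(p2), so
    it comes from some \<open>b\<close> through H(i1); applying H(p1) identifies \<open>b\<close> as
    \<open>x\<close>.\<close>
  let ?z = "mor H B Y d x \<otimes>\<^bsub>obj H Y\<^esub> inv\<^bsub>obj H Y\<^esub> mor H B Y i2 x"
  have "?z \<in> kernel (obj H Y) (obj H B) (mor H Y B p2)"
    using cl x by (simp add: kernel_def p2i2 p2d)
  then obtain b where b: "b \<in> HX B" "?z = mor H B Y i1 b" using ker by blast
  have "mor H Y B p1 ?z = x" using cl x by (simp add: p1i2 p1d)
  moreover have "mor H Y B p1 (mor H B Y i1 b) = b"
    using mor_comp[OF B Y B i1 p1 b(1)] mor_is_id[OF B comp(2)[OF i1 p1] eqs(1) b(1)] by simp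
  ultimately have z: "?z = mor H B Y i1 x" using b by simp
  have "mor H B Y d x = ?z \<otimes>\<^bsub>obj H Y\<^esub> mor H B Y i2 x"
    using cl by (simp add: GY.m_assoc)
  then have diag: "mor H B Y d x = mor H B Y i1 x \<otimes>\<^bsub>obj H Y\<^esub> mor H B Y i2 x"
    unfolding z .
  note \<phi>D = lca_homD[OF \<phi>] and \<psi>D = lca_homD[OF \<psi>]
  let ?\<Phi> = "\<lambda>x. \<phi> (fst x) \<oplus>\<^bsub>Z\<^esub> \<psi> (snd x)"
  have "?\<Phi> \<in> lca_lin ?P Z"
  proof (rule PZ.lca_lin_add)
    show "(\<lambda>x. \<phi> (fst x)) \<in> lca_lin ?P Z"
      using lca_lin_comp[OF lca_hom_lin[OF \<open>fst \<in> lca_hom ?P B\<close>] lca_hom_lin[OF \<phi>]] by (simp add: o_def)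
    show "(\<lambda>x. \<psi> (snd x)) \<in> lca_lin ?P Z"
      using lca_lin_comp[OF lca_hom_lin[OF S.\<pi>] lca_hom_lin[OF \<psi>]] by (simp add: o_def)
  qed
  then have "?\<Phi> \<in> lca_hom ?P Z"
    by (rule lca_homI) (auto simp: \<phi>D \<psi>D Z.l_distr Z.r_distr orth)
  from lca_hom_comp[OF \<kappa> this] have \<Phi>: "(\<lambda>y. ?\<Phi> (\<kappa> y)) \<in> lca_hom Y Z" by (simp add: o_def)
  interpret \<Phi>: group_hom "obj H Y" "obj H Z" "mor H Y Z (\<lambda>y. ?\<Phi> (\<kappa> y))" by (rule group_hom_mor[OF Y Z \<Phi>])
  have ev: "?\<Phi> (\<kappa> (d a)) = \<phi> a \<oplus>\<^bsub>Z\<^esub> \<psi> a" "?\<Phi> (\<kappa> (i1 a)) = \<phi> a" "?\<Phi> (\<kappa> (i2 a)) = \<psi> a" if "a \<in> carrier B" for a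
  proof -
    have "\<phi> \<zero>\<^bsub>B\<^esub> = \<zero>\<^bsub>Z\<^esub>" "\<psi> \<zero>\<^bsub>B\<^esub> = \<zero>\<^bsub>Z\<^esub>"
      using \<phi>D(4)[of "\<zero>\<^bsub>B\<^esub>" 0] \<psi>D(4)[of "\<zero>\<^bsub>B\<^esub>" 0] \<phi>D(1) \<psi>D(1) by simp_all
    then show "?\<Phi> (\<kappa> (d a)) = \<phi> a \<oplus>\<^bsub>Z\<^esub> \<psi> a" "?\<Phi> (\<kappa> (i1 a)) = \<phi> a" "?\<Phi> (\<kappa> (i2 a)) = \<psi> a"
      using that \<phi>D(1) \<psi>D(1) by (simp_all add: d_def i1_def i2_def \<kappa>\<theta>)
  qed
  have c: "(\<lambda>a. ?\<Phi> (\<kappa> (f a))) \<in> lca_hom B Z" if "f \<in> lca_hom B Y" for f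
    using lca_hom_comp[OF that \<Phi>] by (simp add: o_def)
  show hom: "(\<lambda>a. \<phi> a \<oplus>\<^bsub>Z\<^esub> \<psi> a) \<in> lca_hom B Z"
    by (rule lca_hom_cong[OF B.lc_alg_axioms c[OF d]]) (simp only: ev)
  have "mor H B Z (\<lambda>a. \<phi> a \<oplus>\<^bsub>Z\<^esub> \<psi> a) x = mor H Y Z (\<lambda>y. ?\<Phi> (\<kappa> y)) (mor H B Y d x)"
    unfolding mor_comp[OF B Y Z d \<Phi> x] by (rule mor_cong[OF B Z hom c[OF d] _ x]) (simp only: ev)
  also have "\<dots> = mor H Y Z (\<lambda>y. ?\<Phi> (\<kappa> y)) (mor H B Y i1 x) \<otimes>\<^bsub>obj H Z\<^esub> mor H Y Z (\<lambda>y. ?\<Phi> (\<kappa> y)) (mor H B Y i2 x)"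
    unfolding diag using cl by simp
  also have "mor H Y Z (\<lambda>y. ?\<Phi> (\<kappa> y)) (mor H B Y i1 x) = mor H B Z \<phi> x"
    unfolding mor_comp[OF B Y Z i1 \<Phi> x] by (rule mor_cong[OF B Z c[OF i1] \<phi> _ x]) (simp only: ev)
  also have "mor H Y Z (\<lambda>y. ?\<Phi> (\<kappa> y)) (mor H B Y i2 x) = mor H B Z \<psi> x"
    unfolding mor_comp[OF B Y Z i2 \<Phi> x] by (rule mor_cong[OF B Z c[OF i2] \<psi> _ x]) (simp only: ev)
  finally show "mor H B Z (\<lambda>a. \<phi> a \<oplus>\<^bsub>Z\<^esub> \<psi> a) x = mor H B Z \<phi> x \<otimes>\<^bsub>obj H Z\<^esub> mor H B Z \<psi> x" .
qed

end

subsection \<open>Stability under matrix algebras of arbitrary size\<close>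

text \<open>The identification of M_2(M_n(R)) with M_2n(R): the quotient by \<open>n\<close> selects
  the block and the remainder the position within it. \<open>F\<close> unpacks a block, because
  blocks are given as elements of the chosen model of M_n; \<open>block\<close> cuts out the block
  in position \<open>(a, b)\<close>.\<close>

definition unblock where
  "unblock R n F x = (\<lambda>(i, j). if i < 2 * n \<and> j < 2 * n then F (x (i div n, j div n)) (i mod n, j mod n) else \<zero>\<^bsub>R\<^esub>)"

definition block where
  "block R n a b y = (\<lambda>(i, j). if i < n \<and> j < n then y (a * n + i, b * n + j) else \<zero>\<^bsub>R\<^esub>)"

lemma (in lc_alg) block_mats: "y \<in> mats A m m \<Longrightarrow> block A n a b y \<in> mats A n n"
  by (intro matsI) (auto simp: block_def mats_carrier)

lemma (in lc_alg) finsum_lessThan_double: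
  fixes n :: nat
  assumes "\<And>l. l < 2 * n \<Longrightarrow> f l \<in> carrier A"
  shows "finsum A f {..<2 * n} = (\<Oplus>k\<in>{..<n}. f k) \<oplus> (\<Oplus>k\<in>{..<n}. f (n + k))"
proof -
  have e: "{..<2 * n} = {..<n} \<union> (+) n ` {..<n}"
  proof (intro equalityI subsetI)
    fix l assume "l \<in> {..<2 * n}"
    then have "l < n \<or> l = n + (l - n) \<and> l - n < n" by auto
    then show "l \<in> {..<n} \<union> (+) n ` {..<n}" by blast
  qed auto
  have "finsum A f ({..<n} \<union> (+) n ` {..<n}) = finsum A f {..<n} \<oplus> finsum A f ((+) n ` {..<n})"
    using assms by (intro finsum_Un_disjoint) auto
  moreover have "finsum A f ((+) n ` {..<n}) = (\<Oplus>k\<in>{..<n}. f (n + k))"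
    using assms by (intro finsum_reindex) auto
  ultimately show ?thesis by (simp only: e)
qed

lemma div_less_2: "i < 2 * n \<Longrightarrow> i div n < (2::nat)"
  by (simp add: less_mult_imp_div_less mult.commute)

context stable_functor
begin

lemma unblock_iso:
  assumes T: "T \<in> \<U>" and n: "n \<ge> 1"
  shows "unblock T n (from_mat n T) \<in> lca_iso (mat_lca 2 (mat_obj \<U> n T)) (mat_lca (2 * n) T)"
proof -
  let ?M = "mat_obj \<U> n T" and ?F = "from_mat n T"
  interpret T: lc_alg T using T by (rule lc_alg)
  interpret M: lc_alg ?M using mat_obj[OF T n] by (rule lc_alg)
  interpret M2: top_alg "mat_lca 2 ?M" by (rule M.top_alg_mat)
  interpret T2: top_alg "mat_lca (2 * n) T" by (rule T.top_alg_mat)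
  note F = from_mat_hom[OF T n] and Fc = from_mat_closed[OF T n]
  note FD = lca_homD[OF F, simplified]
  let ?G = "unblock T n ?F"
  define G' where "G' y = (\<lambda>(a, b). if a < 2 \<and> b < 2 then to_mat \<U> n T (block T n a b y) else \<zero>\<^bsub>?M\<^esub>)" for y
  have n0: "0 < n" using n by simp
  have G: "?G \<in> lca_hom (mat_lca 2 ?M) (mat_lca (2 * n) T)"
  proof (rule T.mat_homI[OF M.top_alg_mat])
    fix i j assume ij: "i < 2 * n" "j < 2 * n"
    have "(\<lambda>x. ?F (x (i div n, j div n)) (i mod n, j mod n)) \<in> lca_lin (mat_lca 2 ?M) T"
      using lca_lin_comp[OF lca_lin_comp[OF M.entry_lin lca_hom_lin[OF F]] T.entry_lin] by (simp add: o_def)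
    then show "(\<lambda>x. ?G x (i, j)) \<in> lca_lin (mat_lca 2 ?M) T"
      using ij by (simp add: unblock_def)
    fix x y assume "x \<in> carrier (mat_lca 2 ?M)" "y \<in> carrier (mat_lca 2 ?M)"
    then have xy: "x kl \<in> carrier ?M" "y kl \<in> carrier ?M" for kl by (auto simp: M.mats_carrier)
    have c: "?F (x kl) rs \<in> carrier T" "?F (y kl) rs \<in> carrier T" for kl rs
      using T.mats_carrier[OF Fc] xy by auto
    let ?a = "i div n" and ?b = "j div n" and ?i = "i mod n" and ?j = "j mod n"
    have "mat_mult T (2 * n) (?G x) (?G y) (i, j) =
      (\<Oplus>\<^bsub>T\<^esub>l\<in>{..<2 * n}. ?F (x (?a, l div n)) (?i, l mod n) \<otimes>\<^bsub>T\<^esub> ?F (y (l div n, ?b)) (l mod n, ?j))"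
      unfolding mat_mult_def prod.case using ij c by (intro T.finsum_cong') (auto simp: unblock_def)
    \<comment> \<open>The sum over 2n inner indices is split at \<open>n\<close>; its halves are the
      products through the first and through the second block, the two summands of an entry of a 2
      by 2 product.\<close>
    also have "\<dots> = (\<Oplus>\<^bsub>T\<^esub>k\<in>{..<n}. ?F (x (?a, k div n)) (?i, k mod n) \<otimes>\<^bsub>T\<^esub> ?F (y (k div n, ?b)) (k mod n, ?j))
      \<oplus>\<^bsub>T\<^esub> (\<Oplus>\<^bsub>T\<^esub>k\<in>{..<n}. ?F (x (?a, (n + k) div n)) (?i, (n + k) mod n) \<otimes>\<^bsub>T\<^esub> ?F (y ((n + k) div n, ?b)) ((n + k) mod n, ?j))"
      using c by (intro T.finsum_lessThan_double) auto
    also have "(\<Oplus>\<^bsub>T\<^esub>k\<in>{..<n}. ?F (x (?a, k div n)) (?i, k mod n) \<otimes>\<^bsub>T\<^esub> ?F (y (k div n, ?b)) (k mod n, ?j))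
      = mat_mult T n (?F (x (?a, 0))) (?F (y (0, ?b))) (?i, ?j)"
      unfolding mat_mult_def prod.case using c by (intro T.finsum_cong') auto
    also have "(\<Oplus>\<^bsub>T\<^esub>k\<in>{..<n}. ?F (x (?a, (n + k) div n)) (?i, (n + k) mod n) \<otimes>\<^bsub>T\<^esub> ?F (y ((n + k) div n, ?b)) ((n + k) mod n, ?j))
      = mat_mult T n (?F (x (?a, 1))) (?F (y (1, ?b))) (?i, ?j)"
      unfolding mat_mult_def prod.case using c n0 by (intro T.finsum_cong') auto
    also have "mat_mult T n (?F (x (?a, 0))) (?F (y (0, ?b))) (?i, ?j) \<oplus>\<^bsub>T\<^esub> mat_mult T n (?F (x (?a, 1))) (?F (y (1, ?b))) (?i, ?j)
      = ?F (x (?a, 0) \<otimes>\<^bsub>?M\<^esub> y (0, ?b) \<oplus>\<^bsub>?M\<^esub> x (?a, 1) \<otimes>\<^bsub>?M\<^esub> y (1, ?b)) (?i, ?j)"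
      using xy by (simp add: FD)
    also have "x (?a, 0) \<otimes>\<^bsub>?M\<^esub> y (0, ?b) \<oplus>\<^bsub>?M\<^esub> x (?a, 1) \<otimes>\<^bsub>?M\<^esub> y (1, ?b) = (x \<otimes>\<^bsub>mat_lca 2 ?M\<^esub> y) (?a, ?b)"
      using xy M.finsum_lessThan_2[of "\<lambda>l. x (?a, l) \<otimes>\<^bsub>?M\<^esub> y (l, ?b)"] by (simp add: mat_mult_def)
    finally show "?G (x \<otimes>\<^bsub>mat_lca 2 ?M\<^esub> y) (i, j) = mat_mult T (2 * n) (?G x) (?G y) (i, j)"
      using ij by (simp add: unblock_def)
  next
    fix x assume "x \<in> carrier (mat_lca 2 ?M)"
    then show "?G x \<in> mats T (2 * n) (2 * n)"
      using T.mats_carrier[OF Fc] M.mats_carrier by (intro T.matsI) (auto simp: unblock_def)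
  qed
  have G'_mats: "G' y \<in> mats ?M 2 2" if "y \<in> mats T (2 * n) (2 * n)" for y
    using lca_homD(1)[OF to_mat_hom[OF T n]] T.block_mats[OF that] by (intro M.matsI) (auto simp: G'_def)
  have G': "G' \<in> lca_lin (mat_lca (2 * n) T) (mat_lca 2 ?M)"
  proof (rule M.mat_linI[OF T.top_alg_mat])
    fix a b :: nat assume ab: "a < 2" "b < 2"
    have "block T n a b \<in> lca_lin (mat_lca (2 * n) T) (mat_lca n T)"
    proof (rule T.mat_linI[OF T.top_alg_mat])
      fix i j assume "i < n" "j < n"
      then show "(\<lambda>y. block T n a b y (i, j)) \<in> lca_lin (mat_lca (2 * n) T) T"
        using T.entry_lin by (simp add: block_def)
    qed (simp add: T.block_mats)
    from lca_lin_comp[OF this lca_hom_lin[OF to_mat_hom[OF T n]]]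
    show "(\<lambda>y. G' y (a, b)) \<in> lca_lin (mat_lca (2 * n) T) ?M"
      using ab by (simp add: G'_def o_def)
  qed (simp add: G'_mats)
  have G'G: "G' (?G x) = x" if x: "x \<in> mats ?M 2 2" for x
  proof (rule M.mats_eqI[OF G'_mats x])
    show "?G x \<in> mats T (2 * n) (2 * n)" using lca_homD(1)[OF G] x by simp
    fix a b :: nat assume ab: "a < 2" "b < 2"
    have "block T n a b (?G x) = ?F (x (a, b))"
    proof (rule T.mats_eqI[OF _ Fc[OF M.mats_carrier[OF x]]])
      show "block T n a b (?G x) \<in> mats T n n"
        using lca_homD(1)[OF G] x T.block_mats[of "?G x" "2 * n"] by simp
      fix i j assume "i < n" "j < n"
      moreover from this have "a * n + i < 2 * n" "b * n + j < 2 * n" using ab by (auto simp: less_2_cases_nat)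
      ultimately show "block T n a b (?G x) (i, j) = ?F (x (a, b)) (i, j)"
        by (simp add: block_def unblock_def)
    qed
    then show "G' (?G x) (a, b) = x (a, b)"
      using ab to_from_mat[OF T n M.mats_carrier[OF x]] by (simp add: G'_def)
  qed
  have GG': "?G (G' y) = y" if y: "y \<in> mats T (2 * n) (2 * n)" for y
  proof (rule T.mats_eqI[OF _ y])
    show "?G (G' y) \<in> mats T (2 * n) (2 * n)" using lca_homD(1)[OF G] G'_mats[OF y] by simp
    fix i j assume ij: "i < 2 * n" "j < 2 * n"
    then show "?G (G' y) (i, j) = y (i, j)"
      using n0 by (simp add: unblock_def G'_def div_less_2 from_to_mat[OF T n T.block_mats[OF y]]) (simp add: block_def)
  qed
  have "homeomorphic_maps (topo (mat_lca 2 ?M)) (topo (mat_lca (2 * n) T)) ?G G'"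
    using lca_homD(5)[OF G] lca_linD(4)[OF G'] G'G GG' M2.topspace_eq T2.topspace_eq
    by (simp add: homeomorphic_maps_def)
  with G show ?thesis by (rule lca_isoI)
qed

lemma mor_mat_iso_bij:
  assumes A: "A \<in> \<U>" "n \<ge> 1" and Z: "Z \<in> \<U>" "m \<ge> 1" and G: "G \<in> lca_iso (mat_lca n A) (mat_lca m Z)"
  shows "bij_betw (mor_mat n A m Z G) (HX (mat_obj \<U> n A)) (HX (mat_obj \<U> m Z))"
proof -
  interpret A: lc_alg A using A(1) by (rule lc_alg)
  interpret Z: lc_alg Z using Z(1) by (rule lc_alg)
  interpret lca_isomorphism "mat_lca n A" "mat_lca m Z" G
    by (intro lca_isomorphism.intro lca_isomorphism_axioms.intro A.top_alg_mat Z.top_alg_mat G)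
  note gf' = g_f[unfolded mat_lca_simps] and fg' = f_g[unfolded mat_lca_simps]
    and fc' = f_closed[unfolded mat_lca_simps] and gc' = g_closed[unfolded mat_lca_simps]
  show ?thesis
  proof (rule mor_bij[OF mat_obj[OF A] mat_obj[OF Z] mat_map_hom[OF A Z hom] mat_map_hom[OF Z A g_hom]])
    show "mat_map m Z n A g (mat_map n A m Z G a) = a" if "a \<in> carrier (mat_obj \<U> n A)" for a
      using from_mat_closed[OF A that]
      by (simp add: mat_map_def from_to_mat[OF Z] fc' gf' to_from_mat[OF A that])
    show "mat_map n A m Z G (mat_map m Z n A g a) = a" if "a \<in> carrier (mat_obj \<U> m Z)" for a
      using from_mat_closed[OF Z that]
      by (simp add: mat_map_def from_to_mat[OF A] gc' fg' to_from_mat[OF Z that])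
  qed
qed

text \<open>The inclusion of M_n in M_2n is the corner embedding of M_n into M_2(M_n) followed by
  \<open>unblock\<close>. M_2-stability, applied to the algebra M_n(T), therefore makes it an
  isomorphism under \<open>H\<close>.\<close>

lemma mor_double_bij:
  assumes T: "T \<in> \<U>" and n: "n \<ge> 1"
  shows "bij_betw (mor_mat n T (2 * n) T (\<lambda>x. x)) (HX (mat_obj \<U> n T)) (HX (mat_obj \<U> (2 * n) T))"
proof -
  let ?M = "mat_obj \<U> n T" and ?G = "unblock T n (from_mat n T)"
  interpret T: lc_alg T using T by (rule lc_alg)
  have M: "?M \<in> \<U>" by (rule mat_obj[OF T n])
  interpret M: lc_alg ?M using M by (rule lc_alg)
  have two: "(2::nat) \<ge> 1" "2 * n \<ge> 1" using n by auto
  have eq: "?G (matrix_unit ?M 0 a) = from_mat n T a" if a: "a \<in> carrier ?M" for a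
  proof (rule T.mats_eqI)
    show "?G (matrix_unit ?M 0 a) \<in> mats T (2 * n) (2 * n)"
      using lca_homD(1)[OF lca_iso_lca_hom[OF unblock_iso[OF T n]]] M.matrix_unit_mats[OF a, of 0 2] by simp
    show "from_mat n T a \<in> mats T (2 * n) (2 * n)"
      using from_mat_closed[OF T n a] by (rule T.mats_mono) auto
    have z: "from_mat n T \<zero>\<^bsub>?M\<^esub> = (\<lambda>_. \<zero>\<^bsub>T\<^esub>)"
    proof -
      have "from_mat n T (0 \<odot>\<^bsub>?M\<^esub> a) = (\<lambda>ij. 0 \<odot>\<^bsub>T\<^esub> from_mat n T a ij)"
        using lca_homD(4)[OF from_mat_hom[OF T n] a] by simp
      then show ?thesis using a T.mats_carrier[OF from_mat_closed[OF T n a]] by simp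
    qed
    fix i j assume "i < 2 * n" "j < 2 * n"
    then show "?G (matrix_unit ?M 0 a) (i, j) = from_mat n T a (i, j)"
      using n T.mats_zero[OF from_mat_closed[OF T n a], of i j]
      by (cases "i < n"; cases "j < n") (auto simp: unblock_def matrix_unit_def z div_eq_0_iff)
  qed
  have "mor_mat n T (2 * n) T (\<lambda>x. x) x = (mor_mat 2 ?M (2 * n) T ?G \<circ> mor_into ?M 2 ?M (matrix_unit ?M 0)) x"
    if x: "x \<in> HX ?M" for x
  proof -
    have G: "?G \<in> lca_hom (mat_lca 2 ?M) (mat_lca (2 * n) T)" by (rule lca_iso_lca_hom[OF unblock_iso[OF T n]])
    have u: "matrix_unit ?M 0 \<in> lca_hom ?M (mat_lca 2 ?M)" by (rule matrix_unit_hom[OF M]) simp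
    have "mor_mat n T (2 * n) T (\<lambda>x. x) x = mor_into ?M (2 * n) T (\<lambda>a. from_mat n T a) x"
      by (simp add: mat_map_def)
    also have "\<dots> = mor_into ?M (2 * n) T (\<lambda>a. ?G (matrix_unit ?M 0 a)) x"
    proof (rule mor_into_cong[OF M T two(2) _ _ _ x])
      show "(\<lambda>a. ?G (matrix_unit ?M 0 a)) \<in> lca_hom ?M (mat_lca (2 * n) T)"
        using lca_hom_comp[OF u G] by (simp add: o_def)
      then show "from_mat n T \<in> lca_hom ?M (mat_lca (2 * n) T)"
        by (rule lca_hom_cong[OF M.lc_alg_axioms]) (simp add: eq)
    qed (simp add: eq)
    also have "\<dots> = mor_mat 2 ?M (2 * n) T ?G (mor_into ?M 2 ?M (matrix_unit ?M 0) x)"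
      by (rule mor_mat_into[OF M M two(1) T two(2) u G x, symmetric])
    finally show ?thesis by simp
  qed
  then show ?thesis
    using bij_betw_trans[OF corner_2_bij[OF M] mor_mat_iso_bij[OF M two(1) T two(2) unblock_iso[OF T n]]]
    by (subst bij_betw_cong) auto
qed

lemma mor_incl_comp:
  assumes T: "T \<in> \<U>" and "1 \<le> n" "n \<le> m" "m \<le> k" and x: "x \<in> HX (mat_obj \<U> n T)"
  shows "mor_mat m T k T (\<lambda>x. x) (mor_mat n T m T (\<lambda>x. x) x) = mor_mat n T k T (\<lambda>x. x) x"
  using assms by (intro mor_mat_comp lc_alg.mat_inclusion_hom[OF lc_alg]) auto

lemma mor_incl_image:
  assumes T: "T \<in> \<U>" and "1 \<le> n" "n \<le> m"
  shows "mor_mat n T m T (\<lambda>x. x) ` HX (mat_obj \<U> n T) \<subseteq> HX (mat_obj \<U> m T)"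
  using assms mor_mat_closed[OF T _ T _ lc_alg.mat_inclusion_hom[OF lc_alg[OF T]]] by auto

text \<open>The inclusions \<open>M\<^sub>n \<rightarrow> M\<^sub>n\<^sub>+\<^sub>1 \<rightarrow> M\<^sub>2\<^sub>n \<rightarrow> M\<^sub>2\<^sub>n\<^sub>+\<^sub>2\<close> compose to isomorphisms in both ways.\<close>

lemma mor_incl_Suc_bij:
  assumes T: "T \<in> \<U>" and n: "n \<ge> 1"
  shows "bij_betw (mor_mat n T (Suc n) T (\<lambda>x. x)) (HX (mat_obj \<U> n T)) (HX (mat_obj \<U> (Suc n) T))"
proof -
  let ?i = "\<lambda>n m. mor_mat n T m T (\<lambda>x. x)" and ?X = "\<lambda>n. HX (mat_obj \<U> n T)"
  have b1: "bij_betw (?i (Suc n) (2 * n) \<circ> ?i n (Suc n)) (?X n) (?X (2 * n))"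
    using mor_double_bij[OF T n] mor_incl_comp[OF T n, of "Suc n" "2 * n"] n
    by (subst bij_betw_cong[where g = "?i n (2 * n)"]) auto
  have b2: "bij_betw (?i (2 * n) (2 * Suc n) \<circ> ?i (Suc n) (2 * n)) (?X (Suc n)) (?X (2 * Suc n))"
    using mor_double_bij[OF T, of "Suc n"] mor_incl_comp[OF T, of "Suc n" "2 * n" "2 * Suc n"] n
    by (subst bij_betw_cong[where g = "?i (Suc n) (2 * Suc n)"]) auto
  \<comment> \<open>The inclusion of M_(n+1) in M_2n is the first factor in \<open>b2\<close> and
    hence injective under \<open>H\<close>. It is the second factor in the bijection
    \<open>b1\<close>, so the first factor there is bijective as well.\<close>
  have "inj_on (?i (Suc n) (2 * n)) (?X (Suc n))"
    using b2 inj_on_imageI2 unfolding bij_betw_def by blast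
  then show ?thesis
    using n by (intro bij_betw_of_comp(1)[OF b1] mor_incl_image[OF T]) auto
qed

lemma mor_corner_1_bij:
  assumes T: "T \<in> \<U>"
  shows "bij_betw (mor_into T 1 T (matrix_unit T 0)) (HX T) (HX (mat_obj \<U> 1 T))"
proof -
  interpret T: lc_alg T using T by (rule lc_alg)
  have one: "(1::nat) \<ge> 1" by simp
  interpret M: lc_alg "mat_obj \<U> 1 T" using mat_obj[OF T one] by (rule lc_alg)
  have e: "(\<lambda>x. x (0, 0)) \<in> lca_hom (mat_lca 1 T) T"
  proof (rule lca_homI[OF T.entry_lin])
    fix x y assume "x \<in> carrier (mat_lca 1 T)" "y \<in> carrier (mat_lca 1 T)"
    then have "x (0, 0) \<in> carrier T" "y (0, 0) \<in> carrier T" by (auto simp: T.mats_carrier)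
    then show "(x \<otimes>\<^bsub>mat_lca 1 T\<^esub> y) (0, 0) = x (0, 0) \<otimes>\<^bsub>T\<^esub> y (0, 0)"
      by (simp add: mat_mult_def lessThan_Suc T.finsum_insert)
  qed
  have g: "(\<lambda>y. from_mat 1 T y (0, 0)) \<in> lca_hom (mat_obj \<U> 1 T) T"
    using lca_hom_comp[OF from_mat_hom[OF T one] e] by (simp add: o_def)
  show ?thesis
  proof (rule mor_bij[OF T mat_obj[OF T one] into_mat_hom[OF T one matrix_unit_hom[OF T]] g])
    show "from_mat 1 T (to_mat \<U> 1 T (matrix_unit T 0 a)) (0, 0) = a" if "a \<in> carrier T" for a
      by (subst from_to_mat[OF T one T.matrix_unit_mats[OF that zero_less_one]]) (simp add: matrix_unit_def)
    fix y assume y: "y \<in> carrier (mat_obj \<U> 1 T)"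
    have "matrix_unit T 0 (from_mat 1 T y (0, 0)) = from_mat 1 T y"
      using T.mats_carrier[OF from_mat_closed[OF T one y]]
      by (intro T.mats_eqI[OF T.matrix_unit_mats[OF _ zero_less_one] from_mat_closed[OF T one y]]) (auto simp: matrix_unit_def)
    then show "to_mat \<U> 1 T (matrix_unit T 0 (from_mat 1 T y (0, 0))) = y"
      by (simp only: to_from_mat[OF T one y])
  qed simp
qed

lemma mor_incl_corner:
  assumes T: "T \<in> \<U>" and "1 \<le> n" "n \<le> m" and x: "x \<in> HX T"
  shows "mor_mat n T m T (\<lambda>x. x) (corner_mor \<U> H n T x) = corner_mor \<U> H m T x"
  unfolding corner_mor_eq corner_matrix_unit using assms
  by (intro mor_mat_into lc_alg.mat_inclusion_hom[OF lc_alg] matrix_unit_hom) auto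

text \<open>The corner embedding into M_(n+1) factors through the one into M_n, and the remaining
  inclusion is an isomorphism under \<open>H\<close>; the induction starts with the isomorphism of
  \<open>T\<close> and M_1(T).\<close>

lemma corner_mor_bij:
  assumes T: "T \<in> \<U>" and "n \<ge> 1"
  shows "bij_betw (corner_mor \<U> H n T) (HX T) (HX (mat_obj \<U> n T))"
  using assms(2)
proof (induction n rule: dec_induct)
  case base
  then show ?case using mor_corner_1_bij[OF T] by (simp add: corner_mor_eq corner_matrix_unit)
next
  case (step n)
  have n: "n \<ge> 1" using step by simp
  have "bij_betw (mor_mat n T (Suc n) T (\<lambda>x. x) \<circ> corner_mor \<U> H n T) (HX T) (HX (mat_obj \<U> (Suc n) T))"
    by (rule bij_betw_trans[OF step.IH mor_incl_Suc_bij[OF T n]])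
  then show ?case
    using mor_incl_corner[OF T n, of "Suc n"] by (subst bij_betw_cong) auto
qed

lemma corner_mor_hom:
  assumes T: "T \<in> \<U>" and n: "n \<ge> 1"
  shows "group_hom (obj H T) (obj H (mat_obj \<U> n T)) (corner_mor \<U> H n T)"
  unfolding corner_mor_eq corner_matrix_unit
  using n by (intro group_hom_mor[OF T mat_obj[OF T n] into_mat_hom[OF T n matrix_unit_hom[OF T]]]) simp

end

subsection \<open>The action of idempotents\<close>

locale idem_action = stable_functor \<U> H for \<U> :: "'u lca set" and H :: "('u, 'h) lca_functor" +
  fixes R :: "'a lca" and B :: "'u lca"
  assumes lc_R: "lc_alg R" and rep_R: "represented \<U> R" and B: "B \<in> \<U>"
begin

abbreviation "T \<equiv> tensor_obj \<U> R B"
abbreviation "\<tau> \<equiv> tensor \<U> R B"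

sublocale T: proj_tensor R B T \<tau>
  by (rule proj_tensor[OF lc_R rep_R B])

lemma T: "T \<in> \<U>"
  by (rule tensor_obj_closed[OF lc_R rep_R B])

sublocale G: comm_group "obj H T"
  by (rule group_obj[OF T])

text \<open>The matrix \<open>x \<otimes> b\<close>; for an idempotent \<open>x\<close> this is the
  homomorphism that defines the product, before the passage to the model
  \<open>mat_obj\<close>.\<close>

definition tmat where "tmat x b = (\<lambda>ij. \<tau> (x ij) b)"

lemma tmat_mats: "x \<in> mats R n m \<Longrightarrow> b \<in> carrier B \<Longrightarrow> tmat x b \<in> mats T n m"
  by (intro T.T.matsI) (auto simp: tmat_def T.A.mats_carrier T.A.mats_zero)

lemma tmat_lin:
  assumes x: "x \<in> mats R N N"
  shows "tmat x \<in> lca_lin B (mat_lca N T)"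
proof (rule T.T.mat_linI[OF T.B.top_alg_axioms])
  show "(\<lambda>b. tmat x b (i, j)) \<in> lca_lin B T" for i j
    using T.\<tau>_right_lin[OF T.A.mats_carrier[OF x]] by (simp add: tmat_def)
qed (rule tmat_mats[OF x])

lemma tmat_mult:
  assumes x: "x \<in> mats R n m" and y: "y \<in> mats R n' m'" and b: "b \<in> carrier B" "b' \<in> carrier B"
  shows "mat_mult T N (tmat x b) (tmat y b') = tmat (mat_mult R N x y) (b \<otimes>\<^bsub>B\<^esub> b')"
proof (rule ext, clarify)
  fix i j
  have c: "x ij \<in> carrier R" "y ij \<in> carrier R" for ij
    using T.A.mats_carrier x y by auto
  have "mat_mult T N (tmat x b) (tmat y b') (i, j) = (\<Oplus>\<^bsub>T\<^esub>l\<in>{..<N}. \<tau> (x (i, l) \<otimes>\<^bsub>R\<^esub> y (l, j)) (b \<otimes>\<^bsub>B\<^esub> b'))"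
    by (simp add: mat_mult_def tmat_def T.\<tau>_mult c b)
  also have "\<dots> = \<tau> (\<Oplus>\<^bsub>R\<^esub>l\<in>{..<N}. x (i, l) \<otimes>\<^bsub>R\<^esub> y (l, j)) (b \<otimes>\<^bsub>B\<^esub> b')"
    using b c T.A.finsum_map[OF T.T.abelian_monoid_axioms, of "\<lambda>a. \<tau> a (b \<otimes>\<^bsub>B\<^esub> b')" "{..<N}" "\<lambda>l. x (i, l) \<otimes>\<^bsub>R\<^esub> y (l, j)"]
    by (simp add: T.\<tau>_add_left)
  finally show "mat_mult T N (tmat x b) (tmat y b') (i, j) = tmat (mat_mult R N x y) (b \<otimes>\<^bsub>B\<^esub> b') (i, j)"
    by (simp add: tmat_def mat_mult_def)
qed

lemma tmat_hom:
  assumes p: "p \<in> mats R N N" "mat_mult R N p p = p"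
  shows "tmat p \<in> lca_hom B (mat_lca N T)"
  by (rule lca_homI[OF tmat_lin[OF p(1)]]) (simp add: tmat_mult[OF p(1) p(1)] p(2))

lemma idem_act_eq:
  "idem_act \<U> H R B (n, p) x = inv_into (HX T) (corner_mor \<U> H n T) (mor_into B n T (tmat p) x)"
  by (simp add: idem_act_def Let_def tmat_def)

lemma mor_tmat_closed:
  assumes "(n, p) \<in> idems R" "x \<in> HX B"
  shows "mor_into B n T (tmat p) x \<in> HX (mat_obj \<U> n T)"
  using assms mor_into_closed[OF B T _ tmat_hom] by (simp add: T.A.idems_iff)

lemma idem_act_closed: "a \<in> idems R \<Longrightarrow> x \<in> HX B \<Longrightarrow> idem_act \<U> H R B a x \<in> HX T"
proof -
  assume a: "a \<in> idems R" and x: "x \<in> HX B"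
  obtain n p where [simp]: "a = (n, p)" by (metis prod.exhaust)
  have n: "n \<ge> 1" using a by (simp add: T.A.idems_iff)
  show ?thesis
    using mor_tmat_closed[of n p x] a x bij_betw_imp_surj_on[OF corner_mor_bij[OF T n]]
    by (simp add: idem_act_eq inv_into_into)
qed

lemma corner_idem_act:
  "(n, p) \<in> idems R \<Longrightarrow> x \<in> HX B \<Longrightarrow> corner_mor \<U> H n T (idem_act \<U> H R B (n, p) x) = mor_into B n T (tmat p) x"
  unfolding idem_act_eq using mor_tmat_closed[of n p x] corner_mor_bij[OF T, of n]
  by (simp add: T.A.idems_iff bij_betw_def f_inv_into_f)

text \<open>\<open>idem_act\<close> is a preimage under the stability isomorphism. As that map is
  bijective, equations for the action can be verified after applying
  \<open>corner_mor\<close>.\<close>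

lemma idem_act_eqI:
  assumes "(n, p) \<in> idems R" and y: "y \<in> HX T" and e: "corner_mor \<U> H n T y = mor_into B n T (tmat p) x"
  shows "idem_act \<U> H R B (n, p) x = y"
  using assms corner_mor_bij[OF T, of n]
  by (simp add: idem_act_eq e[symmetric] bij_betw_inv_into_left T.A.idems_iff)

lemma idems_extend:
  assumes p: "(n, p) \<in> idems R" and N: "n \<le> N"
  shows "(N, p) \<in> idems R"
proof -
  have pn: "n \<ge> 1" "p \<in> mats R n n" "mat_mult R n p p = p" using p by (auto simp: T.A.idems_iff)
  then have "mat_mult R N p p = p"
    using T.A.mat_mult_extend[of p n n p n n N n] N by simp
  then show ?thesis using pn N T.A.mats_mono[OF pn(2) N N] by (simp add: T.A.idems_iff)
qed

text \<open>The inclusion of M_n in M_N carries corners to corners and \<open>p \<otimes> b\<close>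
  to itself. Two idempotents of different sizes can therefore be brought to a common size.\<close>

lemma idem_act_extend:
  assumes p: "(n, p) \<in> idems R" and N: "n \<le> N" and x: "x \<in> HX B"
  shows "idem_act \<U> H R B (N, p) x = idem_act \<U> H R B (n, p) x"
proof (rule idem_act_eqI[OF idems_extend[OF p N] idem_act_closed[OF p x]])
  have n: "n \<ge> 1" "N \<ge> 1" and h: "tmat p \<in> lca_hom B (mat_lca n T)"
    using p N tmat_hom by (auto simp: T.A.idems_iff)
  have "corner_mor \<U> H N T (idem_act \<U> H R B (n, p) x) = mor_mat n T N T (\<lambda>x. x) (corner_mor \<U> H n T (idem_act \<U> H R B (n, p) x))"
    by (rule mor_incl_corner[OF T n(1) N idem_act_closed[OF p x], symmetric])
  also have "\<dots> = mor_mat n T N T (\<lambda>x. x) (mor_into B n T (tmat p) x)"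
    by (simp only: corner_idem_act[OF p x])
  also have "\<dots> = mor_into B N T (tmat p) x"
    by (rule mor_mat_into[OF B T n(1) T n(2) h T.T.mat_inclusion_hom[OF N] x])
  finally show "corner_mor \<U> H N T (idem_act \<U> H R B (n, p) x) = mor_into B N T (tmat p) x" .
qed

text \<open>At a common size \<open>N\<close>, an equivalence between \<open>p\<close> and
  \<open>q\<close> provides linear maps \<open>b \<mapsto> u' \<otimes> b\<close> and
  \<open>b \<mapsto> v' \<otimes> b\<close> that link the two homomorphisms
  \<open>b \<mapsto> p \<otimes> b\<close> and \<open>b \<mapsto> q \<otimes> b\<close> as in
  \<open>mor_linked\<close>.\<close>

lemma idem_act_equiv:
  assumes a: "a \<in> idems R" and b: "b \<in> idems R" and ab: "idem_equiv R a b" and x: "x \<in> HX B"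
  shows "idem_act \<U> H R B a x = idem_act \<U> H R B b x"
proof -
  obtain n p m q where [simp]: "a = (n, p)" "b = (m, q)" by (metis prod.exhaust)
  define N where "N = max n m"
  have nm: "n \<le> N" "m \<le> N" "N \<ge> 1" using a by (auto simp: N_def T.A.idems_iff)
  obtain u v where u0: "u \<in> mats R n m" and v0: "v \<in> mats R m n" and uv: "mat_mult R m u v = p" "mat_mult R n v u = q"
    using ab by (auto simp: idem_equiv_def)
  interpret M: top_alg "mat_lca N R" by (rule T.A.top_alg_mat)
  let ?M = "mat_lca N R"
  have pq: "p \<in> carrier ?M" "q \<in> carrier ?M" "p \<otimes>\<^bsub>?M\<^esub> p = p" "q \<otimes>\<^bsub>?M\<^esub> q = q"
    using idems_extend[of n p N] idems_extend[of m q N] a b nm by (simp_all add: T.A.idems_iff)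
  have u: "u \<in> carrier ?M" and v: "v \<in> carrier ?M"
    using T.A.mats_mono[OF u0] T.A.mats_mono[OF v0] nm by simp_all
  have uv': "u \<otimes>\<^bsub>?M\<^esub> v = p" "v \<otimes>\<^bsub>?M\<^esub> u = q"
    using uv T.A.mat_mult_extend[OF u0 v0, of N m] T.A.mat_mult_extend[OF v0 u0, of N n] nm by simp_all
  \<comment> \<open>The witnesses are cut down by \<open>p\<close>: the equivalence only gives
    \<open>u v = p\<close> and \<open>v u = q\<close>, whereas \<open>mor_linked\<close> also asks
    for \<open>p u' = u' = u' q\<close> and \<open>q v' = v' = v' p\<close>.\<close>
  define u' where "u' = p \<otimes>\<^bsub>?M\<^esub> u"
  define v' where "v' = v \<otimes>\<^bsub>?M\<^esub> p"
  note [simp] = u v pq(1,2)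
  have pu: "p \<otimes>\<^bsub>?M\<^esub> u = u \<otimes>\<^bsub>?M\<^esub> q" and vp: "v \<otimes>\<^bsub>?M\<^esub> p = q \<otimes>\<^bsub>?M\<^esub> v"
    unfolding uv'[symmetric] using M.m_assoc[OF u v u] M.m_assoc[OF v u v] by (simp_all del: mat_lca_simps)
  have u'v': "u' \<in> carrier ?M" "v' \<in> carrier ?M"
    unfolding u'_def v'_def by (intro M.m_closed u v pq(1,2))+
  have ids: "p \<otimes>\<^bsub>?M\<^esub> u' = u'" "u' \<otimes>\<^bsub>?M\<^esub> q = u'" "u' \<otimes>\<^bsub>?M\<^esub> v' = p" "v' \<otimes>\<^bsub>?M\<^esub> u' = q" "q \<otimes>\<^bsub>?M\<^esub> v' = v'" "v' \<otimes>\<^bsub>?M\<^esub> p = v'"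
  proof -
    show "p \<otimes>\<^bsub>?M\<^esub> u' = u'" unfolding u'_def using M.m_assoc[OF pq(1) pq(1) u] pq(3) by simp
    show "u' \<otimes>\<^bsub>?M\<^esub> q = u'" unfolding u'_def pu using M.m_assoc[OF u pq(2) pq(2)] pq(4) by simp
    show "v' \<otimes>\<^bsub>?M\<^esub> p = v'" unfolding v'_def using M.m_assoc[OF v pq(1) pq(1)] pq(3) by simp
    show "q \<otimes>\<^bsub>?M\<^esub> v' = v'" unfolding v'_def vp using M.m_assoc[OF pq(2) pq(2) v] pq(4) by simp
    have "u' \<otimes>\<^bsub>?M\<^esub> v' = p \<otimes>\<^bsub>?M\<^esub> (u \<otimes>\<^bsub>?M\<^esub> v') "
      unfolding u'_def by (rule M.m_assoc[OF pq(1) u u'v'(2)])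
    also have "u \<otimes>\<^bsub>?M\<^esub> v' = (u \<otimes>\<^bsub>?M\<^esub> v) \<otimes>\<^bsub>?M\<^esub> p"
      unfolding v'_def by (rule M.m_assoc[OF u v pq(1), symmetric])
    finally show "u' \<otimes>\<^bsub>?M\<^esub> v' = p" unfolding uv' pq(3) .
    have "v' \<otimes>\<^bsub>?M\<^esub> u' = q \<otimes>\<^bsub>?M\<^esub> (v \<otimes>\<^bsub>?M\<^esub> u')"
      unfolding v'_def vp by (rule M.m_assoc[OF pq(2) v u'v'(1)])
    also have "v \<otimes>\<^bsub>?M\<^esub> u' = (v \<otimes>\<^bsub>?M\<^esub> u) \<otimes>\<^bsub>?M\<^esub> q"
      unfolding u'_def pu by (rule M.m_assoc[OF v u pq(2), symmetric])
    finally show "v' \<otimes>\<^bsub>?M\<^esub> u' = q" unfolding uv' pq(4) .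
  qed
  note mats = pq(1,2) u'v'
  note toD = lca_homD[OF to_mat_hom[OF T nm(3)], unfolded mat_lca_simps]
  have tm: "to_mat \<U> N T (tmat y b) \<otimes>\<^bsub>mat_obj \<U> N T\<^esub> to_mat \<U> N T (tmat z b') = to_mat \<U> N T (tmat (y \<otimes>\<^bsub>?M\<^esub> z) (b \<otimes>\<^bsub>B\<^esub> b'))"
    if "y \<in> carrier ?M" "z \<in> carrier ?M" "b \<in> carrier B" "b' \<in> carrier B" for y z b b'
    using that tmat_mats by (simp add: toD(3)[symmetric] tmat_mult)
  have lin: "(\<lambda>b. to_mat \<U> N T (tmat y b)) \<in> lca_lin B (mat_obj \<U> N T)" if "y \<in> carrier ?M" for y
    using that lca_lin_comp[OF tmat_lin lca_hom_lin[OF to_mat_hom[OF T nm(3)]]] by (simp add: o_def)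
  have hom: "(\<lambda>b. to_mat \<U> N T (tmat y b)) \<in> lca_hom B (mat_obj \<U> N T)" if "y \<in> carrier ?M" "y \<otimes>\<^bsub>?M\<^esub> y = y" for y
    using that by (intro into_mat_hom[OF T nm(3)] tmat_hom) simp_all
  have "mor_into B N T (tmat p) x = mor_into B N T (tmat q) x"
    by (rule mor_linked[OF B mat_obj[OF T nm(3)] hom[OF pq(1,3)] hom[OF pq(2,4)] lin[OF u'v'(1)] lin[OF u'v'(2)] _ _ _ _ _ _ x])
      (simp_all only: tm mats ids)
  then have "idem_act \<U> H R B (N, p) x = idem_act \<U> H R B (N, q) x"
    by (simp add: idem_act_eq)
  then show ?thesis using idem_act_extend[OF _ nm(1) x] idem_act_extend[OF _ nm(2) x] a b by simp
qed

text \<open>Moved to the lower block, \<open>q\<close> becomes an idempotent \<open>q'\<close> that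
  is orthogonal to \<open>p\<close> and equivalent to \<open>q\<close>; its row and column shifts
  are the witnesses. \<open>mor_orthogonal_sum\<close> then splits the action of
  \<open>p + q'\<close>.\<close>

lemma idem_act_sum:
  assumes a: "a \<in> idems R" and b: "b \<in> idems R" and x: "x \<in> HX B"
  shows "idem_act \<U> H R B (idem_sum R a b) x = idem_act \<U> H R B a x \<otimes>\<^bsub>obj H T\<^esub> idem_act \<U> H R B b x"
proof -
  obtain n p m q where [simp]: "a = (n, p)" "b = (m, q)" by (metis prod.exhaust)
  have p: "n \<ge> 1" "p \<in> mats R n n" "mat_mult R n p p = p" and q: "m \<ge> 1" "q \<in> mats R m m" "mat_mult R m q q = q"
    using a b by (auto simp: T.A.idems_iff)
  define N where "N = n + m"
  have N: "N \<ge> 1" "n \<le> N" using p by (auto simp: N_def)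
  define q' where "q' = place R n n q"
  have q'm: "q' \<in> mats R N N" unfolding q'_def N_def using T.A.place_mats[OF q(2)] by simp
  have q'i: "(N, q') \<in> idems R"
    using N(1) q'm T.A.mat_mult_place[OF q(2) q(2), of n N n n] q by (simp add: T.A.idems_iff q'_def N_def)
  have eq: "idem_equiv R (N, q') (m, q)"
  proof -
    have "place R n 0 q \<in> mats R N m" "place R 0 n q \<in> mats R m N"
      unfolding N_def by (rule T.A.place_mats[OF q(2)]; simp)+
    moreover have "mat_mult R m (place R n 0 q) (place R 0 n q) = q'"
      using T.A.mat_mult_place[OF q(2) q(2), of 0 m n n] q by (simp add: q'_def)
    moreover have "mat_mult R N (place R 0 n q) (place R n 0 q) = q"
      using T.A.mat_mult_place[OF q(2) q(2), of n N 0 0] q by (simp add: N_def)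
    ultimately show ?thesis by (auto simp: idem_equiv_def)
  qed
  have pN: "(N, p) \<in> idems R" using idems_extend[of n p N] a N by simp
  then have pN': "p \<in> mats R N N" "mat_mult R N p p = p" by (auto simp: T.A.idems_iff)
  have q'N: "mat_mult R N q' q' = q'" using q'i by (simp add: T.A.idems_iff)
  have pq': "mat_mult R N p q' = (\<lambda>_. \<zero>\<^bsub>R\<^esub>)" "mat_mult R N q' p = (\<lambda>_. \<zero>\<^bsub>R\<^esub>)"
    using T.A.mat_mult_place_disjoint[OF p(2) q(2), of 0 n N 0 n] T.A.mat_mult_place_disjoint[OF q(2) p(2), of n 0 N n 0]
    by (simp_all add: q'_def)
  note toh = to_mat_hom[OF T N(1)]
  note toD = lca_homD[OF toh, unfolded mat_lca_simps]
  interpret Z: lc_alg "mat_obj \<U> N T" using mat_obj[OF T N(1)] by (rule lc_alg)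
  have z: "to_mat \<U> N T (\<lambda>_. \<zero>\<^bsub>T\<^esub>) = \<zero>\<^bsub>mat_obj \<U> N T\<^esub>"
    using toD(4)[of "\<lambda>_. \<zero>\<^bsub>T\<^esub>" 0] toD(1)[of "\<lambda>_. \<zero>\<^bsub>T\<^esub>"] by simp
  have tz: "tmat (\<lambda>_. \<zero>\<^bsub>R\<^esub>) b = (\<lambda>_. \<zero>\<^bsub>T\<^esub>)" if "b \<in> carrier B" for b
    using that by (simp add: tmat_def)
  have orth: "to_mat \<U> N T (tmat p b) \<otimes>\<^bsub>mat_obj \<U> N T\<^esub> to_mat \<U> N T (tmat q' b') = \<zero>\<^bsub>mat_obj \<U> N T\<^esub>"
    "to_mat \<U> N T (tmat q' b) \<otimes>\<^bsub>mat_obj \<U> N T\<^esub> to_mat \<U> N T (tmat p b') = \<zero>\<^bsub>mat_obj \<U> N T\<^esub>"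
    if b: "b \<in> carrier B" "b' \<in> carrier B" for b b'
    using b by (simp_all add: toD(3)[symmetric] tmat_mats[OF pN'(1)] tmat_mats[OF q'm]
        tmat_mult[OF pN'(1) q'm] tmat_mult[OF q'm pN'(1)] pq' tz z)
  define s where "s = (\<lambda>ij. p ij \<oplus>\<^bsub>R\<^esub> q' ij)"
  have s: "idem_sum R a b = (N, s)"
    using T.A.idem_sum_place[OF p(2) q(2)] by (simp add: N_def s_def q'_def)
  have si: "(N, s) \<in> idems R" using T.A.idem_sum_closed[OF a b] s by simp
  have st: "to_mat \<U> N T (tmat s b) = to_mat \<U> N T (tmat p b) \<oplus>\<^bsub>mat_obj \<U> N T\<^esub> to_mat \<U> N T (tmat q' b)"
    if b: "b \<in> carrier B" for b
  proof -
    have "tmat s b = (\<lambda>ij. tmat p b ij \<oplus>\<^bsub>T\<^esub> tmat q' b ij)"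
      using b T.A.mats_carrier[OF pN'(1)] T.A.mats_carrier[OF q'm] by (simp add: tmat_def s_def T.\<tau>_add_left)
    then show ?thesis using toD(2)[OF tmat_mats[OF pN'(1) b] tmat_mats[OF q'm b]] by simp
  qed
  note h = into_mat_hom[OF T N(1) tmat_hom[OF pN']] into_mat_hom[OF T N(1) tmat_hom[OF q'm q'N]]
  have os: "(\<lambda>b. to_mat \<U> N T (tmat p b) \<oplus>\<^bsub>mat_obj \<U> N T\<^esub> to_mat \<U> N T (tmat q' b)) \<in> lca_hom B (mat_obj \<U> N T)"
    "mor H B (mat_obj \<U> N T) (\<lambda>b. to_mat \<U> N T (tmat p b) \<oplus>\<^bsub>mat_obj \<U> N T\<^esub> to_mat \<U> N T (tmat q' b)) x
      = mor_into B N T (tmat p) x \<otimes>\<^bsub>obj H (mat_obj \<U> N T)\<^esub> mor_into B N T (tmat q') x"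
    by (rule mor_orthogonal_sum[OF B mat_obj[OF T N(1)] h orth x]; assumption)+
  have sh: "(\<lambda>b. to_mat \<U> N T (tmat s b)) \<in> lca_hom B (mat_obj \<U> N T)"
    by (rule lca_hom_cong[OF T.B.lc_alg_axioms os(1)]) (rule st)
  have sum: "mor_into B N T (tmat s) x = mor_into B N T (tmat p) x \<otimes>\<^bsub>obj H (mat_obj \<U> N T)\<^esub> mor_into B N T (tmat q') x"
    unfolding os(2)[symmetric] by (rule mor_cong[OF B mat_obj[OF T N(1)] sh os(1) st x])
  interpret c: group_hom "obj H T" "obj H (mat_obj \<U> N T)" "corner_mor \<U> H N T"
    by (rule corner_mor_hom[OF T N(1)])
  have "idem_act \<U> H R B (N, s) x = idem_act \<U> H R B (N, p) x \<otimes>\<^bsub>obj H T\<^esub> idem_act \<U> H R B (N, q') x"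
    using idem_act_closed[OF pN x] idem_act_closed[OF q'i x]
    by (intro idem_act_eqI[OF si]) (simp_all add: corner_idem_act[OF pN x] corner_idem_act[OF q'i x] sum)
  then show ?thesis
    using idem_act_extend[of n p N x] idem_act_equiv[OF q'i b] eq a N x s by simp
qed

text \<open>The stabilising idempotent \<open>r\<close> contributes the same factor on both sides
  and cancels in the group \<open>H(T)\<close>. The identity is stated without inverses so that it
  can be used in either direction.\<close>

lemma idem_act_K0_rel:
  assumes rel: "((p, q), (p', q')) \<in> K0_rel R" and x: "x \<in> HX B"
  shows "idem_act \<U> H R B p x \<otimes>\<^bsub>obj H T\<^esub> idem_act \<U> H R B q' x = idem_act \<U> H R B p' x \<otimes>\<^bsub>obj H T\<^esub> idem_act \<U> H R B q x"
proof -
  obtain r where i: "p \<in> idems R" "q \<in> idems R" "p' \<in> idems R" "q' \<in> idems R" "r \<in> idems R"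
    and e: "idem_equiv R (idem_sum R (idem_sum R p q') r) (idem_sum R (idem_sum R p' q) r)"
    using rel unfolding K0_rel_def mem_Collect_eq prod.case by blast
  note s = T.A.idem_sum_closed
  have "idem_act \<U> H R B (idem_sum R (idem_sum R p q') r) x = idem_act \<U> H R B (idem_sum R (idem_sum R p' q) r) x"
    by (rule idem_act_equiv[OF _ _ e x]) (intro s i)+
  then have "(idem_act \<U> H R B p x \<otimes>\<^bsub>obj H T\<^esub> idem_act \<U> H R B q' x) \<otimes>\<^bsub>obj H T\<^esub> idem_act \<U> H R B r x
    = (idem_act \<U> H R B p' x \<otimes>\<^bsub>obj H T\<^esub> idem_act \<U> H R B q x) \<otimes>\<^bsub>obj H T\<^esub> idem_act \<U> H R B r x"
    by (simp only: idem_act_sum i s x)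
  then show ?thesis
    by (rule G.right_cancel[THEN iffD1, rotated -1]) (intro G.m_closed idem_act_closed i x)+
qed

text \<open>A 1 by 1 idempotent acts through \<open>b \<mapsto> e \<otimes> b\<close> itself. This
  connects the action with the homomorphisms \<open>\<alpha>' \<otimes> id\<close> and
  \<open>\<alpha>bar' \<otimes> id\<close>, which send \<open>1 \<otimes> b\<close> to such
  elements.\<close>

lemma idem_act_corner:
  assumes e: "e \<in> carrier R" "e \<otimes>\<^bsub>R\<^esub> e = e" and x: "x \<in> HX B"
  shows "(1, corner R e) \<in> idems R" "\<tau> e \<in> lca_hom B T" "idem_act \<U> H R B (1, corner R e) x = mor H B T (\<tau> e) x"
proof -
  show i: "(1, corner R e) \<in> idems R"
    using e T.A.matrix_unit_mats[of e 0 1] lca_homD(3)[OF T.A.matrix_unit_hom[of 0 1] e(1) e(1)]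
    by (simp add: T.A.idems_iff corner_matrix_unit)
  show h: "\<tau> e \<in> lca_hom B T"
    by (rule lca_homI[OF T.\<tau>_right_lin[OF e(1)]]) (simp add: T.\<tau>_mult e)
  have one: "(1::nat) \<ge> 1" by simp
  have "corner_mor \<U> H 1 T (mor H B T (\<tau> e) x) = mor_into B 1 T (\<lambda>b. matrix_unit T 0 (\<tau> e b)) x"
    unfolding corner_mor_eq corner_matrix_unit by (rule mor_into_pre[OF B T T one h matrix_unit_hom[OF T] x]) simp
  also have "\<dots> = mor_into B 1 T (tmat (corner R e)) x"
  proof (rule mor_into_cong[OF B T one _ _ _ x])
    show "tmat (corner R e) \<in> lca_hom B (mat_lca 1 T)"
      using i tmat_hom by (simp add: T.A.idems_iff)
    show "matrix_unit T 0 (\<tau> e b) = tmat (corner R e) b" if "b \<in> carrier B" for b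
      using that by (simp add: matrix_unit_def corner_def tmat_def fun_eq_iff)
    then show "(\<lambda>b. matrix_unit T 0 (\<tau> e b)) \<in> lca_hom B (mat_lca 1 T)"
      by (intro lca_hom_cong[OF T.B.lc_alg_axioms \<open>tmat (corner R e) \<in> lca_hom B (mat_lca 1 T)\<close>])
  qed
  finally show "idem_act \<U> H R B (1, corner R e) x = mor H B T (\<tau> e) x"
    by (intro idem_act_eqI[OF i mor_closed[OF B T h x]])
qed

end

text \<open>Applying \<open>f \<otimes> id\<close> to all entries turns \<open>p \<otimes> b\<close>
  into \<open>f(p) \<otimes> b\<close>, and the same entrywise homomorphism respects the upper left
  corner.\<close>

lemma (in stable_functor) idem_act_natural:
  assumes R: "lc_alg R" "represented \<U> R" and S: "lc_alg S" "represented \<U> S" and B: "B \<in> \<U>"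
    and f: "f \<in> lca_hom R S" and a: "a \<in> idems R" and x: "x \<in> HX B"
  shows "mor H (tensor_obj \<U> R B) (tensor_obj \<U> S B) (tensor_map \<U> R S B f) (idem_act \<U> H R B a x)
    = idem_act \<U> H S B (map_idem f a) x"
proof -
  interpret R: idem_action \<U> H R B
    by (intro idem_action.intro idem_action_axioms.intro stable_functor_axioms R B)
  interpret S: idem_action \<U> H S B
    by (intro idem_action.intro idem_action_axioms.intro stable_functor_axioms S B)
  interpret TT: lc_alg_pair R.T S.T ..
  interpret f: complex_alg_hom R S f by unfold_locales (rule lca_homD(6)[OF f])
  obtain n p where [simp]: "a = (n, p)" by (metis prod.exhaust)
  have ni: "(n, p) \<in> idems R" "(n, f \<circ> p) \<in> idems S" using a f.map_idems[OF a] by (simp_all add: map_idem_def)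
  then have p: "n \<ge> 1" "p \<in> mats R n n" "mat_mult R n p p = p" "0 < n" and fp: "f \<circ> p \<in> mats S n n" "mat_mult S n (f \<circ> p) (f \<circ> p) = f \<circ> p"
    by (auto simp: R.T.A.idems_iff S.T.A.idems_iff)
  define g where "g = tensor_map \<U> R S B f"
  have g: "g \<in> lca_hom R.T S.T" and g\<tau>: "\<And>a b. a \<in> carrier R \<Longrightarrow> b \<in> carrier B \<Longrightarrow> g (R.\<tau> a b) = S.\<tau> (f a) b"
    using tensor_map[OF R S B f] by (simp_all add: g_def)
  have gl: "g \<in> lca_lin R.T S.T" by (rule lca_hom_lin[OF g])
  let ?E = "entrywise S.T n (\<lambda>_ _. g)"
  have E: "?E \<in> lca_hom (mat_lca n R.T) (mat_lca n S.T)"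
    by (rule TT.entrywise_hom[OF gl]) (simp add: lca_homD[OF g])
  let ?y = "idem_act \<U> H R B (n, p) x"
  have y: "?y \<in> HX R.T" by (rule R.idem_act_closed[OF ni(1) x])
  have "corner_mor \<U> H n S.T (mor H R.T S.T g ?y) = mor_mat n R.T n S.T ?E (corner_mor \<U> H n R.T ?y)"
    unfolding corner_mor_eq corner_matrix_unit
    by (rule mor_entrywise[OF R.T S.T p(4) gl g _ y, symmetric]) (simp add: lca_homD[OF g])
  also have "\<dots> = mor_mat n R.T n S.T ?E (mor_into B n R.T (R.tmat p) x)"
    by (simp only: R.corner_idem_act[OF ni(1) x])
  also have "\<dots> = mor_into B n S.T (\<lambda>b. ?E (R.tmat p b)) x"
    by (rule mor_mat_into[OF B R.T p(1) S.T p(1) R.tmat_hom[OF p(2,3)] E x])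
  also have "\<dots> = mor_into B n S.T (S.tmat (f \<circ> p)) x"
  proof (rule mor_into_cong[OF B S.T p(1) _ S.tmat_hom[OF fp] _ x])
    show "?E (R.tmat p b) = S.tmat (f \<circ> p) b" if b: "b \<in> carrier B" for b
    proof (rule S.T.T.mats_eqI[OF _ S.tmat_mats[OF fp(1) b]])
      show "?E (R.tmat p b) \<in> mats S.T n n"
        using lca_homD(1)[OF E] R.tmat_mats[OF p(2) b] by simp
      fix i j assume "i < n" "j < n"
      then show "?E (R.tmat p b) (i, j) = S.tmat (f \<circ> p) b (i, j)"
        using g\<tau>[OF R.T.A.mats_carrier[OF p(2)] b] by (simp add: entrywise_def R.tmat_def S.tmat_def)
    qed
    show "(\<lambda>b. ?E (R.tmat p b)) \<in> lca_hom B (mat_lca n S.T)"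
      using lca_hom_comp[OF R.tmat_hom[OF p(2,3)] E] by (simp add: o_def)
  qed
  finally show ?thesis
    using S.idem_act_eqI[OF ni(2) mor_closed[OF R.T S.T g y]] by (simp add: map_idem_def g_def)
qed

subsection \<open>Quasihomomorphisms\<close>

lemma D_alg_simps [simp]:
  "carrier (D_alg B1 B2 Bhat i \<alpha>) = carrier B1 \<times> carrier B2"
  "(a, b) \<otimes>\<^bsub>D_alg B1 B2 Bhat i \<alpha>\<^esub> (a', b') = (a \<otimes>\<^bsub>B1\<^esub> a',
     inv_into (carrier B2) i (\<alpha> a \<otimes>\<^bsub>Bhat\<^esub> i b') \<oplus>\<^bsub>B2\<^esub> inv_into (carrier B2) i (i b \<otimes>\<^bsub>Bhat\<^esub> \<alpha> a') \<oplus>\<^bsub>B2\<^esub> b \<otimes>\<^bsub>B2\<^esub> b')"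
  "\<zero>\<^bsub>D_alg B1 B2 Bhat i \<alpha>\<^esub> = (\<zero>\<^bsub>B1\<^esub>, \<zero>\<^bsub>B2\<^esub>)"
  "(a, b) \<oplus>\<^bsub>D_alg B1 B2 Bhat i \<alpha>\<^esub> (a', b') = (a \<oplus>\<^bsub>B1\<^esub> a', b \<oplus>\<^bsub>B2\<^esub> b')"
  "c \<odot>\<^bsub>D_alg B1 B2 Bhat i \<alpha>\<^esub> (a, b) = (c \<odot>\<^bsub>B1\<^esub> a, c \<odot>\<^bsub>B2\<^esub> b)"
  "topo (D_alg B1 B2 Bhat i \<alpha>) = prod_topology (topo B1) (topo B2)"
  by (simp_all add: D_alg_def)

locale quasihomomorphism = lc_alg_pair B1 B2 for B1 :: "'a lca" and B2 :: "'b lca" +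
  fixes Bhat :: "(complex, 'c) module" and i \<alpha> \<alpha>bar
  assumes quasihom: "quasihom B1 B2 Bhat i \<alpha> \<alpha>bar"
begin

sublocale h: complex_alg Bhat
  using quasihom by unfold_locales (simp add: quasihom_def)

sublocale ih: complex_alg_hom B2 Bhat i
  using quasihom by unfold_locales (simp add: quasihom_def)

sublocale \<alpha>h: complex_alg_hom B1 Bhat \<alpha>
  using quasihom by unfold_locales (simp add: quasihom_def)

sublocale \<alpha>barh: complex_alg_hom B1 Bhat \<alpha>bar
  using quasihom by unfold_locales (simp add: quasihom_def)

lemma i_inj: "inj_on i (carrier B2)"
  using quasihom by (simp add: quasihom_def)

definition j where "j = inv_into (carrier B2) i"

lemma j: "y \<in> i ` carrier B2 \<Longrightarrow> j y \<in> carrier B2" "y \<in> i ` carrier B2 \<Longrightarrow> i (j y) = y"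
  unfolding j_def by (rule inv_into_into f_inv_into_f, assumption)+

lemma j_i: "b \<in> carrier B2 \<Longrightarrow> j (i b) = b"
  unfolding j_def by (rule inv_into_f_f[OF i_inj])

lemma in_image:
  "a \<in> carrier B1 \<Longrightarrow> b \<in> carrier B2 \<Longrightarrow> \<alpha> a \<otimes>\<^bsub>Bhat\<^esub> i b \<in> i ` carrier B2"
  "a \<in> carrier B1 \<Longrightarrow> b \<in> carrier B2 \<Longrightarrow> i b \<otimes>\<^bsub>Bhat\<^esub> \<alpha> a \<in> i ` carrier B2"
  "a \<in> carrier B1 \<Longrightarrow> \<alpha> a \<ominus>\<^bsub>Bhat\<^esub> \<alpha>bar a \<in> i ` carrier B2"
  using quasihom by (simp_all add: quasihom_def)

text \<open>The quasihomomorphism condition concerns the difference of \<alpha> and \<alpha>bar,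
  while \<open>D_split_bar\<close> contains the opposite difference; this lemma converts one into
  the other.\<close>

lemma diff_bar: "a \<in> carrier B1 \<Longrightarrow> \<alpha>bar a \<ominus>\<^bsub>Bhat\<^esub> \<alpha> a = i ((-1) \<odot>\<^bsub>B2\<^esub> j (\<alpha> a \<ominus>\<^bsub>Bhat\<^esub> \<alpha>bar a))"
proof -
  assume a: "a \<in> carrier B1"
  have "i ((-1) \<odot>\<^bsub>B2\<^esub> j (\<alpha> a \<ominus>\<^bsub>Bhat\<^esub> \<alpha>bar a)) = (-1) \<odot>\<^bsub>Bhat\<^esub> (\<alpha> a \<ominus>\<^bsub>Bhat\<^esub> \<alpha>bar a)"
    using j[OF in_image(3)[OF a]] by (simp add: ih.smult)
  then show ?thesis
    using a by (simp add: h.sub_smult \<alpha>h.closed \<alpha>barh.closed h.smult_add_right h.smult_smult h.a_comm)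
qed

abbreviation "D \<equiv> D_alg B1 B2 Bhat i \<alpha>"

text \<open>The homomorphism from \<open>D\<close> to the ambient algebra that is \<alpha> on the
  first summand and the inclusion on the second. Together with the first projection it is injective,
  so identities in \<open>D\<close> can be verified in \<open>B1\<close> and in \<open>Bhat\<close>,
  where multiplication has no correction terms.\<close>

definition \<Theta> where "\<Theta> x = \<alpha> (fst x) \<oplus>\<^bsub>Bhat\<^esub> i (snd x)"

lemma \<Theta>_closed: "x \<in> carrier D \<Longrightarrow> \<Theta> x \<in> carrier Bhat"
  by (auto simp: \<Theta>_def \<alpha>h.closed ih.closed)

lemma D_closed: "x \<in> carrier D \<Longrightarrow> y \<in> carrier D \<Longrightarrow> x \<otimes>\<^bsub>D\<^esub> y \<in> carrier D"
  "x \<in> carrier D \<Longrightarrow> y \<in> carrier D \<Longrightarrow> x \<oplus>\<^bsub>D\<^esub> y \<in> carrier D"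
  "x \<in> carrier D \<Longrightarrow> c \<odot>\<^bsub>D\<^esub> x \<in> carrier D"
  by (auto simp: j_def[symmetric] j in_image)

lemma \<Theta>_mult: "x \<in> carrier D \<Longrightarrow> y \<in> carrier D \<Longrightarrow> \<Theta> (x \<otimes>\<^bsub>D\<^esub> y) = \<Theta> x \<otimes>\<^bsub>Bhat\<^esub> \<Theta> y"
  by (cases x; cases y)
    (simp add: \<Theta>_def j_def[symmetric] j in_image ih.add ih.mult \<alpha>h.mult \<alpha>h.closed ih.closed h.l_distr h.r_distr h.a_ac)

lemma \<Theta>_add: "x \<in> carrier D \<Longrightarrow> y \<in> carrier D \<Longrightarrow> \<Theta> (x \<oplus>\<^bsub>D\<^esub> y) = \<Theta> x \<oplus>\<^bsub>Bhat\<^esub> \<Theta> y"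
  by (cases x; cases y) (simp add: \<Theta>_def ih.add \<alpha>h.add \<alpha>h.closed ih.closed h.a_ac)

lemma \<Theta>_smult: "x \<in> carrier D \<Longrightarrow> \<Theta> (c \<odot>\<^bsub>D\<^esub> x) = c \<odot>\<^bsub>Bhat\<^esub> \<Theta> x"
  by (cases x) (simp add: \<Theta>_def ih.smult \<alpha>h.smult \<alpha>h.closed ih.closed h.smult_add_right)

lemma D_eqI:
  assumes "x \<in> carrier D" "y \<in> carrier D" "fst x = fst y" "\<Theta> x = \<Theta> y"
  shows "x = y"
proof -
  have "i (snd x) = i (snd y)"
    using assms h.r_neg1[of "\<alpha> (fst y)" "i (snd x)"] h.r_neg1[of "\<alpha> (fst y)" "i (snd y)"]
    by (auto simp: \<Theta>_def \<alpha>h.closed ih.closed)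
  then have "snd x = snd y" using assms inj_onD[OF i_inj] by auto
  then show ?thesis using assms by (simp add: prod_eq_iff)
qed

lemma fst_D [simp]:
  "fst (x \<otimes>\<^bsub>D\<^esub> y) = fst x \<otimes>\<^bsub>B1\<^esub> fst y" "fst (x \<oplus>\<^bsub>D\<^esub> y) = fst x \<oplus>\<^bsub>B1\<^esub> fst y" "fst (c \<odot>\<^bsub>D\<^esub> x) = c \<odot>\<^bsub>B1\<^esub> fst x"
  by (cases x; cases y; simp)+

lemma complex_algebra_D: "complex_algebra D"
proof -
  have zero: "\<zero>\<^bsub>D\<^esub> \<in> carrier D" by simp
  have fc: "fst x \<in> carrier B1" if "x \<in> carrier D" for x using that by auto
  note cl = D_closed zero \<Theta>_closed fc
  have \<Theta>_zero: "\<Theta> \<zero>\<^bsub>D\<^esub> = \<zero>\<^bsub>Bhat\<^esub>" by (simp add: \<Theta>_def)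
  note \<Theta> = \<Theta>_mult \<Theta>_add \<Theta>_smult \<Theta>_zero
  have fz: "fst \<zero>\<^bsub>D\<^esub> = \<zero>\<^bsub>B1\<^esub>" by simp
  note B1 = A.smult_add_left A.smult_add_right A.smult_smult A.l_distr A.r_distr A.m_assoc A.smult_mult_left A.smult_mult_right A.a_ac
  note h = h.smult_add_left h.smult_add_right h.smult_smult h.l_distr h.r_distr h.m_assoc h.smult_mult_left h.smult_mult_right h.a_ac
  show ?thesis
    by (rule complex_algebraI; (intro cl | rule D_eqI); (intro cl)?; assumption?)
      (simp_all only: \<Theta> cl B1 h fz fst_D A.l_zero h.l_zero A.smult_1 h.smult_1 A.smult_0 h.smult_0)
qed

lemma continuous_j:
  "continuous_map (prod_topology (topo B1) (topo B2)) (topo B2) (\<lambda>(a, b). j (\<alpha> a \<otimes>\<^bsub>Bhat\<^esub> i b))"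
  "continuous_map (prod_topology (topo B2) (topo B1)) (topo B2) (\<lambda>(b, a). j (i b \<otimes>\<^bsub>Bhat\<^esub> \<alpha> a))"
  "continuous_map (topo B1) (topo B2) (\<lambda>a. j (\<alpha> a \<ominus>\<^bsub>Bhat\<^esub> \<alpha>bar a))"
  using quasihom by (simp_all add: quasihom_def j_def)

lemma lc_algebra_D: "lc_algebra D"
proof (rule lc_algebra_prodI[OF complex_algebra_D])
  let ?X = "prod_topology (topo D) (topo D)"
  have "(\<lambda>(x, y). x \<otimes>\<^bsub>D\<^esub> y) = (\<lambda>z. (fst (fst z) \<otimes>\<^bsub>B1\<^esub> fst (snd z),
    j (\<alpha> (fst (fst z)) \<otimes>\<^bsub>Bhat\<^esub> i (snd (snd z))) \<oplus>\<^bsub>B2\<^esub> j (i (snd (fst z)) \<otimes>\<^bsub>Bhat\<^esub> \<alpha> (fst (snd z)))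
      \<oplus>\<^bsub>B2\<^esub> snd (fst z) \<otimes>\<^bsub>B2\<^esub> snd (snd z)))"
    by (auto simp: fun_eq_iff j_def)
  moreover have "continuous_map ?X (topo B2) (\<lambda>z. j (\<alpha> (fst (fst z)) \<otimes>\<^bsub>Bhat\<^esub> i (snd (snd z))))"
    using continuous_map_compose[OF continuous_map_pairedI[OF continuous_map_projections(1,4)] continuous_j(1)]
    by (simp add: o_def)
  moreover have "continuous_map ?X (topo B2) (\<lambda>z. j (i (snd (fst z)) \<otimes>\<^bsub>Bhat\<^esub> \<alpha> (fst (snd z))))"
    using continuous_map_compose[OF continuous_map_pairedI[OF continuous_map_projections(2,3)] continuous_j(2)]
    by (simp add: o_def)
  ultimately show "continuous_map ?X (topo D) (\<lambda>(x, y). x \<otimes>\<^bsub>D\<^esub> y)"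
    by (simp add: continuous_map_pairedI A.continuous_mult B.continuous_mult B.continuous_add continuous_map_projections)
qed simp_all

sublocale D: lc_alg D
  by unfold_locales (rule lc_algebra_D)

lemma D_incl_hom: "D_incl B1 \<in> lca_hom B2 D"
proof -
  have "D_incl B1 (x \<otimes>\<^bsub>B2\<^esub> y) = D_incl B1 x \<otimes>\<^bsub>D\<^esub> D_incl B1 y" if "x \<in> carrier B2" "y \<in> carrier B2" for x y
    using that j_i[of "\<zero>\<^bsub>B2\<^esub>"] by (simp add: D_incl_def j_def[symmetric] ih.closed)
  then show ?thesis
    by (auto simp: lca_hom_def alg_hom_def D_incl_def[abs_def] continuous_map_pairedI continuous_map_id[unfolded id_def])
qed

lemma D_split_hom: "D_split B2 \<in> lca_hom B1 D"
proof -
  have "D_split B2 (x \<otimes>\<^bsub>B1\<^esub> y) = D_split B2 x \<otimes>\<^bsub>D\<^esub> D_split B2 y" if "x \<in> carrier B1" "y \<in> carrier B1" for x y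
    using that j_i[of "\<zero>\<^bsub>B2\<^esub>"] by (simp add: D_split_def j_def[symmetric] \<alpha>h.closed)
  then show ?thesis
    by (auto simp: lca_hom_def alg_hom_def D_split_def[abs_def] continuous_map_pairedI continuous_map_id[unfolded id_def])
qed

text \<open>Composed with \<Theta> the splitting becomes \<alpha>bar, and composed with the first
  projection the identity. Both are homomorphisms, hence by \<open>D_eqI\<close> so is the
  splitting.\<close>

lemma D_split_bar_hom: "D_split_bar B2 Bhat i \<alpha> \<alpha>bar \<in> lca_hom B1 D"
proof -
  let ?s = "D_split_bar B2 Bhat i \<alpha> \<alpha>bar"
  have s: "?s a = (a, (-1) \<odot>\<^bsub>B2\<^esub> j (\<alpha> a \<ominus>\<^bsub>Bhat\<^esub> \<alpha>bar a))" if "a \<in> carrier B1" for a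
    using that by (simp add: D_split_bar_def diff_bar j_def[symmetric] j_i j in_image)
  have cl: "?s a \<in> carrier D" if "a \<in> carrier B1" for a
    using that by (simp add: s j in_image)
  have \<Theta>: "\<Theta> (?s a) = \<alpha>bar a" if "a \<in> carrier B1" for a
    using that by (simp add: s \<Theta>_def diff_bar[symmetric] h.add_sub_cancel \<alpha>h.closed \<alpha>barh.closed)
  have f: "fst (?s a) = a" for a by (simp add: D_split_bar_def)
  have "continuous_map (topo B1) (topo D) (\<lambda>a. (a, (-1) \<odot>\<^bsub>B2\<^esub> j (\<alpha> a \<ominus>\<^bsub>Bhat\<^esub> \<alpha>bar a)))"
    by (simp add: continuous_map_pairedI continuous_map_id[unfolded id_def] B.continuous_smult continuous_j(3))
  then have "continuous_map (topo B1) (topo D) ?s"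
    by (rule continuous_map_eq) (simp add: s)
  moreover have "?s (x \<oplus>\<^bsub>B1\<^esub> y) = ?s x \<oplus>\<^bsub>D\<^esub> ?s y" "?s (x \<otimes>\<^bsub>B1\<^esub> y) = ?s x \<otimes>\<^bsub>D\<^esub> ?s y" "?s (c \<odot>\<^bsub>B1\<^esub> x) = c \<odot>\<^bsub>D\<^esub> ?s x"
    if "x \<in> carrier B1" "y \<in> carrier B1" for x y c
    using that by (intro D_eqI; simp only: cl D_closed f fst_D \<Theta> \<Theta>_add \<Theta>_mult \<Theta>_smult A.a_closed A.m_closed A.smult_closed
        \<alpha>barh.add \<alpha>barh.mult \<alpha>barh.smult)+
  ultimately show ?thesis
    using cl by (simp add: lca_hom_def alg_hom_def del: D_alg_simps)
qed

lemma split_extension_D: "split_extension B2 D B1 (D_incl B1) fst (D_split B2)"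
proof (rule split_extensionI[OF D_incl_hom _ D_split_hom B.lc_algebra lc_algebra_D, where r = snd])
  show "fst \<in> lca_hom D B1"
    by (auto simp: lca_hom_def alg_hom_def continuous_map_fst)
  show "snd \<in> lca_lin D B2"
    by (auto simp: lca_lin_def continuous_map_snd)
qed (auto simp: D_incl_def D_split_def)

end

subsection \<open>Lifting a difference of idempotents along an ideal\<close>

definition mat2 :: "('a, 'm) ring_scheme \<Rightarrow> 'a \<Rightarrow> 'a \<Rightarrow> 'a \<Rightarrow> 'a \<Rightarrow> 'a matrix" where
  "mat2 R a b c d = (\<lambda>(i, j). if i = 0 \<and> j = 0 then a else if i = 0 \<and> j = 1 then b
     else if i = 1 \<and> j = 0 then c else if i = 1 \<and> j = 1 then d else \<zero>\<^bsub>R\<^esub>)"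

context complex_alg
begin

lemma mat2_mats [simp]:
  "a \<in> carrier R \<Longrightarrow> b \<in> carrier R \<Longrightarrow> c \<in> carrier R \<Longrightarrow> d \<in> carrier R \<Longrightarrow> mat2 R a b c d \<in> mats R 2 2"
  by (intro matsI) (auto simp: mat2_def)

lemma mat2_mult:
  assumes "a \<in> carrier R" "b \<in> carrier R" "c \<in> carrier R" "d \<in> carrier R"
    "a' \<in> carrier R" "b' \<in> carrier R" "c' \<in> carrier R" "d' \<in> carrier R"
  shows "mat_mult R 2 (mat2 R a b c d) (mat2 R a' b' c' d')
    = mat2 R (a \<otimes> a' \<oplus> b \<otimes> c') (a \<otimes> b' \<oplus> b \<otimes> d') (c \<otimes> a' \<oplus> d \<otimes> c') (c \<otimes> b' \<oplus> d \<otimes> d')"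
proof (rule ext, clarify)
  fix i j
  show "mat_mult R 2 (mat2 R a b c d) (mat2 R a' b' c' d') (i, j)
    = mat2 R (a \<otimes> a' \<oplus> b \<otimes> c') (a \<otimes> b' \<oplus> b \<otimes> d') (c \<otimes> a' \<oplus> d \<otimes> c') (c \<otimes> b' \<oplus> d \<otimes> d') (i, j)"
    using assms finsum_lessThan_2[of "\<lambda>l. mat2 R a b c d (i, l) \<otimes> mat2 R a' b' c' d' (l, j)"]
    by (cases "i = 0"; cases "i = 1"; cases "j = 0"; cases "j = 1") (simp_all add: mat_mult_def mat2_def)
qed

lemma mat2_diag: "(2, mat2 R a \<zero> \<zero> b) = idem_sum R (1, corner R a) (1, corner R b)"
  by (auto simp: idem_sum_def mat2_def corner_def fun_eq_iff)

lemma mat2_corner: "mat2 R a \<zero> \<zero> \<zero> = corner R a"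
  by (auto simp: mat2_def corner_def fun_eq_iff)

lemma corner_idem:
  assumes "e \<in> carrier R" "e \<otimes> e = e"
  shows "(1, corner R e) \<in> idems R"
  using assms by (auto simp: idems_iff mats_def corner_def mat_mult_def lessThan_Suc finsum_insert fun_eq_iff)

text \<open>With \<open>e' = 1 - e\<close> and the symmetry \<open>u = [[e, e'], [e', e]]\<close>, the matrix below is \<open>u diag(f, e') u\<close>.\<close>

lemma conjugate_idem:
  assumes c: "e \<in> carrier R" "e' \<in> carrier R" "f \<in> carrier R"
    and e: "e \<otimes> e = e" "e' \<otimes> e' = e'" "e \<otimes> e' = \<zero>" "e' \<otimes> e = \<zero>" and f: "f \<otimes> f = f"
    and unit: "f \<otimes> e \<oplus> f \<otimes> e' = f"
  defines "P \<equiv> (2, mat2 R (e \<otimes> f \<otimes> e \<oplus> e') (e \<otimes> f \<otimes> e') (e' \<otimes> f \<otimes> e) (e' \<otimes> f \<otimes> e'))"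
  shows "P \<in> idems R" "idem_equiv R P (idem_sum R (1, corner R f) (1, corner R e'))"
proof -
  have d: "a \<otimes> (a \<otimes> x) = a \<otimes> x" if "a \<otimes> a = a" "a \<in> carrier R" "x \<in> carrier R" for a x
    using m_assoc[OF that(2,2,3)] that(1) by simp
  have z: "a \<otimes> (b \<otimes> x) = \<zero>" if "a \<otimes> b = \<zero>" "a \<in> carrier R" "b \<in> carrier R" "x \<in> carrier R" for a b x
    using m_assoc[OF that(2,3,4)] that by simp
  note simps = m_assoc e f d[OF e(1)] d[OF e(2)] d[OF f] z[OF e(3)] z[OF e(4)]
  \<comment> \<open>These are \<open>u diag(f, e')\<close> and \<open>diag(f, e') u\<close>,
    multiplied out with the orthogonality of \<open>e\<close> and \<open>e'\<close>. Their products
    in the two orders are the conjugate \<open>u diag(f, e') u\<close> and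
    \<open>diag(f, e')\<close>.\<close>
  define X where "X = mat2 R (e \<otimes> f) e' (e' \<otimes> f) \<zero>"
  define Y where "Y = mat2 R (f \<otimes> e) (f \<otimes> e') e' \<zero>"
  have XY: "X \<in> mats R 2 2" "Y \<in> mats R 2 2" unfolding X_def Y_def using c by simp_all
  have xy: "mat_mult R 2 X Y = snd P"
    unfolding X_def Y_def P_def using c by (simp add: mat2_mult simps)
  \<comment> \<open>The hypothesis \<open>unit\<close> says that \<open>e + e'\<close> acts as a
    unit to the right of \<open>f\<close>; multiplied by \<open>f\<close>, it is the upper left
    entry of \<open>Y X\<close>.\<close>
  have unit': "f \<otimes> (e \<otimes> f) \<oplus> f \<otimes> (e' \<otimes> f) = f"
  proof -
    have "f \<otimes> (e \<otimes> f) \<oplus> f \<otimes> (e' \<otimes> f) = (f \<otimes> e \<oplus> f \<otimes> e') \<otimes> f" using c by (simp add: l_distr m_assoc)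
    then show ?thesis using unit f by simp
  qed
  have yx: "mat_mult R 2 Y X = mat2 R f \<zero> \<zero> e'"
    unfolding X_def Y_def using c unit' by (simp add: mat2_mult simps)
  have "mat_mult R 2 (snd P) (snd P) = mat_mult R 2 X (mat_mult R 2 (mat_mult R 2 Y X) Y)"
    unfolding xy[symmetric] using XY mat_mult_mats[OF XY, of 2] mat_mult_mats[OF XY(2,1), of 2]
      mat_mult_assoc[OF XY mat_mult_mats[OF XY], of 2 2 2] mat_mult_assoc[OF XY(2,1,2), of 2 2] by simp
  also have "mat_mult R 2 (mat_mult R 2 Y X) Y = Y"
    unfolding yx unfolding Y_def using c by (simp add: mat2_mult simps)
  finally show "P \<in> idems R"
    using mat_mult_mats[OF XY, of 2] by (simp add: P_def idems_iff xy)
  show "idem_equiv R P (idem_sum R (1, corner R f) (1, corner R e'))"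
    unfolding mat2_diag[symmetric] P_def idem_equiv_def prod.case
    using XY xy yx by (auto simp: P_def)
qed

end

lemma (in comm_group) difference_eqI:
  assumes c: "p \<in> carrier G" "q' \<in> carrier G" "p' \<in> carrier G" "q \<in> carrier G" and e: "p \<otimes> q' = p' \<otimes> q"
  shows "p \<otimes> inv q = p' \<otimes> inv q'"
proof -
  have "p \<otimes> inv q = p \<otimes> q' \<otimes> inv q' \<otimes> inv q"
    using c by (simp add: m_assoc[of p])
  also have "\<dots> = p' \<otimes> (q \<otimes> (inv q' \<otimes> inv q))" unfolding e using c by (simp add: m_assoc)
  also have "q \<otimes> (inv q' \<otimes> inv q) = inv q'"
    using c by (simp add: m_comm[of "inv q'"] m_assoc[symmetric])
  finally show ?thesis .
qed

text \<open>The direct sum of two zero idempotents is equivalent to one of them, so the value equals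
  its own square in a group.\<close>

lemma (in idem_action) idem_act_zero:
  assumes x: "x \<in> HX B"
  shows "idem_act \<U> H R B (zero_idem R) x = \<one>\<^bsub>obj H T\<^esub>"
proof -
  note z = T.A.zero_idem_idems
  have "idem_act \<U> H R B (idem_sum R (zero_idem R) (zero_idem R)) x = idem_act \<U> H R B (zero_idem R) x"
    by (rule idem_act_equiv[OF T.A.idem_sum_closed[OF z z] z T.A.idem_sum_zero[OF z] x])
  then show ?thesis
    using idem_act_closed[OF z x] by (simp add: idem_act_sum[OF z z x])
qed

text \<open>An injective homomorphism is injective on matrices, so the equation
  \<open>p p = p\<close> can be tested on the image. This is how matrices over A^+ are seen to be
  idempotent by a computation over D^+.\<close>

lemma (in complex_alg_hom) idems_reflect:
  assumes inj: "inj_on f (carrier R)" and p: "p \<in> mats R n n" and fp: "(n, f \<circ> p) \<in> idems S"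
  shows "(n, p) \<in> idems R"
proof -
  have "f \<circ> mat_mult R n p p = f \<circ> p"
    using fp map_mat_mult[OF p p] by (simp add: S.idems_iff)
  then have "f (mat_mult R n p p ij) = f (p ij)" for ij
    by (metis comp_apply)
  then have "mat_mult R n p p = p"
    using inj_onD[OF inj] R.mats_carrier[OF R.mat_mult_mats[OF p p]] R.mats_carrier[OF p] by blast
  then show ?thesis using p fp by (simp add: R.idems_iff S.idems_iff)
qed

lemma (in complex_alg_hom) map_corner: "map_idem f (n, corner R a) = (n, corner S (f a))"
  by (auto simp: map_idem_def corner_def fun_eq_iff)

context lc_alg
begin

text \<open>\<open>E'\<close> is \<open>1 - e\<close> in the unitisation. The identities listed are
  the ones that \<open>conjugate_idem\<close> asks of a complementary pair.\<close>

lemma unit_complement: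
  assumes e: "e \<in> carrier A" "e \<otimes> e = e" and f: "f \<in> carrier A"
  defines "E' \<equiv> ((-1) \<odot> e, 1)"
  shows "E' \<in> carrier (unitisation A)" "unit_incl e \<otimes>\<^bsub>unitisation A\<^esub> unit_incl e = unit_incl e"
    "E' \<otimes>\<^bsub>unitisation A\<^esub> E' = E'" "unit_incl e \<otimes>\<^bsub>unitisation A\<^esub> E' = \<zero>\<^bsub>unitisation A\<^esub>"
    "E' \<otimes>\<^bsub>unitisation A\<^esub> unit_incl e = \<zero>\<^bsub>unitisation A\<^esub>"
    "unit_incl f \<otimes>\<^bsub>unitisation A\<^esub> unit_incl e \<oplus>\<^bsub>unitisation A\<^esub> unit_incl f \<otimes>\<^bsub>unitisation A\<^esub> E' = unit_incl f"
    "unit_incl e \<oplus>\<^bsub>unitisation A\<^esub> E' = (\<zero>, 1)"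
proof -
  have n: "x \<oplus> (-1) \<odot> x = \<zero>" "(-1) \<odot> x \<oplus> x = \<zero>" if "x \<in> carrier A" for x
    using smult_add_left[OF that, of 1 "-1"] smult_add_left[OF that, of "-1" 1] that by simp_all
  have n2: "x \<oplus> ((-1) \<odot> x \<oplus> y) = y" if "x \<in> carrier A" "y \<in> carrier A" for x y
    using that n(1)[OF that(1)] a_assoc[of x "(-1) \<odot> x" y] by simp
  show "E' \<in> carrier (unitisation A)" "unit_incl e \<otimes>\<^bsub>unitisation A\<^esub> unit_incl e = unit_incl e"
    "E' \<otimes>\<^bsub>unitisation A\<^esub> E' = E'" "unit_incl e \<otimes>\<^bsub>unitisation A\<^esub> E' = \<zero>\<^bsub>unitisation A\<^esub>"
    "E' \<otimes>\<^bsub>unitisation A\<^esub> unit_incl e = \<zero>\<^bsub>unitisation A\<^esub>"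
    "unit_incl f \<otimes>\<^bsub>unitisation A\<^esub> unit_incl e \<oplus>\<^bsub>unitisation A\<^esub> unit_incl f \<otimes>\<^bsub>unitisation A\<^esub> E' = unit_incl f"
    "unit_incl e \<oplus>\<^bsub>unitisation A\<^esub> E' = (\<zero>, 1)"
    using e f by (simp_all add: E'_def unit_incl_def smult_mult_left smult_mult_right smult_smult n n2)
qed

lemma unit_incl_hom: "unit_incl \<in> lca_hom A (unitisation A)"
  using split_extension_unitisation by (simp add: split_extension_def)

lemma unit_map_hom:
  assumes "lc_alg B" and f: "f \<in> lca_hom A B"
  shows "unit_map f \<in> lca_hom (unitisation A) (unitisation B)"
proof -
  interpret B: lc_alg B by fact
  have "continuous_map (prod_topology (topo A) euclidean) (prod_topology (topo B) euclidean) (\<lambda>x. (f (fst x), snd x))"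
    by (intro continuous_map_pairedI continuous_map_snd continuous_map_compose[OF continuous_map_fst lca_homD(5)[OF f], unfolded o_def])
  then have "continuous_map (topo (unitisation A)) (topo (unitisation B)) (unit_map f)"
    by (simp add: case_prod_unfold unit_map_def)
  then show ?thesis
    using unit_map_alg_hom[OF complex_alg_axioms B.complex_alg_axioms lca_homD(6)[OF f]] by (simp add: lca_hom_def)
qed

end

section \<open>The lift of [e] - [f] for a quasihomomorphism from the scalars\<close>

locale scalar_quasihom = quasihomomorphism complex_lca A Ahat i \<alpha> \<alpha>bar
  for A :: "'b lca" and Ahat :: "(complex, 'c) module" and i \<alpha> \<alpha>bar
begin

abbreviation "Dp \<equiv> unitisation D"
abbreviation "Ap \<equiv> unitisation A"

sublocale Dp: lc_alg Dp by unfold_locales (rule D.lc_algebra_unitisation)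
sublocale Ap: lc_alg Ap by unfold_locales (rule B.lc_algebra_unitisation)

definition e where "e = D_split A 1"
definition f where "f = D_split_bar A Ahat i \<alpha> \<alpha>bar 1"
abbreviation "E \<equiv> unit_incl e"
abbreviation "F \<equiv> unit_incl f"
definition E' where "E' = ((-1) \<odot>\<^bsub>D\<^esub> e, 1::complex)"

lemma ef: "e \<in> carrier D" "e \<otimes>\<^bsub>D\<^esub> e = e" "f \<in> carrier D" "f \<otimes>\<^bsub>D\<^esub> f = f"
  using lca_homD(1,3)[OF D_split_hom, of 1] lca_homD(1,3)[OF D_split_bar_hom, of 1]
  by (simp_all add: e_def f_def del: D_alg_simps)

lemmas EE' = D.unit_complement[OF ef(1,2,1), folded E'_def] D.unit_complement[OF ef(1,2,3), folded E'_def]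

lemma EF_closed: "E \<in> carrier Dp" "F \<in> carrier Dp"
  using lca_homD(1)[OF D.unit_incl_hom] ef by blast+

lemma F_idem: "F \<otimes>\<^bsub>Dp\<^esub> F = F"
  using D.unit_complement(2)[OF ef(3,4,3)] .

lemmas Dp_idems = Dp.corner_idem[OF EF_closed(1) EE'(2)] Dp.corner_idem[OF EF_closed(2) F_idem]
  Dp.corner_idem[OF EE'(1,3)]

abbreviation "P \<equiv> mat2 Dp (E \<otimes>\<^bsub>Dp\<^esub> F \<otimes>\<^bsub>Dp\<^esub> E \<oplus>\<^bsub>Dp\<^esub> E') (E \<otimes>\<^bsub>Dp\<^esub> F \<otimes>\<^bsub>Dp\<^esub> E')
  (E' \<otimes>\<^bsub>Dp\<^esub> F \<otimes>\<^bsub>Dp\<^esub> E) (E' \<otimes>\<^bsub>Dp\<^esub> F \<otimes>\<^bsub>Dp\<^esub> E')"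

lemma P: "(2, P) \<in> idems Dp" "idem_equiv Dp (2, P) (idem_sum Dp (1, corner Dp F) (1, corner Dp E'))"
  using Dp.conjugate_idem[OF EF_closed(1) EE'(1) EF_closed(2) EE'(2-5) F_idem EE'(13)] by simp_all

text \<open>The conjugation of \<open>conjugate_idem\<close> with \<open>f = e\<close>: the upper
  left entry is \<open>e + e' = 1\<close> and the other entries vanish.\<close>

lemma one: "(2, corner Dp (\<zero>\<^bsub>D\<^esub>, 1)) \<in> idems Dp"
  "idem_equiv Dp (2, corner Dp (\<zero>\<^bsub>D\<^esub>, 1)) (idem_sum Dp (1, corner Dp E) (1, corner Dp E'))"
proof -
  have "mat2 Dp (E \<otimes>\<^bsub>Dp\<^esub> E \<otimes>\<^bsub>Dp\<^esub> E \<oplus>\<^bsub>Dp\<^esub> E') (E \<otimes>\<^bsub>Dp\<^esub> E \<otimes>\<^bsub>Dp\<^esub> E')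
    (E' \<otimes>\<^bsub>Dp\<^esub> E \<otimes>\<^bsub>Dp\<^esub> E) (E' \<otimes>\<^bsub>Dp\<^esub> E \<otimes>\<^bsub>Dp\<^esub> E') = corner Dp (\<zero>\<^bsub>D\<^esub>, 1)"
    unfolding EE' Dp.l_null[OF EF_closed(1)] Dp.l_null[OF EE'(1)] by (rule Dp.mat2_corner)
  then show "(2, corner Dp (\<zero>\<^bsub>D\<^esub>, 1)) \<in> idems Dp"
    "idem_equiv Dp (2, corner Dp (\<zero>\<^bsub>D\<^esub>, 1)) (idem_sum Dp (1, corner Dp E) (1, corner Dp E'))"
    using Dp.conjugate_idem[OF EF_closed(1) EE'(1) EF_closed(1) EE'(2-5) EE'(2) EE'(6)] by simp_all
qed

abbreviation "up \<equiv> unit_map (D_incl complex_lca)"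

text \<open>An element of D^+ has the form \<open>((z, a), w)\<close> with \<open>z\<close> in
  \<complex>, \<open>a\<close> in \<open>A\<close> and \<open>w\<close> the scalar of the
  unitisation. The image of A^+ under \<open>up\<close> consists of the elements with
  \<open>z = 0\<close>, and there \<open>low\<close> is the inverse of \<open>up\<close>.\<close>

definition low where "low x = (snd (fst x), snd x)"

sublocale up: complex_alg_hom Ap Dp up
  by unfold_locales (rule unit_map_alg_hom[OF B.complex_alg_axioms D.complex_alg_axioms lca_homD(6)[OF D_incl_hom]])

lemma up_inj: "inj_on up (carrier Ap)"
  by (auto simp: inj_on_def unit_map_def D_incl_def)

lemma up_low: "fst (fst x) = 0 \<Longrightarrow> up (low x) = x"
  by (cases x) (auto simp: unit_map_def D_incl_def low_def prod_eq_iff)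

text \<open>The pair formed by \<open>fst (fst x)\<close> and \<open>snd x\<close> is the image of
  \<open>x\<close> in \<complex>^+ under the unitised projection of \<open>D\<close> onto
  \<complex>; these are the operations of \<complex>^+ in coordinates.\<close>

lemma fst_mult: "fst (fst (x \<otimes>\<^bsub>Dp\<^esub> y)) = fst (fst x) * fst (fst y) + (snd x * fst (fst y) + snd y * fst (fst x))"
  and snd_mult: "snd (x \<otimes>\<^bsub>Dp\<^esub> y) = snd x * snd y"
  and fst_add: "fst (fst (x \<oplus>\<^bsub>Dp\<^esub> y)) = fst (fst x) + fst (fst y)"
  and snd_add: "snd (x \<oplus>\<^bsub>Dp\<^esub> y) = snd x + snd y"
  by (cases x; cases y; simp del: D_alg_simps)+

lemma EF_components: "fst (fst E) = 1" "snd E = 0" "fst (fst F) = 1" "snd F = 0" "fst (fst E') = -1" "snd E' = 1"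
  by (simp_all add: unit_incl_def e_def f_def E'_def D_split_def D_split_bar_def del: D_alg_simps)

text \<open>\<open>E\<close> and \<open>F\<close> have the same image in \<complex>^+, so over
  \<complex>^+ the matrix \<open>P\<close> becomes the conjugate of diag(E, E') and hence diag(1,
  0). Its entries thus come from A^+, with scalar part diag(1, 0).\<close>

lemma P_low: "up \<circ> (low \<circ> P) = P" "snd \<circ> (low \<circ> P) = corner complex_lca 1" "low \<circ> P \<in> mats Ap 2 2"
proof -
  have "fst (fst (P ij)) = 0" for ij
    by (cases ij) (simp add: mat2_def fst_mult snd_mult fst_add snd_add EF_components)
  then show "up \<circ> (low \<circ> P) = P"
    by (simp add: fun_eq_iff up_low)
  show "snd \<circ> (low \<circ> P) = corner complex_lca 1"
    by (auto simp: fun_eq_iff low_def mat2_def corner_def fst_mult snd_mult fst_add snd_add EF_components)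
  have "P ij \<in> carrier Dp" for ij
    using Dp.mats_carrier[of P 2 2] P(1) by (simp add: Dp.idems_iff)
  then have "low (P ij) \<in> carrier Ap" for ij
    by (auto simp: low_def mem_Times_iff simp del: split_paired_All)
  moreover have "low \<zero>\<^bsub>Dp\<^esub> = \<zero>\<^bsub>Ap\<^esub>" by (simp add: low_def)
  moreover have "P \<in> mats Dp 2 2" using P(1) by (simp add: Dp.idems_iff)
  ultimately show "low \<circ> P \<in> mats Ap 2 2"
    using Dp.mats_zero[of P 2 2] by (intro Ap.matsI) simp_all
qed

abbreviation "z \<equiv> zero_idem Dp"
abbreviation "EE \<equiv> (1::nat, corner Dp E)"
abbreviation "FF \<equiv> (1::nat, corner Dp F)"

text \<open>The preimage is the class of diag(1, 0) minus that of \<open>low \<circ> P\<close>, two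
  idempotents over A^+ with the same scalar part; in K(D^+) the summand \<open>E'\<close> cancels.
  The right-hand side has zero summands because it is the literal product of [E] - [0] and [0] -
  [F].\<close>

lemma K0_lift:
  "\<exists>y\<in>carrier (K0 A). K0_map D (D_incl complex_lca) y = K0_class Dp (idem_sum Dp EE z) (idem_sum Dp z FF)"
proof
  let ?one = "(2::nat, corner Ap (\<zero>\<^bsub>A\<^esub>, 1))" and ?p = "(2::nat, low \<circ> P)"
  interpret s: complex_alg_hom Ap complex_lca snd
    by unfold_locales (rule snd_alg_hom)
  have "up (\<zero>\<^bsub>A\<^esub>, 1) = (\<zero>\<^bsub>D\<^esub>, 1)" by (simp add: unit_map_def D_incl_def)
  then have up_one: "map_idem up ?one = (2, corner Dp (\<zero>\<^bsub>D\<^esub>, 1))"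
    unfolding up.map_corner by simp
  have one_idem: "?one \<in> idems Ap"
  proof (rule up.idems_reflect[OF up_inj])
    show "corner Ap (\<zero>\<^bsub>A\<^esub>, 1) \<in> mats Ap 2 2"
      unfolding corner_matrix_unit by (rule Ap.matrix_unit_mats) auto
    show "(2, up \<circ> corner Ap (\<zero>\<^bsub>A\<^esub>, 1)) \<in> idems Dp" using one(1) up_one by (simp add: map_idem_def)
  qed
  have p_idem: "?p \<in> idems Ap"
    using up.idems_reflect[OF up_inj P_low(3)] P(1) P_low(1) by simp
  have up_p: "map_idem up ?p = (2, P)" by (simp add: map_idem_def P_low(1))
  have "map_idem snd ?one = map_idem snd ?p"
    unfolding s.map_corner by (simp add: map_idem_def P_low(2))
  then show "K0_class Ap ?one ?p \<in> carrier (K0 A)"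
    using K0_class_in_K0[OF B.complex_alg_axioms one_idem p_idem] A.K0_class_diag[OF s.map_idems[OF p_idem]] by simp
  have "K0_map D (D_incl complex_lca) (K0_class Ap ?one ?p) = K0_class Dp (2, corner Dp (\<zero>\<^bsub>D\<^esub>, 1)) (2, P)"
    unfolding K0_map_def up.map_K0_class[OF one_idem p_idem] up_one up_p ..
  also have "\<dots> = K0_class Dp (idem_sum Dp EE z) (idem_sum Dp z FF)"
  proof (rule Dp.K0_class_eqI[OF one(1) P(1)])
    note i = Dp_idems one(1) P(1) Dp.zero_idem_idems
    note s = Dp.idem_sum_closed
    show "idem_sum Dp EE z \<in> idems Dp" "idem_sum Dp z FF \<in> idems Dp" by (intro s i)+
    \<comment> \<open>Both idempotents are replaced by their conjugates, after which the two sides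
      consist of the same summands \<open>E\<close>, \<open>E'\<close>, \<open>z\<close> and
      \<open>F\<close> in different order.\<close>
    have eqs: "idem_class Dp (2, corner Dp (\<zero>\<^bsub>D\<^esub>, 1)) = idem_class Dp (idem_sum Dp EE (1, corner Dp E'))"
      "idem_class Dp (2, P) = idem_class Dp (idem_sum Dp FF (1, corner Dp E'))"
      using one(2) P(2) by (simp_all only: Dp.idem_class_eq_iff s i)
    note c = i[THEN Dp.idem_class_closed]
    have "idem_class Dp (idem_sum Dp (2, corner Dp (\<zero>\<^bsub>D\<^esub>, 1)) (idem_sum Dp z FF))
      = idem_class Dp (idem_sum Dp (idem_sum Dp EE z) (2, P))"
      by (simp only: Dp.idem_class_mult[symmetric] s i eqs) (simp only: Dp.V.m_ac Dp.V.m_closed c)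
    then show "idem_equiv Dp (idem_sum Dp (2, corner Dp (\<zero>\<^bsub>D\<^esub>, 1)) (idem_sum Dp z FF)) (idem_sum Dp (idem_sum Dp EE z) (2, P))"
      by (subst (asm) Dp.idem_class_eq_iff) (intro s i)+
  qed
  finally show "K0_map D (D_incl complex_lca) (K0_class Ap ?one ?p) = K0_class Dp (idem_sum Dp EE z) (idem_sum Dp z FF)" .
qed

lemma K0_map_unit:
  assumes g: "g \<in> lca_hom complex_lca D" and a: "g 1 \<in> carrier D" "g 1 \<otimes>\<^bsub>D\<^esub> g 1 = g 1"
  shows "K0_map D g K0_unit = K0_class Dp (1, corner Dp (unit_incl (g 1))) z"
proof -
  interpret Cp: complex_alg "unitisation complex_lca" by (rule complex_alg_unitisation[OF A.complex_alg_axioms])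
  interpret g: complex_alg_hom "unitisation complex_lca" Dp "unit_map g"
    by unfold_locales (rule unit_map_alg_hom[OF A.complex_alg_axioms D.complex_alg_axioms lca_homD(6)[OF g]])
  have u: "(1, corner (unitisation complex_lca) (unit_incl 1)) \<in> idems (unitisation complex_lca)"
    by (rule Cp.corner_idem) (simp_all add: unit_incl_def)
  have "unit_map g (unit_incl 1) = unit_incl (g 1)" by (simp add: unit_map_def unit_incl_def)
  then show ?thesis
    unfolding K0_map_def K0_unit_def g.map_K0_class[OF u Cp.zero_idem_idems] g.map_corner g.map_zero_idem by simp
qed

text \<open>The value of \<open>K0_quasi\<close> is a choice of preimage, and \<open>K0_lift\<close>
  shows that there is one; membership in K(A) and the image in K(D) are then the two facts that the
  comparison uses.\<close>

lemma K0_quasi_unit: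
  defines "x \<equiv> K0_quasi complex_lca A Ahat i \<alpha> \<alpha>bar K0_unit"
  shows "x \<in> carrier (K0 A)" "K0_map D (D_incl complex_lca) x = K0_class Dp (idem_sum Dp EE z) (idem_sum Dp z FF)"
proof -
  interpret s: complex_alg_hom Dp complex_lca snd
    by unfold_locales (rule snd_alg_hom)
  have "map_idem snd FF = zero_idem complex_lca"
    unfolding s.map_corner by (auto simp: zero_idem_def corner_def EF_components fun_eq_iff)
  then have "K0_class Dp FF z \<in> carrier (K0 D)"
    using K0_class_in_K0[OF D.complex_alg_axioms Dp_idems(2) Dp.zero_idem_idems] A.K0_class_diag[OF A.zero_idem_idems]
    by (simp add: s.map_zero_idem)
  then have inv: "inv\<^bsub>K0 D\<^esub> K0_class Dp FF z = K0_class Dp z FF"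
    using K0_inv[OF D.complex_alg_axioms] Dp.K0_class_inv[OF Dp_idems(2) Dp.zero_idem_idems] by simp
  have "x = inv_into (carrier (K0 A)) (K0_map D (D_incl complex_lca))
      (K0_class Dp EE z \<otimes>\<^bsub>K0 D\<^esub> inv\<^bsub>K0 D\<^esub> K0_class Dp FF z)"
    using K0_map_unit[OF D_split_hom] K0_map_unit[OF D_split_bar_hom] ef
    by (simp add: x_def K0_quasi_def Let_def e_def f_def del: D_alg_simps K0_simps)
  also have "\<dots> = inv_into (carrier (K0 A)) (K0_map D (D_incl complex_lca))
      (K0_class Dp (idem_sum Dp EE z) (idem_sum Dp z FF))"
    unfolding inv K0_simps Dp.K0_class_mult[OF Dp_idems(1) Dp.zero_idem_idems Dp.zero_idem_idems Dp_idems(2)] ..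
  finally have x: "x = inv_into (carrier (K0 A)) (K0_map D (D_incl complex_lca))
      (K0_class Dp (idem_sum Dp EE z) (idem_sum Dp z FF))" .
  obtain y where y: "y \<in> carrier (K0 A)" "K0_map D (D_incl complex_lca) y = K0_class Dp (idem_sum Dp EE z) (idem_sum Dp z FF)"
    using K0_lift by blast
  have im: "K0_class Dp (idem_sum Dp EE z) (idem_sum Dp z FF) \<in> K0_map D (D_incl complex_lca) ` carrier (K0 A)"
    using y by (metis imageI)
  show "x \<in> carrier (K0 A)" unfolding x by (rule inv_into_into[OF im])
  show "K0_map D (D_incl complex_lca) x = K0_class Dp (idem_sum Dp EE z) (idem_sum Dp z FF)"
    unfolding x by (rule f_inv_into_f[OF im])
qed

end

subsection \<open>Comparison of the two maps\<close>

context stable_functor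
begin

lemma idem_action: "lc_alg R \<Longrightarrow> represented \<U> R \<Longrightarrow> B \<in> \<U> \<Longrightarrow> idem_action \<U> H R B"
  by (intro idem_action.intro idem_action_axioms.intro stable_functor_axioms)

text \<open>\<open>tensor_map\<close> is obtained by choice, so a composite agrees with the map of
  the composite only on the carrier; there it follows from agreement on elementary tensors.\<close>

lemma mor_tensor_map_comp:
  assumes A: "lc_alg A" "represented \<U> A" and C: "lc_alg C" "represented \<U> C" and E: "lc_alg E" "represented \<U> E"
    and B: "B \<in> \<U>" and f: "f \<in> lca_hom A C" and g: "g \<in> lca_hom C E" and h: "h \<in> lca_hom A E"
    and hgf: "\<And>a. a \<in> carrier A \<Longrightarrow> h a = g (f a)" and x: "x \<in> HX (tensor_obj \<U> A B)"
  shows "mor H (tensor_obj \<U> C B) (tensor_obj \<U> E B) (tensor_map \<U> C E B g)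
      (mor H (tensor_obj \<U> A B) (tensor_obj \<U> C B) (tensor_map \<U> A C B f) x)
    = mor H (tensor_obj \<U> A B) (tensor_obj \<U> E B) (tensor_map \<U> A E B h) x"
proof -
  interpret TA: proj_tensor A B "tensor_obj \<U> A B" "tensor \<U> A B" by (rule proj_tensor[OF A B])
  interpret TE: proj_tensor E B "tensor_obj \<U> E B" "tensor \<U> E B" by (rule proj_tensor[OF E B])
  note U = tensor_obj_closed[OF A B] tensor_obj_closed[OF C B] tensor_obj_closed[OF E B]
  note f' = tensor_map[OF A C B f] and g' = tensor_map[OF C E B g] and h' = tensor_map[OF A E B h]
  have gf: "(\<lambda>a. tensor_map \<U> C E B g (tensor_map \<U> A C B f a)) \<in> lca_hom (tensor_obj \<U> A B) (tensor_obj \<U> E B)"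
    using lca_hom_comp[OF f'(1) g'(1)] by (simp add: o_def)
  show ?thesis
    unfolding mor_comp[OF U f'(1) g'(1) x]
  proof (rule mor_cong[OF U(1,3) gf h'(1) _ x])
    fix a assume a: "a \<in> carrier (tensor_obj \<U> A B)"
    show "tensor_map \<U> C E B g (tensor_map \<U> A C B f a) = tensor_map \<U> A E B h a"
      by (rule TA.tensor_lin_eq[OF TE.T.lc_alg_axioms lca_hom_lin[OF gf] lca_hom_lin[OF h'(1)] _ a])
        (simp add: f'(2) g'(2) h'(2) lca_homD(1)[OF f] hgf)
  qed
qed

text \<open>The composite sends \<open>b\<close> to \<open>1 \<otimes> b\<close> and then to
  \<open>f(1) \<otimes> b\<close>, which is how the 1 by 1 idempotent \<open>f(1)\<close>
  acts.\<close>

lemma mor_tensor_scalar: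
  assumes D: "lc_alg D" "represented \<U> D" and B: "B \<in> \<U>" and f: "f \<in> lca_hom complex_lca D" and x: "x \<in> HX B"
  shows "mor H (tensor_obj \<U> complex_lca B) (tensor_obj \<U> D B) (tensor_map \<U> complex_lca D B f)
      (mor H B (tensor_obj \<U> complex_lca B) (scalar_tensor \<U> B) x)
    = idem_act \<U> H D B (1, corner D (f 1)) x"
    "mor H B (tensor_obj \<U> complex_lca B) (scalar_tensor \<U> B) x \<in> HX (tensor_obj \<U> complex_lca B)"
proof -
  have C: "lc_alg complex_lca" by unfold_locales (rule lc_algebra_complex_lca)
  interpret C: idem_action \<U> H complex_lca B by (rule idem_action[OF C represented_complex B])
  interpret D: idem_action \<U> H D B by (rule idem_action[OF D B])
  have s: "scalar_tensor \<U> B = tensor \<U> complex_lca B 1"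
    by (simp add: scalar_tensor_def fun_eq_iff)
  have h: "scalar_tensor \<U> B \<in> lca_hom B C.T"
    unfolding s using x by (intro C.idem_act_corner(2)) auto
  have f1: "f 1 \<in> carrier D" "f 1 \<otimes>\<^bsub>D\<^esub> f 1 = f 1"
    using lca_homD(1,3)[OF f, of 1] by simp_all
  note t = tensor_map[OF C represented_complex D B f]
  have th: "(\<lambda>b. tensor_map \<U> complex_lca D B f (scalar_tensor \<U> B b)) \<in> lca_hom B D.T"
    using lca_hom_comp[OF h t(1)] by (simp add: o_def)
  show "mor H C.T D.T (tensor_map \<U> complex_lca D B f) (mor H B C.T (scalar_tensor \<U> B) x)
    = idem_act \<U> H D B (1, corner D (f 1)) x"
    unfolding mor_comp[OF B C.T D.T h t(1) x] D.idem_act_corner(3)[OF f1 x]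
    by (rule mor_cong[OF B D.T th D.idem_act_corner(2)[OF f1 x] _ x]) (simp add: s t(2))
  show "mor H B C.T (scalar_tensor \<U> B) x \<in> HX C.T"
    by (rule mor_closed[OF B C.T h x])
qed

lemma split_tensor_exact:
  assumes S: "split_ext I E Q \<iota> \<pi> s" and I: "represented \<U> I" and Q: "represented \<U> Q" and B: "B \<in> \<U>"
  shows "inj_on (mor H (tensor_obj \<U> I B) (tensor_obj \<U> E B) (tensor_map \<U> I E B \<iota>)) (HX (tensor_obj \<U> I B))"
    "mor H (tensor_obj \<U> I B) (tensor_obj \<U> E B) (tensor_map \<U> I E B \<iota>) ` HX (tensor_obj \<U> I B)
      = kernel (obj H (tensor_obj \<U> E B)) (obj H (tensor_obj \<U> Q B))
          (mor H (tensor_obj \<U> E B) (tensor_obj \<U> Q B) (tensor_map \<U> E Q B \<pi>))"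
proof -
  interpret split_ext I E Q \<iota> \<pi> s by (rule S)
  have E: "represented \<U> E" by (rule represented_extension[OF universe I Q])
  note U = tensor_obj_closed[OF I.lc_alg_axioms I B] tensor_obj_closed[OF E.lc_alg_axioms E B] tensor_obj_closed[OF Q.lc_alg_axioms Q B]
  note ex = split_exact[unfolded split_exact_def, rule_format, OF U split_extension_tensor[OF S I Q B]]
  show "inj_on (mor H (tensor_obj \<U> I B) (tensor_obj \<U> E B) (tensor_map \<U> I E B \<iota>)) (HX (tensor_obj \<U> I B))"
    "mor H (tensor_obj \<U> I B) (tensor_obj \<U> E B) (tensor_map \<U> I E B \<iota>) ` HX (tensor_obj \<U> I B)
      = kernel (obj H (tensor_obj \<U> E B)) (obj H (tensor_obj \<U> Q B))
          (mor H (tensor_obj \<U> E B) (tensor_obj \<U> Q B) (tensor_map \<U> E Q B \<pi>))"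
    using ex by blast+
qed

lemma K0_act_eq_quasi_tensor:
  assumes A: "A \<in> \<U>" and B: "B \<in> \<U>" and q: "quasihom complex_lca A Ahat i \<alpha> \<alpha>bar" and b: "b \<in> HX B"
  shows "K0_act \<U> H A B (K0_quasi complex_lca A Ahat i \<alpha> \<alpha>bar K0_unit) b =
    quasi_tensor \<U> H complex_lca A Ahat i \<alpha> \<alpha>bar B (mor H B (tensor_obj \<U> complex_lca B) (scalar_tensor \<U> B) b)"
proof -
  have C: "lc_alg complex_lca" by unfold_locales (rule lc_algebra_complex_lca)
  note rC = represented_complex and rA = represented_self[OF A]
  interpret scalar_quasihom A Ahat i \<alpha> \<alpha>bar
    using C lc_alg[OF A] q
    by (simp add: scalar_quasihom_def quasihomomorphism_def quasihomomorphism_axioms_def lc_alg_pair_def)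
  have sD: "split_ext A D complex_lca (D_incl complex_lca) fst (D_split A)"
    by (rule split_extI[OF B.lc_algebra lc_algebra_D A.lc_algebra split_extension_D])
  have rD: "represented \<U> D" by (rule split_ext.represented_extension[OF sD universe rA rC])
  have sDp: "split_ext D Dp complex_lca unit_incl snd (\<lambda>z. (\<zero>\<^bsub>D\<^esub>, z))"
    by (rule split_extI[OF lc_algebra_D Dp.lc_algebra A.lc_algebra D.split_extension_unitisation])
  have sAp: "split_ext A Ap complex_lca unit_incl snd (\<lambda>z. (\<zero>\<^bsub>A\<^esub>, z))"
    by (rule split_extI[OF B.lc_algebra Ap.lc_algebra A.lc_algebra B.split_extension_unitisation])
  have rDp: "represented \<U> Dp" by (rule split_ext.represented_extension[OF sDp universe rD rC])
  have rAp: "represented \<U> Ap" by (rule split_ext.represented_extension[OF sAp universe rA rC])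
  note lA = B.lc_alg_axioms and lD = D.lc_alg_axioms and lAp = Ap.lc_alg_axioms and lDp = Dp.lc_alg_axioms
  interpret iC: idem_action \<U> H complex_lca B by (rule idem_action[OF C rC B])
  interpret iD: idem_action \<U> H D B by (rule idem_action[OF lD rD B])
  interpret iAp: idem_action \<U> H Ap B by (rule idem_action[OF lAp rAp B])
  interpret iDp: idem_action \<U> H Dp B by (rule idem_action[OF lDp rDp B])
  interpret s: complex_alg_hom Ap complex_lca snd
    by unfold_locales (rule snd_alg_hom)
  define x where "x = K0_quasi complex_lca A Ahat i \<alpha> \<alpha>bar K0_unit"
  note x = K0_quasi_unit[folded x_def]
  note zC = A.zero_idem_idems and zD = Dp.zero_idem_idems
  \<comment> \<open>The representatives picked inside \<open>K0_unital_act\<close>. Nothing is known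
    of them except that they lie in the class \<open>x\<close>, which is shown to be nonempty by an
    arbitrary pair \<open>p0\<close>, \<open>q0\<close>.\<close>
  define p where "p = fst (SOME pq. pq \<in> x)"
  define r where "r = snd (SOME pq. pq \<in> x)"
  obtain p0 q0 where pq0: "p0 \<in> idems Ap" "q0 \<in> idems Ap" "x = K0_class Ap p0 q0"
    using subgroup.subset[OF subgroup_K0[OF B.complex_alg_axioms]] x(1) by (blast elim: Ap.K0_unital_cases)
  have "(SOME pq. pq \<in> x) \<in> x"
    by (rule someI[of "\<lambda>pq. pq \<in> x" "(p0, q0)"]) (simp only: pq0(3) Ap.K0_class_self[OF pq0(1,2)])
  then have "(p, r) \<in> x" by (simp add: p_def r_def)
  then have rel: "((p0, q0), (p, r)) \<in> K0_rel Ap" by (simp add: pq0(3))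
  then have pr: "p \<in> idems Ap" "r \<in> idems Ap" by (auto simp: Ap.K0_rel_iff simp del: split_paired_Ex)
  have xpr: "x = K0_class Ap p r"
    unfolding pq0(3) by (rule equiv_class_eq[OF Ap.equiv_K0_rel rel])
  define w where "w = idem_act \<U> H Ap B p b \<otimes>\<^bsub>obj H iAp.T\<^esub> inv\<^bsub>obj H iAp.T\<^esub> idem_act \<U> H Ap B r b"
  have w: "w \<in> HX iAp.T" unfolding w_def using iAp.idem_act_closed[OF _ b] pr by simp
  have act_zero_D: "idem_act \<U> H Dp B z b = \<one>\<^bsub>obj H iDp.T\<^esub>" and act_zero_C: "idem_act \<U> H complex_lca B (zero_idem complex_lca) b = \<one>\<^bsub>obj H iC.T\<^esub>"
    using iDp.idem_act_zero[OF b] iC.idem_act_zero[OF b] .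

  let ?mor = "\<lambda>A C f. mor H (tensor_obj \<U> A B) (tensor_obj \<U> C B) (tensor_map \<U> A C B f)"
  have hs: "snd \<in> lca_hom Ap complex_lca" using sAp by (simp add: split_ext_def split_ext_axioms_def split_extension_def)
  interpret ms: group_hom "obj H iAp.T" "obj H iC.T" "?mor Ap complex_lca snd"
    by (rule group_hom_mor[OF iAp.T iC.T tensor_map(1)[OF lAp rAp C rC B hs]])
  \<comment> \<open>As \<open>x\<close> lies in the kernel K(A), the scalar parts of
    \<open>p\<close> and \<open>r\<close> act in the same way on H(B), so \<open>w\<close> vanishes
    in H(\<complex> \<otimes> B). By exactness \<open>w\<close> comes from H(A \<otimes> B), which
    makes the \<open>inv_into\<close> in \<open>K0_act\<close> a true preimage.\<close>
  have "K0_class complex_lca (map_idem snd p) (map_idem snd r) = K0_class complex_lca (zero_idem complex_lca) (zero_idem complex_lca)"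
    using x(1) K0_class_in_K0[OF B.complex_alg_axioms pr] by (simp add: xpr A.K0_unital_one)
  then have "((map_idem snd p, map_idem snd r), (zero_idem complex_lca, zero_idem complex_lca)) \<in> K0_rel complex_lca"
    by (subst (asm) A.K0_class_eq_iff) (simp_all add: s.map_idems pr zC)
  from iC.idem_act_K0_rel[OF this b]
  have "idem_act \<U> H complex_lca B (map_idem snd p) b = idem_act \<U> H complex_lca B (map_idem snd r) b"
    using iC.idem_act_closed[OF s.map_idems b] pr by (simp add: act_zero_C)
  then have "?mor Ap complex_lca snd w = \<one>\<^bsub>obj H iC.T\<^esub>"
    using iAp.idem_act_closed[OF _ b] iC.idem_act_closed[OF s.map_idems b] pr
    by (simp add: w_def idem_act_natural[OF lAp rAp C rC B hs _ b])
  then have "w \<in> ?mor A Ap unit_incl ` HX (tensor_obj \<U> A B)"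
    unfolding split_tensor_exact(2)[OF sAp rA rC B] using w by (simp add: kernel_def)
  moreover have K0_act: "K0_act \<U> H A B x b = inv_into (HX (tensor_obj \<U> A B)) (?mor A Ap unit_incl) w"
    by (simp add: K0_act_def K0_unital_act_def w_def p_def r_def case_prod_beta Let_def)
  ultimately have y: "K0_act \<U> H A B x b \<in> HX (tensor_obj \<U> A B)" "?mor A Ap unit_incl (K0_act \<U> H A B x b) = w"
    by (simp_all add: inv_into_into f_inv_into_f)

  have hup: "up \<in> lca_hom Ap Dp" by (rule B.unit_map_hom[OF lD D_incl_hom])
  interpret mup: group_hom "obj H iAp.T" "obj H iDp.T" "?mor Ap Dp up"
    by (rule group_hom_mor[OF iAp.T iDp.T tensor_map(1)[OF lAp rAp lDp rDp B hup]])
  have i: "map_idem up p \<in> idems Dp" "map_idem up r \<in> idems Dp" "idem_sum Dp EE z \<in> idems Dp" "idem_sum Dp z FF \<in> idems Dp"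
    by (intro up.map_idems pr Dp.idem_sum_closed Dp_idems zD)+
  \<comment> \<open>Over D^+ the class \<open>x\<close> becomes [E] - [F], so there the action of
    the unknown representatives can be exchanged for that of \<open>E\<close> and
    \<open>F\<close>.\<close>
  have "K0_class Dp (map_idem up p) (map_idem up r) = K0_class Dp (idem_sum Dp EE z) (idem_sum Dp z FF)"
    using x(2) unfolding xpr K0_map_def up.map_K0_class[OF pr] .
  then have "((map_idem up p, map_idem up r), (idem_sum Dp EE z, idem_sum Dp z FF)) \<in> K0_rel Dp"
    unfolding Dp.K0_class_eq_iff[OF i] .
  note iDp.idem_act_K0_rel[OF this b]
  moreover note cl = iDp.idem_act_closed[OF Dp_idems(1) b] iDp.idem_act_closed[OF Dp_idems(2) b]
    iDp.idem_act_closed[OF i(1) b] iDp.idem_act_closed[OF i(2) b]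
  ultimately have rel: "idem_act \<U> H Dp B (map_idem up p) b \<otimes>\<^bsub>obj H iDp.T\<^esub> idem_act \<U> H Dp B FF b
    = idem_act \<U> H Dp B EE b \<otimes>\<^bsub>obj H iDp.T\<^esub> idem_act \<U> H Dp B (map_idem up r) b"
    by (simp only: iDp.idem_act_sum Dp_idems zD b act_zero_D iDp.G.l_one iDp.G.r_one)
  have "?mor Ap Dp up w = idem_act \<U> H Dp B (map_idem up p) b \<otimes>\<^bsub>obj H iDp.T\<^esub> inv\<^bsub>obj H iDp.T\<^esub> idem_act \<U> H Dp B (map_idem up r) b"
    using iAp.idem_act_closed[OF _ b] pr
    by (simp add: w_def idem_act_natural[OF lAp rAp lDp rDp B hup _ b])
  also have "\<dots> = idem_act \<U> H Dp B EE b \<otimes>\<^bsub>obj H iDp.T\<^esub> inv\<^bsub>obj H iDp.T\<^esub> idem_act \<U> H Dp B FF b"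
    using iDp.G.difference_eqI[OF cl(3,2,1,4) rel] .
  finally have up_w: "?mor Ap Dp up w = idem_act \<U> H Dp B EE b \<otimes>\<^bsub>obj H iDp.T\<^esub> inv\<^bsub>obj H iDp.T\<^esub> idem_act \<U> H Dp B FF b" .

  \<comment> \<open>The element of H(D \<otimes> B) to which \<open>quasi_tensor\<close> applies its
    \<open>inv_into\<close>; it has the same image in H(D^+ \<otimes> B) as
    \<open>w\<close>.\<close>
  define v where "v = idem_act \<U> H D B (1, corner D e) b \<otimes>\<^bsub>obj H iD.T\<^esub> inv\<^bsub>obj H iD.T\<^esub> idem_act \<U> H D B (1, corner D f) b"
  have ie: "(1, corner D e) \<in> idems D" "(1, corner D f) \<in> idems D"
    by (rule D.corner_idem ef)+
  have v: "v \<in> HX iD.T" using iD.idem_act_closed[OF _ b] ie by (simp add: v_def)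
  interpret mi: group_hom "obj H iD.T" "obj H iDp.T" "?mor D Dp unit_incl"
    by (rule group_hom_mor[OF iD.T iDp.T tensor_map(1)[OF lD rD lDp rDp B D.unit_incl_hom]])
  interpret ui: complex_alg_hom D Dp unit_incl
    by unfold_locales (rule lca_homD(6)[OF D.unit_incl_hom])
  have incl_v: "?mor D Dp unit_incl v = idem_act \<U> H Dp B EE b \<otimes>\<^bsub>obj H iDp.T\<^esub> inv\<^bsub>obj H iDp.T\<^esub> idem_act \<U> H Dp B FF b"
    using iD.idem_act_closed[OF _ b] ie
    by (simp add: v_def idem_act_natural[OF lD rD lDp rDp B D.unit_incl_hom _ b] ui.map_corner)
  let ?y = "K0_act \<U> H A B x b"
  have comp: "(\<lambda>a. unit_incl (D_incl complex_lca a)) \<in> lca_hom A Dp"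
    using lca_hom_comp[OF D_incl_hom D.unit_incl_hom] by (simp add: o_def)
  have iota: "?mor A D (D_incl complex_lca) ?y \<in> HX iD.T"
    by (rule mor_closed[OF tensor_obj_closed[OF lA rA B] iD.T tensor_map(1)[OF lA rA lD rD B D_incl_hom] y(1)])
  \<comment> \<open>The homomorphism from \<open>A\<close> to D^+ factors through \<open>D\<close>
    and also through A^+; the first factorisation meets \<open>quasi_tensor\<close>, the second the
    product.\<close>
  have "?mor D Dp unit_incl (?mor A D (D_incl complex_lca) ?y) = ?mor A Dp (\<lambda>a. unit_incl (D_incl complex_lca a)) ?y"
    by (rule mor_tensor_map_comp[OF lA rA lD rD lDp rDp B D_incl_hom D.unit_incl_hom comp HOL.refl y(1)])
  also have "\<dots> = ?mor Ap Dp up (?mor A Ap unit_incl ?y)"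
    by (rule mor_tensor_map_comp[OF lA rA lAp rAp lDp rDp B B.unit_incl_hom hup comp _ y(1), symmetric])
      (simp add: unit_incl_def unit_map_def)
  also have "\<dots> = ?mor D Dp unit_incl v"
    unfolding y(2) up_w incl_v ..
  \<comment> \<open>The extension of \<complex> by \<open>D\<close> given by D^+ stays split after
    tensoring, so its inclusion is injective under \<open>H\<close>.\<close>
  finally have "?mor A D (D_incl complex_lca) ?y = v"
    by (rule inj_onD[OF split_tensor_exact(1)[OF sDp rD rC B] _ iota v])
  then have "inv_into (HX (tensor_obj \<U> A B)) (?mor A D (D_incl complex_lca)) v = ?y"
    using inv_into_f_f[OF split_tensor_exact(1)[OF sD rA rC B] y(1)] by simp
  moreover have "quasi_tensor \<U> H complex_lca A Ahat i \<alpha> \<alpha>bar B (mor H B (tensor_obj \<U> complex_lca B) (scalar_tensor \<U> B) b)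
    = inv_into (HX (tensor_obj \<U> A B)) (?mor A D (D_incl complex_lca)) v"
    unfolding quasi_tensor_def Let_def v_def
    by (simp only: mor_tensor_scalar(1)[OF lD rD B D_split_hom b] mor_tensor_scalar(1)[OF lD rD B D_split_bar_hom b] e_def f_def)
  ultimately show ?thesis by (simp add: x_def)
qed

end

theorem proposition31:
  fixes \<U> :: "'u lca set"
    and H :: "('u, 'h) lca_functor"
    and A B :: "'u lca"
    and Ahat :: "(complex, 'c) module"
    and i :: "'u \<Rightarrow> 'c"
    and \<alpha> \<alpha>bar :: "complex \<Rightarrow> 'c"
  assumes "lca_universe \<U>"
    and "A \<in> \<U>" and "B \<in> \<U>"
    and "is_functor \<U> H" and "split_exact \<U> H" and "M2_stable \<U> H"
    and "quasihom complex_lca A Ahat i \<alpha> \<alpha>bar"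
  shows "\<forall>b\<in>carrier (obj H B).
    K0_act \<U> H A B (K0_quasi complex_lca A Ahat i \<alpha> \<alpha>bar K0_unit) b =
    quasi_tensor \<U> H complex_lca A Ahat i \<alpha> \<alpha>bar B
      (mor H B (tensor_obj \<U> complex_lca B) (scalar_tensor \<U> B) b)"
proof -
  interpret stable_functor \<U> H
    using assms by unfold_locales
  show ?thesis using K0_act_eq_quasi_tensor assms by blast
qed

end
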